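(* Let $V\in L^1(\mathbb{R}^3)\cap L^{3/2}(\mathbb{R}^3)$ be real-valued and let $\mu>0$. Assume that $e_\mu=\inf\operatorname{spec}\mathcal{V}_\mu<0$, and let $b_\mu(\lambda)=\inf\operatorname{spec}\big(\lambda\mathcal{V}_\mu-\lambda^2\mathcal{W}_\mu\big)$. Then the critical temperature $T_c=T_c(\lambda V)$ is strictly positive and satisfies $$\lim_{\lambda\to0}\left(\ln\left(\frac{\mu}{T_c}\right)+\frac{1}{\sqrt\mu\,b_\mu(\lambda)}\right)=2-\gamma-\ln(8/\pi),$$ where $\gamma\approx0.5772$ denotes Euler's constant.
   Context: Fourier transform: $\hat V(p)=(2\pi)^{-3/2}\int_{\mathbb{R}^3}V(x)e^{-ip\cdot x}dx$. Here $\lambda>0$ is a coupling parameter and $\lambda\to0$ means $\lambda\downarrow0$. For $T>0$, $K_T$ is the operator on $L^2(\mathbb{R}^3)$ acting as multiplication in Fourier space by $K_T(p)=\dfrac{p^2-\mu}{\tanh\frac{p^2-\mu}{2T}}$. The critical temperature is $T_c(\lambda V)=\inf\{T>0:K_T+\lambda V\ge0\}$, the sum being understood in the sense of quadratic forms. Let $\Omega\subset\mathbb{R}^3$ be the unit $2$-sphere with surface measure $d\omega$, and $$(\mathcal{V}_\mu u)(p)=\frac{1}{(2\pi)^{3/2}}\int_\Omega\hat V(\sqrt\mu(p-q))\,u(q)\,d\omega(q),\qquad u\in L^2(\Omega).$$ Let $\mathfrak{F}:L^1(\mathbb{R}^3)\to L^2(\Omega)$ be $(\mathfrak{F}\psi)(p)=(2\pi)^{-3/2}\int_{\mathbb{R}^3}\psi(x)e^{i\sqrt\mu\,x\cdot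 p}dx$, with adjoint $\mathfrak{F}^\dagger$ (so that $\mathfrak{F}V\mathfrak{F}^\dagger=\mathcal{V}_\mu$, up to the reflection $p\mapsto-p$ of $\Omega$). Set $$m_\mu(T)=\frac{1}{4\pi}\int_{\mathbb{R}^3}\left(\frac{1}{K_T(p)}-\frac{1}{p^2}\right)dp,\qquad M_T=K_T^{-1}-m_\mu(T)\,\mathfrak{F}^\dagger\mathfrak{F}.$$ The operator $\mathcal{W}_\mu$ on $L^2(\Omega)$ is defined via its quadratic form $$\langle u|\mathcal{W}_\mu|u\rangle=\lim_{T\to0}\langle u|\mathfrak{F}VM_TV\mathfrak{F}^\dagger|u\rangle,\qquad u\in L^2(\Omega).$$ In forming $\lambda\mathcal V_\mu-\lambda^2\mathcal W_\mu$, $\mathcal V_\mu$ is understood as $\mathfrak{F}V\mathfrak{F}^\dagger$, for which both operators use the same convention. *)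

theory Defs
  imports "HOL-Analysis.Analysis"
begin

section \<open>Operators on \<open>L\<^sup>2\<close> of a measure\<close>

text \<open>Elements of \<open>L\<^sup>2(M)\<close> are represented by functions, and equality of elements is equality
  almost everywhere.  Operators are accordingly maps on functions.\<close>

definition L2_space :: "'a measure \<Rightarrow> ('a \<Rightarrow> complex) set" where
  "L2_space M = {f \<in> borel_measurable M. integrable M (\<lambda>x. (cmod (f x))\<^sup>2)}"

definition L2_norm :: "'a measure \<Rightarrow> ('a \<Rightarrow> complex) \<Rightarrow> real" where
  "L2_norm M f = sqrt (\<integral>x. (cmod (f x))\<^sup>2 \<partial>M)"

definition L2_inner :: "'a measure \<Rightarrow> ('a \<Rightarrow> complex) \<Rightarrow> ('a \<Rightarrow> complex) \<Rightarrow> complex" where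
  "L2_inner M f g = (\<integral>x. cnj (f x) * g x \<partial>M)"

definition bounded_operator :: "'a measure \<Rightarrow> (('a \<Rightarrow> complex) \<Rightarrow> ('a \<Rightarrow> complex)) \<Rightarrow> bool" where
  "bounded_operator M A \<longleftrightarrow>
     (\<forall>f \<in> L2_space M. A f \<in> L2_space M) \<and>
     (\<forall>f \<in> L2_space M. \<forall>g \<in> L2_space M. \<forall>c.
        AE x in M. A (\<lambda>y. c * f y + g y) x = c * A f x + A g x) \<and>
     (\<exists>C. \<forall>f \<in> L2_space M. L2_norm M (A f) \<le> C * L2_norm M f)"

text \<open>\<open>z\<close> is in the spectrum iff \<open>A - z\<close> has no bounded two-sided inverse on \<open>L\<^sup>2(M)\<close>.\<close>

definition spectrum :: "'a measure \<Rightarrow> (('a \<Rightarrow> complex) \<Rightarrow> ('a \<Rightarrow> complex)) \<Rightarrow> complex set" where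
  "spectrum M A = {z. \<not> (\<exists>R. bounded_operator M R \<and>
     (\<forall>f \<in> L2_space M.
        (AE x in M. R (\<lambda>y. A f y - z * f y) x = f x) \<and>
        (AE x in M. A (R f) x - z * R f x = f x)))}"

text \<open>Used only for self-adjoint operators, whose spectrum is real.\<close>

definition inf_spec :: "'a measure \<Rightarrow> (('a \<Rightarrow> complex) \<Rightarrow> ('a \<Rightarrow> complex)) \<Rightarrow> real" where
  "inf_spec M A = Inf (Re ` spectrum M A)"


section \<open>Fourier transform\<close>

definition fourier :: "(real^3 \<Rightarrow> complex) \<Rightarrow> real^3 \<Rightarrow> complex" where
  "fourier \<psi> p =
     of_real ((2 * pi) powr (- 3 / 2)) * (\<integral>x. \<psi> x * exp (- \<i> * of_real (p \<bullet> x)) \<partial>lebesgue)"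

text \<open>\<open>\<phi>\<close> is the Fourier--Plancherel transform of \<open>\<psi> \<in> L\<^sup>2\<close>: the limit in \<open>L\<^sup>2\<close> of the
  transforms of the truncations of \<open>\<psi>\<close> to balls of radius \<open>R \<rightarrow> \<infinity>\<close>.\<close>

definition L2_fourier :: "(real^3 \<Rightarrow> complex) \<Rightarrow> (real^3 \<Rightarrow> complex) \<Rightarrow> bool" where
  "L2_fourier \<psi> \<phi> \<longleftrightarrow>
     \<psi> \<in> L2_space lebesgue \<and> \<phi> \<in> L2_space lebesgue \<and>
     ((\<lambda>R. \<integral>\<^sup>+p. ennreal ((cmod (fourier (\<lambda>x. indicator (cball 0 R) x * \<psi> x) p - \<phi> p))\<^sup>2)
          \<partial>lebesgue) \<longlongrightarrow> 0) at_top"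


section \<open>The critical temperature\<close>

text \<open>On the null set \<open>p\<^sup>2 = \<mu>\<close> the symbol takes the limiting value \<open>2 T\<close>.\<close>

definition K_symbol :: "real \<Rightarrow> real \<Rightarrow> real^3 \<Rightarrow> real" where
  "K_symbol \<mu> T p =
     (if p \<bullet> p = \<mu> then 2 * T else (p \<bullet> p - \<mu>) / tanh ((p \<bullet> p - \<mu>) / (2 * T)))"

text \<open>\<open>K\<^sub>T + V \<ge> 0\<close> as a quadratic form on the form domain of \<open>K\<^sub>T\<close>, which is
  \<open>H\<^sup>1(\<real>\<^sup>3)\<close>.  For \<open>V \<in> L\<^bsup>3/2\<^esup>\<close> the potential term is absolutely
  convergent there, by Sobolev's inequality.\<close>

definition KT_plus_nonneg :: "real \<Rightarrow> real \<Rightarrow> (real^3 \<Rightarrow> real) \<Rightarrow> bool" where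
  "KT_plus_nonneg \<mu> T V \<longleftrightarrow>
     (\<forall>\<psi> \<phi>. L2_fourier \<psi> \<phi> \<and> integrable lebesgue (\<lambda>p. K_symbol \<mu> T p * (cmod (\<phi> p))\<^sup>2) \<longrightarrow>
        0 \<le> (\<integral>p. K_symbol \<mu> T p * (cmod (\<phi> p))\<^sup>2 \<partial>lebesgue)
              + (\<integral>x. V x * (cmod (\<psi> x))\<^sup>2 \<partial>lebesgue))"

definition critical_temperature :: "real \<Rightarrow> (real^3 \<Rightarrow> real) \<Rightarrow> real" where
  "critical_temperature \<mu> V = Inf {T. 0 < T \<and> KT_plus_nonneg \<mu> T V}"


section \<open>Operators on the unit sphere\<close>

text \<open>The surface measure of \<open>A \<subseteq> \<Omega>\<close> is three times the Lebesgue measure of the cone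
  \<open>{r \<omega> | \<omega> \<in> A, 0 < r < 1}\<close>, so that \<open>dp = r\<^sup>2 dr d\<omega>\<close> in polar coordinates.
  Note that \<^term>\<open>sgn p\<close> is \<open>p / |p|\<close>.\<close>

definition sphere_measure :: "(real^3) measure" where
  "sphere_measure =
     scale_measure 3
       (distr (restrict_space lborel (ball 0 1 - {0})) (restrict_space borel (sphere 0 1)) sgn)"

definition calV :: "real \<Rightarrow> (real^3 \<Rightarrow> real) \<Rightarrow> (real^3 \<Rightarrow> complex) \<Rightarrow> real^3 \<Rightarrow> complex" where
  "calV \<mu> V u p =
     of_real (1 / (2 * pi) powr (3 / 2)) *
     (\<integral>q. fourier (\<lambda>x. of_real (V x)) (sqrt \<mu> *\<^sub>R (p - q)) * u q \<partial>sphere_measure)"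

definition frakF :: "real \<Rightarrow> (real^3 \<Rightarrow> complex) \<Rightarrow> real^3 \<Rightarrow> complex" where
  "frakF \<mu> \<psi> p =
     of_real ((2 * pi) powr (- 3 / 2)) *
     (\<integral>x. \<psi> x * exp (\<i> * of_real (sqrt \<mu> * (x \<bullet> p))) \<partial>lebesgue)"

definition frakF_adj :: "real \<Rightarrow> (real^3 \<Rightarrow> complex) \<Rightarrow> real^3 \<Rightarrow> complex" where
  "frakF_adj \<mu> u x =
     of_real ((2 * pi) powr (- 3 / 2)) *
     (\<integral>p. u p * exp (- \<i> * of_real (sqrt \<mu> * (x \<bullet> p))) \<partial>sphere_measure)"

definition FVF :: "real \<Rightarrow> (real^3 \<Rightarrow> real) \<Rightarrow> (real^3 \<Rightarrow> complex) \<Rightarrow> real^3 \<Rightarrow> complex" where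
  "FVF \<mu> V u = frakF \<mu> (\<lambda>x. of_real (V x) * frakF_adj \<mu> u x)"

definition m_mu :: "real \<Rightarrow> real \<Rightarrow> real" where
  "m_mu \<mu> T = 1 / (4 * pi) * (\<integral>p. (1 / K_symbol \<mu> T p - 1 / (p \<bullet> p)) \<partial>lebesgue)"

text \<open>The form \<open>\<langle>\<psi>|M\<^sub>T|\<psi>\<rangle>\<close> for \<open>M\<^sub>T = K\<^sub>T\<^sup>-\<^sup>1 - m\<^sub>\<mu>(T) F\<^sup>\<dagger> F\<close>.  It is
  needed for \<open>\<psi> = V F\<^sup>\<dagger> u\<close>, which is in \<open>L\<^sup>1 \<inter> L\<^bsup>3/2\<^esup>\<close> but in general not in
  \<open>L\<^sup>2\<close>; the transform of \<open>\<psi>\<close> is therefore the one on \<open>L\<^sup>1\<close>.\<close>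

definition M_form :: "real \<Rightarrow> real \<Rightarrow> (real^3 \<Rightarrow> complex) \<Rightarrow> real" where
  "M_form \<mu> T \<psi> =
     (\<integral>p. (cmod (fourier \<psi> p))\<^sup>2 / K_symbol \<mu> T p \<partial>lebesgue)
       - m_mu \<mu> T * (L2_norm sphere_measure (frakF \<mu> \<psi>))\<^sup>2"

text \<open>A bounded operator on complex \<open>L\<^sup>2(\<Omega>)\<close> is determined by its quadratic form, up to
  equality almost everywhere of its values.\<close>

definition is_calW :: "real \<Rightarrow> (real^3 \<Rightarrow> real) \<Rightarrow>
    ((real^3 \<Rightarrow> complex) \<Rightarrow> real^3 \<Rightarrow> complex) \<Rightarrow> bool" where
  "is_calW \<mu> V W \<longleftrightarrow> bounded_operator sphere_measure W \<and>
     (\<forall>u \<in> L2_space sphere_measure.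
        ((\<lambda>T. of_real (M_form \<mu> T (\<lambda>x. of_real (V x) * frakF_adj \<mu> u x)))
            \<longlongrightarrow> L2_inner sphere_measure u (W u)) (at_right 0))"

definition calW :: "real \<Rightarrow> (real^3 \<Rightarrow> real) \<Rightarrow> (real^3 \<Rightarrow> complex) \<Rightarrow> real^3 \<Rightarrow> complex" where
  "calW \<mu> V = (SOME W. is_calW \<mu> V W)"

definition e_mu :: "real \<Rightarrow> (real^3 \<Rightarrow> real) \<Rightarrow> real" where
  "e_mu \<mu> V = inf_spec sphere_measure (calV \<mu> V)"

text \<open>Here the first-order operator is taken as \<open>F V F\<^sup>\<dagger>\<close>, which differs from
  \<^const>\<open>calV\<close> by the reflection \<open>p \<mapsto> -p\<close>, to match the convention in \<^const>\<open>calW\<close>.\<close>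

definition b_mu :: "real \<Rightarrow> (real^3 \<Rightarrow> real) \<Rightarrow> real \<Rightarrow> real" where
  "b_mu \<mu> V l =
     inf_spec sphere_measure (\<lambda>u p. of_real l * FVF \<mu> V u p - of_real (l\<^sup>2) * calW \<mu> V u p)"


section \<open>Consistency of the normalisations\<close>

lemma sgn_measurable_sphere:
  "sgn \<in> restrict_space lborel (ball 0 1 - {0::real^3}) \<rightarrow>\<^sub>M restrict_space borel (sphere 0 1)"
proof (rule measurable_restrict_space2)
  show "sgn \<in> space (restrict_space lborel (ball 0 1 - {0::real^3})) \<rightarrow> sphere 0 1"
    by (auto simp: space_restrict_space norm_sgn)
  show "sgn \<in> restrict_space lborel (ball 0 1 - {0::real^3}) \<rightarrow>\<^sub>M borel"
    by (rule measurable_restrict_space1) simp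
qed

lemma space_sphere_measure [simp]: "space sphere_measure = sphere 0 1"
  by (simp add: sphere_measure_def space_scale_measure space_restrict_space)

lemma sets_sphere_measure [measurable_cong]:
  "sets sphere_measure = sets (restrict_space borel (sphere 0 1))"
  by (simp add: sphere_measure_def)

lemma emeasure_sphere_measure:
  assumes "A \<in> sets (restrict_space borel (sphere 0 (1::real) :: (real^3) set))"
  shows "emeasure sphere_measure A = 3 * emeasure lborel {x. x \<noteq> 0 \<and> norm x < 1 \<and> sgn x \<in> A}"
proof -
  have eq: "sgn -` A \<inter> (ball 0 1 - {0}) = {x. x \<noteq> 0 \<and> norm x < 1 \<and> sgn x \<in> A}"
    by auto
  show ?thesis
    using assms
    by (simp add: sphere_measure_def emeasure_distr[OF sgn_measurable_sphere]
        space_restrict_space emeasure_restrict_space eq[symmetric])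
qed

lemma emeasure_sphere_measure_space:
  "emeasure sphere_measure (sphere 0 1) = ennreal (4 * pi)"
proof -
  have eq: "{x::real^3. x \<noteq> 0 \<and> norm x < 1 \<and> sgn x \<in> sphere 0 1} = ball 0 1 - {0}"
    by (auto simp: norm_sgn)
  have "emeasure lborel (ball 0 1 - {0::real^3}) = emeasure lborel (ball 0 1 :: (real^3) set)"
    by (rule emeasure_Diff_null_set) auto
  also have "\<dots> = ennreal (4 / 3 * pi)"
    by (simp add: emeasure_ball unit_ball_vol_3)
  finally have vol: "emeasure lborel (ball 0 1 - {0::real^3}) = ennreal (4 / 3 * pi)" .
  have "emeasure sphere_measure (sphere 0 1) = ennreal 3 * ennreal (4 / 3 * pi)"
    by (subst emeasure_sphere_measure, simp add: sets_restrict_space_iff, unfold eq vol) simp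
  also have "\<dots> = ennreal (3 * (4 / 3 * pi))"
    by (rule ennreal_mult[symmetric]) auto
  finally show ?thesis
    by simp
qed

interpretation sphere_measure: finite_measure sphere_measure
  by standard (simp add: emeasure_sphere_measure_space)

lemma inner_measurable_pair:
  "(\<lambda>(x, p). x \<bullet> p) \<in> borel_measurable (lebesgue \<Otimes>\<^sub>M (sphere_measure :: (real^3) measure))"
proof -
  have 1: "(\<lambda>z. fst z) \<in> borel_measurable (lebesgue \<Otimes>\<^sub>M (sphere_measure :: (real^3) measure))"
    by (rule measurable_compose[OF measurable_fst]) (simp add: measurable_completion)
  have "(\<lambda>p. p) \<in> borel_measurable (restrict_space borel (sphere 0 1 :: (real^3) set))"
    by (rule measurable_restrict_space1) simp
  then have "(\<lambda>p. p) \<in> borel_measurable sphere_measure"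
    by (simp cong: measurable_cong_sets add: sets_sphere_measure)
  then have 2: "(\<lambda>z. snd z) \<in> borel_measurable (lebesgue \<Otimes>\<^sub>M (sphere_measure :: (real^3) measure))"
    by (rule measurable_compose[OF measurable_snd])
  show ?thesis
    unfolding case_prod_beta by (rule borel_measurable_inner[OF 1 2])
qed

lemma L2_sphere_integrable:
  assumes "u \<in> L2_space sphere_measure"
  shows "integrable sphere_measure u"
proof (rule Bochner_Integration.integrable_bound)
  show "integrable sphere_measure (\<lambda>x. 1 + (cmod (u x))\<^sup>2)"
    using assms by (simp add: L2_space_def)
  show "u \<in> borel_measurable sphere_measure"
    using assms by (simp add: L2_space_def)
  have "t \<le> 1 + t\<^sup>2" if "0 \<le> t" for t :: real
    using zero_le_power2[of "t - 1"] that by (simp add: power2_eq_square algebra_simps)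
  then show "AE x in sphere_measure. norm (u x) \<le> norm (1 + (cmod (u x))\<^sup>2)"
    by (smt (verit) AE_I2 norm_ge_zero real_norm_def)
qed

lemma sphere_fubini:
  fixes \<psi> u :: "real^3 \<Rightarrow> complex"
  assumes \<psi>: "integrable lebesgue \<psi>" and u: "integrable sphere_measure u"
  shows "(\<integral>p. (\<integral>x. \<psi> x * exp (\<i> * of_real (s * (x \<bullet> p))) \<partial>lebesgue) * u p \<partial>sphere_measure) =
    (\<integral>x. \<psi> x * (\<integral>p. u p * exp (\<i> * of_real (s * (x \<bullet> p))) \<partial>sphere_measure) \<partial>lebesgue)"
proof -
  interpret L: sigma_finite_measure "lebesgue :: (real^3) measure"
  proof
    obtain A :: "(real^3) set set" where
      "countable A" "A \<subseteq> sets lborel" "\<Union>A = space lborel" "\<forall>a\<in>A. emeasure lborel a \<noteq> \<infinity>"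
      using lborel.sigma_finite_countable by blast
    then show "\<exists>A. countable A \<and> A \<subseteq> sets lebesgue \<and> \<Union>A = space (lebesgue :: (real^3) measure) \<and>
        (\<forall>a\<in>A. emeasure lebesgue a \<noteq> \<infinity>)"
      by (intro exI[of _ A]) auto
  qed
  interpret P: pair_sigma_finite "lebesgue :: (real^3) measure" sphere_measure ..
  let ?f = "\<lambda>(x, p). \<psi> x * u p * exp (\<i> * of_real (s * (x \<bullet> p)))"
  have [measurable]: "\<psi> \<in> borel_measurable lebesgue" "u \<in> borel_measurable sphere_measure"
    using assms by auto
  note [measurable] = inner_measurable_pair[unfolded case_prod_beta]
  have int: "integrable (lebesgue \<Otimes>\<^sub>M sphere_measure) ?f"
  proof (rule P.Fubini_integrable)
    show "?f \<in> borel_measurable (lebesgue \<Otimes>\<^sub>M sphere_measure)"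
      unfolding case_prod_beta by measurable
    have "integrable lebesgue (\<lambda>x. norm (\<psi> x) * (\<integral>p. norm (u p) \<partial>sphere_measure))"
      using \<psi> by auto
    then show "integrable lebesgue (\<lambda>x. \<integral>p. norm (?f (x, p)) \<partial>sphere_measure)"
      by (simp add: norm_mult)
    have "integrable sphere_measure (\<lambda>p. \<psi> x * u p * exp (\<i> * of_real (s * (x \<bullet> p))))" for x
    proof (rule Bochner_Integration.integrable_bound)
      show "integrable sphere_measure (\<lambda>p. \<psi> x * u p)"
        using u by simp
      have [measurable]: "(\<lambda>p. x \<bullet> p) \<in> borel_measurable sphere_measure"
        using measurable_Pair2[OF inner_measurable_pair, of x] by simp
      show "(\<lambda>p. \<psi> x * u p * exp (\<i> * of_real (s * (x \<bullet> p)))) \<in> borel_measurable sphere_measure"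
        by measurable
    qed (simp add: norm_mult)
    then show "AE x in lebesgue. integrable sphere_measure (\<lambda>p. ?f (x, p))"
      by simp
  qed
  have "(\<integral>p. (\<integral>x. \<psi> x * u p * exp (\<i> * of_real (s * (x \<bullet> p))) \<partial>lebesgue) \<partial>sphere_measure) =
      (\<integral>x. (\<integral>p. \<psi> x * u p * exp (\<i> * of_real (s * (x \<bullet> p))) \<partial>sphere_measure) \<partial>lebesgue)"
    using P.Fubini_integral[OF int] by simp
  moreover have "(\<integral>x. \<psi> x * u p * exp (\<i> * of_real (s * (x \<bullet> p))) \<partial>lebesgue) =
      (\<integral>x. \<psi> x * exp (\<i> * of_real (s * (x \<bullet> p))) \<partial>lebesgue) * u p" for p
    by (subst integral_mult_left_zero[symmetric]) (simp add: mult_ac)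
  moreover have "(\<integral>p. \<psi> x * u p * exp (\<i> * of_real (s * (x \<bullet> p))) \<partial>sphere_measure) =
      \<psi> x * (\<integral>p. u p * exp (\<i> * of_real (s * (x \<bullet> p))) \<partial>sphere_measure)" for x
    by (subst integral_mult_right_zero[symmetric]) (simp add: mult_ac)
  ultimately show ?thesis
    by simp
qed

lemma frakF_adjoint:
  assumes \<psi>: "integrable lebesgue \<psi>" and u: "u \<in> L2_space sphere_measure"
  shows "L2_inner sphere_measure (frakF \<mu> \<psi>) u = L2_inner lebesgue \<psi> (frakF_adj \<mu> u)"
proof -
  let ?c = "complex_of_real ((2 * pi) powr (- 3 / 2))"
  have "L2_inner sphere_measure (frakF \<mu> \<psi>) u =
      ?c * (\<integral>p. (\<integral>x. cnj (\<psi> x) * exp (\<i> * of_real (- sqrt \<mu> * (x \<bullet> p))) \<partial>lebesgue) * u p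
              \<partial>sphere_measure)"
  proof -
    have "cnj (\<integral>x. \<psi> x * exp (\<i> * of_real (sqrt \<mu> * (x \<bullet> p))) \<partial>lebesgue) =
        (\<integral>x. cnj (\<psi> x) * exp (\<i> * of_real (- sqrt \<mu> * (x \<bullet> p))) \<partial>lebesgue)" for p
      by (subst Bochner_Integration.integral_cnj[symmetric]) (simp add: exp_cnj)
    then show ?thesis
      unfolding L2_inner_def frakF_def
      by (subst integral_mult_right_zero[symmetric]) (simp only: complex_cnj_mult complex_cnj_complex_of_real mult_ac)
  qed
  also have "\<dots> = ?c * (\<integral>x. cnj (\<psi> x) *
      (\<integral>p. u p * exp (\<i> * of_real (- sqrt \<mu> * (x \<bullet> p))) \<partial>sphere_measure) \<partial>lebesgue)"
    by (subst sphere_fubini) (use \<psi> L2_sphere_integrable[OF u] in auto)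
  also have "\<dots> = L2_inner lebesgue \<psi> (frakF_adj \<mu> u)"
    unfolding L2_inner_def frakF_adj_def
    by (subst integral_mult_right_zero[symmetric]) (simp add: mult_ac)
  finally show ?thesis .
qed

end

theory Submission
 imports Defs "HOL-Probability.Probability" "HOL-Real_Asymp.Real_Asymp"
begin

text \<open>By the Birman--Schwinger principle, if \<open>K\<^sub>T + \<lambda>V\<close> is not nonnegative, then \<open>-1 / s\<close> is an approximate
 eigenvalue of \<open>|V|\<^sup>1\<^sup>/\<^sup>2 K\<^sub>T\<^sup>-\<^sup>1 V\<^sup>1\<^sup>/\<^sup>2\<close> for some \<open>0 < s \<le> \<lambda>\<close>. Here \<open>K\<^sub>T\<^sup>-\<^sup>1\<close> is the sum of the singular part
 \<open>m\<^sub>\<mu>(T) F\<^sup>* F\<close> on the Fermi sphere and of \<open>M\<^sub>T\<close>, which between factors \<open>|V|\<^sup>1\<^sup>/\<^sup>2\<close> stays bounded and converges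
 as \<open>T \<rightarrow> 0\<close>: the function \<open>r \<mapsto> sinc (r |x|)\<close> has a logarithmic modulus of continuity uniformly in \<open>x\<close>, and large
 momenta are controlled by the Hardy--Littlewood--Sobolev inequality. Restricting an approximate eigenvector
 to the sphere gives a trial vector for \<open>\<lambda>V\<^sub>\<mu> - \<lambda>\<^sup>2W\<^sub>\<mu>\<close> and so bounds \<open>T\<^sub>c\<close> from above; conversely, for a near-minimizer
 \<open>u\<close> of that form, \<open>K\<^sub>T\<^sup>-\<^sup>1 V F\<^sup>* u\<close> is a trial vector for \<open>K\<^sub>T + \<lambda>V\<close>, which bounds \<open>T\<^sub>c\<close> from below. Together
 \<open>m\<^sub>\<mu>(T\<^sub>c) = - 1 / b\<^sub>\<mu>(\<lambda>) + o(1)\<close>, and \<open>m\<^sub>\<mu>(T) = \<surd>\<mu> (ln (\<mu> / T) + \<gamma> - 2 + ln (8 / \<pi>)) + o(1)\<close>, where the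
 constant comes from \<open>\<integral> tanh x / x\<close> by the Wallis product.\<close>

section \<open>The Hilbert space structure of \<open>L^2\<close>\<close>

text \<open>At the critical temperature \<open>m_mu\<close> is of order 1/\<lambda>, so a limit for
  m + 1/b needs 1/m = -b + o(\<lambda>^2). Both bounds therefore keep the second-order operator W
  exactly and leave an error \<lambda> + \<open>eta\<close> in m, where \<open>eta\<close> tends to
  0 with T, but without a rate. The obstacle is that V is only in L^1 and L^(3/2), so V times the
  adjoint of F applied to u need not be square integrable. Writing V = |V|^(1/2) sgn(V) |V|^(1/2),
  all estimates are made for square integrable w: then |V|^(1/2) w is integrable, its transform is
  continuous and can be restricted to the Fermi sphere, and its pairing with 1/p^2 is finite.
  Eigenvectors are only approximate on both sides, so every argument is in weak form with a
  prescribed tolerance. The coupling s found by Birman--Schwinger is smaller than \<lambda>, while b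
  is formed at \<lambda>; \<open>rayleigh_shrink\<close> bridges this gap.\<close>

lemma L2_measurable [measurable_dest]: "f \<in> L2_space M ==> f \<in> borel_measurable M" by (simp add: L2_space_def)

lemma borel_measurable_cnj [measurable (raw)]:
 "f \<in> borel_measurable M ==> (%x. cnj (f x)) \<in> borel_measurable M"
 by (rule borel_measurable_continuous_on[OF continuous_on_cnj[OF continuous_on_id]])

lemma L2_square_integrable: "f \<in> L2_space M ==> integrable M (%x. (cmod (f x))^2)" by (simp add: L2_space_def)

lemma L2_spaceI:
 assumes "f \<in> borel_measurable M" "integrable M g" "AE x in M. (cmod (f x))^2 <= g x"
 shows "f \<in> L2_space M" unfolding L2_space_def
 by (intro CollectI conjI assms(1) Bochner_Integration.integrable_bound[OF assms(2)]) (use assms in auto)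

lemma L2_inner_integrable:
 assumes "f \<in> L2_space M" "g \<in> L2_space M"
 shows "integrable M (%x. cnj (f x) * g x)"
proof (rule Bochner_Integration.integrable_bound)
 note [measurable] = assms[THEN L2_measurable]
 show "integrable M (%x. (cmod (f x))^2 + (cmod (g x))^2)" using assms by (simp add: L2_square_integrable)
 show "(%x. cnj (f x) * g x) \<in> borel_measurable M" by measurable
 have "cmod a * cmod b <= (cmod a)^2 + (cmod b)^2" for a b
  using sum_squares_bound[of "cmod a" "cmod b"] mult_nonneg_nonneg[OF norm_ge_zero[of a] norm_ge_zero[of b]] by linarith
 then show "AE x in M. norm (cnj (f x) * g x) <= norm ((cmod (f x))^2 + (cmod (g x))^2)" by (simp add: norm_mult)
qed

lemma L2_lincomb:
 assumes "f \<in> L2_space M" "g \<in> L2_space M"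
 shows "(%x. c * f x + g x) \<in> L2_space M"
proof (rule L2_spaceI)
 note [measurable] = assms[THEN L2_measurable]
 show "(%x. c * f x + g x) \<in> borel_measurable M" by measurable
 show "integrable M (%x. 2 * ((cmod c)^2 * (cmod (f x))^2) + 2 * (cmod (g x))^2)" using assms by (simp add: L2_square_integrable)
 have "(cmod (a + b))^2 <= 2 * (cmod a)^2 + 2 * (cmod b)^2" for a b
 proof -
  have "(cmod (a + b))^2 <= (cmod a + cmod b)^2" by (simp add: norm_triangle_ineq power_mono)
  also have "... <= 2 * (cmod a)^2 + 2 * (cmod b)^2"
   using sum_squares_bound[of "cmod a" "cmod b"] by (simp add: power2_eq_square algebra_simps)
  finally show ?thesis .
 qed
 then show "AE x in M. (cmod (c * f x + g x))^2 <= 2 * ((cmod c)^2 * (cmod (f x))^2) + 2 * (cmod (g x))^2"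
  by (metis (no_types, lifting) AE_I2 norm_mult power_mult_distrib)
qed

lemma L2_zero [simp]: "(%x. 0) \<in> L2_space M" by (simp add: L2_space_def)

lemma L2_add: "f \<in> L2_space M ==> g \<in> L2_space M ==> (%x. f x + g x) \<in> L2_space M" using L2_lincomb[of f M g 1] by simp

lemma L2_scale: "f \<in> L2_space M ==> (%x. c * f x) \<in> L2_space M" using L2_lincomb[of f M "%x. 0" c] by simp

lemma L2_diff: "f \<in> L2_space M ==> g \<in> L2_space M ==> (%x. f x - g x) \<in> L2_space M"
 using L2_lincomb[of g M f "- 1"] by (simp add: algebra_simps)

lemma L2_cnj: "f \<in> L2_space M ==> (%x. cnj (f x)) \<in> L2_space M" by (auto simp: L2_space_def)

lemma L2_norm_nonneg [simp]: "0 <= L2_norm M f" by (simp add: L2_norm_def)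

lemma L2_norm_sq: "(L2_norm M f)^2 = (LINT x|M. (cmod (f x))^2)" by (simp add: L2_norm_def)

lemma L2_inner_self: "L2_inner M f f = of_real ((L2_norm M f)^2)" unfolding L2_norm_sq L2_inner_def
 by (subst integral_complex_of_real[symmetric]) (metis (no_types, lifting) complex_norm_square mult.commute)

lemma L2_inner_cnj: "cnj (L2_inner M f g) = L2_inner M g f"
 unfolding L2_inner_def by (subst Bochner_Integration.integral_cnj[symmetric]) (simp add: mult.commute)

lemma L2_inner_lincomb_right:
 assumes "f \<in> L2_space M" "g \<in> L2_space M" "h \<in> L2_space M"
 shows "L2_inner M h (%x. c * f x + g x) = c * L2_inner M h f + L2_inner M h g"
proof -
 have "L2_inner M h (%x. c * f x + g x) = (LINT x|M. c * (cnj (h x) * f x) + cnj (h x) * g x)"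
  unfolding L2_inner_def by (simp add: algebra_simps)
 also have "... = c * L2_inner M h f + L2_inner M h g" unfolding L2_inner_def using L2_inner_integrable assms
  by (subst Bochner_Integration.integral_add) auto
 finally show ?thesis .
qed

lemma L2_inner_lincomb_left:
 assumes "f \<in> L2_space M" "g \<in> L2_space M" "h \<in> L2_space M"
 shows "L2_inner M (%x. c * f x + g x) h = cnj c * L2_inner M f h + L2_inner M g h"
 using arg_cong[OF L2_inner_lincomb_right[OF assms, of c], of cnj] by (simp only: L2_inner_cnj complex_cnj_add complex_cnj_mult)

lemma L2_inner_zero [simp]: "L2_inner M (%x. 0) f = 0" "L2_inner M f (%x. 0) = 0" by (simp_all add: L2_inner_def)

lemma L2_inner_scale_right: "L2_inner M h (%x. c * f x) = c * L2_inner M h f" by (simp add: L2_inner_def mult.left_commute)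

lemma L2_inner_scale_left: "L2_inner M (%x. c * f x) h = cnj c * L2_inner M f h" by (simp add: L2_inner_def mult.assoc)

lemma L2_inner_diff_right:
 assumes "f \<in> L2_space M" "g \<in> L2_space M" "h \<in> L2_space M"
 shows "L2_inner M h (%x. f x - g x) = L2_inner M h f - L2_inner M h g"
 using L2_inner_lincomb_right[OF assms(2,1,3), of "-1"] by simp

lemma L2_inner_diff_left:
 assumes "f \<in> L2_space M" "g \<in> L2_space M" "h \<in> L2_space M"
 shows "L2_inner M (%x. f x - g x) h = L2_inner M f h - L2_inner M g h"
 using L2_inner_lincomb_left[OF assms(2,1,3), of "-1"] by simp

lemma L2_norm_scale: "L2_norm M (%x. c * f x) = cmod c * L2_norm M f"
 by (simp add: L2_norm_def norm_mult power_mult_distrib real_sqrt_mult)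

lemma L2_norm_minus: "L2_norm M (%x. f x - g x) = L2_norm M (%x. g x - f x)" by (simp add: L2_norm_def norm_minus_commute)

text \<open>A nonnegative quadratic in z has nonpositive discriminant. This serves as
  Cauchy--Schwarz for the inner product of L2, for the form of A - \<nu>, and for the form behind
  \<open>Birman_Schwinger\<close>; these may degenerate, so q = 0 is included.\<close>

lemma hermitian_discriminant:
 fixes a a' :: complex and p q :: real
 assumes "!!z. Im (z * a + cnj z * a') = 0" and "!!z. 0 <= p + Re (z * a + cnj z * a') + (cmod z)^2 * q" and "0 <= q"
 shows "(cmod a)^2 <= p * q"
proof -
 \<comment> \<open>The values z = 1 and z = \<i> of the reality assumption already determine
   a'.\<close>
 have "a' = cnj a" using assms(1)[of 1] assms(1)[of \<i>] by (simp add: complex_eq_iff)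
 \<comment> \<open>Taking z along -cnj a reduces everything to a real quadratic in s.\<close>
 have *: "0 <= p - 2 * s * (cmod a)^2 + s^2 * ((cmod a)^2 * q)" for s
 proof -
  have "0 <= p + Re ((- of_real s * cnj a) * a + cnj (- of_real s * cnj a) * cnj a) + (cmod (- of_real s * cnj a))^2 * q"
   using assms(2)[of "- of_real s * cnj a"] \<open>a' = cnj a\<close> by simp
  also have "... = p - 2 * s * (cmod a)^2 + s^2 * ((cmod a)^2 * q)"
   unfolding norm_mult power_mult_distrib by (simp add: cmod_power2) (simp add: algebra_simps power2_eq_square cmod_power2[unfolded power2_eq_square])
  finally show ?thesis .
 qed
 show ?thesis
 proof (cases "q = 0")
  case True
  have "cmod a = 0"
  proof (rule ccontr)
   assume "cmod a ~= 0"
   then have "(cmod a)^2 > 0" by simp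
   \<comment> \<open>For q = 0 the quadratic is affine in s, and this s gives it the value
     -1.\<close>
   then show False using *[of "(p + 1) / (2 * (cmod a)^2)"] True by (simp add: field_simps)
  qed
  then show ?thesis using True by simp
 next
  case False
  then have "q > 0" using assms(3) by simp
  have "1 / q * (1 / q) * q = 1 / q" using \<open>q > 0\<close> by (simp add: field_simps)
  then have "0 <= p - (cmod a)^2 / q" using *[of "1 / q"] \<open>q > 0\<close> by (simp add: power2_eq_square field_simps)
  then show ?thesis using \<open>q > 0\<close> by (simp add: field_simps)
 qed
qed

lemma L2_norm_lincomb_sq:
 assumes "f \<in> L2_space M" "g \<in> L2_space M"
 shows "of_real ((L2_norm M (%x. c * f x + g x))^2) =
  of_real ((L2_norm M g)^2) + (c * L2_inner M g f + cnj c * L2_inner M f g)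
   + of_real ((cmod c)^2 * (L2_norm M f)^2)"
proof -
 have "L2_inner M (%x. c * f x + g x) (%x. c * f x + g x) =
   cnj c * (c * L2_inner M f f + L2_inner M f g) + (c * L2_inner M g f + L2_inner M g g)" using assms L2_lincomb[OF assms]
  by (simp add: L2_inner_lincomb_right L2_inner_lincomb_left) (simp add: algebra_simps)
 moreover have "c * (cnj c * p) = of_real ((cmod c)^2) * p" for p unfolding complex_norm_square by (simp add: mult.assoc)
 ultimately show ?thesis by (simp add: L2_inner_self ring_distribs mult.left_commute[of "cnj c" c])
qed

lemma L2_Cauchy_Schwarz:
 assumes "f \<in> L2_space M" "g \<in> L2_space M"
 shows "cmod (L2_inner M f g) <= L2_norm M f * L2_norm M g"
proof -
 have "(cmod (L2_inner M f g))^2 <= (L2_norm M f)^2 * (L2_norm M g)^2"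
 proof (rule hermitian_discriminant[where a' = "L2_inner M g f"])
  fix z
  note e = L2_norm_lincomb_sq[OF assms(2,1), of z]
  show "Im (z * L2_inner M f g + cnj z * L2_inner M g f) = 0" using arg_cong[OF e, of Im] by simp
  show "0 <= (L2_norm M f)^2 + Re (z * L2_inner M f g + cnj z * L2_inner M g f) + (cmod z)^2 * (L2_norm M g)^2"
   using arg_cong[OF e, of Re] by simp (metis zero_le_power2)
 qed simp
 then show ?thesis by (simp flip: power_mult_distrib add: power2_le_iff_abs_le abs_of_nonneg)
qed

lemma L2_norm_triangle:
 assumes "f \<in> L2_space M" "g \<in> L2_space M"
 shows "L2_norm M (%x. f x + g x) <= L2_norm M f + L2_norm M g"
proof (rule power2_le_imp_le)
 have "(L2_norm M (%x. f x + g x))^2 =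
   Re (of_real ((L2_norm M g)^2) + (L2_inner M g f + L2_inner M f g) + of_real ((L2_norm M f)^2))"
  using arg_cong[OF L2_norm_lincomb_sq[OF assms, of 1], of Re] by simp
 also have "... <= (L2_norm M g)^2 + (cmod (L2_inner M g f) + cmod (L2_inner M f g)) + (L2_norm M f)^2"
  using complex_Re_le_cmod[of "L2_inner M g f"] complex_Re_le_cmod[of "L2_inner M f g"] by simp
 also have "... <= (L2_norm M f + L2_norm M g)^2" using L2_Cauchy_Schwarz[OF assms] L2_Cauchy_Schwarz[OF assms(2,1)]
  by (simp add: power2_eq_square algebra_simps)
 finally show "(L2_norm M (%x. f x + g x))^2 <= (L2_norm M f + L2_norm M g)^2" .
qed simp

lemma L2_norm_triangle3:
 assumes "f \<in> L2_space M" "g \<in> L2_space M" "h \<in> L2_space M"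
 shows "L2_norm M (%x. f x - h x) <= L2_norm M (%x. f x - g x) + L2_norm M (%x. g x - h x)"
 using L2_norm_triangle[OF L2_diff[OF assms(1,2)] L2_diff[OF assms(2,3)]] by simp

lemma L2_norm_cong_AE:
 assumes "AE x in M. f x = g x" "f \<in> L2_space M" "g \<in> L2_space M"
 shows "L2_norm M f = L2_norm M g"
proof -
 note [measurable] = assms(2,3)[THEN L2_measurable]
 show ?thesis unfolding L2_norm_def using assms(1) by (intro arg_cong[where f = sqrt] integral_cong_AE) auto
qed

lemma L2_inner_cong_AE:
 assumes "AE x in M. f x = g x" "f \<in> L2_space M" "g \<in> L2_space M" "h \<in> L2_space M"
 shows "L2_inner M h f = L2_inner M h g"
proof -
 note [measurable] = assms(2,3,4)[THEN L2_measurable]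
 show ?thesis unfolding L2_inner_def using assms(1) by (intro integral_cong_AE) auto
qed

lemma L2_norm_eq_0:
 assumes "f \<in> L2_space M"
 shows "L2_norm M f = 0 \<longleftrightarrow> (AE x in M. f x = 0)"
 unfolding L2_norm_def using integral_nonneg_eq_0_iff_AE[OF L2_square_integrable[OF assms]] by simp

lemma L2_norm_ennreal:
 assumes "f \<in> L2_space M"
 shows "nn_integral M (%x. ennreal ((cmod (f x))^2)) = ennreal ((L2_norm M f)^2)"
 unfolding L2_norm_sq by (rule nn_integral_eq_integral[OF L2_square_integrable[OF assms]]) simp

text \<open>The form in which Fatou's lemma delivers its bounds: membership in L2 and the norm
  estimate come together from one nonnegative integral.\<close>

lemma L2_nn_integralI:
 assumes "f \<in> borel_measurable M" "nn_integral M (%x. ennreal ((cmod (f x))^2)) <= ennreal (c^2)" "0 <= c"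
 shows "f \<in> L2_space M" "L2_norm M f <= c"
proof -
 show f: "f \<in> L2_space M" unfolding L2_space_def using assms by (auto simp: integrable_iff_bounded intro: order_le_less_trans)
 have "ennreal ((L2_norm M f)^2) <= ennreal (c^2)" using assms(2) L2_norm_ennreal[OF f] by simp
 then have "(L2_norm M f)^2 <= c^2" by (subst (asm) ennreal_le_iff) auto
 then show "L2_norm M f <= c" using assms(3) by (rule power2_le_imp_le)
qed

text \<open>A subsequence with \<open>\<parallel>d\<^sub>k\<parallel> \<le> 2\<^sup>-\<^sup>k\<close> has \<open>\<Sum> 2\<^sup>k |d\<^sub>k|\<^sup>2 < \<infinity>\<close> almost everywhere, hence converges there;
 Fatou's lemma upgrades this to convergence in norm.\<close>

lemma L2_complete:
 assumes f: "!!n. f n \<in> L2_space M"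
  and C: "!!e. e > 0 ==> EX N. ALL m>=N. ALL n>=N. L2_norm M (%x. f m x - f n x) < e"
 shows "EX g:L2_space M. (%n. L2_norm M (%x. f n x - g x)) \<longlonglongrightarrow> 0"
proof -
 note [measurable] = f[THEN L2_measurable]
 obtain r where r: "strict_mono r" "!!k. ALL m>=r k. ALL n>=r k. L2_norm M (%x. f m x - f n x) < (1/2)^k"
 proof -
  have "EX r. strict_mono r & (ALL k. ALL m>=r k. ALL n>=r k. L2_norm M (%x. f m x - f n x) < (1/2)^k)"
  proof -
   have "ALL k. EX N. ALL m>=N. ALL n>=N. L2_norm M (%x. f m x - f n x) < (1/2)^k" using C by simp
   then obtain N where N: "!!k. ALL m>=N k. ALL n>=N k. L2_norm M (%x. f m x - f n x) < (1/2)^k" by metis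
   define r where "r = rec_nat (N 0) (%k x. max (Suc x) (N (Suc k)))"
   have "r (Suc k) >= Suc (r k)" "r (Suc k) >= N (Suc k)" "r 0 = N 0" for k by (auto simp: r_def)
   then have "strict_mono r" "r k >= N k" for k
    by (auto simp: strict_mono_Suc_iff Suc_le_eq) (metis not0_implies_Suc order_refl)
   then show ?thesis using N by (meson order_trans)
  qed
  then show ?thesis using that by blast
 qed
 define d where "d k x = f (r (Suc k)) x - f (r k) x" for k x
 have dL: "d k \<in> L2_space M" for k unfolding d_def by (intro L2_diff f)
 note [measurable] = dL[THEN L2_measurable]
 have dn: "L2_norm M (d k) <= (1/2)^k" for k using r(2)[of k] strict_mono_mono[OF r(1)] unfolding d_def
  by (metis le_SucI less_eq_real_def monoD order_refl)
 have "nn_integral M (%x. (\<Sum>k. ennreal (2^k * (cmod (d k x))^2))) = (\<Sum>k. nn_integral M (%x. ennreal (2^k * (cmod (d k x))^2)))"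
  by (rule nn_integral_suminf) measurable
 also have "... = (\<Sum>k. ennreal (2^k * (L2_norm M (d k))^2))" by (simp add: ennreal_mult nn_integral_cmult L2_norm_ennreal[OF dL])
 also have "... <= (\<Sum>k. ennreal ((1/2)^k))"
 proof (intro suminf_le ennreal_leI)
  fix k
  have "(L2_norm M (d k))^2 <= ((1/2)^k)^2" by (intro power_mono dn) simp
  then have "2^k * (L2_norm M (d k))^2 <= 2^k * ((1/2)^k)^2" by (rule mult_left_mono) simp
  also have "... = (1/2::real)^k" by (simp add: power2_eq_square power_divide field_simps)
  finally show "2^k * (L2_norm M (d k))^2 <= (1/2)^k" .
 qed auto
 also have "... = ennreal 2"
  by (subst suminf_ennreal_eq[where x = 2]) (auto intro: power_half_series simp: geometric_sums[of "1/2::real", simplified])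
 finally have fin: "nn_integral M (%x. (\<Sum>k. ennreal (2^k * (cmod (d k x))^2))) ~= \<infinity>"
  by (metis ennreal_less_top infinity_ennreal_def not_le)
 have "AE x in M. (\<Sum>k. ennreal (2^k * (cmod (d k x))^2)) ~= \<infinity>" by (rule nn_integral_noteq_infinite[OF _ fin]) measurable
 then have conv: "AE x in M. convergent (%k. f (r k) x)"
 proof eventually_elim
  case (elim x)
  then have "summable (%k. 2^k * (cmod (d k x))^2)" by (intro summable_suminf_not_top) auto
  then have "summable (%k. 2^k * (cmod (d k x))^2 + (1/2)^k)" by (intro summable_add summable_geometric) auto
  moreover have "cmod (d k x) <= 2^k * (cmod (d k x))^2 + (1/2)^k" for k
  proof -
   define y where "y = 2^k * cmod (d k x)"
   \<comment> \<open>With y = 2^k |d_k| this trades the summable weighted squares for a summable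
     majorant of |d_k| itself.\<close>
   have "y <= y^2 + 1" using sum_power2_ge_zero[of "y - 1/2" 0] by (simp add: power2_eq_square algebra_simps)
   then have "(1/2)^k * y <= (1/2)^k * (y^2 + 1)" by (rule mult_left_mono) simp
   then show ?thesis by (simp add: y_def power2_eq_square power_divide field_simps)
  qed
  ultimately have "summable (%k. d k x)" by (rule summable_comparison_test'[where N = 0])
  then have "convergent (%n. (\<Sum>k<n. d k x) + f (r 0) x)" by (simp add: summable_iff_convergent convergent_add_const_right_iff)
  moreover have "(\<Sum>k<n. d k x) + f (r 0) x = f (r n) x" for n unfolding d_def by (subst sum_lessThan_telescope) simp
  ultimately show ?case by simp
 qed
 define g where "g x = lim (%k. f (r k) x)" for x
 have gm [measurable]: "g \<in> borel_measurable M" unfolding g_def by measurable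
 have glim: "AE x in M. (%k. f (r k) x) \<longlonglongrightarrow> g x" using conv by eventually_elim (simp add: g_def convergent_LIMSEQ_iff)
 have key: "nn_integral M (%x. ennreal ((cmod (f n x - g x))^2)) <= ennreal (((1/2)^k)^2)" if "n >= r k" for n k
 proof -
  have "nn_integral M (%x. ennreal ((cmod (f n x - g x))^2)) = nn_integral M (%x. liminf (%j. ennreal ((cmod (f n x - f (r j) x))^2)))"
  proof (rule nn_integral_cong_AE)
   show "AE x in M. ennreal ((cmod (f n x - g x))^2) = liminf (%j. ennreal ((cmod (f n x - f (r j) x))^2))" using glim
   proof eventually_elim
    case (elim x)
    then have "(%j. ennreal ((cmod (f n x - f (r j) x))^2)) \<longlonglongrightarrow> ennreal ((cmod (f n x - g x))^2)" by (intro tendsto_intros)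
    from lim_imp_Liminf[OF trivial_limit_sequentially this] show ?case by (rule sym)
   qed
  qed
  also have "... <= liminf (%j. nn_integral M (%x. ennreal ((cmod (f n x - f (r j) x))^2)))"
   by (rule nn_integral_liminf) measurable
  also have "... = liminf (%j. ennreal ((L2_norm M (%x. f n x - f (r j) x))^2))"
   by (simp add: L2_norm_ennreal[OF L2_diff[OF f f]])
  also have "... <= liminf (%j. ennreal (((1/2)^k)^2))"
  proof (rule Liminf_mono)
   show "\<forall>\<^sub>F j in sequentially. ennreal ((L2_norm M (%x. f n x - f (r j) x))^2) <= ennreal (((1/2)^k)^2)"
    using eventually_ge_at_top[of k]
   proof eventually_elim
    case (elim j)
    then have "r j >= r k" using strict_mono_mono[OF r(1)] by (simp add: monoD)
    then have "L2_norm M (%x. f n x - f (r j) x) < (1/2)^k" using r(2)[of k] that by blast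
    then show ?case by (intro ennreal_leI power_mono) auto
   qed
  qed
  also have "... = ennreal (((1/2)^k)^2)" by (simp add: Liminf_const)
  finally show ?thesis .
 qed
 have kL: "(%x. f n x - g x) \<in> L2_space M" "L2_norm M (%x. f n x - g x) <= (1/2)^k" if "n >= r k" for n k
  by (rule L2_nn_integralI[OF _ key[OF that]]; simp)+
 have "g \<in> L2_space M" using L2_diff[OF f[of "r 0"] kL(1)[of 0 "r 0"]] by simp
 moreover have "(%n. L2_norm M (%x. f n x - g x)) \<longlonglongrightarrow> 0"
 proof (rule LIMSEQ_I)
  fix e :: real assume "e > 0"
  then obtain k where "(1/2::real)^k < e" using real_arch_pow_inv[of e "1/2"] by auto
  then show "EX no. ALL n>=no. norm (L2_norm M (%x. f n x - g x) - 0) < e"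
   using kL(2)[of k] by (intro exI[of _ "r k"]) (auto intro: order_le_less_trans)
 qed
 ultimately show ?thesis by blast
qed

section \<open>Bounded operators and the bottom of the spectrum\<close>

lemma bounded_operator_L2: "bounded_operator M A ==> f \<in> L2_space M ==> A f \<in> L2_space M" by (simp add: bounded_operator_def)

lemma bounded_operator_lincomb:
 "bounded_operator M A ==> f \<in> L2_space M ==> g \<in> L2_space M ==>
  AE x in M. A (%y. c * f y + g y) x = c * A f x + A g x" by (simp add: bounded_operator_def)

lemma bounded_operator_bound:
 assumes "bounded_operator M A"
 obtains C where "C > 0" "!!f. f \<in> L2_space M ==> L2_norm M (A f) <= C * L2_norm M f"
proof -
 obtain C where C: "!!f. f \<in> L2_space M ==> L2_norm M (A f) <= C * L2_norm M f"
  using assms unfolding bounded_operator_def by blast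
 show ?thesis
 proof
  show "max C 1 > 0" by simp
  show "L2_norm M (A f) <= max C 1 * L2_norm M f" if "f \<in> L2_space M" for f
   by (rule order_trans[OF C[OF that]]) (simp add: mult_right_mono)
 qed
qed

lemma bounded_operator_diff:
 assumes "bounded_operator M A" "f \<in> L2_space M" "g \<in> L2_space M"
 shows "AE x in M. A (%y. f y - g y) x = A f x - A g x" using bounded_operator_lincomb[OF assms(1,3,2), of "-1"] by simp

lemma bounded_operator_inner_lincomb:
 assumes "bounded_operator M A" "f \<in> L2_space M" "g \<in> L2_space M" "h \<in> L2_space M"
 shows "L2_inner M h (A (%y. c * f y + g y)) = c * L2_inner M h (A f) + L2_inner M h (A g)"
proof -
 note L = bounded_operator_L2[OF assms(1)]
 have "L2_inner M h (A (%y. c * f y + g y)) = L2_inner M h (%x. c * A f x + A g x)"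
  by (rule L2_inner_cong_AE[OF bounded_operator_lincomb[OF assms(1-3)]]) (intro L L2_lincomb assms)+
 also have "... = c * L2_inner M h (A f) + L2_inner M h (A g)" by (intro L2_inner_lincomb_right L assms)
 finally show ?thesis .
qed

lemma bounded_operator_lincomb_op:
 assumes A: "bounded_operator M A" and B: "bounded_operator M B"
 shows "bounded_operator M (%u x. c * A u x + d * B u x)"
proof -
 obtain C1 where C1: "!!f. f \<in> L2_space M ==> L2_norm M (A f) <= C1 * L2_norm M f"
  using A unfolding bounded_operator_def by blast
 obtain C2 where C2: "!!f. f \<in> L2_space M ==> L2_norm M (B f) <= C2 * L2_norm M f"
  using B unfolding bounded_operator_def by blast
 note L = bounded_operator_L2[OF A] bounded_operator_L2[OF B]
 have "L2_norm M (%x. c * A f x + d * B f x) <= (cmod c * C1 + cmod d * C2) * L2_norm M f" if "f \<in> L2_space M" for f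
 proof -
  have "L2_norm M (%x. c * A f x + d * B f x) <= cmod c * L2_norm M (A f) + cmod d * L2_norm M (B f)"
   using L2_norm_triangle[OF L2_scale L2_scale, OF L(1)[OF that] L(2)[OF that], of c d] by (simp add: L2_norm_scale)
  also have "... <= cmod c * (C1 * L2_norm M f) + cmod d * (C2 * L2_norm M f)"
   by (intro add_mono mult_left_mono C1 C2 that) auto
  finally show ?thesis by (simp add: algebra_simps)
 qed
 moreover have "AE x in M. c * A (%y. e * f y + g y) x + d * B (%y. e * f y + g y) x
   = e * (c * A f x + d * B f x) + (c * A g x + d * B g x)" if "f \<in> L2_space M" "g \<in> L2_space M" for f g e
  using bounded_operator_lincomb[OF A that, of e] bounded_operator_lincomb[OF B that, of e]
  by eventually_elim (simp add: algebra_simps)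
 ultimately show ?thesis unfolding bounded_operator_def using L by (auto intro!: L2_lincomb[OF _ L2_scale])
qed

lemma bounded_operator_id: "bounded_operator M (%u. u)" unfolding bounded_operator_def by (auto intro!: exI[of _ 1])

lemma bounded_operator_shift:
 assumes "bounded_operator M A"
 shows "bounded_operator M (%u x. A u x - z * u x)"
 using bounded_operator_lincomb_op[OF assms bounded_operator_id, of 1 "-z"] by simp

text \<open>The step t = \<delta>/C^2 minimises 1 - 2 t \<delta> + t^2 C^2, which bounds the squared
  norm of 1 - t A; the minimum is 1 - \<delta>^2/C^2.\<close>

lemma coercive_contraction:
 assumes f: "f \<in> L2_space M" "Af \<in> L2_space M"
  and "Re (L2_inner M f Af) >= \<delta> * (L2_norm M f)^2" "L2_norm M Af <= C * L2_norm M f" "0 < \<delta>" "\<delta> <= C"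
 shows "L2_norm M (%x. f x - of_real (\<delta> / C^2) * Af x) <= sqrt (1 - \<delta>^2 / C^2) * L2_norm M f"
proof (rule power2_le_imp_le)
 define t where "t = \<delta> / C^2"
 have C: "C > 0" using assms by simp
 have t: "t > 0" unfolding t_def using assms C by simp
 have q: "0 <= 1 - \<delta>^2 / C^2" using assms C by (simp add: power_mono)
 have "(L2_norm M (%x. f x - of_real t * Af x))^2 =
   (L2_norm M f)^2 - t * Re (L2_inner M f Af + L2_inner M Af f) + t^2 * (L2_norm M Af)^2"
  using arg_cong[OF L2_norm_lincomb_sq[OF f(2,1), of "- of_real t"], of Re] by (simp add: algebra_simps)
 also have "Re (L2_inner M f Af + L2_inner M Af f) = 2 * Re (L2_inner M f Af)"
  using arg_cong[OF L2_inner_cnj[of M f Af], of Re] by simp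
 also have "(L2_norm M f)^2 - t * (2 * Re (L2_inner M f Af)) + t^2 * (L2_norm M Af)^2
   <= (L2_norm M f)^2 - t * (2 * (\<delta> * (L2_norm M f)^2)) + t^2 * (C * L2_norm M f)^2"
  using assms t by (intro add_mono diff_left_mono mult_left_mono power_mono) auto
 also have "... = (1 - \<delta>^2 / C^2) * (L2_norm M f)^2" unfolding t_def using C by (simp add: field_simps power2_eq_square)
 finally show "(L2_norm M (%x. f x - of_real (\<delta> / C^2) * Af x))^2 <= (sqrt (1 - \<delta>^2 / C^2) * L2_norm M f)^2"
  unfolding t_def[symmetric] power_mult_distrib using q by simp
qed (use assms in \<open>simp add: power_mono\<close>)

text \<open>Lax--Milgram by Banach's fixed point theorem: a solution of A g = h is a fixed point of
  f - t (A f - h), which contracts by \<open>coercive_contraction\<close>. The limit of the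
  iteration is a fixed point only almost everywhere.\<close>

lemma coercive_surjective:
 assumes A: "bounded_operator M A" and "0 < \<delta>"
  and co: "!!f. f \<in> L2_space M ==> Re (L2_inner M f (A f)) >= \<delta> * (L2_norm M f)^2"
  and h: "h \<in> L2_space M"
 shows "EX g:L2_space M. AE x in M. A g x = h x"
proof -
 obtain C0 where C0: "!!f. f \<in> L2_space M ==> L2_norm M (A f) <= C0 * L2_norm M f"
  using A unfolding bounded_operator_def by blast
 \<comment> \<open>The enlargement makes C positive and at least \<delta>, so that 1 -
   \<delta>^2/C^2 lies in [0, 1).\<close>
 define C where "C = max C0 (2 * \<delta>)"
 have C: "L2_norm M (A f) <= C * L2_norm M f" if "f \<in> L2_space M" for f
  by (rule order_trans[OF C0[OF that]]) (simp add: C_def mult_right_mono)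
 have C\<delta>: "\<delta> < C" "C > 0" using \<open>0 < \<delta>\<close> by (auto simp: C_def)
 define t where "t = \<delta> / C^2"
 have t: "t > 0" using C\<delta> \<open>0 < \<delta>\<close> by (simp add: t_def)
 define q where "q = sqrt (1 - \<delta>^2 / C^2)"
 have q: "0 <= q" "q < 1" using C\<delta> \<open>0 < \<delta>\<close> by (auto simp: q_def power_mono)
 note L = bounded_operator_L2[OF A]
 define \<Phi> where "\<Phi> f x = f x - of_real t * (A f x - h x)" for f :: "'a => complex" and x
 have \<Phi>L: "\<Phi> f \<in> L2_space M" if "f \<in> L2_space M" for f unfolding \<Phi>_def by (intro L2_diff L2_scale that L h)
 have \<Phi>: "L2_norm M (%x. \<Phi> f x - \<Phi> g x) <= q * L2_norm M (%x. f x - g x)" if fg: "f \<in> L2_space M" "g \<in> L2_space M" for f g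
 proof -
  let ?d = "%x. f x - g x"
  have d: "?d \<in> L2_space M" by (intro L2_diff fg)
  have "L2_norm M (%x. \<Phi> f x - \<Phi> g x) = L2_norm M (%x. ?d x - of_real t * A ?d x)"
  proof (rule L2_norm_cong_AE)
   show "AE x in M. \<Phi> f x - \<Phi> g x = ?d x - of_real t * A ?d x" using bounded_operator_diff[OF A fg]
    by eventually_elim (simp add: \<Phi>_def right_diff_distrib)
  qed (intro L2_diff \<Phi>L fg L2_scale L d)+
  also have "... <= q * L2_norm M ?d" unfolding q_def t_def using C\<delta> \<open>0 < \<delta>\<close> by (intro coercive_contraction d L co C) auto
  finally show ?thesis .
 qed
 define s where "s n = (\<Phi> ^^ n) (%x. 0)" for n
 have s0: "s 0 = (%x. 0)" and sS: "s (Suc n) = \<Phi> (s n)" for n by (simp_all add: s_def)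
 have sL: "s n \<in> L2_space M" for n by (induction n) (auto simp: s0 sS \<Phi>L)
 define D where "D = L2_norm M (s 1)"
 have b: "L2_norm M (s k) <= D / (1 - q)" for k
 proof (induction k)
  case 0
  have "0 <= D / (1 - q)" using q unfolding D_def by (intro divide_nonneg_pos) auto
  then show ?case by (simp add: s0 L2_norm_def)
 next
  case (Suc k)
  have "L2_norm M (s (Suc k)) <= L2_norm M (%x. s (Suc k) x - s 1 x) + L2_norm M (s 1)"
   using L2_norm_triangle[OF L2_diff[OF sL[of "Suc k"] sL[of 1]] sL[of 1]] by simp
  also have "L2_norm M (%x. s (Suc k) x - s 1 x) <= q * L2_norm M (s k)" using \<Phi>[OF sL[of k] sL[of 0]] by (simp add: sS s0)
  also have "q * L2_norm M (s k) <= q * (D / (1 - q))" using Suc q by (intro mult_left_mono) auto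
  also have "q * (D / (1 - q)) + L2_norm M (s 1) = D / (1 - q)" using q unfolding D_def[symmetric] by (simp add: field_simps)
  finally show ?case by simp
 qed
 have c: "L2_norm M (%x. s (n + k) x - s n x) <= q ^ n * (D / (1 - q))" for n k
 proof (induction n)
  case 0 then show ?case using b[of k] by (simp add: s0)
 next
  case (Suc n)
  have "L2_norm M (%x. s (Suc n + k) x - s (Suc n) x) <= q * L2_norm M (%x. s (n + k) x - s n x)"
   using \<Phi>[OF sL sL, of "n + k" n] by (simp add: sS)
  also have "... <= q * (q ^ n * (D / (1 - q)))" using Suc q by (intro mult_left_mono) auto
  finally show ?case by (simp add: mult.assoc)
 qed
 have q0: "(%n. q ^ n * (D / (1 - q))) \<longlonglongrightarrow> 0" using q by (intro tendsto_mult_left_zero LIMSEQ_realpow_zero) auto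
 have "EX N. ALL m>=N. ALL n>=N. L2_norm M (%x. s m x - s n x) < e" if e: "e > 0" for e
 proof -
  obtain N where N: "!!n. n >= N ==> q ^ n * (D / (1 - q)) < e"
   using order_tendstoD(2)[OF q0 e] by (auto simp: eventually_sequentially)
  have "L2_norm M (%x. s m x - s n x) < e" if "m >= N" "n >= N" for m n
  proof (cases "n <= m")
   case True
   then show ?thesis using c[of n "m - n"] N[OF that(2)] by simp
  next
   case False
   then show ?thesis using c[of m "n - m"] N[OF that(1)] L2_norm_minus[of M "s m" "s n"] by simp
  qed
  then show ?thesis by blast
 qed
 from L2_complete[OF sL this] obtain g where g: "g \<in> L2_space M" "(%n. L2_norm M (%x. s n x - g x)) \<longlonglongrightarrow> 0" by blast
 have "L2_norm M (%x. \<Phi> g x - g x) <= L2_norm M (%x. s n x - g x) + L2_norm M (%x. s (Suc n) x - g x)" for n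
 proof -
  have "L2_norm M (%x. \<Phi> g x - g x) <= L2_norm M (%x. \<Phi> g x - s (Suc n) x) + L2_norm M (%x. s (Suc n) x - g x)"
   by (intro L2_norm_triangle3 \<Phi>L sL g)
  also have "L2_norm M (%x. \<Phi> g x - s (Suc n) x) <= q * L2_norm M (%x. g x - s n x)" using \<Phi>[OF g(1) sL[of n]] by (simp add: sS)
  also have "... <= 1 * L2_norm M (%x. g x - s n x)" using q by (intro mult_right_mono) auto
  finally show ?thesis using L2_norm_minus[of M g "s n"] by simp
 qed
 moreover have "(%n. L2_norm M (%x. s n x - g x) + L2_norm M (%x. s (Suc n) x - g x)) \<longlonglongrightarrow> 0"
  using tendsto_add[OF g(2) LIMSEQ_Suc[OF g(2)]] by simp
 ultimately have "L2_norm M (%x. \<Phi> g x - g x) <= 0" by (intro LIMSEQ_le_const) auto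
 then have "L2_norm M (%x. \<Phi> g x - g x) = 0" using L2_norm_nonneg by (metis order_antisym)
 then have "AE x in M. \<Phi> g x - g x = 0" by (subst (asm) L2_norm_eq_0) (intro L2_diff \<Phi>L g)
 then have "AE x in M. A g x = h x" by eventually_elim (use t in \<open>simp add: \<Phi>_def\<close>)
 then show ?thesis using g by blast
qed

lemma coercive_norm_le:
 assumes "f \<in> L2_space M" "Af \<in> L2_space M" "Re (L2_inner M f Af) >= \<delta> * (L2_norm M f)^2"
 shows "\<delta> * L2_norm M f <= L2_norm M Af"
proof (cases "L2_norm M f = 0")
 case False
 then have n: "L2_norm M f > 0" using L2_norm_nonneg[of M f] by linarith
 have "(\<delta> * L2_norm M f) * L2_norm M f <= cmod (L2_inner M f Af)"
  using assms(3) complex_Re_le_cmod[of "L2_inner M f Af"] by (simp add: power2_eq_square)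
 also have "... <= L2_norm M Af * L2_norm M f" using L2_Cauchy_Schwarz[OF assms(1,2)] by (simp add: mult.commute)
 finally show ?thesis using n by simp
qed simp

text \<open>The inverse is picked by choice, solution by solution, so its linearity holds only
  almost everywhere and comes from the injectivity of A, itself a consequence of coercivity.\<close>

lemma coercive_inverse:
 assumes A: "bounded_operator M A" and \<delta>: "0 < \<delta>"
  and co: "!!f. f \<in> L2_space M ==> Re (L2_inner M f (A f)) >= \<delta> * (L2_norm M f)^2"
 shows "EX R. bounded_operator M R & (ALL f:L2_space M. (AE x in M. R (A f) x = f x) & (AE x in M. A (R f) x = f x))"
proof -
 note L = bounded_operator_L2[OF A]
 obtain R where R: "!!h. h \<in> L2_space M ==> R h \<in> L2_space M"
   "!!h. h \<in> L2_space M ==> AE x in M. A (R h) x = h x" using coercive_surjective[OF A \<delta> co] by metis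
 have inj: "AE x in M. f x = g x" if fg: "f \<in> L2_space M" "g \<in> L2_space M" and e: "AE x in M. A f x = A g x" for f g
 proof -
  let ?d = "%x. f x - g x"
  have d: "?d \<in> L2_space M" by (intro L2_diff fg)
  have "AE x in M. A ?d x = 0" using e bounded_operator_diff[OF A fg] by eventually_elim simp
  then have "L2_norm M (A ?d) = 0" using L2_norm_eq_0[OF L[OF d]] by simp
  then have "\<delta> * L2_norm M ?d <= 0" using coercive_norm_le[OF d L[OF d] co[OF d]] by simp
  then have "L2_norm M ?d = 0" using \<delta> L2_norm_nonneg[of M ?d] by (simp add: mult_le_0_iff)
  then show ?thesis by (subst (asm) L2_norm_eq_0[OF d]) simp
 qed
 have "bounded_operator M R" unfolding bounded_operator_def
 proof (intro conjI ballI allI)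
  fix f g c assume fg: "f \<in> L2_space M" "g \<in> L2_space M"
  note l = L2_lincomb[OF fg, of c]
  show "AE x in M. R (%y. c * f y + g y) x = c * R f x + R g x"
  proof (rule inj)
   show "AE x in M. A (R (%y. c * f y + g y)) x = A (%x. c * R f x + R g x) x" using R(2)[OF l] R(2)[OF fg(1)] R(2)[OF fg(2)]
     bounded_operator_lincomb[OF A R(1)[OF fg(1)] R(1)[OF fg(2)], of c] by eventually_elim simp
  qed (intro R l L2_lincomb fg)+
 next
  show "EX C. ALL f:L2_space M. L2_norm M (R f) <= C * L2_norm M f"
  proof (intro exI[of _ "1 / \<delta>"] ballI)
   fix f assume f: "f \<in> L2_space M"
   have "\<delta> * L2_norm M (R f) <= L2_norm M (A (R f))" by (intro coercive_norm_le R f L co)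
   also have "... = L2_norm M f" by (rule L2_norm_cong_AE[OF R(2)[OF f] L[OF R(1)[OF f]] f])
   finally show "L2_norm M (R f) <= 1 / \<delta> * L2_norm M f" using \<delta> by (simp add: field_simps)
  qed
 qed (rule R)
 moreover have "AE x in M. R (A f) x = f x" if "f \<in> L2_space M" for f
  by (rule inj[OF R(1)[OF L[OF that]] that R(2)[OF L[OF that]]])
 ultimately show ?thesis using R by blast
qed

text \<open>Symmetry enters as reality of the quadratic form, which over the complex numbers is
  equivalent; this suits W, which is known only through its form. A nonzero vector makes the
  numerical range nonempty.\<close>

locale real_form_operator =
 fixes M :: "'a measure" and A
 assumes A: "bounded_operator M A"
  and real: "!!u. u \<in> L2_space M ==> Im (L2_inner M u (A u)) = 0"
  and nontrivial: "EX u:L2_space M. L2_norm M u > 0"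
begin

abbreviation (input) "E == L2_space M"
abbreviation (input) "N == L2_norm M"
abbreviation (input) "ip == L2_inner M"

definition numerical_range :: "real set" where
 "numerical_range = {Re (ip u (A u)) |u. u \<in> E & N u = 1}"

lemma form_bound:
 obtains C where "C > 0" "!!u. u \<in> E ==> \<bar>Re (ip u (A u))\<bar> <= C * (N u)^2"
proof -
 obtain C where C: "C > 0" "!!f. f \<in> E ==> N (A f) <= C * N f" by (rule bounded_operator_bound[OF A]) auto
 have "\<bar>Re (ip u (A u))\<bar> <= C * (N u)^2" if u: "u \<in> E" for u
 proof -
  have "\<bar>Re (ip u (A u))\<bar> <= N u * N (A u)"
   using abs_Re_le_cmod L2_Cauchy_Schwarz[OF u bounded_operator_L2[OF A u]] by (rule order_trans)
  also have "... <= N u * (C * N u)" by (intro mult_left_mono C u) simp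
  finally show ?thesis by (simp add: power2_eq_square mult_ac)
 qed
 with C(1) show ?thesis using that by blast
qed

lemma normalize:
 assumes "u \<in> E" "N u > 0"
 defines "v == %x. of_real (1 / N u) * u x"
 shows "v \<in> E" "N v = 1"
  "ip v (A v) = of_real (1 / (N u)^2) * ip u (A u)"
proof -
 let ?c = "complex_of_real (1 / N u)"
 show v: "v \<in> E" unfolding v_def by (intro L2_scale assms)
 show "N v = 1" unfolding v_def L2_norm_scale using assms(2) by (simp add: norm_divide)
 \<comment> \<open>Linearity is available only in the shape c f + g, so scaling u leaves a term A 0,
   which vanishes in norm but need not be the zero function.\<close>
 have "A (%x. 0) \<in> E" by (intro bounded_operator_L2[OF A]) simp
 have "N (A (%x. 0)) = 0"
 proof -
  obtain C where "!!f. f \<in> E ==> N (A f) <= C * N f" by (rule bounded_operator_bound[OF A]) auto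
  from this[OF L2_zero] have "N (A (%x. 0)) <= C * N (%x. 0)" .
  also have "N (%x. 0) = 0" by (simp add: L2_norm_def)
  finally show ?thesis using L2_norm_nonneg[of M "A (%x. 0)"] by linarith
 qed
 then have "ip v (A (%x. 0)) = 0" using L2_Cauchy_Schwarz[OF v \<open>A (%x. 0) \<in> E\<close>] by simp
 moreover have "ip v (A v) = ?c * ip v (A u) + ip v (A (%x. 0))"
  using bounded_operator_inner_lincomb[OF A assms(1) L2_zero v, of ?c] unfolding v_def by simp
 moreover have "ip v (A u) = ?c * ip u (A u)" unfolding v_def L2_inner_scale_left by simp
 ultimately show "ip v (A v) = of_real (1 / (N u)^2) * ip u (A u)" by (simp add: power2_eq_square)
qed

lemma numerical_range_nonempty: "numerical_range ~= {}"
proof -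
 obtain u where u: "u \<in> E" "N u > 0" using nontrivial by blast
 show ?thesis unfolding numerical_range_def using normalize(1,2)[OF u] by blast
qed

lemma numerical_range_bdd: "bdd_below numerical_range"
proof -
 obtain C where C: "C > 0" "!!u. u \<in> E ==> \<bar>Re (ip u (A u))\<bar> <= C * (N u)^2" by (rule form_bound) auto
 have "- C <= Re (ip u (A u))" if "u \<in> E" "N u = 1" for u using C(2)[OF that(1)] that(2) by simp
 then show ?thesis unfolding numerical_range_def by (intro bdd_belowI[of _ "-C"]) blast
qed

definition \<nu> where "\<nu> = Inf numerical_range"

lemma form_ge:
 assumes u: "u \<in> E"
 shows "\<nu> * (N u)^2 <= Re (ip u (A u))"
proof (cases "N u = 0")
 case True
 obtain C where "!!u. u \<in> E ==> \<bar>Re (ip u (A u))\<bar> <= C * (N u)^2" by (rule form_bound) auto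
 from this[OF u] True show ?thesis by simp
next
 case False
 then have n: "N u > 0" using L2_norm_nonneg[of M u] by linarith
 note v = normalize[OF u n]
 have "\<nu> <= Re (ip (%x. of_real (1 / N u) * u x) (A (%x. of_real (1 / N u) * u x)))"
  unfolding \<nu>_def by (rule cInf_lower[OF _ numerical_range_bdd]) (use v numerical_range_def in blast)
 also have "... = Re (ip u (A u)) / (N u)^2" unfolding v(3) by simp
 finally show ?thesis using n by (simp add: field_simps)
qed

lemma shifted_form:
 assumes "f \<in> E" "u \<in> E"
 shows "ip f (%x. A u x - z * u x) = ip f (A u) - z * ip f u"
 using L2_inner_diff_right[OF bounded_operator_L2[OF A assms(2)] L2_scale[OF assms(2)] assms(1)]
 by (simp add: L2_inner_scale_right)

text \<open>For \<open>B = A - \<nu> \<ge> 0\<close> the Cauchy--Schwarz inequality of its form, applied to \<open>u\<close> and \<open>B u\<close>,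
 turns an approximate minimiser into an approximate eigenvector.\<close>

lemma approximate_eigenvector:
 assumes "\<epsilon> > 0"
 shows "EX u:E. N u = 1 & N (%x. A u x - of_real \<nu> * u x) <= \<epsilon>"
proof -
 define B where "B u x = A u x - of_real \<nu> * u x" for u x
 have Bop: "bounded_operator M B" using bounded_operator_shift[OF A, of "of_real \<nu>"] unfolding B_def .
 note BL = bounded_operator_L2[OF Bop]
 obtain C where C: "C > 0" "!!f. f \<in> E ==> N (B f) <= C * N f" by (rule bounded_operator_bound[OF Bop]) auto
 have Bin: "ip u (B u) = ip u (A u) - of_real (\<nu> * (N u)^2)" if "u \<in> E" for u
  using shifted_form[OF that that, of "of_real \<nu>"] unfolding B_def by (simp add: L2_inner_self)
 have Bre: "Im (ip u (B u)) = 0" "0 <= Re (ip u (B u))" if "u \<in> E" for u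
  using Bin[OF that] real[OF that] form_ge[OF that] by simp_all
 have CS: "(cmod (ip y (B u)))^2 <= Re (ip y (B y)) * Re (ip u (B u))" if y: "y \<in> E" and u: "u \<in> E" for y u
 proof (rule hermitian_discriminant[where a' = "ip u (B y)"])
  fix z
  let ?w = "%x. z * u x + y x"
  have w: "?w \<in> E" by (rule L2_lincomb[OF u y])
  have e: "ip ?w (B ?w) = ip y (B y) + (z * ip y (B u) + cnj z * ip u (B y))
    + of_real ((cmod z)^2) * ip u (B u)" unfolding bounded_operator_inner_lincomb[OF Bop u y w]
   unfolding L2_inner_lincomb_left[OF u y BL[OF u]] L2_inner_lincomb_left[OF u y BL[OF y]]
   unfolding complex_norm_square by (simp add: algebra_simps)
  show "Im (z * ip y (B u) + cnj z * ip u (B y)) = 0" using arg_cong[OF e, of Im] Bre(1)[OF w] Bre(1)[OF u] Bre(1)[OF y] by simp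
  show "0 <= Re (ip y (B y)) + Re (z * ip y (B u) + cnj z * ip u (B y)) + (cmod z)^2 * Re (ip u (B u))"
   using arg_cong[OF e, of Re] Bre(2)[OF w] by simp
 qed (rule Bre(2)[OF u])
 \<comment> \<open>\<open>CS\<close> will bound the fourth power of N (B u) by C \<eta> times its
   square, and this \<eta> turns that into N (B u) <= \<epsilon>.\<close>
 define \<eta> where "\<eta> = \<epsilon>^2 / C"
 have \<eta>: "\<eta> > 0" using assms C by (simp add: \<eta>_def)
 obtain t where "t \<in> numerical_range" "t < \<nu> + \<eta>"
  using cInf_lessD[OF numerical_range_nonempty, of "\<nu> + \<eta>"] \<eta> unfolding \<nu>_def by auto
 then obtain u where u: "u \<in> E" "N u = 1" "Re (ip u (A u)) < \<nu> + \<eta>" unfolding numerical_range_def by blast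
 have "N (B u) <= \<epsilon>"
 proof (cases "N (B u) = 0")
  case False
  then have n: "N (B u) > 0" using L2_norm_nonneg[of M "B u"] by linarith
  have "((N (B u))^2)^2 = (cmod (ip (B u) (B u)))^2" unfolding L2_inner_self by (simp only: norm_of_real abs_power2 power2_abs)
  also have "... <= Re (ip (B u) (B (B u))) * Re (ip u (B u))" by (rule CS[OF BL[OF u(1)] u(1)])
  also have "... <= (C * (N (B u))^2) * \<eta>"
  proof (rule mult_mono)
   have "Re (ip (B u) (B (B u))) <= N (B u) * N (B (B u))"
    using complex_Re_le_cmod L2_Cauchy_Schwarz[OF BL[OF u(1)] BL[OF BL[OF u(1)]]] by (rule order_trans)
   also have "... <= N (B u) * (C * N (B u))" by (intro mult_left_mono C BL u) simp
   finally show "Re (ip (B u) (B (B u))) <= C * (N (B u))^2" by (simp add: power2_eq_square mult_ac)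
   show "Re (ip u (B u)) <= \<eta>" using Bin[OF u(1)] u by simp
   show "0 <= Re (ip u (B u))" by (rule Bre[OF u(1)])
  qed (use C in simp)
  also have "... = (N (B u))^2 * \<epsilon>^2" using C by (simp add: \<eta>_def)
  finally have "(N (B u))^2 * (N (B u))^2 <= (N (B u))^2 * \<epsilon>^2" by (simp only: power2_eq_square)
  moreover have "(N (B u))^2 > 0" using n by simp
  ultimately have "(N (B u))^2 <= \<epsilon>^2" by (simp only: mult_le_cancel_left_pos)
  then show ?thesis by (rule power2_le_imp_le) (use assms in simp)
 qed (use assms in simp)
 then show ?thesis using u unfolding B_def by blast
qed

text \<open>\<nu> is in the spectrum because a bounded inverse would contradict an approximate
  eigenvector, and nothing lies to its left because A - z is coercive whenever Re z < \<nu>; nonreal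
  z need no separate argument. That the minimum is attained also shows the spectrum to be nonempty
  and bounded below.\<close>

lemma inf_spec_eq: "inf_spec M A = \<nu>" unfolding inf_spec_def
proof (rule cInf_eq_minimum)
 have "of_real \<nu> \<in> spectrum M A" unfolding spectrum_def
 proof (clarify)
  fix R assume R: "bounded_operator M R" and i: "ALL f:E. (AE x in M. R (%y. A f y - complex_of_real \<nu> * f y) x = f x) &
    (AE x in M. A (R f) x - complex_of_real \<nu> * R f x = f x)"
  obtain C where C: "C > 0" "!!f. f \<in> E ==> N (R f) <= C * N f" by (rule bounded_operator_bound[OF R]) auto
  obtain u where u: "u \<in> E" "N u = 1"
    "N (%x. A u x - of_real \<nu> * u x) <= 1 / (2 * C)" using approximate_eigenvector[of "1 / (2 * C)"] C by auto
  let ?B = "%x. A u x - of_real \<nu> * u x"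
  have B: "?B \<in> E" by (intro L2_diff L2_scale bounded_operator_L2[OF A] u)
  have "1 = N (R ?B)" using L2_norm_cong_AE[OF _ bounded_operator_L2[OF R B] u(1)] i u by auto
  also have "... <= C * N ?B" by (rule C(2)[OF B])
  also have "... <= C * (1 / (2 * C))" using C(1) u(3) by (intro mult_left_mono) auto
  also have "... = 1 / 2" using C(1) by simp
  finally show False by simp
 qed
 then show "\<nu> \<in> Re ` spectrum M A" by (intro image_eqI[of _ _ "of_real \<nu>"]) auto
 fix r assume "r \<in> Re ` spectrum M A"
 then obtain z where z: "z \<in> spectrum M A" "r = Re z" by blast
 show "\<nu> <= r"
 proof (rule ccontr)
  assume "~ \<nu> <= r"
  then have \<delta>: "\<nu> - Re z > 0" using z by simp
  have "EX R. bounded_operator M R & (ALL f:E.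
    (AE x in M. R (%y. A f y - z * f y) x = f x) & (AE x in M. A (R f) x - z * R f x = f x))"
  proof (rule coercive_inverse[OF bounded_operator_shift[OF A] \<delta>])
   fix f assume f: "f \<in> E"
   show "(\<nu> - Re z) * (N f)^2 <= Re (ip f (%x. A f x - z * f x))"
    using form_ge[OF f] by (simp add: shifted_form[OF f f] L2_inner_self algebra_simps)
  qed
  then show False using z(1) unfolding spectrum_def by blast
 qed
qed

lemma inf_spec_le_form:
 "u \<in> E ==> inf_spec M A * (N u)^2 <= Re (ip u (A u))" unfolding inf_spec_eq by (rule form_ge)

lemma inf_spec_approximate_eigenvector:
 assumes "\<epsilon> > 0"
 obtains u where "u \<in> E" "N u = 1"
  "N (%x. A u x - of_real (inf_spec M A) * u x) <= \<epsilon>" using approximate_eigenvector[OF assms] unfolding inf_spec_eq by blast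

end

section \<open>Polar coordinates\<close>

lemma ident_measurable_sphere [measurable]: "(%p. p) \<in> sphere_measure \<rightarrow>\<^sub>M borel"
 unfolding measurable_cong_sets[OF sets_sphere_measure refl] by (rule measurable_restrict_space1) simp

lemma continuous_measurable_sphere:
 fixes f :: "real^3 => 'b::topological_space"
 shows "continuous_on UNIV f ==> f \<in> borel_measurable sphere_measure"
 by (rule measurable_compose[OF ident_measurable_sphere]) (rule borel_measurable_continuous_onI)

definition radial_measure :: "real measure" where
 "radial_measure = density lborel (%r. ennreal (r^2) * indicator {0<..} r)"

lemma sets_radial_measure [measurable_cong, simp]: "sets radial_measure = sets borel" by (simp add: radial_measure_def)

lemma emeasure_radial_measure: "emeasure radial_measure {..<a} = ennreal ((max 0 a) ^ 3 / 3)"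
proof (cases "a > 0")
 case True
 have "emeasure radial_measure {..<a} = nn_integral lborel (%r. ennreal (r^2) * indicator {0..a} r)"
  unfolding radial_measure_def by (subst emeasure_density)
    (auto intro!: nn_integral_cong_AE AE_I[where N="{0,a}"] simp: emeasure_lborel_countable
     split: split_indicator_asm)
 also have "... = ennreal (a ^ 3 / 3 - 0 ^ 3 / 3)"
  using True by (intro nn_integral_FTC_Icc[where F = "%r. r ^ 3 / 3"]) (auto intro!: derivative_eq_intros)
 finally show ?thesis using True by (simp add: max_def)
next
 case False
 have "emeasure radial_measure {..<a} = nn_integral lborel (%r. ennreal (r^2) * indicator {0<..} r * indicator {..<a} r)"
  unfolding radial_measure_def by (subst emeasure_density) auto
 also have "... = nn_integral lborel (%r::real. 0)" using False by (intro nn_integral_cong) (auto split: split_indicator)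
 finally show ?thesis using False by (simp add: max_def)
qed

lemma sigma_finite_radial: "sigma_finite_measure radial_measure" unfolding radial_measure_def
 by (rule sigma_finite_measure.sigma_finite_iff_density_finite[OF lborel.sigma_finite_measure_axioms, THEN iffD2])
   (auto split: split_indicator)

interpretation radial: sigma_finite_measure radial_measure by (rule sigma_finite_radial)

interpretation polar: pair_sigma_finite radial_measure sphere_measure ..

lemma norm_sgn_scale: "norm x *\<^sub>R sgn x = (x :: 'a :: real_normed_vector)" by (cases "x = 0") (simp_all add: sgn_div_norm)

text \<open>Dilation by a multiplies volumes by a^3, and the factor 3 in
  \<open>sphere_measure\<close> leaves a^3/3, the mass that \<open>radial_measure\<close> gives to
  (0, a).\<close>

lemma emeasure_cone:
 fixes B :: "(real^3) set"
 assumes B: "B \<in> sets sphere_measure" and a: "a > 0"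
 shows "emeasure lborel {x. x ~= 0 & norm x < a & sgn x \<in> B} = ennreal (a ^ 3 / 3) * emeasure sphere_measure B"
proof -
 have "B \<in> sets borel" using B unfolding sets_sphere_measure by (subst (asm) sets_restrict_space_iff) auto
 then have [measurable]: "B \<in> sets borel" .
 let ?S = "%a. {x::real^3. x ~= 0 & norm x < a & sgn x \<in> B}"
 have [measurable]: "?S b \<in> sets borel" for b by measurable
 have "emeasure lborel (?S a) = emeasure (density (distr lborel borel (%x. 0 + a *\<^sub>R x)) (%_. \<bar>a\<bar>^DIM(real^3))) (?S a)"
  using a by (subst lborel_affine[of a "0::real^3", symmetric]) auto
 also have "... = nn_integral (distr lborel borel (%x. a *\<^sub>R x)) (%x. ennreal (a^3) * indicator (?S a) x)"
  using a by (subst emeasure_density) (auto simp: )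
 also have "... = ennreal (a^3) * emeasure lborel ((%x. a *\<^sub>R x) -` ?S a)"
  by (subst nn_integral_cmult_indicator) (auto simp: emeasure_distr)
 also have "(%x. a *\<^sub>R x) -` ?S a = ?S 1" using a by (auto simp: sgn_scaleR)
 finally have "emeasure lborel (?S a) = ennreal (a^3) * emeasure lborel (?S 1)" .
 moreover have "emeasure sphere_measure B = 3 * emeasure lborel (?S 1)"
  using emeasure_sphere_measure[of B] B unfolding sets_sphere_measure by simp
 moreover have "ennreal (a ^ 3 / 3) * (3 * m) = ennreal (a^3) * m" for m :: ennreal
 proof -
  have "ennreal (a ^ 3 / 3) * (3 * m) = ennreal (a ^ 3 / 3) * ennreal 3 * m" by (simp add: mult.assoc)
  also have "ennreal (a ^ 3 / 3) * ennreal 3 = ennreal (a^3)" using a by (subst ennreal_mult[symmetric]) auto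
  finally show ?thesis .
 qed
 ultimately show ?thesis by simp
qed

lemma polar_measurable [measurable]:
 "(%(r, \<omega>). r *\<^sub>R \<omega>) \<in> radial_measure \<Otimes>\<^sub>M sphere_measure \<rightarrow>\<^sub>M (borel :: (real^3) measure)"
proof -
 have "snd \<in> radial_measure \<Otimes>\<^sub>M sphere_measure \<rightarrow>\<^sub>M (borel :: (real^3) measure)"
  by (rule measurable_compose[OF measurable_snd ident_measurable_sphere])
 moreover have "fst \<in> radial_measure \<Otimes>\<^sub>M sphere_measure \<rightarrow>\<^sub>M (borel :: real measure)"
  using measurable_fst[of radial_measure sphere_measure] by (simp add: measurable_cong_sets[OF refl sets_radial_measure])
 ultimately show ?thesis unfolding case_prod_beta by (rule borel_measurable_scaleR[rotated])
qed

text \<open>Proved backwards: the product measure is the image of Lebesgue measure off the origin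
  under x -> (|x|, x/|x|), and composing with (r, \<omega>) -> r \<omega> restores x. The origin,
  which has no direction, is a null set.\<close>

lemma lborel_polar:
 "(lborel :: (real^3) measure) = distr (radial_measure \<Otimes>\<^sub>M sphere_measure) borel (%(r, \<omega>). r *\<^sub>R \<omega>)"
proof -
 let ?L = "restrict_space lborel (UNIV - {0}) :: (real^3) measure"
 let ?P = "radial_measure \<Otimes>\<^sub>M sphere_measure"
 have sgn_m: "sgn \<in> ?L \<rightarrow>\<^sub>M restrict_space borel (sphere 0 1)" by (rule measurable_restrict_space2)
    (auto simp: space_restrict_space norm_sgn intro: measurable_restrict_space1)
 have pm [measurable]: "(%x. (norm x, sgn x)) \<in> ?L \<rightarrow>\<^sub>M ?P"
 proof (rule measurable_Pair)
  show "norm \<in> ?L \<rightarrow>\<^sub>M radial_measure"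
   by (subst measurable_cong_sets[OF refl sets_radial_measure]) (auto intro: measurable_restrict_space1)
  show "sgn \<in> ?L \<rightarrow>\<^sub>M sphere_measure" using sgn_m by (subst measurable_cong_sets[OF refl sets_sphere_measure])
 qed
 have eq: "?P = distr ?L ?P (%x. (norm x, sgn x))"
 proof (rule pair_measure_eqI)
  show "sigma_finite_measure radial_measure" "sigma_finite_measure sphere_measure"
   by (rule sigma_finite_radial) (rule sphere_measure.sigma_finite_measure_axioms)
  fix A B assume A: "A \<in> sets radial_measure" and B: "B \<in> sets (sphere_measure :: (real^3) measure)"
  have "B \<in> sets borel" using B unfolding sets_sphere_measure by (subst (asm) sets_restrict_space_iff) auto
  then have Bm [measurable]: "B \<in> sets borel" .
  let ?D = "{x::real^3. x ~= 0 & sgn x \<in> B}"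
  have [measurable]: "?D \<in> sets borel" by measurable
  let ?N = "distr (restrict_space lborel ?D) borel norm :: real measure"
  have Nm: "norm \<in> restrict_space lborel ?D \<rightarrow>\<^sub>M (borel :: real measure)" by (rule measurable_restrict_space1) simp
  have N: "emeasure ?N X = emeasure lborel {x. norm x \<in> X & x ~= 0 & sgn x \<in> B}" if "X \<in> sets borel" for X
  proof -
   have "emeasure ?N X = emeasure (restrict_space lborel ?D) (norm -` X \<inter> ?D)"
    using that by (subst emeasure_distr[OF Nm]) (auto simp: space_restrict_space)
   also have "... = emeasure lborel (norm -` X \<inter> ?D)" by (rule emeasure_restrict_space) auto
   also have "norm -` X \<inter> ?D = {x. norm x \<in> X & x ~= 0 & sgn x \<in> B}" by auto
   finally show ?thesis .
  qed
  \<comment> \<open>For fixed B both sides are measures in the radial variable; the half-lines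
    \<open>{..<a}\<close>, where \<open>emeasure_cone\<close> applies, form a generator closed under
    intersections.\<close>
  have "scale_measure (emeasure sphere_measure B) radial_measure = ?N"
  proof (rule measure_eqI_generator_eq[where E = "range lessThan" and \<Omega> = UNIV and A = "%i::nat. {..<real i}"])
   show "Int_stable (range (lessThan :: real => _))"
    proof (clarsimp simp: Int_stable_def)
    fix a b :: real
    have "{..<a} \<inter> {..<b} = {..<min a b}" by auto
    then show "{..<a} \<inter> {..<b} \<in> range lessThan" by simp
   qed
   show "sets (scale_measure (emeasure sphere_measure B) radial_measure) = sigma_sets UNIV (range lessThan)"
    by (simp add: borel_Iio)
   show "sets ?N = sigma_sets UNIV (range lessThan)" by (simp add: borel_Iio)
   show "(\<Union>i. {..<real i}) = UNIV" by (auto intro: reals_Archimedean2)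
   fix X :: "real set" assume "X \<in> range lessThan"
   then obtain a where X: "X = {..<a}" by auto
   show "emeasure (scale_measure (emeasure sphere_measure B) radial_measure) X = emeasure ?N X"
   proof (cases "a > 0")
    case True
    have "{x. norm x \<in> X & x ~= 0 & sgn x \<in> B} = {x. x ~= 0 & norm x < a & sgn x \<in> B}" using X by auto
    then have "emeasure ?N X = ennreal (a ^ 3 / 3) * emeasure sphere_measure B"
     using N[of X] emeasure_cone[OF B True] X by simp
    then show ?thesis using True by (simp add: X emeasure_radial_measure mult.commute max_def)
   next
    case False
    have "{x. norm x \<in> X & x ~= 0 & sgn x \<in> B} = {}" using False X by (auto) (metis norm_ge_zero order_le_less_trans)
    then have "emeasure ?N X = 0" using N[of X] X by (simp only:) simp
    then show ?thesis using False by (simp add: X emeasure_radial_measure max_def)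
   qed
  next
   fix i :: nat
   show "emeasure (scale_measure (emeasure sphere_measure B) radial_measure) {..<real i} ~= \<infinity>"
    by (simp add: emeasure_radial_measure ennreal_mult_eq_top_iff sphere_measure.emeasure_finite)
  qed auto
  then have "emeasure radial_measure A * emeasure sphere_measure B = emeasure ?N A"
   by (metis emeasure_scale_measure mult.commute)
  also have "... = emeasure lborel ({x. norm x \<in> A & x ~= 0 & sgn x \<in> B})" using A by (intro N) simp
  also have "... = emeasure ?L {x. norm x \<in> A & x ~= 0 & sgn x \<in> B}" by (rule emeasure_restrict_space[symmetric]) auto
  also have "... = emeasure (distr ?L ?P (%x. (norm x, sgn x))) (A \<times> B)"
   using A B by (subst emeasure_distr[OF pm]) (auto simp: space_restrict_space intro!: arg_cong[where f = "emeasure ?L"])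
  finally show "emeasure radial_measure A * emeasure sphere_measure B = ..." .
 qed simp
 have "distr ?P borel (%(r, \<omega>). r *\<^sub>R \<omega>) = distr ?L borel ((%(r, \<omega>). r *\<^sub>R \<omega>) \<circ> (%x. (norm x, sgn x)))"
  by (subst eq) (rule distr_distr[OF polar_measurable pm])
 also have "(%(r, \<omega>). r *\<^sub>R \<omega>) \<circ> (%x. (norm x, sgn x)) = (%x. x :: real^3)" by (auto simp: norm_sgn_scale)
 also have "distr ?L borel (%x. x) = lborel"
 proof (rule measure_eqI)
  fix X assume "X \<in> sets (distr ?L borel (%x. x))"
  then have X: "X \<in> sets borel" by simp
  have "emeasure (distr ?L borel (%x. x)) X = emeasure ?L (X - {0})"
   using X by (subst emeasure_distr) (auto simp: space_restrict_space intro!: measurable_restrict_space1 arg_cong[where f = "emeasure ?L"])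
  also have "... = emeasure lborel (X - {0})" by (rule emeasure_restrict_space) auto
  also have "... = emeasure lborel X" using X by (intro emeasure_Diff_null_set) auto
  finally show "emeasure (distr ?L borel (%x. x)) X = emeasure lborel X" .
 qed simp
 finally show ?thesis by simp
qed

lemma nn_integral_radial:
 assumes [measurable]: "f \<in> borel_measurable borel"
 shows "nn_integral radial_measure (%r. f r) = nn_integral lborel (%r. ennreal (r^2) * indicator {0<..} r * f r)"
 unfolding radial_measure_def by (rule nn_integral_density) auto

lemma nn_integral_polar:
 fixes f :: "real^3 => ennreal"
 assumes [measurable]: "f \<in> borel_measurable borel"
 shows "nn_integral lborel (%x. f x) = nn_integral radial_measure (%r. nn_integral sphere_measure (%\<omega>. f (r *\<^sub>R \<omega>)))"
 by (subst lborel_polar, subst nn_integral_distr) (auto simp: sphere_measure.nn_integral_fst[symmetric] case_prod_beta)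

lemma integrable_polar:
 fixes f :: "real^3 => 'b::{banach, second_countable_topology}"
 assumes "f \<in> borel_measurable borel"
 shows "integrable lborel f \<longleftrightarrow> integrable (radial_measure \<Otimes>\<^sub>M sphere_measure) (%(r, \<omega>). f (r *\<^sub>R \<omega>))" unfolding lborel_polar
 by (subst integrable_distr_eq[OF polar_measurable]) (use assms in \<open>simp_all add: case_prod_beta'\<close>)

lemma integral_polar:
 fixes f :: "real^3 => 'b::{banach, second_countable_topology}"
 assumes f: "integrable lborel f"
 shows "(LINT x|lborel. f x) = (LINT r|radial_measure. (LINT \<omega>|sphere_measure. f (r *\<^sub>R \<omega>)))"
  and "integrable radial_measure (%r. LINT \<omega>|sphere_measure. f (r *\<^sub>R \<omega>))"
proof -
 have fm: "f \<in> borel_measurable borel" using borel_measurable_integrable[OF f] by simp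
 have i: "integrable (radial_measure \<Otimes>\<^sub>M sphere_measure) (%(r, \<omega>). f (r *\<^sub>R \<omega>))" using f integrable_polar[OF fm] by simp
 show "integrable radial_measure (%r. LINT \<omega>|sphere_measure. f (r *\<^sub>R \<omega>))" using polar.integrable_fst'[OF i] by simp
 have "(LINT x|lborel. f x) = (LINT z|(radial_measure \<Otimes>\<^sub>M sphere_measure). (case z of (r, \<omega>) => f (r *\<^sub>R \<omega>)))"
  unfolding lborel_polar by (subst integral_distr[OF polar_measurable]) (use fm in \<open>simp_all add: case_prod_beta'\<close>)
 also have "... = (LINT r|radial_measure. (LINT \<omega>|sphere_measure. f (r *\<^sub>R \<omega>)))" using polar.integral_fst'[OF i] by simp
 finally show "(LINT x|lborel. f x) = ..." .
qed

lemma radial_integrable_iff: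
 fixes f :: "real => 'b::{banach, second_countable_topology}"
 assumes [measurable]: "f \<in> borel_measurable borel"
 shows "integrable radial_measure f \<longleftrightarrow> integrable lborel (%r. (r^2 * indicator {0<..} r) *\<^sub>R f r)"
  and "(LINT r|radial_measure. f r) = (LINT r|lborel. (r^2 * indicator {0<..} r) *\<^sub>R f r)"
proof -
 have *: "radial_measure = density lborel (%r. ennreal (r^2 * indicator {0<..} r))"
  unfolding radial_measure_def by (auto intro!: density_cong split: split_indicator)
 show "integrable radial_measure f \<longleftrightarrow> integrable lborel (%r. (r^2 * indicator {0<..} r) *\<^sub>R f r)"
  unfolding * by (rule integrable_density) auto
 show "(LINT r|radial_measure. f r) = (LINT r|lborel. (r^2 * indicator {0<..} r) *\<^sub>R f r)"
  unfolding * by (rule integral_density) auto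
qed

section \<open>Rotation invariance of Lebesgue measure\<close>

lemma lborel_orthogonal_invariant:
 fixes f :: "real^3 => real^3"
 assumes f: "orthogonal_transformation f"
 shows "distr lborel borel f = lborel"
proof (rule lborel_eqI[symmetric])
 have lf: "linear f" using f by (rule orthogonal_transformation_linear)
 then have [measurable]: "f \<in> borel_measurable borel"
  by (intro borel_measurable_continuous_onI linear_continuous_on linear_linear[THEN iffD2])
 obtain g where g: "orthogonal_transformation g" "g \<circ> f = id" "f \<circ> g = id"
  using orthogonal_transformation_inv[OF f] orthogonal_transformation_bij[OF f]
  by (metis bij_is_inj bij_is_surj inv_o_cancel surj_iff)
 fix l u :: "real^3" assume lu: "!!b. b \<in> Basis ==> l \<bullet> b <= u \<bullet> b"
 have "emeasure (distr lborel borel f) (box l u) = emeasure lborel (f -` box l u)" by (subst emeasure_distr) auto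
 also have "f -` box l u = g ` box l u" using g(2,3) by (auto simp: fun_eq_iff image_iff) metis+
 also have "emeasure lborel (g ` box l u) = emeasure lebesgue (g ` box l u)"
 proof -
  have "g ` box l u = f -` box l u" using g(2,3) by (auto simp: fun_eq_iff image_iff) metis+
  moreover have "f -` box l u \<in> sets borel" using measurable_sets[of f borel borel "box l u"] by simp
  ultimately show ?thesis by simp
 qed
 also have "... = ennreal (measure lebesgue (g ` box l u))"
  using measurable_orthogonal_image[OF g(1), of "box l u"] by (simp add: emeasure_eq_measure2 fmeasurableD2)
 also have "measure lebesgue (g ` box l u) = measure lebesgue (box l u)" by (rule measure_orthogonal_image[OF g(1)]) simp
 also have "ennreal (measure lebesgue (box l u)) = (\<Prod>b\<in>Basis. (u - l) \<bullet> b)" using lu by (simp add: measure_lborel_box_eq)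
 finally show "emeasure (distr lborel borel f) (box l u) = (\<Prod>b\<in>Basis. (u - l) \<bullet> b)" .
qed simp

section \<open>Gaussians and the Fourier transform of the sphere\<close>

text \<open>\<open>lborel\<close> is by definition the image of a product measure over the basis, so
  Fubini for finite products transfers.\<close>

lemma lborel_integral_prod:
 fixes f :: "'a::euclidean_space => real => complex"
 assumes f: "!!b. b \<in> Basis ==> integrable lborel (f b)"
 shows "integrable lborel (%x. \<Prod>b\<in>Basis. f b (x \<bullet> b))"
  and "(LINT x|lborel. (\<Prod>b\<in>Basis. f b (x \<bullet> b))) = (\<Prod>b\<in>Basis. LINT x|lborel. f b x)"
proof -
 interpret product_sigma_finite "%_::'a. interval_measure (%x. x)"
  by (simp add: lborel_eq_real[symmetric] product_sigma_finite_def lborel.sigma_finite_measure_axioms)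
 have fi: "integrable (interval_measure (%x. x)) (f b)" if "b \<in> Basis" for b using f[OF that] by (simp add: lborel_eq_real)
 have [measurable]: "f b \<in> borel_measurable borel" if "b \<in> Basis" for b using borel_measurable_integrable[OF f[OF that]] by simp
 have inner: "(\<Sum>c\<in>Basis. g c *\<^sub>R c) \<bullet> b = g b" if "b \<in> Basis" for g and b :: 'a
  using that by (simp add: inner_sum_left inner_Basis if_distrib sum.delta cong: if_cong)
 let ?T = "%g::'a => real. \<Sum>b\<in>Basis. g b *\<^sub>R b"
 have T [measurable]: "?T \<in> (\<Pi>\<^sub>M b\<in>Basis. interval_measure (%x. x)) \<rightarrow>\<^sub>M borel" by measurable
 have m: "(%x. \<Prod>b\<in>Basis. f b (x \<bullet> b)) \<in> borel_measurable (borel :: 'a measure)" by measurable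
 have e: "(\<Prod>b\<in>Basis. f b (?T g \<bullet> b)) = (\<Prod>b\<in>Basis. f b (g b))" for g by (intro prod.cong refl) (simp add: inner)
 show "integrable lborel (%x. \<Prod>b\<in>Basis. f b (x \<bullet> b))" unfolding lborel_def integrable_distr_eq[OF T m] e
  by (rule product_integrable_prod) (use fi in auto)
 have "(LINT x|(lborel::'a measure). (\<Prod>b\<in>Basis. f b (x \<bullet> b))) = (\<Prod>b\<in>Basis. integral\<^sup>L (interval_measure (%x. x)) (f b))"
  unfolding lborel_def integral_distr[OF T m] e by (rule product_integral_prod) (use fi in auto)
 then show "(LINT x|lborel. (\<Prod>b\<in>Basis. f b (x \<bullet> b))) = (\<Prod>b\<in>Basis. LINT x|lborel. f b x)" by (simp add: lborel_eq_real)
qed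

text \<open>exp(-t x^2) is a multiple of the standard normal density at c x with c^2 = 2 t, so the
  value is read off the characteristic function of the normal distribution.\<close>

lemma gaussian_fourier_1:
 assumes t: "t > 0"
 shows "integrable lborel (%x. exp (\<i> * of_real (a * x)) * complex_of_real (exp (- t * x^2)))"
  and "(LINT x|lborel. exp (\<i> * of_real (a * x)) * complex_of_real (exp (- t * x^2)))
   = of_real (sqrt (pi / t) * exp (- a\<^sup>2 / (4 * t)))"
proof -
 define c where "c = sqrt (2 * t)"
 have c: "c > 0" "c^2 = 2 * t" using t by (auto simp: c_def)
 have dens: "exp (- t * x^2) = sqrt (2 * pi) * std_normal_density (0 + c * x)" for x
  using c by (simp add: normal_density_def power_mult_distrib)
 have e: "exp (\<i> * of_real (a * x)) * complex_of_real (exp (- t * x^2)) =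
   of_real (sqrt (2 * pi)) * (std_normal_density (0 + c * x) *\<^sub>R iexp ((a / c) * (0 + c * x)))" for x
  unfolding dens using c by (simp add: scaleR_conv_of_real mult_ac)
 have int: "integrable lborel (%x. std_normal_density x *\<^sub>R iexp ((a / c) * x))"
 proof (rule Bochner_Integration.integrable_bound)
  show "integrable lborel (%x. std_normal_density x)" by simp
 qed (auto simp: norm_mult)
 show "integrable lborel (%x. exp (\<i> * of_real (a * x)) * complex_of_real (exp (- t * x^2)))"
  unfolding e by (intro integrable_mult_right lborel_integrable_real_affine[OF int]) (use c in simp)
 have "(LINT x|lborel. std_normal_density x *\<^sub>R iexp ((a / c) * x)) = char std_normal_distribution (a / c)"
  unfolding char_def by (subst integral_density) auto
 also have "... = of_real (exp (- a\<^sup>2 / (4 * t)))" using c by (simp add: char_std_normal_distribution power_divide)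
 finally have I: "(LINT x|lborel. std_normal_density x *\<^sub>R iexp ((a / c) * x)) = of_real (exp (- a\<^sup>2 / (4 * t)))" .
 have "(LINT x|lborel. exp (\<i> * of_real (a * x)) * complex_of_real (exp (- t * x^2)))
   = of_real (sqrt (2 * pi)) * (LINT x|lborel. std_normal_density (0 + c * x) *\<^sub>R iexp ((a / c) * (0 + c * x)))"
  unfolding e by (rule integral_mult_right_zero)
 also have "(LINT x|lborel. std_normal_density (0 + c * x) *\<^sub>R iexp ((a / c) * (0 + c * x)))
   = (1 / c) *\<^sub>R (LINT x|lborel. std_normal_density x *\<^sub>R iexp ((a / c) * x))"
  using lborel_integral_real_affine[of c "%x. std_normal_density x *\<^sub>R iexp ((a / c) * x)" 0] c by (simp add: field_simps)
 also have "of_real (sqrt (2 * pi)) * ((1 / c) *\<^sub>R (LINT x|lborel. std_normal_density x *\<^sub>R iexp ((a / c) * x)))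
   = of_real (sqrt (2 * pi) / c * exp (- a\<^sup>2 / (4 * t)))" unfolding I by (simp add: scaleR_conv_of_real)
 also have "sqrt (2 * pi) / c = sqrt (pi / t)" unfolding c_def by (simp add: real_sqrt_divide[symmetric])
 finally show "(LINT x|lborel. exp (\<i> * of_real (a * x)) * complex_of_real (exp (- t * x^2)))
   = of_real (sqrt (pi / t) * exp (- a\<^sup>2 / (4 * t)))" .
qed

lemma gaussian_fourier:
 fixes a :: "real^3"
 assumes t: "t > 0"
 shows "integrable lborel (%x. exp (\<i> * of_real (a \<bullet> x)) * complex_of_real (exp (- t * (x \<bullet> x))))"
  and "(LINT x|lborel. exp (\<i> * of_real (a \<bullet> x)) * complex_of_real (exp (- t * (x \<bullet> x))))
   = of_real (sqrt (pi / t) ^ 3 * exp (- (a \<bullet> a) / (4 * t)))"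
proof -
 have e: "exp (\<i> * of_real (a \<bullet> x)) * complex_of_real (exp (- t * (x \<bullet> x))) =
   (\<Prod>b\<in>Basis. exp (\<i> * of_real ((a \<bullet> b) * (x \<bullet> b))) * complex_of_real (exp (- t * (x \<bullet> b)^2)))" for x
  by (subst (1 2) euclidean_inner) (simp add: prod.distrib exp_sum[symmetric] sum_distrib_left power2_eq_square sum_negf
     flip: of_real_prod exp_of_real)
 note * = gaussian_fourier_1[OF t]
 show "integrable lborel (%x. exp (\<i> * of_real (a \<bullet> x)) * complex_of_real (exp (- t * (x \<bullet> x))))"
  unfolding e by (rule lborel_integral_prod(1)) (rule *)
 have "(LINT x|lborel. exp (\<i> * of_real (a \<bullet> x)) * complex_of_real (exp (- t * (x \<bullet> x))))
   = (\<Prod>b\<in>Basis. complex_of_real (sqrt (pi / t) * exp (- (a \<bullet> b)\<^sup>2 / (4 * t))))"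
  unfolding e by (subst lborel_integral_prod(2)) (use * in auto)
 also have "... = of_real (sqrt (pi / t) ^ 3 * (\<Prod>b\<in>Basis. exp (- (a \<bullet> b)\<^sup>2 / (4 * t))))" by (simp add: prod.distrib)
 also have "(\<Prod>b\<in>Basis. exp (- (a \<bullet> b)\<^sup>2 / (4 * t))) = exp (- (a \<bullet> a) / (4 * t))"
  by (subst euclidean_inner) (simp add: exp_sum[symmetric] power2_eq_square sum_negf sum_divide_distrib)
 finally show "(LINT x|lborel. exp (\<i> * of_real (a \<bullet> x)) * complex_of_real (exp (- t * (x \<bullet> x))))
   = of_real (sqrt (pi / t) ^ 3 * exp (- (a \<bullet> a) / (4 * t)))" .
qed

text \<open>Orthogonal maps preserve volume and commute with x -> x/|x|, so they carry the cone over
  a subset of the sphere to the cone over its image.\<close>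

lemma sphere_orthogonal_invariant:
 assumes T: "orthogonal_transformation (T :: real^3 => real^3)"
 shows "distr sphere_measure sphere_measure T = sphere_measure" and "T \<in> sphere_measure \<rightarrow>\<^sub>M sphere_measure"
proof -
 have lT: "linear T" using T by (rule orthogonal_transformation_linear)
 then have Tb [measurable]: "T \<in> borel_measurable borel"
  by (intro borel_measurable_continuous_onI linear_continuous_on linear_linear[THEN iffD2])
 have nT: "norm (T x) = norm x" for x using T by (rule orthogonal_transformation_norm)
 have sT: "sgn (T x) = T (sgn x)" for x using lT by (simp add: sgn_div_norm nT linear_scale)
 show Tm: "T \<in> sphere_measure \<rightarrow>\<^sub>M sphere_measure"
  unfolding measurable_cong_sets[OF sets_sphere_measure sets_sphere_measure] by (rule measurable_restrict_space2)
    (auto simp: space_restrict_space nT intro: measurable_restrict_space1)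
 show "distr sphere_measure sphere_measure T = sphere_measure"
 proof (rule measure_eqI)
  fix A assume "A \<in> sets (distr sphere_measure sphere_measure T)"
  then have A: "A \<in> sets (restrict_space borel (sphere 0 (1::real) :: (real^3) set))" by (simp add: sets_sphere_measure)
  then have [measurable]: "A \<in> sets borel" by (subst (asm) sets_restrict_space_iff) auto
  have Am: "A \<in> sets sphere_measure" using A by (simp add: sets_sphere_measure)
  have TA: "T -` A \<inter> space sphere_measure \<in> sets (restrict_space borel (sphere 0 (1::real) :: (real^3) set))"
   using measurable_sets[OF Tm Am] by (simp add: sets_sphere_measure)
  have "emeasure (distr sphere_measure sphere_measure T) A = emeasure sphere_measure (T -` A \<inter> space sphere_measure)"
   by (rule emeasure_distr[OF Tm Am])
  also have "... = 3 * emeasure lborel {x. x ~= 0 & norm x < 1 & sgn x \<in> T -` A \<inter> space sphere_measure}"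
   by (rule emeasure_sphere_measure[OF TA])
  also have "{x. x ~= 0 & norm x < 1 & sgn x \<in> T -` A \<inter> space sphere_measure}
    = T -` {x. x ~= 0 & norm x < 1 & sgn x \<in> A}" using nT by (auto simp: sT norm_sgn) (metis norm_eq_zero)+
  also have "emeasure lborel (T -` {x. x ~= 0 & norm x < 1 & sgn x \<in> A})
    = emeasure (distr lborel borel T) {x. x ~= 0 & norm x < 1 & sgn x \<in> A}" by (subst emeasure_distr) auto
  also have "3 * ... = emeasure sphere_measure A"
   unfolding lborel_orthogonal_invariant[OF T] by (rule emeasure_sphere_measure[OF A, symmetric])
  finally show "emeasure (distr sphere_measure sphere_measure T) A = emeasure sphere_measure A" .
 qed simp
qed

lemma sphere_integral_orthogonal:
 fixes F :: "real^3 => 'b::{banach, second_countable_topology}"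
 assumes "orthogonal_transformation T" "F \<in> borel_measurable sphere_measure"
 shows "(LINT \<omega>|sphere_measure. F (T \<omega>)) = (LINT \<omega>|sphere_measure. F \<omega>)"
 using integral_distr[OF sphere_orthogonal_invariant(2)[OF assms(1)] assms(2)]
 by (simp add: sphere_orthogonal_invariant(1)[OF assms(1)])

lemma measure_sphere: "measure sphere_measure (sphere 0 1 :: (real^3) set) = 4 * pi"
 by (simp add: measure_def emeasure_sphere_measure_space)

lemma sphere_bounded_integrable:
 fixes F :: "real^3 => 'b::{banach, second_countable_topology}"
 assumes "F \<in> borel_measurable sphere_measure" "!!\<omega>. norm \<omega> = 1 ==> norm (F \<omega>) <= C"
 shows "integrable sphere_measure F" by (rule sphere_measure.integrable_const_bound[where B = C]) (use assms in auto)

section \<open>Moments and Fourier transform of the surface measure\<close>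

lemma sphere_moment_odd:
 fixes e :: "real^3"
 shows "(LINT \<omega>|sphere_measure. (\<omega> \<bullet> e) ^ (2 * k + 1)) = 0"
proof -
 have m: "(%\<omega>. (\<omega> \<bullet> e) ^ (2 * k + 1)) \<in> borel_measurable sphere_measure"
  by (intro continuous_measurable_sphere continuous_intros)
 have "orthogonal_transformation (%x::real^3. - x)" by (simp add: orthogonal_transformation_def linear_iff)
 from sphere_integral_orthogonal[OF this m]
 show ?thesis by simp
qed

text \<open>The integral of exp(-|x|^2) (x . e)^(2k) is computed as a product over coordinates and
  in polar coordinates. The radial integral is again a one-dimensional Gaussian moment, with k + 1
  in place of k because of the weight r^2, and J(k+1)/J(k) = (2k+1)/2.\<close>

lemma sphere_moment_even:
 fixes e :: "real^3"
 assumes e: "e \<in> Basis"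
 shows "(LINT \<omega>|sphere_measure. (\<omega> \<bullet> e) ^ (2 * k)) = 4 * pi / (2 * k + 1)"
proof -
 define J where "J k = sqrt pi / 2 * (fact (2 * k) / (2 ^ (2 * k) * fact k))" for k :: nat
 have pos: "has_bochner_integral lborel (%x::real. indicator {0..} x *\<^sub>R (exp (- x\<^sup>2) * x ^ (2 * k))) (J k)" for k
  using gaussian_moment_even_pos[of k] by (simp add: J_def)
 have full: "has_bochner_integral lborel (%x::real. exp (- x\<^sup>2) * x ^ (2 * k)) (2 *\<^sub>R J k)" for k
  by (rule has_bochner_integral_even_function[OF pos]) simp
 define F where "F x = (\<Prod>b\<in>Basis. complex_of_real (exp (- (x \<bullet> b)\<^sup>2) * (x \<bullet> b) ^ (2 * (if b = e then k else 0))))" for x :: "real^3"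
 have fi: "integrable lborel (%x::real. complex_of_real (exp (- x\<^sup>2) * x ^ (2 * j)))" for j
  using full[of j] by (simp only: integrable_of_real has_bochner_integral_iff)
 have F: "integrable lborel F" unfolding F_def by (rule lborel_integral_prod(1)) (rule fi)
 have cB: "card (Basis - {e}) = 2" using e by simp
 have "(LINT x|lborel. F x) = (\<Prod>b\<in>Basis. complex_of_real (2 * J (if b = e then k else 0)))"
  unfolding F_def by (subst lborel_integral_prod(2)[OF fi]) (use full in \<open>simp add: has_bochner_integral_iff del: of_real_mult\<close>)
 also have "... = of_real (2 * J k * (2 * J 0)^2)"
  using e cB by (subst prod.remove[OF _ e]) (auto simp: power2_eq_square prod_constant[symmetric] intro!: prod.cong)
 also have "2 * J 0 = sqrt pi" by (simp add: J_def)
 finally have I1: "(LINT x|lborel. F x) = of_real (2 * J k * pi)" by simp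
 have Fe: "F x = of_real (exp (- (x \<bullet> x)) * (x \<bullet> e) ^ (2 * k))" for x
 proof -
  have "F x = of_real ((\<Prod>b\<in>Basis. exp (- (x \<bullet> b)\<^sup>2)) * (\<Prod>b\<in>Basis. (x \<bullet> b) ^ (2 * (if b = e then k else 0))))"
   unfolding F_def by (simp add: prod.distrib)
  also have "(\<Prod>b\<in>Basis. exp (- (x \<bullet> b)\<^sup>2)) = exp (- (x \<bullet> x))"
   by (subst euclidean_inner) (simp add: exp_sum[symmetric] power2_eq_square sum_negf)
  also have "(\<Prod>b\<in>Basis. (x \<bullet> b) ^ (2 * (if b = e then k else 0))) = (x \<bullet> e) ^ (2 * k)"
   using e by (subst prod.remove[OF _ e]) (auto intro!: prod.neutral)
  finally show ?thesis .
 qed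
 let ?M = "LINT \<omega>|sphere_measure. (\<omega> \<bullet> e) ^ (2 * k)"
 have "(LINT x|lborel. F x) = (LINT r|radial_measure. of_real (exp (- r\<^sup>2) * r ^ (2 * k) * ?M))"
 proof -
  have "(LINT x|lborel. F x) = (LINT r|radial_measure. (LINT \<omega>|sphere_measure. F (r *\<^sub>R \<omega>)))" by (rule integral_polar(1)[OF F])
  also have "... = (LINT r|radial_measure. of_real (exp (- r\<^sup>2) * r ^ (2 * k) * ?M))"
  proof (intro Bochner_Integration.integral_cong refl)
   fix r
   have "(LINT \<omega>|sphere_measure. F (r *\<^sub>R \<omega>)) = (LINT \<omega>|sphere_measure. of_real (exp (- r\<^sup>2) * r ^ (2 * k) * (\<omega> \<bullet> e) ^ (2 * k)))"
    by (intro Bochner_Integration.integral_cong refl) (simp add: Fe dot_square_norm power_mult_distrib)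
   then show "(LINT \<omega>|sphere_measure. F (r *\<^sub>R \<omega>)) = of_real (exp (- r\<^sup>2) * r ^ (2 * k) * ?M)"
    by (simp only: integral_complex_of_real integral_mult_right_zero)
  qed
  finally show ?thesis .
 qed
 also have "... = (LINT r|lborel. (r^2 * indicator {0<..} r) *\<^sub>R of_real (exp (- r\<^sup>2) * r ^ (2 * k) * ?M))"
  by (rule radial_integrable_iff(2)) measurable
 also have "... = (LINT r|lborel. of_real ((indicator {0..} r *\<^sub>R (exp (- r\<^sup>2) * r ^ (2 * Suc k))) * ?M))"
  by (intro Bochner_Integration.integral_cong refl) (auto simp: scaleR_conv_of_real power2_eq_square split: split_indicator)
 also have "... = of_real (J (Suc k) * ?M)"
  using pos[of "Suc k"] by (simp only: integral_complex_of_real has_bochner_integral_iff integral_mult_left_zero)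
 finally have "J (Suc k) * ?M = 2 * J k * pi" using I1 by (metis of_real_eq_iff)
 moreover have "J (Suc k) = J k * ((2 * k + 1) / 2)"
 proof -
  have "fact (2 * Suc k) = 2 * real (Suc k) * ((2 * k + 1) * fact (2 * k))" by (simp add: field_simps)
  moreover have "(2::real) ^ (2 * Suc k) = 4 * 2 ^ (2 * k)" by simp
  moreover have "c * (2 * K * (m * F) / (4 * P * (K * G))) = c * (F / (P * G)) * (m / 2)"
   if "K > 0" for c K m F P G :: real using that by (simp add: field_simps)
  ultimately show ?thesis unfolding J_def fact_Suc[of k] by (simp only: of_nat_0_less_iff zero_less_Suc of_nat_mult of_nat_fact)
 qed
 moreover have "J k > 0" by (simp add: J_def)
 ultimately have "J k * ((2 * k + 1) / 2 * ?M) = J k * (2 * pi)" by simp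
 then have "(2 * k + 1) / 2 * ?M = 2 * pi" using \<open>J k > 0\<close> by (simp only: mult_cancel_left) simp
 then show ?thesis by (simp add: field_simps)
qed

lemma sphere_integral_inner:
 fixes x :: "real^3" and F :: "real => complex"
 assumes e: "e \<in> Basis" and F: "continuous_on UNIV F"
 shows "(LINT \<omega>|sphere_measure. F (x \<bullet> \<omega>)) = (LINT \<omega>|sphere_measure. F (norm x * (\<omega> \<bullet> e)))"
proof -
 have "norm (norm x *\<^sub>R e) = norm x" using e by simp
 from orthogonal_transformation_exists[OF this]
 obtain T where T: "orthogonal_transformation T" "T (norm x *\<^sub>R e) = x" by blast
 have i: "x \<bullet> T \<omega> = norm x * (\<omega> \<bullet> e)" for \<omega>
 proof -
  have "x \<bullet> T \<omega> = T (norm x *\<^sub>R e) \<bullet> T \<omega>" by (simp only: T(2))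
  also have "... = (norm x *\<^sub>R e) \<bullet> \<omega>" using T(1) by (simp only: orthogonal_transformation_def)
  finally show ?thesis by (simp add: inner_commute)
 qed
 have "(%\<omega>. F (x \<bullet> \<omega>)) \<in> borel_measurable sphere_measure"
  by (intro continuous_measurable_sphere continuous_on_compose2[OF F] continuous_intros) auto
 from sphere_integral_orthogonal[OF T(1) this] show ?thesis by (simp add: i)
qed

text \<open>A rotation moves x to the axis e, and the exponential series is integrated termwise: odd
  moments vanish and even ones produce the sine series divided by |x|.\<close>

lemma sphere_fourier:
 fixes x :: "real^3"
 shows "(LINT \<omega>|sphere_measure. exp (\<i> * of_real (x \<bullet> \<omega>))) = of_real (4 * pi * sinc (norm x))"
proof -
 obtain e :: "real^3" where e: "e \<in> Basis" using nonempty_Basis by blast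
 define s where "s = norm x"
 have s: "s >= 0" by (simp add: s_def)
 have 1: "(LINT \<omega>|sphere_measure. exp (\<i> * of_real (x \<bullet> \<omega>))) = (LINT \<omega>|sphere_measure. exp (\<i> * of_real (s * (\<omega> \<bullet> e))))"
  unfolding s_def by (rule sphere_integral_inner[OF e]) (intro continuous_intros)
 define f where "f n \<omega> = (\<i> * of_real (s * (\<omega> \<bullet> e))) ^ n /\<^sub>R fact n" for n and \<omega> :: "real^3"
 have le1: "\<bar>\<omega> \<bullet> e\<bar> <= 1" if "norm \<omega> = 1" for \<omega> using Basis_le_norm[OF e, of \<omega>] that by simp
 have fb: "norm (f n \<omega>) <= s ^ n /\<^sub>R fact n" if "norm \<omega> = 1" for n \<omega>
 proof -
  have "(s * \<bar>\<omega> \<bullet> e\<bar>) ^ n <= (s * 1) ^ n" using s le1[OF that] by (intro power_mono mult_left_mono) auto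
  then show ?thesis using s unfolding f_def by (simp add: norm_power norm_mult abs_mult divide_right_mono field_simps)
 qed
 have fm: "f n \<in> borel_measurable sphere_measure" for n
  unfolding f_def[abs_def] by (intro continuous_measurable_sphere continuous_intros)
 have fi: "integrable sphere_measure (f n)" for n by (rule sphere_bounded_integrable[OF fm fb])
 have sm: "summable (%n. s ^ n /\<^sub>R fact n)" by (rule summable_exp_generic)
 have "(%n. integral\<^sup>L sphere_measure (f n)) sums (LINT \<omega>|sphere_measure. (\<Sum>n. f n \<omega>))"
 proof (rule sums_integral[OF fi])
  show "AE \<omega> in sphere_measure. summable (%n. norm (f n \<omega>))"
   by (rule AE_I2, rule summable_comparison_test'[OF sm]) (use fb in simp)
  show "summable (%n. LINT \<omega>|sphere_measure. norm (f n \<omega>))"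
  proof (rule summable_comparison_test'[OF summable_mult[OF sm]])
   fix n
   have "(LINT \<omega>|sphere_measure. norm (f n \<omega>)) <= (LINT \<omega>|(sphere_measure :: (real^3) measure). s ^ n /\<^sub>R fact n)"
    using fi fb by (intro integral_mono_AE) auto
   then show "norm (LINT \<omega>|sphere_measure. norm (f n \<omega>)) <= (4 * pi) * (s ^ n /\<^sub>R fact n)" using measure_sphere by simp
  qed
 qed
 also have "(%\<omega>. \<Sum>n. f n \<omega>) = (%\<omega>. exp (\<i> * of_real (s * (\<omega> \<bullet> e))))" by (auto simp: f_def exp_def)
 finally have S: "(%n. integral\<^sup>L sphere_measure (f n)) sums (LINT \<omega>|sphere_measure. exp (\<i> * of_real (s * (\<omega> \<bullet> e))))" .
 \<comment> \<open>The factor s matches the n-th moment with the coefficient of s^(n+1) in the sine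
   series. For s = 0 it loses all information, and that case is closed by the total mass 4
   pi.\<close>
 have fn: "of_real s * integral\<^sup>L sphere_measure (f n) = of_real (4 * pi * (sin_coeff (Suc n) *\<^sub>R s ^ Suc n))" for n
 proof -
  have "f n = (%\<omega>. (\<i> ^ n * of_real (s ^ n / fact n)) * of_real ((\<omega> \<bullet> e) ^ n))"
   by (auto simp: f_def power_mult_distrib scaleR_conv_of_real field_simps)
  then have If: "integral\<^sup>L sphere_measure (f n) = \<i> ^ n * of_real (s ^ n / fact n * (LINT \<omega>|sphere_measure. (\<omega> \<bullet> e) ^ n))"
   by (simp only: integral_mult_right_zero integral_complex_of_real of_real_mult mult.assoc)
  show ?thesis
  proof (cases "even n")
   case True
   then obtain k where k: "n = 2 * k" by blast
   have "\<i> ^ n = of_real ((- 1) ^ k)" unfolding k by (simp add: power_mult)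
   then have "of_real s * integral\<^sup>L sphere_measure (f n) = of_real (s * ((-1) ^ k * (s ^ n / fact n * (4 * pi / (2 * k + 1)))))"
    unfolding If using sphere_moment_even[OF e, of k] k by simp
   also have "s * ((-1) ^ k * (s ^ n / fact n * (4 * pi / (2 * k + 1)))) = 4 * pi * (sin_coeff (Suc n) *\<^sub>R s ^ Suc n)"
    unfolding k sin_coeff_def by (simp add: field_simps)
   finally show ?thesis .
  next
   case False
   then obtain k where k: "n = 2 * k + 1" using oddE by blast
   have "sin_coeff (Suc n) = 0" using False by (simp add: sin_coeff_def)
   then show ?thesis unfolding If using sphere_moment_odd[of e k] k by simp
  qed
 qed
 have "(%n. sin_coeff (Suc n) *\<^sub>R s ^ Suc n) sums sin s" using sin_converges[of s] by (subst sums_Suc_iff) simp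
 then have "(%n. complex_of_real (4 * pi * (sin_coeff (Suc n) *\<^sub>R s ^ Suc n))) sums of_real (4 * pi * sin s)"
  by (intro sums_of_real sums_mult)
 moreover have "(%n. complex_of_real (4 * pi * (sin_coeff (Suc n) *\<^sub>R s ^ Suc n))) sums
   (of_real s * (LINT \<omega>|sphere_measure. exp (\<i> * of_real (s * (\<omega> \<bullet> e)))))" unfolding fn[symmetric] by (rule sums_mult[OF S])
 ultimately have "of_real s * (LINT \<omega>|sphere_measure. exp (\<i> * of_real (s * (\<omega> \<bullet> e)))) = complex_of_real (4 * pi * sin s)"
  by (rule sums_unique2[symmetric])
 then have "(LINT \<omega>|sphere_measure. exp (\<i> * of_real (s * (\<omega> \<bullet> e)))) = of_real (4 * pi * sinc s)"
  using measure_sphere by (cases "s = 0") (auto simp: field_simps scaleR_conv_of_real)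
 then show ?thesis unfolding 1 by (simp add: s_def)
qed

lemma abs_sinc_le_1: "\<bar>sinc x\<bar> <= 1" using abs_sin_x_le_abs_x[of x] by (simp add: field_simps)

text \<open>The derivative of \<open>u \<mapsto> sinc (s e\<^sup>u)\<close> is \<open>cos (s e\<^sup>u) - sinc (s e\<^sup>u)\<close>, whence a Lipschitz bound
 uniform in \<open>s\<close>.\<close>

lemma sinc_log_Lipschitz:
 assumes "r > 0" "r' > 0"
 shows "\<bar>sinc (r * s) - sinc (r' * s)\<bar> <= 2 * \<bar>ln (r / r')\<bar>"
proof (cases "s = 0")
 case False
 define \<phi> where "\<phi> u = sin (exp u * s) / (exp u * s)" for u
 have \<phi>: "\<phi> u = sinc (exp u * s)" for u using False by (simp add: \<phi>_def)
 have d: "(\<phi> has_field_derivative (cos (exp u * s) - sinc (exp u * s))) (at u within UNIV)" for u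
  unfolding \<phi>_def using False by (auto intro!: derivative_eq_intros simp: field_simps power2_eq_square)
 have "\<bar>cos (exp u * s) - sinc (exp u * s)\<bar> <= 2" for u
  using abs_sinc_le_1[of "exp u * s"] abs_cos_le_one[of "exp u * s"] by linarith
 then have "norm (\<phi> (ln r) - \<phi> (ln r')) <= 2 * norm (ln r - ln r')" by (intro field_differentiable_bound[of UNIV \<phi>, OF _ d]) auto
 moreover have "exp (ln r) = r" "exp (ln r') = r'" using assms by auto
 moreover have "ln (r / r') = ln r - ln r'" using assms by (simp add: ln_div)
 ultimately show ?thesis unfolding \<phi> by (simp only: real_norm_def)
qed simp

section \<open>Radial integrals inside and outside a ball\<close>

lemma nn_integral_radial_const:
 fixes f :: "real => real"
 assumes [measurable]: "f \<in> borel_measurable borel" and nn: "!!r. r >= 0 ==> f r >= 0"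
 shows "nn_integral lborel (%x. ennreal (f (norm (x::real^3)))) = ennreal (4 * pi) * nn_integral lborel (%r. ennreal (r^2 * f r) * indicator {0<..} r)"
proof -
 have "nn_integral lborel (%x. ennreal (f (norm (x::real^3)))) = nn_integral radial_measure (%r. nn_integral (sphere_measure :: (real^3) measure) (%\<omega>. ennreal (f (norm (r *\<^sub>R \<omega>)))))"
  by (rule nn_integral_polar) measurable
 also have "... = nn_integral radial_measure (%r. ennreal (f \<bar>r\<bar>) * ennreal (4 * pi))"
 proof (intro nn_integral_cong)
  fix r
  have "nn_integral (sphere_measure :: (real^3) measure) (%\<omega>. ennreal (f (norm (r *\<^sub>R \<omega>)))) = nn_integral (sphere_measure :: (real^3) measure) (%\<omega>. ennreal (f \<bar>r\<bar>))"
   by (intro nn_integral_cong) simp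
  then show "nn_integral (sphere_measure :: (real^3) measure) (%\<omega>. ennreal (f (norm (r *\<^sub>R \<omega>)))) = ennreal (f \<bar>r\<bar>) * ennreal (4 * pi)"
   by (simp add: emeasure_sphere_measure_space)
 qed
 also have "... = nn_integral lborel (%r. ennreal (r^2) * indicator {0<..} r * (ennreal (f \<bar>r\<bar>) * ennreal (4 * pi)))"
  by (rule nn_integral_radial) measurable
 also have "... = nn_integral lborel (%r. ennreal (4 * pi) * (ennreal (r^2 * f r) * indicator {0<..} r))"
  using nn by (intro nn_integral_cong) (auto simp: ennreal_mult mult_ac split: split_indicator)
 also have "... = ennreal (4 * pi) * nn_integral lborel (%r. ennreal (r^2 * f r) * indicator {0<..} r)"
  by (rule nn_integral_cmult) measurable
 finally show ?thesis .
qed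

lemma nn_integral_inverse_square_ball:
 assumes "\<rho> > 0"
 shows "nn_integral lborel (%z. ennreal (1 / (norm z)^2) * indicator {z. norm z < \<rho>} (z::real^3)) = ennreal (4 * pi * \<rho>)"
proof -
 have "nn_integral lborel (%z. ennreal (1 / (norm z)^2) * indicator {z. norm z < \<rho>} (z::real^3))
   = nn_integral lborel (%z. ennreal ((%r. indicator {..<\<rho>} r / r^2) (norm (z::real^3))))"
  by (intro nn_integral_cong) (auto split: split_indicator)
 also have "... = ennreal (4 * pi) * nn_integral lborel (%r. ennreal (r^2 * (indicator {..<\<rho>} r / r^2)) * indicator {0<..} r)"
  by (rule nn_integral_radial_const) auto
 also have "nn_integral lborel (%r. ennreal (r^2 * (indicator {..<\<rho>} r / r^2)) * indicator {0<..} r) = nn_integral lborel (%r. indicator {0<..<\<rho>} r)"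
  by (intro nn_integral_cong) (auto split: split_indicator)
 also have "... = ennreal \<rho>" using assms by simp
 finally show ?thesis using assms by (simp add: ennreal_mult)
qed

lemma nn_integral_inverse_sixth_outside:
 assumes "\<rho> > 0"
 shows "nn_integral lborel (%z. ennreal (1 / (norm z) ^ 6) * indicator {z. \<rho> <= norm z} (z::real^3)) = ennreal (4 * pi / (3 * \<rho> ^ 3))"
proof -
 have "nn_integral lborel (%z. ennreal (1 / (norm z) ^ 6) * indicator {z. \<rho> <= norm z} (z::real^3))
   = nn_integral lborel (%z. ennreal ((%r. indicator {\<rho>..} r / r ^ 6) (norm (z::real^3))))"
  by (intro nn_integral_cong) (auto split: split_indicator)
 also have "... = ennreal (4 * pi) * nn_integral lborel (%r. ennreal (r^2 * (indicator {\<rho>..} r / r ^ 6)) * indicator {0<..} r)"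
  by (rule nn_integral_radial_const) auto
 also have "nn_integral lborel (%r. ennreal (r^2 * (indicator {\<rho>..} r / r ^ 6)) * indicator {0<..} r) = nn_integral lborel (%r. ennreal (1 / r ^ 4) * indicator {\<rho>..} r)"
 proof (intro nn_integral_cong)
  fix r :: real
  show "ennreal (r^2 * (indicator {\<rho>..} r / r ^ 6)) * indicator {0<..} r = ennreal (1 / r ^ 4) * indicator {\<rho>..} r"
   using assms by (auto split: split_indicator simp: field_simps power_numeral_reduce)
 qed
 also have "... = ennreal (0 - (- 1 / (3 * \<rho> ^ 3)))"
 proof (rule nn_integral_FTC_atLeast)
  fix r :: real assume "\<rho> <= r"
  then show "((%r. - 1 / (3 * r ^ 3)) has_field_derivative 1 / r ^ 4) (at r)"
   using assms by (auto intro!: derivative_eq_intros simp: field_simps power_numeral_reduce)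
  show "0 <= 1 / r ^ 4" by simp
 next
  show "((%r::real. - 1 / (3 * r ^ 3)) \<longlongrightarrow> 0) at_top" by real_asymp
 qed auto
 finally show ?thesis using assms by (simp add: ennreal_mult[symmetric])
qed

section \<open>The Fourier transform\<close>

interpretation leb: sigma_finite_measure "lebesgue :: 'a::euclidean_space measure"
proof
 obtain A :: "'a set set" where
  "countable A" "A \<subseteq> sets lborel" "\<Union>A = space lborel" "ALL a:A. emeasure lborel a ~= \<infinity>"
  using lborel.sigma_finite_countable by blast
 then show "EX A. countable A & A \<subseteq> sets lebesgue & \<Union>A = space (lebesgue :: 'a measure) &
   (ALL a:A. emeasure lebesgue a ~= \<infinity>)" by (intro exI[of _ A]) auto
qed

interpretation leb2: pair_sigma_finite "lebesgue :: 'a::euclidean_space measure" "lebesgue :: 'b::euclidean_space measure" ..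

interpretation leb_sphere: pair_sigma_finite "lebesgue :: 'a::euclidean_space measure" "sphere_measure :: (real^3) measure" ..

lemma ident_measurable_lebesgue: "(%x. x) \<in> lebesgue \<rightarrow>\<^sub>M borel" by (rule measurable_completion) simp

lemma continuous_measurable_lebesgue:
 fixes f :: "'a::euclidean_space => 'b::topological_space"
 shows "continuous_on UNIV f ==> f \<in> borel_measurable lebesgue"
 by (rule measurable_completion) (simp add: borel_measurable_continuous_onI)

lemma fst_measurable_lebesgue [measurable]: "fst \<in> lebesgue \<Otimes>\<^sub>M N \<rightarrow>\<^sub>M borel"
 by (rule measurable_compose[OF measurable_fst ident_measurable_lebesgue])

lemma snd_measurable_lebesgue [measurable]: "snd \<in> N \<Otimes>\<^sub>M lebesgue \<rightarrow>\<^sub>M borel"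
 by (rule measurable_compose[OF measurable_snd ident_measurable_lebesgue])

lemma snd_measurable_sphere [measurable]: "snd \<in> N \<Otimes>\<^sub>M sphere_measure \<rightarrow>\<^sub>M borel"
 by (rule measurable_compose[OF measurable_snd ident_measurable_sphere])

lemma (in pair_sigma_finite) integrable_kernel:
 fixes f :: "'a => complex" and g :: "'b => complex" and K :: "'a => 'b => complex"
 assumes f: "integrable M1 f" and g: "integrable M2 g"
  and K: "(%(x, y). K x y) \<in> borel_measurable (M1 \<Otimes>\<^sub>M M2)"
  and b: "!!x y. norm (K x y) <= C"
 shows "integrable (M1 \<Otimes>\<^sub>M M2) (%(x, y). f x * g y * K x y)"
proof (rule Bochner_Integration.integrable_bound)
 note [measurable] = borel_measurable_integrable[OF f] borel_measurable_integrable[OF g] K[unfolded case_prod_beta]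
 have "integrable (M1 \<Otimes>\<^sub>M M2) (%(x, y). f x * g y)"
 proof (rule Fubini_integrable)
  show "integrable M1 (%x. LINT y|M2. norm ((%(x, y). f x * g y) (x, y)))" using f by (simp add: norm_mult)
 qed (use g in \<open>auto simp: case_prod_beta\<close>)
 then show "integrable (M1 \<Otimes>\<^sub>M M2) (%z. C *\<^sub>R (f (fst z) * g (snd z)))"
  unfolding case_prod_beta by (rule integrable_scaleR_right)
 show "(%(x, y). f x * g y * K x y) \<in> borel_measurable (M1 \<Otimes>\<^sub>M M2)" unfolding case_prod_beta by measurable
 have "norm (f x * g y * K x y) <= norm (C *\<^sub>R (f x * g y))" for x y
  using mult_left_mono[OF order_trans[OF b abs_ge_self], of "norm (f x * g y)" x y] by (simp add: norm_mult mult_ac)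
 then show "AE z in M1 \<Otimes>\<^sub>M M2. norm ((%(x, y). f x * g y * K x y) z) <= norm (C *\<^sub>R (f (fst z) * g (snd z)))"
  by (simp add: case_prod_beta)
qed

lemma (in pair_sigma_finite) kernel_Fubini:
 fixes f :: "'a => complex" and g :: "'b => complex" and K :: "'a => 'b => complex"
 assumes "integrable M1 f" "integrable M2 g" and "(%(x, y). K x y) \<in> borel_measurable (M1 \<Otimes>\<^sub>M M2)" and "!!x y. norm (K x y) <= C"
 shows "(LINT x|M1. f x * (LINT y|M2. g y * K x y)) = (LINT y|M2. g y * (LINT x|M1. f x * K x y))"
proof -
 have "(LINT x|M1. f x * (LINT y|M2. g y * K x y)) = (LINT x|M1. (LINT y|M2. f x * g y * K x y))" by (simp add: mult.assoc)
 also have "... = (LINT y|M2. (LINT x|M1. f x * g y * K x y))" using Fubini_integral[OF integrable_kernel[OF assms]] by simp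
 also have "... = (LINT y|M2. g y * (LINT x|M1. f x * K x y))" by (simp add: mult.assoc mult.left_commute[of _ "g _"])
 finally show ?thesis .
qed

lemma continuous_pair_measurable:
 fixes F :: "'a::euclidean_space \<times> 'b::euclidean_space => 'c::topological_space"
 assumes "continuous_on UNIV F"
 shows "F \<in> borel_measurable (lebesgue \<Otimes>\<^sub>M lebesgue)"
proof -
 have "(%z. (fst z, snd z)) \<in> lebesgue \<Otimes>\<^sub>M lebesgue \<rightarrow>\<^sub>M (borel :: ('a \<times> 'b) measure)" by (rule borel_measurable_Pair) measurable
 from measurable_compose[OF this borel_measurable_continuous_onI[OF assms]] show ?thesis by simp
qed

lemma continuous_pair_measurable_sphere:
 fixes F :: "'a::euclidean_space \<times> (real^3) => 'c::topological_space"
 assumes "continuous_on UNIV F"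
 shows "F \<in> borel_measurable (lebesgue \<Otimes>\<^sub>M sphere_measure)"
proof -
 have "(%z. (fst z, snd z)) \<in> lebesgue \<Otimes>\<^sub>M sphere_measure \<rightarrow>\<^sub>M (borel :: ('a \<times> (real^3)) measure)"
  by (rule borel_measurable_Pair) measurable
 from measurable_compose[OF this borel_measurable_continuous_onI[OF assms]] show ?thesis by simp
qed

abbreviation (input) "leb == lebesgue :: (real^3) measure"
abbreviation (input) "sph == sphere_measure"
abbreviation (input) "H == L2_space leb"
abbreviation (input) "nH == L2_norm leb"
abbreviation (input) "iH == L2_inner leb"
abbreviation (input) ft_const :: real where "ft_const == (2 * pi) powr (- 3 / 2)"

lemma ft_const_square: "ft_const * ft_const = 1 / (8 * pi ^ 3)"
proof -
 have "ft_const * ft_const = (2 * pi) powr (- 3)" by (simp add: powr_add[symmetric])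
 also have "... = 1 / (2 * pi) ^ 3" by (simp add: powr_minus powr_numeral inverse_eq_divide)
 finally show ?thesis by (simp add: power_mult_distrib)
qed

lemma fourier_eq: "fourier \<psi> p = of_real ft_const * (LINT x|leb. \<psi> x * exp (- \<i> * of_real (p \<bullet> x)))" by (simp add: fourier_def)

lemma fourier_integrand_integrable:
 assumes "integrable leb \<psi>"
 shows "integrable leb (%x. \<psi> x * exp (- \<i> * of_real (p \<bullet> x)))"
proof (rule Bochner_Integration.integrable_bound[OF assms])
 have [measurable]: "\<psi> \<in> borel_measurable leb" using assms by auto
 show "(%x. \<psi> x * exp (- \<i> * of_real (p \<bullet> x))) \<in> borel_measurable leb"
  by (intro borel_measurable_times[OF borel_measurable_integrable[OF assms]]
    continuous_measurable_lebesgue continuous_intros)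
qed (simp add: norm_mult)

lemma fourier_bound:
 assumes "integrable leb \<psi>"
 shows "cmod (fourier \<psi> p) <= ft_const * (LINT x|leb. cmod (\<psi> x))"
proof -
 have "cmod (LINT x|leb. \<psi> x * exp (- \<i> * of_real (p \<bullet> x))) <= (LINT x|leb. cmod (\<psi> x * exp (- \<i> * of_real (p \<bullet> x))))"
  by (rule integral_norm_bound)
 then show ?thesis by (simp add: fourier_def norm_mult mult_left_mono)
qed

lemma fourier_continuous:
 assumes "integrable leb \<psi>"
 shows "continuous_on UNIV (fourier \<psi>)" unfolding continuous_on_sequentially
proof (intro allI ballI impI, elim conjE)
 fix u and a :: "real^3" assume u: "u \<longlonglongrightarrow> a"
 have "(%n. LINT x|leb. \<psi> x * exp (- \<i> * of_real (u n \<bullet> x))) \<longlonglongrightarrow> (LINT x|leb. \<psi> x * exp (- \<i> * of_real (a \<bullet> x)))"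
  by (rule integral_dominated_convergence[where w = "%x. norm (\<psi> x)"])
    (use fourier_integrand_integrable[OF assms] assms in \<open>auto simp: norm_mult intro!: tendsto_intros u\<close>)
 then show "(fourier \<psi> \<circ> u) \<longlonglongrightarrow> fourier \<psi> a" unfolding fourier_def o_def by (intro tendsto_intros)
qed

lemma fourier_measurable [measurable]:
 assumes "integrable leb \<psi>"
 shows "fourier \<psi> \<in> borel_measurable borel" "fourier \<psi> \<in> borel_measurable leb" using fourier_continuous[OF assms]
 by (auto intro: borel_measurable_continuous_onI continuous_measurable_lebesgue)

lemma fourier_lincomb:
 assumes "integrable leb f" "integrable leb g"
 shows "fourier (%x. c * f x + g x) p = c * fourier f p + fourier g p"
proof -
 have "(LINT x|leb. (c * f x + g x) * exp (- \<i> * of_real (p \<bullet> x))) =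
   (LINT x|leb. c * (f x * exp (- \<i> * of_real (p \<bullet> x))) + g x * exp (- \<i> * of_real (p \<bullet> x)))" by (simp add: algebra_simps)
 also have "... = c * (LINT x|leb. f x * exp (- \<i> * of_real (p \<bullet> x))) + (LINT x|leb. g x * exp (- \<i> * of_real (p \<bullet> x)))"
  using fourier_integrand_integrable assms by (subst Bochner_Integration.integral_add) auto
 finally show ?thesis by (simp add: fourier_eq algebra_simps)
qed

lemma fourier_diff:
 assumes "integrable leb f" "integrable leb g"
 shows "fourier (%x. f x - g x) p = fourier f p - fourier g p" using fourier_lincomb[OF assms(2,1), of "-1" p] by simp

lemma fourier_cong_AE:
 fixes f g :: "real^3 => complex"
 assumes "AE x in lebesgue. f x = g x" "f \<in> borel_measurable leb" "g \<in> borel_measurable leb"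
 shows "fourier f = fourier g"
proof
 fix p :: "real^3"
 have [measurable]: "f \<in> borel_measurable leb" "g \<in> borel_measurable leb" by fact+
 note [measurable] = ident_measurable_lebesgue
 have [measurable]: "(%x. exp (- \<i> * of_real (p \<bullet> x))) \<in> borel_measurable leb"
  by (intro continuous_measurable_lebesgue continuous_intros)
 show "fourier f p = fourier g p" unfolding fourier_eq
  by (intro arg_cong[where f = "%z. _ * z"] integral_cong_AE) (use assms(1) in auto)
qed

lemma fourier_minus: "fourier f (- p) = cnj (fourier (%x. cnj (f x)) p)" unfolding fourier_eq complex_cnj_mult
 by (subst Bochner_Integration.integral_cnj[symmetric]) (simp add: exp_cnj)

lemma frakF_eq_fourier: "frakF \<mu> \<psi> p = fourier \<psi> (- (sqrt \<mu> *\<^sub>R p))" unfolding frakF_def fourier_def by (simp add: inner_commute)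

section \<open>Parseval-type identities for integrable functions, with and without a Gaussian
  weight\<close>

lemma multiplication_formula:
 assumes f: "integrable leb f" and b: "integrable leb b"
 shows "(LINT p|leb. b p * fourier f p) = (LINT y|leb. f y * fourier b y)"
proof -
 have "(LINT p|leb. b p * (LINT x|leb. f x * exp (- \<i> * of_real (p \<bullet> x))))
   = (LINT x|leb. f x * (LINT p|leb. b p * exp (- \<i> * of_real (p \<bullet> x))))"
 proof (rule leb2.kernel_Fubini[OF b f, where C = 1])
  show "(%(p, x). exp (- \<i> * complex_of_real (p \<bullet> x))) \<in> borel_measurable (leb \<Otimes>\<^sub>M leb)"
   unfolding case_prod_beta by (intro continuous_pair_measurable continuous_intros)
 qed simp
 then have "of_real ft_const * (LINT p|leb. b p * (LINT x|leb. f x * exp (- \<i> * of_real (p \<bullet> x))))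
   = of_real ft_const * (LINT x|leb. f x * (LINT p|leb. b p * exp (- \<i> * of_real (x \<bullet> p))))" by (simp add: inner_commute)
 then show ?thesis unfolding fourier_eq by (subst (asm) (1 2) integral_mult_right_zero[symmetric]) (simp only: mult.left_commute)
qed

lemma multiplication_formula_cnj:
 assumes f: "integrable leb f" and a: "integrable leb a"
 shows "(LINT p|leb. cnj (fourier f p) * a p) = (LINT x|leb. cnj (f x) * fourier a (- x))"
proof -
 have "cnj (LINT p|leb. cnj (a p) * fourier f p) = cnj (LINT y|leb. f y * fourier (%x. cnj (a x)) y)"
  by (subst multiplication_formula) (use f a in auto)
 then show ?thesis by (simp add: Bochner_Integration.integral_cnj[symmetric] fourier_minus mult.commute)
qed

text \<open>The kernel (4 pi t)^(-3/2) exp(-|z|^2/(4t)) of the heat semigroup at time t.\<close>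

definition heat_kernel :: "real => real^3 => real" where
 "heat_kernel t z = (1 / (2 * sqrt (pi * t))) ^ 3 * exp (- (z \<bullet> z) / (4 * t))"

lemma heat_kernel_eq:
 assumes "t > 0"
 shows "ft_const * ft_const * (sqrt (pi / t) ^ 3 * exp (- (z \<bullet> z) / (4 * t))) = heat_kernel t z"
proof -
 have "1 / (8 * pi ^ 3) * sqrt (pi / t) ^ 3 = (1 / (2 * pi) * sqrt (pi / t)) ^ 3" by (simp add: power_mult_distrib power_divide)
 also have "1 / (2 * pi) * sqrt (pi / t) = 1 / (2 * sqrt (pi * t))"
 proof -
  have "sqrt (pi / t) * sqrt (pi * t) = pi" using assms by (simp add: real_sqrt_mult[symmetric])
  then show ?thesis using assms by (simp add: field_simps)
 qed
 finally show ?thesis unfolding heat_kernel_def ft_const_square by (simp only: mult.assoc[symmetric])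
qed

lemma gaussian_integrable_lebesgue:
 fixes a :: "real^3"
 assumes "t > 0"
 shows "integrable leb (%p. exp (\<i> * of_real (a \<bullet> p)) * complex_of_real (exp (- t * (p \<bullet> p))))"
  and "(LINT p|leb. exp (\<i> * of_real (a \<bullet> p)) * complex_of_real (exp (- t * (p \<bullet> p))))
   = of_real (sqrt (pi / t) ^ 3 * exp (- (a \<bullet> a) / (4 * t)))"
proof -
 have m: "(%p. exp (\<i> * of_real (a \<bullet> p)) * complex_of_real (exp (- t * (p \<bullet> p)))) \<in> borel_measurable lborel"
  unfolding measurable_lborel2 by (intro borel_measurable_continuous_onI continuous_intros)
 show "integrable leb (%p. exp (\<i> * of_real (a \<bullet> p)) * complex_of_real (exp (- t * (p \<bullet> p))))"
  unfolding integrable_completion[OF m] by (rule gaussian_fourier[OF assms])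
 show "(LINT p|leb. exp (\<i> * of_real (a \<bullet> p)) * complex_of_real (exp (- t * (p \<bullet> p))))
   = of_real (sqrt (pi / t) ^ 3 * exp (- (a \<bullet> a) / (4 * t)))"
  unfolding integral_completion[OF m] by (rule gaussian_fourier[OF assms])
qed

text \<open>The Gaussian makes the Fourier side integrable, and transforming back gives convolution
  with the heat kernel. Letting t tend to 0 leads to Plancherel's theorem, integrating over t leads
  to the Newton potential.\<close>

lemma heat_identity:
 assumes f: "integrable leb f" and g: "integrable leb g" and t: "t > 0"
 shows "(LINT p|leb. cnj (fourier f p) * (fourier g p * of_real (exp (- t * (p \<bullet> p)))))
   = (LINT x|leb. cnj (f x) * (LINT y|leb. g y * of_real (heat_kernel t (x - y))))"
  and "integrable leb (%p. fourier g p * of_real (exp (- t * (p \<bullet> p))))"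
proof -
 note [measurable] = fourier_measurable[OF g]
 have G: "integrable leb (%p::real^3. complex_of_real (exp (- t * (p \<bullet> p))))"
  using gaussian_integrable_lebesgue(1)[OF t, of 0] by simp
 show i: "integrable leb (%p. fourier g p * of_real (exp (- t * (p \<bullet> p))))"
 proof (rule Bochner_Integration.integrable_bound)
  let ?C = "ft_const * (LINT x|leb. cmod (g x))"
  show "integrable leb (%p::real^3. ?C *\<^sub>R complex_of_real (exp (- t * (p \<bullet> p))))" using G by (rule integrable_scaleR_right)
  show "(%p. fourier g p * of_real (exp (- t * (p \<bullet> p)))) \<in> borel_measurable leb"
   using borel_measurable_integrable[OF G] by measurable
  show "AE p in lebesgue. norm (fourier g p * of_real (exp (- t * (p \<bullet> p)))) <= norm (?C *\<^sub>R complex_of_real (exp (- t * (p \<bullet> p))))"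
  proof (rule AE_I2)
   fix p
   have "cmod (fourier g p) <= \<bar>?C\<bar>" using fourier_bound[OF g, of p] by linarith
   then show "norm (fourier g p * of_real (exp (- t * (p \<bullet> p)))) <= norm (?C *\<^sub>R complex_of_real (exp (- t * (p \<bullet> p))))"
    unfolding norm_mult norm_scaleR by (rule mult_right_mono) simp
  qed
 qed
 have "fourier (%p. fourier g p * of_real (exp (- t * (p \<bullet> p)))) (- x) = (LINT y|leb. g y * of_real (heat_kernel t (x - y)))" for x
 proof -
  let ?b = "%p. exp (\<i> * of_real (x \<bullet> p)) * complex_of_real (exp (- t * (p \<bullet> p)))"
  have "(LINT p|leb. fourier g p * of_real (exp (- t * (p \<bullet> p))) * exp (- \<i> * of_real (- x \<bullet> p)))
    = (LINT p|leb. ?b p * fourier g p)" by (intro Bochner_Integration.integral_cong refl) (simp add: mult_ac)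
  also have "... = (LINT y|leb. g y * fourier ?b y)"
   by (rule multiplication_formula[OF g gaussian_integrable_lebesgue(1)[OF t]])
  also have "of_real ft_const * ... = (LINT y|leb. of_real ft_const * (g y * fourier ?b y))" by simp
  also have "... = (LINT y|leb. g y * of_real (heat_kernel t (x - y)))"
  proof (intro Bochner_Integration.integral_cong refl)
   fix y
   have "fourier ?b y = of_real ft_const * (LINT p|leb. exp (\<i> * of_real ((x - y) \<bullet> p)) * complex_of_real (exp (- t * (p \<bullet> p))))"
    unfolding fourier_eq by (intro arg_cong[where f = "%z. _ * z"] Bochner_Integration.integral_cong refl)
      (simp add: inner_diff_left algebra_simps exp_diff exp_minus divide_inverse)
   also have "... = of_real (ft_const * (sqrt (pi / t) ^ 3 * exp (- ((x - y) \<bullet> (x - y)) / (4 * t))))"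
    unfolding gaussian_integrable_lebesgue(2)[OF t] by simp
   finally have "of_real ft_const * (g y * fourier ?b y) = g y * of_real (ft_const * ft_const * (sqrt (pi / t) ^ 3 * exp (- ((x - y) \<bullet> (x - y)) / (4 * t))))"
    by (simp add: mult_ac)
   then show "of_real ft_const * (g y * fourier ?b y) = g y * of_real (heat_kernel t (x - y))" unfolding heat_kernel_eq[OF t] .
  qed
  finally show ?thesis unfolding fourier_eq .
 qed
 then show "(LINT p|leb. cnj (fourier f p) * (fourier g p * of_real (exp (- t * (p \<bullet> p)))))
   = (LINT x|leb. cnj (f x) * (LINT y|leb. g y * of_real (heat_kernel t (x - y))))"
  by (subst multiplication_formula_cnj[OF f i]) simp
qed

section \<open>Plancherel's theorem\<close>

lemma L2_norm_reverse_triangle: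
 assumes "f \<in> L2_space M" "g \<in> L2_space M"
 shows "\<bar>L2_norm M f - L2_norm M g\<bar> <= L2_norm M (%x. f x - g x)" using L2_norm_triangle[OF L2_diff[OF assms] assms(2)]
  L2_norm_triangle[OF L2_diff[OF assms(2,1)] assms(1)] L2_norm_minus[of M f g] by simp

lemma L2_norm_tendsto:
 assumes "!!n. F n \<in> L2_space M" "f \<in> L2_space M" "((%n. L2_norm M (%x. F n x - f x)) \<longlongrightarrow> 0) G"
 shows "((%n. L2_norm M (F n)) \<longlongrightarrow> L2_norm M f) G"
proof -
 have "((%n. L2_norm M (F n) - L2_norm M f) \<longlongrightarrow> 0) G" by (rule Lim_null_comparison[OF always_eventually assms(3)])
    (use L2_norm_reverse_triangle[OF assms(1,2)] in simp)
 then show ?thesis by (rule LIM_zero_cancel)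
qed

lemma L2_inner_tendsto_left:
 assumes "!!n. F n \<in> L2_space M" "f \<in> L2_space M" "h \<in> L2_space M" and "((%n. L2_norm M (%x. F n x - f x)) \<longlongrightarrow> 0) G"
 shows "((%n. L2_inner M (F n) h) \<longlongrightarrow> L2_inner M f h) G"
proof -
 have "((%n. L2_inner M (F n) h - L2_inner M f h) \<longlongrightarrow> 0) G"
 proof (rule Lim_null_comparison[OF always_eventually tendsto_mult_left_zero[OF assms(4)]])
  show "ALL n. norm (L2_inner M (F n) h - L2_inner M f h) <= L2_norm M (%x. F n x - f x) * L2_norm M h"
   using L2_Cauchy_Schwarz[OF L2_diff[OF assms(1,2)] assms(3)] by (simp add: L2_inner_diff_left[OF assms(1-3)])
 qed
 then show ?thesis by (rule LIM_zero_cancel)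
qed

definition trunc :: "real => (real^3 => complex) => real^3 => complex" where
 "trunc R h x = indicator (cball 0 R) x * h x"

lemma trunc_L2:
 assumes h: "h \<in> H"
 shows "trunc R h \<in> H" "integrable leb (trunc R h)"
  "nH (trunc R h) <= nH h"
proof -
 have [measurable]: "h \<in> borel_measurable leb" using h by (rule L2_measurable)
 have [measurable]: "cball 0 R \<in> sets leb" by simp
 have m: "trunc R h \<in> borel_measurable leb" unfolding trunc_def[abs_def] by measurable
 show L: "trunc R h \<in> H" by (rule L2_spaceI[OF m L2_square_integrable[OF h]]) (auto simp: trunc_def split: split_indicator)
 have b: "integrable leb (indicator (cball 0 R) :: real^3 => real)"
  using emeasure_lborel_cball_finite[of "0::real^3"] by (simp add: integrable_indicator_iff)
 show "integrable leb (trunc R h)"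
 proof (rule Bochner_Integration.integrable_bound[OF Bochner_Integration.integrable_add[OF b L2_square_integrable[OF h]] m])
  have "t <= 1 + t^2" if "0 <= t" for t :: real
   using zero_le_power2[of "t - 1"] that by (simp add: power2_eq_square algebra_simps)
  then show "AE x in lebesgue. norm (trunc R h x) <= norm (indicator (cball 0 R) x + (cmod (h x))^2)"
   by (intro AE_I2) (auto simp: trunc_def norm_mult split: split_indicator)
 qed
 show "nH (trunc R h) <= nH h" unfolding L2_norm_def
  by (intro real_sqrt_le_mono integral_mono L2_square_integrable L h) (auto simp: trunc_def split: split_indicator)
qed

lemma trunc_tendsto:
 assumes h: "h \<in> H"
 shows "((%R. nH (%x. trunc R h x - h x)) \<longlongrightarrow> 0) at_top"
proof -
 have [measurable]: "h \<in> borel_measurable leb" using h by (rule L2_measurable)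
 have [measurable]: "cball 0 R \<in> sets leb" for R by simp
 have "((%R. LINT x|leb. (cmod (trunc R h x - h x))^2) \<longlongrightarrow> (LINT x|leb. 0)) at_top"
 proof (rule integral_dominated_convergence_at_top[where w = "%x. (cmod (h x))^2"])
  show "(%x. (cmod (trunc R h x - h x))^2) \<in> borel_measurable leb" for R unfolding trunc_def by measurable
  show "AE x in lebesgue. ((%R. (cmod (trunc R h x - h x))^2) \<longlongrightarrow> 0) at_top"
  proof (intro AE_I2 tendsto_eventually)
   fix x
   show "\<forall>\<^sub>F R in at_top. (cmod (trunc R h x - h x))^2 = 0"
    using eventually_ge_at_top[of "norm x"] by eventually_elim (simp add: trunc_def)
  qed
  show "\<forall>\<^sub>F R in at_top. AE x in lebesgue. norm ((cmod (trunc R h x - h x))^2) <= (cmod (h x))^2"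
   by (intro always_eventually allI AE_I2) (auto simp: trunc_def split: split_indicator)
 qed (use L2_square_integrable[OF h] in auto)
 then have "((%R. sqrt (LINT x|leb. (cmod (trunc R h x - h x))^2)) \<longlongrightarrow> sqrt 0) at_top" by (intro tendsto_intros) simp
 then show ?thesis by (simp add: L2_norm_def)
qed

text \<open>Treated as a property of single functions, so that \<open>plancherel_limit\<close> can
  propagate it from continuous functions to bounded ones and from these to all functions in L1 and
  L2.\<close>

definition plancherel :: "(real^3 => complex) => bool" where
 "plancherel f \<longleftrightarrow> integrable leb f & f \<in> H & fourier f \<in> H &
   nH (fourier f) = nH f"

text \<open>Convergence in L1 gives pointwise limits of the transforms, convergence in L2 bounds
  their distances, and Fatou's lemma joins the two. The isometry is assumed for differences as well,
  since the property is not yet known to be stable under subtraction.\<close>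

lemma plancherel_limit:
 assumes f: "f \<in> H" "integrable leb f"
  and F: "!!n. plancherel (F n)" and d: "!!m n. plancherel (%x. F m x - F n x)"
  and L1: "(%n. LINT x|leb. cmod (F n x - f x)) \<longlonglongrightarrow> 0"
  and L2: "(%n. nH (%x. F n x - f x)) \<longlonglongrightarrow> 0"
 shows "plancherel f"
proof -
 have Fi: "integrable leb (F n)" and FL: "F n \<in> H"
  and FfL: "fourier (F n) \<in> H"
  and Fn: "nH (fourier (F n)) = nH (F n)" for n using F[of n] by (auto simp: plancherel_def)
 have dn: "nH (%p. fourier (F m) p - fourier (F n) p) = nH (%x. F m x - F n x)" for m n
  using d[of m n] by (simp add: plancherel_def fourier_diff[OF Fi Fi, abs_def])
 note [measurable] = fourier_measurable[OF f(2)] fourier_measurable[OF Fi]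
 have pt: "(%n. fourier (F n) p) \<longlonglongrightarrow> fourier f p" for p
 proof (rule LIM_zero_cancel, rule Lim_null_comparison[OF always_eventually])
  show "ALL n. norm (fourier (F n) p - fourier f p) <= ft_const * (LINT x|leb. cmod (F n x - f x))"
   using fourier_bound[OF Bochner_Integration.integrable_diff[OF Fi f(2)], of _ p] by (simp add: fourier_diff[OF Fi f(2)])
  show "(%n. ft_const * (LINT x|leb. cmod (F n x - f x))) \<longlonglongrightarrow> 0" by (rule tendsto_mult_right_zero[OF L1])
 qed
 have le: "nn_integral leb (%p. ennreal ((cmod (fourier f p - fourier (F n) p))^2)) <= ennreal ((nH (%x. f x - F n x))^2)" for n
 proof -
  have "nn_integral leb (%p. ennreal ((cmod (fourier f p - fourier (F n) p))^2))
    = nn_integral leb (%p. liminf (%m. ennreal ((cmod (fourier (F m) p - fourier (F n) p))^2)))"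
   by (intro nn_integral_cong lim_imp_Liminf[symmetric] trivial_limit_sequentially tendsto_intros pt)
  also have "... <= liminf (%m. nn_integral leb (%p. ennreal ((cmod (fourier (F m) p - fourier (F n) p))^2)))"
   by (rule nn_integral_liminf) measurable
  also have "... = liminf (%m. ennreal ((nH (%x. F m x - F n x))^2))" by (simp add: L2_norm_ennreal[OF L2_diff[OF FfL FfL]] dn)
  also have "... = ennreal ((nH (%x. f x - F n x))^2)"
   by (intro lim_imp_Liminf trivial_limit_sequentially tendsto_intros L2_norm_tendsto L2_diff FL f) (use L2 in simp)
  finally show ?thesis .
 qed
 have df: "(%p. fourier f p - fourier (F n) p) \<in> H"
  "nH (%p. fourier f p - fourier (F n) p) <= nH (%x. f x - F n x)" for n by (rule L2_nn_integralI[OF _ le]; simp)+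
 have ff: "fourier f \<in> H" using L2_add[OF df(1)[of 0] FfL[of 0]] by simp
 have "(%n. nH (%p. fourier (F n) p - fourier f p)) \<longlonglongrightarrow> 0" by (rule Lim_null_comparison[OF always_eventually L2])
   (use df(2) L2_norm_minus[of leb f] L2_norm_minus[of leb "fourier f"] in simp)
 from L2_norm_tendsto[OF FfL ff this]
 have "(%n. nH (F n)) \<longlonglongrightarrow> nH (fourier f)" unfolding Fn .
 moreover have "(%n. nH (F n)) \<longlonglongrightarrow> nH f" by (rule L2_norm_tendsto[OF FL f(1) L2])
 ultimately have "nH (fourier f) = nH f" by (rule LIMSEQ_unique)
 then show ?thesis using f ff by (simp add: plancherel_def)
qed

lemma bounded_support_L2:
 fixes f :: "real^3 => complex"
 assumes m: "f \<in> borel_measurable leb" and b: "!!x. cmod (f x) <= B" and s: "!!x. R < norm x ==> f x = 0"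
 shows "integrable leb f" "f \<in> H"
proof -
 have i: "integrable leb (%x. c * indicator (cball 0 R) (x::real^3) :: real)" for c
  using emeasure_lborel_cball_finite[of "0::real^3"] by (intro integrable_mult_right) (simp add: integrable_indicator_iff)
 have B: "B >= 0" using b[of 0] norm_ge_zero order_trans by blast
 have le: "cmod (f x) <= B * indicator (cball 0 R) x" for x using b[of x] s[of x] by (auto split: split_indicator simp: not_le)
 show "integrable leb f" by (rule Bochner_Integration.integrable_bound[OF i[of B] m]) (use le B in \<open>auto simp: abs_mult\<close>)
 have "(cmod (f x))^2 <= B^2 * indicator (cball 0 R) x" for x
  using power_mono[OF le[of x], of 2] by (auto split: split_indicator_asm split_indicator)
 then show "f \<in> H" by (intro L2_spaceI[OF m i[of "B^2"]] AE_I2)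
qed

text \<open>The substitution y = x - 2 s z at time s^2 moves the dependence on s from the kernel
  into the argument of g, where continuity can act.\<close>

lemma heat_kernel_rescaled_integral:
 fixes g :: "real^3 => complex"
 assumes g: "continuous_on UNIV g" and s: "s > 0"
 shows "(LINT y|leb. g y * of_real (heat_kernel (s^2) (x - y)))
  = (LINT z|leb. g (x - (2 * s) *\<^sub>R z) * of_real (exp (- (z \<bullet> z)) / sqrt pi ^ 3))"
proof -
 let ?h = "%y. g y * of_real (heat_kernel (s^2) (x - y))"
 have hm: "?h \<in> borel_measurable lborel" unfolding measurable_lborel2 heat_kernel_def
  using s by (intro borel_measurable_continuous_onI continuous_intros g) auto
 have km: "(%z. g (x - (2 * s) *\<^sub>R z) * of_real (exp (- (z \<bullet> z)) / sqrt pi ^ 3)) \<in> borel_measurable lborel"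
  unfolding measurable_lborel2 by (intro borel_measurable_continuous_onI continuous_intros continuous_on_compose2[OF g]) auto
 have "(LINT y|lborel. ?h y) = (LINT y|(density (distr lborel borel (%z. x + (- (2 * s)) *\<^sub>R z)) (%_. \<bar>- (2 * s)\<bar> ^ DIM(real^3))). ?h y)"
  using s by (subst lborel_affine[of "- (2 * s)" x]) auto
 also have "... = (LINT y|(distr lborel borel (%z. x + (- (2 * s)) *\<^sub>R z)). ((2 * s) ^ 3) *\<^sub>R ?h y)"
  using s hm by (subst integral_density) auto
 also have "... = (LINT z|lborel. ((2 * s) ^ 3) *\<^sub>R ?h (x + (- (2 * s)) *\<^sub>R z))" using hm by (subst integral_distr) auto
 also have "... = (LINT z|lborel. g (x - (2 * s) *\<^sub>R z) * of_real (exp (- (z \<bullet> z)) / sqrt pi ^ 3))"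
 proof (intro Bochner_Integration.integral_cong refl)
  fix z :: "real^3"
  have "(2 * s) ^ 3 * heat_kernel (s^2) ((2 * s) *\<^sub>R z) = exp (- (z \<bullet> z)) / sqrt pi ^ 3" using s unfolding heat_kernel_def
   by (simp add: real_sqrt_mult power_divide power_mult_distrib field_simps power2_eq_square)
  then have "complex_of_real ((2 * s) ^ 3) * of_real (heat_kernel (s^2) ((2 * s) *\<^sub>R z)) = of_real (exp (- (z \<bullet> z)) / sqrt pi ^ 3)"
   by (metis of_real_mult)
  then show "((2 * s) ^ 3) *\<^sub>R ?h (x + (- (2 * s)) *\<^sub>R z) = g (x - (2 * s) *\<^sub>R z) * of_real (exp (- (z \<bullet> z)) / sqrt pi ^ 3)"
   by (simp add: scaleR_conv_of_real mult.left_commute)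
 qed
 finally show ?thesis unfolding integral_completion[OF hm] integral_completion[OF km] .
qed

lemma heat_kernel_approximate_identity:
 fixes g :: "real^3 => complex"
 assumes g: "continuous_on UNIV g" and b: "!!x. cmod (g x) <= B" and s: "s \<longlonglongrightarrow> 0" "!!n. s n > 0"
 shows "(%n. LINT y|leb. g y * of_real (heat_kernel ((s n)^2) (x - y))) \<longlonglongrightarrow> g x"
  and "cmod (LINT y|leb. g y * of_real (heat_kernel ((s n)^2) (x - y))) <= B"
  and "continuous_on UNIV (%x. LINT y|leb. g y * of_real (heat_kernel ((s n)^2) (x - y)))"
proof -
 define k where "k z = exp (- (z \<bullet> z)) / sqrt pi ^ 3" for z :: "real^3"
 have k: "(%z. complex_of_real (k z)) = (%z. of_real (1 / sqrt pi ^ 3) * (exp (\<i> * of_real (0 \<bullet> z)) * complex_of_real (exp (- 1 * (z \<bullet> z)))))"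
  by (auto simp: k_def)
 have ki: "integrable leb (%z. complex_of_real (k z))" "(LINT z|leb. complex_of_real (k z)) = 1"
  unfolding k using gaussian_integrable_lebesgue[of 1 0] by simp_all
 have k0: "k z >= 0" for z by (simp add: k_def)
 have kr: "integrable leb k" "(LINT z|leb. k z) = 1"
  using ki by (simp_all add: complex_of_real_integrable_eq integral_complex_of_real)
 have gm: "(%z. g (x - c *\<^sub>R z) * of_real (k z)) \<in> borel_measurable leb" for x c
  unfolding k_def by (intro continuous_measurable_lebesgue continuous_intros continuous_on_compose2[OF g]) auto
 have bd: "norm (g y * of_real (k z)) <= B * k z" for y z
  using mult_right_mono[OF b[of y] k0[of z]] k0[of z] by (simp add: norm_mult)
 have e: "(LINT y|leb. g y * of_real (heat_kernel ((s n)^2) (x - y)))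
   = (LINT z|leb. g (x - (2 * s n) *\<^sub>R z) * of_real (k z))" for n x
  unfolding k_def by (rule heat_kernel_rescaled_integral[OF g s(2)])
 have cg: "(%n. g (u n)) \<longlonglongrightarrow> g v" if "u \<longlonglongrightarrow> v" for u v using g that by (simp add: continuous_on_sequentially o_def)
 have "(%n. LINT z|leb. g (x - (2 * s n) *\<^sub>R z) * of_real (k z)) \<longlonglongrightarrow> (LINT z|leb. g x * of_real (k z))"
 proof (rule integral_dominated_convergence[where w = "%z. B * k z"])
  show "AE z in lebesgue. (%n. g (x - (2 * s n) *\<^sub>R z) * of_real (k z)) \<longlonglongrightarrow> g x * of_real (k z)"
  proof (intro AE_I2 tendsto_intros cg)
   fix z
   have "(%n. x - (2 * s n) *\<^sub>R z) \<longlonglongrightarrow> x - (2 * 0) *\<^sub>R z" by (intro tendsto_intros s)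
   then show "(%n. x - (2 * s n) *\<^sub>R z) \<longlonglongrightarrow> x" by simp
  qed
 qed (use kr gm[of x] gm[of x 0] bd in auto)
 then show "(%n. LINT y|leb. g y * of_real (heat_kernel ((s n)^2) (x - y))) \<longlonglongrightarrow> g x" unfolding e using ki by simp
 have "cmod (LINT z|leb. g (x - (2 * s n) *\<^sub>R z) * of_real (k z)) <= (LINT z|leb. B * k z)"
  by (rule Bochner_Integration.integral_norm_bound_integral[OF Bochner_Integration.integrable_bound[OF integrable_mult_right[OF kr(1), of B] gm]])
    (use kr bd in \<open>auto intro!: AE_I2 intro: order_trans[OF _ abs_ge_self]\<close>)
 then show "cmod (LINT y|leb. g y * of_real (heat_kernel ((s n)^2) (x - y))) <= B" unfolding e using kr by simp
 show "continuous_on UNIV (%x. LINT y|leb. g y * of_real (heat_kernel ((s n)^2) (x - y)))"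
  unfolding e continuous_on_sequentially o_def
 proof (intro allI ballI impI, elim conjE)
  fix u a assume u: "u \<longlonglongrightarrow> (a::real^3)"
  show "(%j. LINT z|leb. g (u j - (2 * s n) *\<^sub>R z) * of_real (k z)) \<longlonglongrightarrow> (LINT z|leb. g (a - (2 * s n) *\<^sub>R z) * of_real (k z))"
   by (rule integral_dominated_convergence[where w = "%z. B * k z"]) (use kr gm bd in \<open>auto intro!: tendsto_intros cg u\<close>)
 qed
qed

text \<open>In \<open>heat_identity\<close> with f = g the right side tends to the squared norm of g
  as t -> 0. Fatou's lemma first puts the transform into L2; only then is dominated convergence
  available on the left.\<close>

lemma plancherel_continuous:
 fixes g :: "real^3 => complex"
 assumes g: "continuous_on UNIV g" and b: "!!x. cmod (g x) <= B" and s: "!!x. R < norm x ==> g x = 0"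
 shows "plancherel g"
proof -
 have gm: "g \<in> borel_measurable leb" by (rule continuous_measurable_lebesgue[OF g])
 have gi: "integrable leb g" "g \<in> H" using bounded_support_L2[of g B R] gm b s by blast+
 note [measurable] = gm fourier_measurable[OF gi(1)] ident_measurable_lebesgue
 define h where "h n = inverse (real (Suc n))" for n
 have h0: "h \<longlonglongrightarrow> 0" "!!n. h n > 0" unfolding h_def using LIMSEQ_inverse_real_of_nat by auto
 define I where "I n x = (LINT y|leb. g y * of_real (heat_kernel ((h n)^2) (x - y)))" for n x
 note ai = heat_kernel_approximate_identity[OF g b h0]
 have Ilim: "(%n. LINT x|leb. cnj (g x) * I n x) \<longlonglongrightarrow> (LINT x|leb. cnj (g x) * g x)"
 proof (rule integral_dominated_convergence[where w = "%x. B * cmod (g x)"])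
  show "(%x. cnj (g x) * I n x) \<in> borel_measurable leb" for n
   using continuous_measurable_lebesgue[OF ai(3)] unfolding I_def by measurable
  show "AE x in lebesgue. norm (cnj (g x) * I n x) <= B * cmod (g x)" for n
   using ai(2) unfolding I_def by (simp add: norm_mult mult.commute[of B] mult_left_mono)
 qed (use gi ai(1) in \<open>auto simp: I_def intro!: tendsto_intros\<close>)
 have lhs: "(LINT p|leb. (cmod (fourier g p))^2 * exp (- (h n)\<^sup>2 * (p \<bullet> p))) = Re (LINT x|leb. cnj (g x) * I n x)"
  and lhi: "integrable leb (%p. (cmod (fourier g p))^2 * exp (- (h n)\<^sup>2 * (p \<bullet> p)))" for n
 proof -
  have t: "(h n)^2 > 0" using h0(2)[of n] by simp
  have c: "cnj (fourier g p) * (fourier g p * of_real (exp (- (h n)\<^sup>2 * (p \<bullet> p)))) =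
    complex_of_real ((cmod (fourier g p))^2 * exp (- (h n)\<^sup>2 * (p \<bullet> p)))" for p
   unfolding of_real_mult complex_norm_square by (simp add: mult_ac)
  show "(LINT p|leb. (cmod (fourier g p))^2 * exp (- (h n)\<^sup>2 * (p \<bullet> p))) = Re (LINT x|leb. cnj (g x) * I n x)"
   using arg_cong[where f = Re, OF heat_identity(1)[OF gi(1) gi(1) t]]
   unfolding c I_def integral_complex_of_real Re_complex_of_real .
  have "integrable leb (%p. cnj (fourier g p) * (fourier g p * of_real (exp (- (h n)\<^sup>2 * (p \<bullet> p)))))"
  proof (rule Bochner_Integration.integrable_bound)
   let ?C = "ft_const * (LINT x|leb. cmod (g x))"
   note i = heat_identity(2)[OF gi(1) gi(1) t]
   show "integrable leb (%p. ?C *\<^sub>R (fourier g p * of_real (exp (- (h n)\<^sup>2 * (p \<bullet> p)))))"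
    using i by (rule integrable_scaleR_right)
   show "(%p. cnj (fourier g p) * (fourier g p * of_real (exp (- (h n)\<^sup>2 * (p \<bullet> p))))) \<in> borel_measurable leb"
    using borel_measurable_integrable[OF i] by measurable
   show "AE p in lebesgue. norm (cnj (fourier g p) * (fourier g p * of_real (exp (- (h n)\<^sup>2 * (p \<bullet> p)))))
     <= norm (?C *\<^sub>R (fourier g p * of_real (exp (- (h n)\<^sup>2 * (p \<bullet> p)))))"
   proof (rule AE_I2)
    fix p
    have "cmod (fourier g p) <= \<bar>?C\<bar>" using fourier_bound[OF gi(1), of p] by linarith
    then show "norm (cnj (fourier g p) * (fourier g p * of_real (exp (- (h n)\<^sup>2 * (p \<bullet> p)))))
     <= norm (?C *\<^sub>R (fourier g p * of_real (exp (- (h n)\<^sup>2 * (p \<bullet> p)))))"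
     unfolding norm_mult[of "cnj _"] norm_scaleR complex_mod_cnj by (rule mult_right_mono) simp
   qed
  qed
  then show "integrable leb (%p. (cmod (fourier g p))^2 * exp (- (h n)\<^sup>2 * (p \<bullet> p)))"
   unfolding c complex_of_real_integrable_eq .
 qed
 have gg: "(LINT x|leb. cnj (g x) * g x) = of_real ((nH g)^2)" using L2_inner_self[of leb g] by (simp add: L2_inner_def)
 have lim: "(%n. LINT p|leb. (cmod (fourier g p))^2 * exp (- (h n)\<^sup>2 * (p \<bullet> p))) \<longlonglongrightarrow> (nH g)^2"
  using tendsto_Re[OF Ilim] unfolding lhs gg by simp
 have elim: "(%n. (cmod (fourier g p))^2 * exp (- (h n)\<^sup>2 * (p \<bullet> p))) \<longlonglongrightarrow> (cmod (fourier g p))^2" for p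
 proof -
  have "(%n. (cmod (fourier g p))^2 * exp (- (h n)\<^sup>2 * (p \<bullet> p))) \<longlonglongrightarrow> (cmod (fourier g p))^2 * exp (- 0\<^sup>2 * (p \<bullet> p))"
   by (intro tendsto_intros h0)
  then show ?thesis by simp
 qed
 have "nn_integral leb (%p. ennreal ((cmod (fourier g p))^2)) =
   nn_integral leb (%p. liminf (%n. ennreal ((cmod (fourier g p))^2 * exp (- (h n)\<^sup>2 * (p \<bullet> p)))))"
  by (intro nn_integral_cong lim_imp_Liminf[symmetric] trivial_limit_sequentially tendsto_ennrealI elim)
 also have "... <= liminf (%n. nn_integral leb (%p. ennreal ((cmod (fourier g p))^2 * exp (- (h n)\<^sup>2 * (p \<bullet> p)))))"
  by (rule nn_integral_liminf) measurable
 also have "... = liminf (%n. ennreal (LINT p|leb. (cmod (fourier g p))^2 * exp (- (h n)\<^sup>2 * (p \<bullet> p))))"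
  by (subst nn_integral_eq_integral[OF lhi]) auto
 also have "... = ennreal ((nH g)^2)" by (intro lim_imp_Liminf trivial_limit_sequentially tendsto_ennrealI lim)
 finally have ff: "fourier g \<in> H" by (intro L2_nn_integralI(1)[of _ _ "nH g"]) auto
 have "(%n. LINT p|leb. (cmod (fourier g p))^2 * exp (- (h n)\<^sup>2 * (p \<bullet> p))) \<longlonglongrightarrow> (LINT p|leb. (cmod (fourier g p))^2)"
  by (rule integral_dominated_convergence[where w = "%p. (cmod (fourier g p))^2"])
    (use elim L2_square_integrable[OF ff] borel_measurable_integrable[OF lhi] in \<open>auto intro!: mult_left_le\<close>)
 from LIMSEQ_unique[OF this lim] have "(nH (fourier g))^2 = (nH g)^2" by (simp add: L2_norm_sq)
 then show ?thesis using gi ff by (simp add: plancherel_def)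
qed

text \<open>A measurable function is an almost everywhere limit of continuous ones. To keep these
  dominated, \<pi> projects their values to the disc of radius B and \<kappa> cuts them off between
  the radii R and R + 1; neither changes the limit f.\<close>

lemma plancherel_bounded_support:
 fixes f :: "real^3 => complex"
 assumes m: "f \<in> borel_measurable leb" and b: "!!x. cmod (f x) <= B" and s: "!!x. R < norm x ==> f x = 0"
 shows "plancherel f"
proof -
 have fi: "integrable leb f" "f \<in> H" using bounded_support_L2[of f B R] m b s by blast+
 have "f measurable_on UNIV" by (rule lebesgue_measurable_imp_measurable_on[OF m]) simp
 then obtain N G where N: "negligible N" and G: "!!n. continuous_on UNIV (G n)"
  and lim: "!!x. x \<notin> N ==> (%n. G n x) \<longlonglongrightarrow> f x" unfolding measurable_on_def by auto
 have B: "B >= 0" using b[of 0] norm_ge_zero order_trans by blast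
 define \<pi> where "\<pi> = closest_point (cball (0::complex) B)"
 have \<pi>c: "continuous_on UNIV \<pi>" unfolding \<pi>_def using B by (intro continuous_on_closest_point) auto
 have \<pi>b: "cmod (\<pi> z) <= B" for z
  using closest_point_in_set[of "cball (0::complex) B" z] B unfolding \<pi>_def by (auto simp: dist_norm)
 have \<pi>f: "\<pi> (f x) = f x" for x unfolding \<pi>_def using b by (intro closest_point_self) simp
 define \<kappa> where "\<kappa> x = max 0 (min 1 (R + 1 - norm x))" for x :: "real^3"
 have \<kappa>c: "continuous_on UNIV \<kappa>" unfolding \<kappa>_def[abs_def] by (intro continuous_intros)
 have \<kappa>: "0 <= \<kappa> x" "\<kappa> x <= 1" for x by (auto simp: \<kappa>_def)
 have \<kappa>0: "\<kappa> x = 0" if "R + 1 < norm x" for x using that by (simp add: \<kappa>_def)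
 have \<kappa>1: "\<kappa> x = 1" if "norm x <= R" for x using that by (simp add: \<kappa>_def)
 define F where "F n x = of_real (\<kappa> x) * \<pi> (G n x)" for n x
 have Fc: "continuous_on UNIV (F n)" for n
  unfolding F_def[abs_def] by (intro continuous_intros \<kappa>c continuous_on_compose2[OF \<pi>c G]) auto
 have Fb: "cmod (F n x) <= B" for n x using mult_mono[OF \<kappa>(2)[of x] \<pi>b[of "G n x"]] \<kappa>[of x] by (simp add: F_def norm_mult)
 have Fs: "F n x = 0" if "R + 1 < norm x" for n x using \<kappa>0[OF that] by (simp add: F_def)
 have Flim: "(%n. F n x) \<longlonglongrightarrow> f x" if "x \<notin> N" for x
 proof -
  have "(%n. F n x) \<longlonglongrightarrow> of_real (\<kappa> x) * \<pi> (f x)"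
   unfolding F_def using \<pi>c lim[OF that] by (intro tendsto_intros) (simp add: continuous_on_sequentially o_def)
  moreover have "of_real (\<kappa> x) * \<pi> (f x) = f x" using \<kappa>1[of x] s[of x] unfolding \<pi>f by (cases "norm x <= R") auto
  ultimately show ?thesis by simp
 qed
 have AEN: "AE x in lebesgue. x \<notin> N" using N by (simp add: AE_not_in negligible_iff_null_sets)
 have Fm: "F n \<in> borel_measurable leb" for n by (rule continuous_measurable_lebesgue[OF Fc])
 note [measurable] = m Fm
 have w: "integrable leb (%x. c * indicator (cball 0 (R + 1)) (x::real^3) :: real)" for c
  using emeasure_lborel_cball_finite[of "0::real^3"] by (intro integrable_mult_right) (simp add: integrable_indicator_iff)
 have d: "cmod (F n x - f x) <= 2 * B * indicator (cball 0 (R + 1)) x" for n x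
 proof (cases "norm x <= R + 1")
  case True
  then show ?thesis using norm_triangle_ineq4[of "F n x" "f x"] Fb[of n x] b[of x] by simp
 qed (use Fs s in simp)
 show ?thesis
 proof (rule plancherel_limit[OF fi(2,1)])
  show "plancherel (F n)" for n by (rule plancherel_continuous[OF Fc Fb Fs])
  show "plancherel (%x. F k x - F n x)" for k n
  proof (rule plancherel_continuous)
   show "continuous_on UNIV (%x. F k x - F n x)" by (intro continuous_intros Fc)
   show "cmod (F k x - F n x) <= 2 * B" for x using norm_triangle_ineq4[of "F k x" "F n x"] Fb[of k x] Fb[of n x] by simp
   show "F k x - F n x = 0" if "R + 1 < norm x" for x using Fs[OF that] by simp
  qed
  have "(%n. LINT x|leb. cmod (F n x - f x)) \<longlonglongrightarrow> (LINT x|leb. 0)"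
  proof (rule integral_dominated_convergence[OF _ _ w[of "2 * B"]])
   show "AE x in lebesgue. (%n. cmod (F n x - f x)) \<longlonglongrightarrow> 0" using AEN by eventually_elim (intro tendsto_norm_zero LIM_zero Flim)
  qed (use d in auto)
  then show "(%n. LINT x|leb. cmod (F n x - f x)) \<longlonglongrightarrow> 0" by simp
  have "(%n. LINT x|leb. (cmod (F n x - f x))^2) \<longlonglongrightarrow> (LINT x|leb. 0)"
  proof (rule integral_dominated_convergence[OF _ _ w[of "(2 * B)^2"]])
   show "AE x in lebesgue. (%n. (cmod (F n x - f x))^2) \<longlonglongrightarrow> 0"
    using AEN by eventually_elim (use tendsto_power[OF tendsto_norm_zero[OF LIM_zero[OF Flim]], of _ 2] in simp)
   show "AE x in lebesgue. norm ((cmod (F n x - f x))^2) <= (2 * B)^2 * indicator (cball 0 (R + 1)) x" for n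
   proof (rule AE_I2)
    fix x
    show "norm ((cmod (F n x - f x))^2) <= (2 * B)^2 * indicator (cball 0 (R + 1)) x"
     using power_mono[OF d[of n x], of 2] by (cases "norm x <= R + 1") auto
   qed
  qed auto
  then have "(%n. sqrt (LINT x|leb. (cmod (F n x - f x))^2)) \<longlonglongrightarrow> sqrt 0" by (intro tendsto_intros) simp
  then show "(%n. nH (%x. F n x - f x)) \<longlonglongrightarrow> 0" by (simp add: L2_norm_def)
 qed
qed

text \<open>Truncating both values and domain gives bounded functions of bounded support that
  converge in L1 and in L2 at once.\<close>

theorem plancherel_L1_L2:
 fixes f :: "real^3 => complex"
 assumes fi: "integrable leb f" and fL: "f \<in> H"
 shows "plancherel f"
proof -
 define F where "F n x = (if cmod (f x) <= real n & norm x <= real n then f x else 0)" for n :: nat and x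
 have m [measurable]: "f \<in> borel_measurable leb" using fi by auto
 have nm [measurable]: "(%x::real^3. norm x) \<in> borel_measurable leb" by (intro continuous_measurable_lebesgue continuous_intros)
 have Fm [measurable]: "F n \<in> borel_measurable leb" for n unfolding F_def[abs_def] by measurable
 have d: "cmod (F n x - f x) <= cmod (f x)" for n x by (simp add: F_def)
 have Fe: "\<forall>\<^sub>F n in sequentially. F n x = f x" for x using eventually_ge_at_top[of "nat \<lceil>max (cmod (f x)) (norm x)\<rceil>"]
 proof eventually_elim
  case (elim n)
  then have "max (cmod (f x)) (norm x) <= real n" by linarith
  then show ?case by (simp add: F_def)
 qed
 show ?thesis
 proof (rule plancherel_limit[OF fL fi])
  show "plancherel (F n)" for n by (rule plancherel_bounded_support[where B = "real n" and R = "real n"]) (auto simp: F_def)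
  show "plancherel (%x. F k x - F n x)" for k n
  proof (rule plancherel_bounded_support[where B = "real k + real n" and R = "real k + real n"])
   show "cmod (F k x - F n x) <= real k + real n" for x
    using norm_triangle_ineq4[of "F k x" "F n x"] by (rule order_trans) (auto simp: F_def)
  qed (auto simp: F_def)
  have "(%n. LINT x|leb. cmod (F n x - f x)) \<longlonglongrightarrow> (LINT x|leb. 0)"
  proof (rule integral_dominated_convergence[OF _ _ integrable_norm[OF fi]])
   show "AE x in lebesgue. (%n. cmod (F n x - f x)) \<longlonglongrightarrow> 0" by (intro AE_I2 tendsto_eventually eventually_mono[OF Fe]) simp
  qed (use d in auto)
  then show "(%n. LINT x|leb. cmod (F n x - f x)) \<longlonglongrightarrow> 0" by simp
  have "(%n. LINT x|leb. (cmod (F n x - f x))^2) \<longlonglongrightarrow> (LINT x|leb. 0)"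
  proof (rule integral_dominated_convergence[OF _ _ L2_square_integrable[OF fL]])
   show "AE x in lebesgue. (%n. (cmod (F n x - f x))^2) \<longlonglongrightarrow> 0" by (intro AE_I2 tendsto_eventually eventually_mono[OF Fe]) simp
  qed (use d in \<open>auto intro!: power_mono\<close>)
  then have "(%n. sqrt (LINT x|leb. (cmod (F n x - f x))^2)) \<longlonglongrightarrow> sqrt 0" by (intro tendsto_intros) simp
  then show "(%n. nH (%x. F n x - f x)) \<longlonglongrightarrow> 0" by (simp add: L2_norm_def)
 qed
qed

lemma fourier_L2:
 assumes "integrable leb f" "f \<in> H"
 shows "fourier f \<in> H" "nH (fourier f) = nH f" using plancherel_L1_L2[OF assms] by (auto simp: plancherel_def)

lemma plancherel_inner:
 assumes f: "integrable leb f" "f \<in> H"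
  and g: "integrable leb g" "g \<in> H"
 shows "iH (fourier f) (fourier g) = iH f g"
proof -
 have F: "fourier (%x. c * f x + g x) = (%p. c * fourier f p + fourier g p)" for c using fourier_lincomb[OF f(1) g(1)] by blast
 have "nH (fourier (%x. c * f x + g x)) = nH (%x. c * f x + g x)" for c using f g by (intro fourier_L2 L2_lincomb) auto
 then have "c * iH g f + cnj c * iH f g =
   c * iH (fourier g) (fourier f) + cnj c * iH (fourier f) (fourier g)" for c
  using L2_norm_lincomb_sq[OF f(2) g(2), of c] L2_norm_lincomb_sq[OF fourier_L2(1)[OF f] fourier_L2(1)[OF g], of c]
  unfolding F fourier_L2(2)[OF f] fourier_L2(2)[OF g] by simp
 from this[of 1] this[of \<i>] show ?thesis by (simp add: complex_eq_iff)
qed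

lemma ifourier_L2:
 assumes "integrable leb f" "f \<in> H"
 shows "(%x. fourier f (- x)) \<in> H" "nH (%x. fourier f (- x)) = nH f"
proof -
 have c: "integrable leb (%x. cnj (f x))" "(%x. cnj (f x)) \<in> H" using assms by (auto intro: L2_cnj)
 show "(%x. fourier f (- x)) \<in> H" unfolding fourier_minus by (intro L2_cnj fourier_L2 c)
 have "nH (%x. fourier f (- x)) = nH (fourier (%x. cnj (f x)))" unfolding fourier_minus by (simp add: L2_norm_def)
 then show "nH (%x. fourier f (- x)) = nH f" using fourier_L2(2)[OF c] by (simp add: L2_norm_def)
qed

lemma ifourier_inner:
 assumes "integrable leb f" "f \<in> H" "integrable leb g" "g \<in> H"
 shows "iH (%x. fourier f (- x)) (%x. fourier g (- x)) = iH f g"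
proof -
 have c: "integrable leb (%x. cnj (f x))" "(%x. cnj (f x)) \<in> H"
   "integrable leb (%x. cnj (g x))" "(%x. cnj (g x)) \<in> H" using assms by (auto intro: L2_cnj)
 have "iH (%x. cnj (a x)) (%x. cnj (b x)) = cnj (iH a b)" for a b :: "real^3 => complex"
  unfolding L2_inner_def by (subst Bochner_Integration.integral_cnj[symmetric]) simp
 then show ?thesis unfolding fourier_minus using plancherel_inner[OF c] by simp
qed

section \<open>The Fourier transform on L2 as a limit of truncations\<close>

lemma L2_fourier_iff:
 "L2_fourier \<psi> \<phi> \<longleftrightarrow> \<psi> \<in> H & \<phi> \<in> H & ((%R. nH (%p. fourier (trunc R \<psi>) p - \<phi> p)) \<longlongrightarrow> 0) at_top"
proof (cases "\<psi> \<in> H & \<phi> \<in> H")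
 case True
 have d: "(%p. fourier (trunc R \<psi>) p - \<phi> p) \<in> H" for R using True by (intro L2_diff fourier_L2 trunc_L2) auto
 have t: "(%x. indicator (cball 0 R) x * \<psi> x) = trunc R \<psi>" for R by (auto simp: trunc_def)
 have "((%R. ennreal ((nH (%p. fourier (trunc R \<psi>) p - \<phi> p))^2)) \<longlongrightarrow> 0) at_top \<longleftrightarrow>
   ((%R. (nH (%p. fourier (trunc R \<psi>) p - \<phi> p))^2) \<longlongrightarrow> 0) at_top"
  using tendsto_ennreal_iff[where F = at_top and f = "%R. (nH (%p. fourier (trunc R \<psi>) p - \<phi> p))^2" and x = 0] by simp
 also have "... \<longleftrightarrow> ((%R. nH (%p. fourier (trunc R \<psi>) p - \<phi> p)) \<longlongrightarrow> 0) at_top"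
 proof
  assume "((%R. (nH (%p. fourier (trunc R \<psi>) p - \<phi> p))^2) \<longlongrightarrow> 0) at_top"
  from tendsto_real_sqrt[OF this]
  show "((%R. nH (%p. fourier (trunc R \<psi>) p - \<phi> p)) \<longlongrightarrow> 0) at_top" by simp
 next
  assume "((%R. nH (%p. fourier (trunc R \<psi>) p - \<phi> p)) \<longlongrightarrow> 0) at_top"
  from tendsto_power[OF this, of 2]
  show "((%R. (nH (%p. fourier (trunc R \<psi>) p - \<phi> p))^2) \<longlongrightarrow> 0) at_top" by simp
 qed
 finally show ?thesis using True unfolding L2_fourier_def t L2_norm_ennreal[OF d] by simp
qed (auto simp: L2_fourier_def)

lemma L2_fourier_lincomb:
 assumes "L2_fourier \<psi> \<phi>" "L2_fourier \<psi>' \<phi>'"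
 shows "L2_fourier (%x. c * \<psi> x + \<psi>' x) (%p. c * \<phi> p + \<phi>' p)"
proof -
 have L: "\<psi> \<in> H" "\<psi>' \<in> H" "\<phi> \<in> H" "\<phi>' \<in> H" using assms by (auto simp: L2_fourier_def)
 have t: "trunc R (%x. c * \<psi> x + \<psi>' x) = (%x. c * trunc R \<psi> x + trunc R \<psi>' x)" for R by (auto simp: trunc_def algebra_simps)
 have "((%R. nH (%p. fourier (trunc R (%x. c * \<psi> x + \<psi>' x)) p - (c * \<phi> p + \<phi>' p))) \<longlongrightarrow> 0) at_top"
 proof (rule Lim_null_comparison[OF always_eventually])
  show "ALL R. norm (nH (%p. fourier (trunc R (%x. c * \<psi> x + \<psi>' x)) p - (c * \<phi> p + \<phi>' p)))
    <= cmod c * nH (%p. fourier (trunc R \<psi>) p - \<phi> p) + nH (%p. fourier (trunc R \<psi>') p - \<phi>' p)"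
  proof
   fix R
   have "(%p. fourier (trunc R (%x. c * \<psi> x + \<psi>' x)) p - (c * \<phi> p + \<phi>' p)) =
     (%p. c * (fourier (trunc R \<psi>) p - \<phi> p) + (fourier (trunc R \<psi>') p - \<phi>' p))"
    unfolding t fourier_lincomb[OF trunc_L2(2)[OF L(1)] trunc_L2(2)[OF L(2)]] by (auto simp: algebra_simps)
   then show "norm (nH (%p. fourier (trunc R (%x. c * \<psi> x + \<psi>' x)) p - (c * \<phi> p + \<phi>' p)))
    <= cmod c * nH (%p. fourier (trunc R \<psi>) p - \<phi> p) + nH (%p. fourier (trunc R \<psi>') p - \<phi>' p)"
    using L2_norm_triangle[OF L2_scale[of _ leb c] , of "%p. fourier (trunc R \<psi>) p - \<phi> p" "%p. fourier (trunc R \<psi>') p - \<phi>' p"]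
     L by (simp add: L2_norm_scale L2_diff fourier_L2 trunc_L2)
  qed
  have "((%R. cmod c * nH (%p. fourier (trunc R \<psi>) p - \<phi> p) + nH (%p. fourier (trunc R \<psi>') p - \<phi>' p)) \<longlongrightarrow> cmod c * 0 + 0) at_top"
   using assms by (intro tendsto_intros) (auto simp: L2_fourier_iff)
  then show "((%R. cmod c * nH (%p. fourier (trunc R \<psi>) p - \<phi> p) + nH (%p. fourier (trunc R \<psi>') p - \<phi>' p)) \<longlongrightarrow> 0) at_top" by simp
 qed
 then show ?thesis unfolding L2_fourier_iff using L by (auto intro: L2_lincomb)
qed

text \<open>Truncations of \<psi> are integrable, so \<open>plancherel_inner\<close> applies to
  them, and both sides pass to the limit.\<close>

lemma L2_fourier_inner:
 assumes p: "L2_fourier \<psi> \<phi>" and g: "integrable leb g" "g \<in> H"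
 shows "iH \<psi> g = iH \<phi> (fourier g)"
proof -
 have L: "\<psi> \<in> H" "\<phi> \<in> H"
  and lim: "((%R. nH (%p. fourier (trunc R \<psi>) p - \<phi> p)) \<longlongrightarrow> 0) at_top" using p by (auto simp: L2_fourier_iff)
 have "((%R. iH (fourier (trunc R \<psi>)) (fourier g)) \<longlongrightarrow> iH \<phi> (fourier g)) at_top"
  by (rule L2_inner_tendsto_left[OF _ L(2) _ lim]) (use g L in \<open>auto intro: fourier_L2 trunc_L2\<close>)
 moreover have "((%R. iH (fourier (trunc R \<psi>)) (fourier g)) \<longlongrightarrow> iH \<psi> g) at_top"
  unfolding plancherel_inner[OF trunc_L2(2,1)[OF L(1)] g]
  by (rule L2_inner_tendsto_left[OF _ L(1) _ trunc_tendsto[OF L(1)]]) (use g L in \<open>auto intro: trunc_L2\<close>)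
 ultimately show ?thesis using tendsto_unique[OF trivial_limit_at_top_linorder] by blast
qed

text \<open>Duality against truncations of the difference itself gives
 \<open>\<parallel>F (1\<^sub>R \<psi>) - \<phi>\<parallel> \<le> \<parallel>\<psi> - 1\<^sub>R \<psi>\<parallel>\<close>.\<close>

lemma L2_fourier_surjective:
 assumes \<phi>: "\<phi> \<in> H"
 shows "EX \<psi>. L2_fourier \<psi> \<phi>"
proof -
 define P where "P n = trunc (real n) \<phi>" for n :: nat
 have P: "P n \<in> H" "integrable leb (P n)" for n unfolding P_def by (intro trunc_L2 \<phi>)+
 have Plim: "(%n. nH (%p. P n p - \<phi> p)) \<longlonglongrightarrow> 0"
  unfolding P_def by (rule filterlim_compose[OF trunc_tendsto[OF \<phi>] filterlim_real_sequentially])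
 define Q where "Q n x = fourier (P n) (- x)" for n x
 have Q: "Q n \<in> H" for n unfolding Q_def[abs_def] by (intro ifourier_L2 P)
 have Qd: "nH (%x. Q m x - Q n x) = nH (%p. P m p - P n p)" for m n using ifourier_L2(2)[of "%p. P m p - P n p"] P
  by (simp add: Q_def fourier_diff[OF P(2) P(2)] L2_diff)
 have "EX N. ALL m>=N. ALL n>=N. nH (%x. Q m x - Q n x) < e" if e: "e > 0" for e
 proof -
  obtain N where N: "!!n. n >= N ==> nH (%p. P n p - \<phi> p) < e / 2"
   using order_tendstoD(2)[OF Plim, of "e / 2"] e by (auto simp: eventually_sequentially)
  have "nH (%p. P m p - P n p) < e" if "m >= N" "n >= N" for m n
   using L2_norm_triangle3[OF P(1)[of m] \<phi> P(1)[of n]] N[OF that(1)] N[OF that(2)]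
    L2_norm_minus[of leb \<phi> "P n"] by simp
  then show ?thesis unfolding Qd by blast
 qed
 from L2_complete[OF Q this] obtain \<psi> where
  \<psi>: "\<psi> \<in> H" "(%n. nH (%x. Q n x - \<psi> x)) \<longlonglongrightarrow> 0" by blast
 have inv: "iH \<psi> (%x. fourier \<eta> (- x)) = iH \<phi> \<eta>" if \<eta>: "integrable leb \<eta>" "\<eta> \<in> H" for \<eta>
 proof -
  have "(%n. iH (Q n) (%x. fourier \<eta> (- x))) \<longlonglongrightarrow> iH \<psi> (%x. fourier \<eta> (- x))"
   by (rule L2_inner_tendsto_left[OF Q \<psi>(1) _ \<psi>(2)]) (intro ifourier_L2 \<eta>)
  then have "(%n. iH (P n) \<eta>) \<longlonglongrightarrow> iH \<psi> (%x. fourier \<eta> (- x))" unfolding Q_def ifourier_inner[OF P(2,1) \<eta>] .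
  moreover have "(%n. iH (P n) \<eta>) \<longlonglongrightarrow> iH \<phi> \<eta>" by (rule L2_inner_tendsto_left[OF P(1) \<phi> \<eta>(2) Plim])
  ultimately show ?thesis by (rule LIMSEQ_unique)
 qed
 have key: "nH (%p. fourier (trunc R \<psi>) p - \<phi> p) <= nH (%x. trunc R \<psi> x - \<psi> x)" for R
 proof -
  let ?d = "%p. fourier (trunc R \<psi>) p - \<phi> p"
  let ?e = "%x. trunc R \<psi> x - \<psi> x"
  have fL: "fourier (trunc R \<psi>) \<in> H" by (intro fourier_L2 trunc_L2 \<psi>)
  have d: "?d \<in> H" by (intro L2_diff fL \<phi>)
  have e: "?e \<in> H" by (intro L2_diff trunc_L2 \<psi>)
  have "nH (trunc N ?d) <= nH ?e" for N
  proof -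
   let ?\<eta> = "trunc N ?d"
   have \<eta>: "integrable leb ?\<eta>" "?\<eta> \<in> H" by (intro trunc_L2 d)+
   have i\<eta>: "(%x. fourier ?\<eta> (- x)) \<in> H" by (intro ifourier_L2 \<eta>)
   have "iH (fourier (trunc R \<psi>)) ?\<eta> = iH (trunc R \<psi>) (%x. fourier ?\<eta> (- x))"
    unfolding L2_inner_def by (rule multiplication_formula_cnj[OF trunc_L2(2)[OF \<psi>(1)] \<eta>(1)])
   then have "iH ?d ?\<eta> = iH ?e (%x. fourier ?\<eta> (- x))"
    using inv[OF \<eta>] by (simp add: L2_inner_diff_left[OF fL \<phi> \<eta>(2)] L2_inner_diff_left[OF trunc_L2(1)[OF \<psi>(1)] \<psi>(1) i\<eta>])
   moreover have "iH ?d ?\<eta> = of_real ((nH ?\<eta>)^2)" unfolding L2_inner_self[symmetric] L2_inner_def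
    by (intro Bochner_Integration.integral_cong refl) (auto simp: trunc_def split: split_indicator)
   ultimately have "(nH ?\<eta>)^2 = cmod (iH ?e (%x. fourier ?\<eta> (- x)))" by (metis abs_power2 norm_of_real)
   also have "... <= nH ?e * nH ?\<eta>" using L2_Cauchy_Schwarz[OF e i\<eta>] ifourier_L2(2)[OF \<eta>] by simp
   finally have "nH ?\<eta> * nH ?\<eta> <= nH ?e * nH ?\<eta>" by (simp add: power2_eq_square)
   then show ?thesis using L2_norm_nonneg[of leb ?\<eta>] L2_norm_nonneg[of leb ?e]
    by (cases "nH ?\<eta> = 0") (auto simp: mult_le_cancel_right)
  qed
  moreover have "((%N. nH (trunc N ?d)) \<longlongrightarrow> nH ?d) at_top"
   by (rule L2_norm_tendsto[OF _ d trunc_tendsto[OF d]]) (intro trunc_L2 d)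
  ultimately show ?thesis by (intro tendsto_upperbound[OF _ _ trivial_limit_at_top_linorder]) auto
 qed
 have "((%R. nH (%p. fourier (trunc R \<psi>) p - \<phi> p)) \<longlongrightarrow> 0) at_top"
  by (rule Lim_null_comparison[OF always_eventually trunc_tendsto[OF \<psi>(1)]]) (use key in simp)
 then show ?thesis unfolding L2_fourier_iff using \<psi>(1) \<phi> by blast
qed

section \<open>The Hardy--Littlewood--Sobolev and Sobolev inequalities\<close>

lemma nn_integral_reflect_translate:
 fixes h :: "real^3 => ennreal"
 assumes [measurable]: "h \<in> borel_measurable borel"
 shows "nn_integral leb (%y. h (x - y)) = nn_integral lborel (%z. h z)"
proof -
 have "nn_integral lborel (%z. h z) = nn_integral (density (distr lborel borel (%y. x + (- 1) *\<^sub>R y)) (%_. ennreal (\<bar>- 1\<bar> ^ DIM(real^3)))) (%z. h z)"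
  by (subst lborel_affine[of "- 1" x]) auto
 also have "... = nn_integral lborel (%y. h (x - y))" by (simp add: nn_integral_density nn_integral_distr)
 finally show ?thesis by (simp add: nn_integral_completion)
qed

lemma powr_three_halves: "0 <= a ==> a powr (3 / 2) = a * sqrt (a::real)"
proof -
 assume a: "0 <= a"
 have "a powr (3 / 2) = a powr 1 * a powr (1 / 2)" unfolding powr_add[symmetric] by simp
 then show ?thesis using a by (simp add: powr_half_sqrt)
qed

text \<open>Young's inequality for the exponents 3/2 and 3 with a weight: either w <= \<alpha> sqrt
  f and the first term suffices, or f <= w^2/\<alpha>^2 and the second does.\<close>

lemma Young_three_halves:
 fixes f w \<alpha> :: real
 assumes "0 <= f" "0 <= w" "0 < \<alpha>"
 shows "f * w <= \<alpha> * f powr (3 / 2) + w ^ 3 / \<alpha>^2"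
proof (cases "w <= \<alpha> * sqrt f")
 case True
 then have "f * w <= f * (\<alpha> * sqrt f)" using assms by (intro mult_left_mono) auto
 then show ?thesis using assms by (simp add: powr_three_halves mult_ac add_increasing2)
next
 case False
 then have "(\<alpha> * sqrt f)^2 <= w^2" using assms by (intro power_mono) auto
 then have "f <= w^2 / \<alpha>^2" using assms by (simp add: power_mult_distrib field_simps)
 then have "f * w <= w^2 / \<alpha>^2 * w" using assms by (intro mult_right_mono) auto
 then show ?thesis using assms by (simp add: power3_eq_cube power2_eq_square add_increasing)
qed

text \<open>With I the integral of f^(3/2): 4 pi comes from the ball |x - y| < \<rho>, 4 pi/3 from
  its outside and I from Young's inequality; the factor 2 undoes the restriction to f(y) <= f(x).
  That it vanishes with I matters in \<open>large_T_nonneg\<close>.\<close>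

definition hls_const :: "real => real" where
 "hls_const I = 2 * I * (16 * pi / 3 + I)"

text \<open>By symmetry only \<open>f(y) \<le> f(x)\<close> matters.  Splitting at \<open>|x - y| = f(x)\<^sup>-\<^sup>1\<^sup>/\<^sup>2\<close> bounds the inner
 integral by a multiple of \<open>f(x)\<^sup>1\<^sup>/\<^sup>2\<close>.\<close>

lemma hls_inner:
 fixes f :: "real^3 => real"
 assumes [measurable]: "f \<in> borel_measurable leb" and nn: "!!x. 0 <= f x"
  and int: "integrable leb (%x. f x powr (3 / 2))"
 defines "I == LINT x|leb. f x powr (3 / 2)"
 shows "nn_integral leb (%y. ennreal (f x * f y / (norm (x - y))^2) * indicator {y. f y <= f x} y)
   <= ennreal ((16 * pi / 3 + I) * f x powr (3 / 2))"
proof (cases "f x = 0")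
 case False
 then have fx: "f x > 0" using nn[of x] by simp
 define \<rho> where "\<rho> = 1 / sqrt (f x)"
 have \<rho>: "\<rho> > 0" using fx by (simp add: \<rho>_def)
 define A where "A = (%z::real^3. ennreal (1 / (norm z)^2) * indicator {z. norm z < \<rho>} z)"
 define B where "B = (%z::real^3. ennreal (1 / (norm z) ^ 6) * indicator {z. \<rho> <= norm z} z)"
 have Am [measurable]: "A \<in> borel_measurable borel" and Bm [measurable]: "B \<in> borel_measurable borel"
  unfolding A_def B_def by measurable
 have AB[measurable]: "(%y. A (x - y)) \<in> borel_measurable leb" "(%y. B (x - y)) \<in> borel_measurable leb"
  by (rule measurable_compose[OF ident_measurable_lebesgue]; measurable)+
 have I: "nn_integral leb (%y. ennreal (f y powr (3 / 2))) = ennreal I"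
  unfolding I_def by (rule nn_integral_eq_integral[OF int]) simp
 have I0: "I >= 0" unfolding I_def by simp
 have "nn_integral leb (%y. ennreal (f x * f y / (norm (x - y))^2) * indicator {y. f y <= f x} y)
   <= nn_integral leb (%y. ennreal ((f x)^2) * A (x - y) + (ennreal (f x * sqrt (f x)) * ennreal (f y powr (3 / 2)) + B (x - y)))"
 proof (intro nn_integral_mono)
  fix y
  show "ennreal (f x * f y / (norm (x - y))^2) * indicator {y. f y <= f x} y
    <= ennreal ((f x)^2) * A (x - y) + (ennreal (f x * sqrt (f x)) * ennreal (f y powr (3 / 2)) + B (x - y))"
  proof (cases "f y <= f x")
   case fy: True
   show ?thesis
   proof (cases "norm (x - y) < \<rho>")
    case True
    have "f x * f y / (norm (x - y))^2 <= (f x)^2 * (1 / (norm (x - y))^2)"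
     using fy fx by (simp add: power2_eq_square divide_right_mono mult_left_mono)
    then have "ennreal (f x * f y / (norm (x - y))^2) <= ennreal ((f x)^2) * ennreal (1 / (norm (x - y))^2)"
     by (subst ennreal_mult[symmetric]) (auto intro: ennreal_leI)
    also have "... = ennreal ((f x)^2) * A (x - y)" using True by (simp add: A_def)
    finally show ?thesis using fy by (simp add: add_increasing2)
   next
    case False
    \<comment> \<open>The weight sqrt (f x) is chosen so that, after multiplication by f x, the term
      in f y integrates to a multiple of f(x)^(3/2) and f x drops out of the other one.\<close>
    have "f y * (1 / (norm (x - y))^2) <= sqrt (f x) * f y powr (3 / 2) + (1 / (norm (x - y))^2) ^ 3 / (sqrt (f x))^2"
     using fx nn[of y] by (intro Young_three_halves) auto
    then have "f x * (f y * (1 / (norm (x - y))^2)) <= f x * (sqrt (f x) * f y powr (3 / 2) + (1 / (norm (x - y))^2) ^ 3 / (sqrt (f x))^2)"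
     using fx by (intro mult_left_mono) auto
    also have "... = f x * sqrt (f x) * f y powr (3 / 2) + 1 / norm (x - y) ^ 6"
     using fx by (simp add: distrib_left power_divide flip: power_mult)
    finally have "ennreal (f x * f y / (norm (x - y))^2) <= ennreal (f x * sqrt (f x)) * ennreal (f y powr (3 / 2)) + ennreal (1 / norm (x - y) ^ 6)"
     using fx by (simp add: ennreal_mult[symmetric] ennreal_plus[symmetric] del: ennreal_plus)
    also have "ennreal (1 / norm (x - y) ^ 6) = B (x - y)" using False by (simp add: B_def)
    finally show ?thesis using fy by (simp add: add_increasing)
   qed
  qed simp
 qed
 also have "... = ennreal ((f x)^2) * nn_integral leb (%y. A (x - y)) + (ennreal (f x * sqrt (f x)) * ennreal I + nn_integral leb (%y. B (x - y)))"
  by (simp add: nn_integral_add nn_integral_cmult I)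
 also have "nn_integral leb (%y. A (x - y)) = ennreal (4 * pi * \<rho>)"
  unfolding nn_integral_reflect_translate[OF Am] unfolding A_def by (rule nn_integral_inverse_square_ball[OF \<rho>])
 also have "nn_integral leb (%y. B (x - y)) = ennreal (4 * pi / (3 * \<rho> ^ 3))"
  unfolding nn_integral_reflect_translate[OF Bm] unfolding B_def by (rule nn_integral_inverse_sixth_outside[OF \<rho>])
 also have "ennreal ((f x)^2) * ennreal (4 * pi * \<rho>) + (ennreal (f x * sqrt (f x)) * ennreal I + ennreal (4 * pi / (3 * \<rho> ^ 3)))
   = ennreal ((f x)^2 * (4 * pi * \<rho>) + (f x * sqrt (f x) * I + 4 * pi / (3 * \<rho> ^ 3)))"
  using fx I0 \<rho> by (simp add: ennreal_mult[symmetric] ennreal_plus[symmetric] del: ennreal_plus)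
 also have "(f x)^2 * (4 * pi * \<rho>) + (f x * sqrt (f x) * I + 4 * pi / (3 * \<rho> ^ 3)) = (16 * pi / 3 + I) * (f x * sqrt (f x))"
 proof -
  define s where "s = sqrt (f x)"
  have s: "s > 0" "f x = s^2" using fx by (simp_all add: s_def)
  show ?thesis unfolding \<rho>_def s_def[symmetric] unfolding s(2)
   using s(1) by (simp add: field_simps power2_eq_square power3_eq_cube)
 qed
 finally show ?thesis using fx by (simp add: powr_three_halves)
qed (use nn in \<open>auto\<close>)

lemma hls:
 fixes f :: "real^3 => real"
 assumes m [measurable]: "f \<in> borel_measurable leb" and nn: "!!x. 0 <= f x"
  and int: "integrable leb (%x. f x powr (3 / 2))"
 shows "nn_integral leb (%x. nn_integral leb (%y. ennreal (f x * f y / (norm (x - y))^2)))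
   <= ennreal (hls_const (LINT x|leb. f x powr (3 / 2)))"
proof -
 define I where "I = (LINT x|leb. f x powr (3 / 2))"
 have I0: "I >= 0" unfolding I_def by simp
 define F where "F x y = ennreal (f x * f y / (norm (x - y))^2)" for x y
 define J where "J x y = F x y * indicator {y. f y <= f x} y" for x y
 have F2: "(%z. F (fst z) (snd z)) \<in> borel_measurable (leb \<Otimes>\<^sub>M leb)"
 proof -
  have n: "(%z::(real^3) \<times> (real^3). norm (fst z - snd z)) \<in> borel_measurable (leb \<Otimes>\<^sub>M leb)"
   by (intro continuous_pair_measurable continuous_intros)
  note [measurable] = n
  show ?thesis unfolding F_def by measurable
 qed
 have Fm [measurable]: "(%(x, y). F x y) \<in> borel_measurable (leb \<Otimes>\<^sub>M leb)" using F2 by (simp add: case_prod_beta)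
 have Jm [measurable]: "(%(x, y). J x y) \<in> borel_measurable (leb \<Otimes>\<^sub>M leb)"
 proof -
  have "(%(x, y). J x y) = (%z. F (fst z) (snd z) * indicator {z. f (snd z) <= f (fst z)} z)"
   by (auto simp: J_def fun_eq_iff split: split_indicator)
  moreover have "... \<in> borel_measurable (leb \<Otimes>\<^sub>M leb)" using F2 by measurable
  ultimately show ?thesis by simp
 qed
 have J1 [measurable]: "(%y. J x y) \<in> borel_measurable leb" for x using measurable_Pair2[OF Jm, of x] by simp
 have J2 [measurable]: "(%y. J y x) \<in> borel_measurable leb" for x using measurable_Pair1[OF Jm, of x] by simp
 have Js [measurable]: "(%(x, y). J y x) \<in> borel_measurable (leb \<Otimes>\<^sub>M leb)" using measurable_pair_swap[OF Jm] by simp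
 have "nn_integral leb (%x. nn_integral leb (%y. F x y)) <= nn_integral leb (%x. nn_integral leb (%y. J x y + J y x))"
  by (intro nn_integral_mono) (auto simp: J_def F_def norm_minus_commute mult.commute split: split_indicator)
 also have "... = nn_integral leb (%x. nn_integral leb (%y. J x y)) + nn_integral leb (%x. nn_integral leb (%y. J y x))"
  by (simp add: nn_integral_add leb.borel_measurable_nn_integral)
 also have "nn_integral leb (%x. nn_integral leb (%y. J y x)) = nn_integral leb (%x. nn_integral leb (%y. J x y))"
  by (rule leb2.Fubini'[OF Jm])
 also have "nn_integral leb (%x. nn_integral leb (%y. J x y)) <= nn_integral leb (%x. ennreal ((16 * pi / 3 + I) * f x powr (3 / 2)))"
  unfolding J_def F_def I_def by (intro nn_integral_mono hls_inner m nn int)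
 also have "... = ennreal ((16 * pi / 3 + I) * I)" using I0 int unfolding I_def by (subst nn_integral_eq_integral) auto
 finally have "nn_integral leb (%x. nn_integral leb (%y. F x y)) <= ennreal ((16 * pi / 3 + I) * I) + ennreal ((16 * pi / 3 + I) * I)"
  by (simp add: add_mono)
 also have "... = ennreal (hls_const I)" using I0 unfolding hls_const_def
  by (subst ennreal_plus[symmetric]) (auto simp: algebra_simps)
 finally show ?thesis unfolding F_def I_def .
qed

section \<open>The Newton potential as the time integral of the heat kernel\<close>

definition newton_const :: real where
 "newton_const = (1 / (2 * sqrt pi)) ^ 3 * (64 / 3 + 2)"

lemma newton_const_pos: "newton_const > 0" by (simp add: newton_const_def)

lemma exp_minus_le:
 assumes "x > 0"
 shows "exp (- x) <= 2 / (x^2 :: real)"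
proof -
 have "x^2 / 2 <= exp x" using exp_lower_Taylor_quadratic[of x] assms by simp
 then show ?thesis using assms by (simp add: exp_minus field_simps)
qed

text \<open>For small t the bound exp(-x) <= 2/x^2 gives t^(1/2) |z|^(-4), integrable at t = 0; for
  large t the prefactor t^(-3/2) alone is integrable at infinity.\<close>

lemma heat_kernel_bound:
 assumes "t > 0" "z ~= 0"
 shows "heat_kernel t z <= (1 / (2 * sqrt pi)) ^ 3 * (if t <= (norm z)^2 then 32 * sqrt t / (norm z) ^ 4 else 1 / (t * sqrt t))"
proof -
 define s where "s = norm z"
 have s: "s > 0" "z \<bullet> z = s^2" using assms by (auto simp: s_def dot_square_norm)
 have "sqrt t ^ 3 = t * sqrt t" using assms by (simp add: power3_eq_cube)
 then have h: "heat_kernel t z = (1 / (2 * sqrt pi)) ^ 3 * (exp (- (s^2 / (4 * t))) / (t * sqrt t))"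
  unfolding heat_kernel_def s(2) by (simp add: real_sqrt_mult power_mult_distrib power_divide)
 have "exp (- (s^2 / (4 * t))) <= 1" using assms by simp
 then have 1: "exp (- (s^2 / (4 * t))) / (t * sqrt t) <= 1 / (t * sqrt t)" using assms by (intro divide_right_mono) auto
 have "exp (- (s^2 / (4 * t))) <= 2 / (s^2 / (4 * t))^2" using s assms by (intro exp_minus_le) auto
 also have "... = 32 * t^2 / s ^ 4" using s assms by (simp add: power_divide power_mult_distrib flip: power_mult)
 finally have "exp (- (s^2 / (4 * t))) / (t * sqrt t) <= 32 * t^2 / s ^ 4 / (t * sqrt t)"
  using assms by (intro divide_right_mono) auto
 also have "... = 32 * sqrt t / s ^ 4" using s assms by (simp add: field_simps power2_eq_square)
 finally have 2: "exp (- (s^2 / (4 * t))) / (t * sqrt t) <= 32 * sqrt t / s ^ 4" .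
 show ?thesis unfolding h s_def[symmetric] using 1 2 by (intro mult_left_mono) auto
qed

text \<open>The exact value is 1/(4 pi |z|); the two-piece bound, split at t = |z|^2, contributes
  the 64/3 and the 2 in \<open>newton_const\<close>.\<close>

lemma heat_kernel_time_integral:
 assumes "z ~= 0"
 shows "nn_integral lborel (%t. ennreal (heat_kernel t z) * indicator {0<..} t) <= ennreal (newton_const / norm z)"
proof -
 define s where "s = norm z"
 have s: "s > 0" using assms by (auto simp: s_def)
 define c where "c = (1 / (2 * sqrt pi)) ^ 3"
 have c: "c > 0" by (simp add: c_def)
 have "nn_integral lborel (%t. ennreal (heat_kernel t z) * indicator {0<..} t)
   <= nn_integral lborel (%t. ennreal (c * (32 * sqrt t / s ^ 4)) * indicator {0..s^2} t + ennreal (c * (1 / (t * sqrt t))) * indicator {s^2..} t)"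
 proof (intro nn_integral_mono)
  fix t :: real
  show "ennreal (heat_kernel t z) * indicator {0<..} t <= ennreal (c * (32 * sqrt t / s ^ 4)) * indicator {0..s^2} t + ennreal (c * (1 / (t * sqrt t))) * indicator {s^2..} t"
   using heat_kernel_bound[of t z] assms unfolding c_def[symmetric] s_def[symmetric]
   by (cases "t > 0"; cases "t <= s^2") (auto intro!: ennreal_leI add_increasing2 split: split_indicator)
 qed
 also have "... = nn_integral lborel (%t. ennreal (c * (32 * sqrt t / s ^ 4)) * indicator {0..s^2} t) + nn_integral lborel (%t. ennreal (c * (1 / (t * sqrt t))) * indicator {s^2..} t)"
  by (rule nn_integral_add) auto
 also have "nn_integral lborel (%t. ennreal (c * (32 * sqrt t / s ^ 4)) * indicator {0..s^2} t) = ennreal (c * (64 / 3 * (s^2 * sqrt (s^2)) / s ^ 4) - c * (64 / 3 * (0 * sqrt 0) / s ^ 4))"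
 proof (rule nn_integral_FTC_Icc)
  fix t :: real assume "t \<in> {0..s^2}"
  then have "0 <= t" by simp
  \<comment> \<open>The derivative of sqrt is missing at t = 0; there the difference quotient is
    sqrt h itself.\<close>
  have "((%t. t * sqrt t) has_real_derivative 3 / 2 * sqrt t) (at t)"
  proof (cases "t = 0")
   case False
   then show ?thesis using \<open>0 <= t\<close> by (auto intro!: derivative_eq_intros simp: field_simps)
  next
   case True
   have "((%h. sqrt h) \<longlongrightarrow> sqrt 0) (at 0)" by (intro tendsto_intros)
   then have "((%h. sqrt h) \<longlongrightarrow> 0) (at 0)" by simp
   then have "((%h. (h * sqrt h - 0) / (h - 0)) \<longlongrightarrow> 0) (at 0)"
    by (rule Lim_transform_eventually) (auto simp: eventually_at_filter)
   then show ?thesis unfolding True has_field_derivative_iff by simp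
  qed
  then have "((%t. 64 / 3 * c / s ^ 4 * (t * sqrt t)) has_real_derivative 64 / 3 * c / s ^ 4 * (3 / 2 * sqrt t)) (at t)"
   by (rule DERIV_cmult)
  then show "((%t. c * (64 / 3 * (t * sqrt t) / s ^ 4)) has_real_derivative c * (32 * sqrt t / s ^ 4)) (at t)"
   by (simp add: mult_ac)
 qed (use c s in auto)
 also have "nn_integral lborel (%t. ennreal (c * (1 / (t * sqrt t))) * indicator {s^2..} t) = ennreal (0 - (- c * 2 / sqrt (s^2)))"
 proof (rule nn_integral_FTC_atLeast)
  fix t :: real assume "s^2 <= t"
  then have t: "t > 0" using s zero_less_power2[of s] by linarith
  show "((%t. - c * 2 / sqrt t) has_real_derivative c * (1 / (t * sqrt t))) (at t)"
   using t by (auto intro!: derivative_eq_intros simp: field_simps)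
  show "0 <= c * (1 / (t * sqrt t))" using t c by simp
 next
  show "((%t. - c * 2 / sqrt t) \<longlongrightarrow> 0) at_top" by real_asymp
 qed auto
 also have "ennreal (c * (64 / 3 * (s^2 * sqrt (s^2)) / s ^ 4) - c * (64 / 3 * (0 * sqrt 0) / s ^ 4)) + ennreal (0 - (- c * 2 / sqrt (s^2)))
   = ennreal (newton_const / s)"
 proof -
  have "c * (64 / 3 * (s^2 * sqrt (s^2)) / s ^ 4) = c * (64 / 3) / s" using s by (simp add: field_simps power_numeral_reduce)
  then show ?thesis using s c unfolding newton_const_def c_def[symmetric]
   by (subst ennreal_plus[symmetric]) (auto simp: field_simps)
 qed
 finally show ?thesis unfolding s_def .
qed

lemma norm_integral_le_nn_integral:
 fixes f :: "'a => 'b::{banach, second_countable_topology}"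
 shows "ennreal (norm (LINT x|M. f x)) <= nn_integral M (%x. ennreal (norm (f x)))"
 by (cases "integrable M f") (auto intro: integral_norm_bound_ennreal simp: not_integrable_integral_eq)

text \<open>a/b is the integral of a exp(-t b) over t > 0. As an inequality it also covers b = 0,
  where the quotient is 0 by convention.\<close>

lemma quotient_le_Laplace:
 fixes a b :: real
 assumes "0 <= a" "0 <= b"
 shows "ennreal (a / b) <= nn_integral lborel (%t. ennreal (a * exp (- t * b)) * indicator {0<..} t)"
proof (cases "b = 0")
 case False
 then have b: "b > 0" using assms by simp
 have "nn_integral lborel (%t. ennreal (a * exp (- t * b)) * indicator {0..} t) = ennreal (0 - (- (a / b) * exp (- 0 * b)))"
 proof (rule nn_integral_FTC_atLeast)
  show "((%t. - (a / b) * exp (- t * b)) has_real_derivative a * exp (- t * b)) (at t)" for t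
   using b by (auto intro!: derivative_eq_intros)
  show "((%t. - (a / b) * exp (- t * b)) \<longlongrightarrow> 0) at_top" using b by real_asymp
 qed (use assms in auto)
 moreover have "nn_integral lborel (%t. ennreal (a * exp (- t * b)) * indicator {0..} t) = nn_integral lborel (%t. ennreal (a * exp (- t * b)) * indicator {0<..} t)"
  by (intro nn_integral_cong_AE AE_I[where N = "{0}"]) (auto split: split_indicator_asm)
 ultimately show ?thesis by simp
qed simp

lemma heat_kernel_nonneg [simp]: "t >= 0 ==> 0 <= heat_kernel t z" by (simp add: heat_kernel_def)

lemma fourier_gaussian_weight_bound:
 assumes g: "integrable leb g" and t: "t > 0"
 shows "nn_integral leb (%p. ennreal ((cmod (fourier g p))^2 * exp (- t * (p \<bullet> p))))
  <= nn_integral leb (%x. nn_integral leb (%y. ennreal (cmod (g x) * cmod (g y) * heat_kernel t (x - y))))"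
proof -
 note [measurable] = borel_measurable_integrable[OF g]
 note i = heat_identity(2)[OF g g t]
 have c: "cnj (fourier g p) * (fourier g p * of_real (exp (- t * (p \<bullet> p)))) =
   complex_of_real ((cmod (fourier g p))^2 * exp (- t * (p \<bullet> p)))" for p
  unfolding of_real_mult complex_norm_square by (simp add: mult_ac)
 have "integrable leb (%p. cnj (fourier g p) * (fourier g p * of_real (exp (- t * (p \<bullet> p)))))"
 proof (rule Bochner_Integration.integrable_bound)
  let ?C = "ft_const * (LINT x|leb. cmod (g x))"
  show "integrable leb (%p. ?C *\<^sub>R (fourier g p * of_real (exp (- t * (p \<bullet> p)))))" using i by (rule integrable_scaleR_right)
  show "(%p. cnj (fourier g p) * (fourier g p * of_real (exp (- t * (p \<bullet> p))))) \<in> borel_measurable leb"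
   using fourier_measurable[OF g] borel_measurable_integrable[OF i] by measurable
  show "AE p in lebesgue. norm (cnj (fourier g p) * (fourier g p * of_real (exp (- t * (p \<bullet> p)))))
    <= norm (?C *\<^sub>R (fourier g p * of_real (exp (- t * (p \<bullet> p)))))"
  proof (rule AE_I2)
   fix p
   have "cmod (fourier g p) <= \<bar>?C\<bar>" using fourier_bound[OF g, of p] by linarith
   then show "norm (cnj (fourier g p) * (fourier g p * of_real (exp (- t * (p \<bullet> p)))))
    <= norm (?C *\<^sub>R (fourier g p * of_real (exp (- t * (p \<bullet> p)))))"
    unfolding norm_mult[of "cnj _"] norm_scaleR complex_mod_cnj by (rule mult_right_mono) simp
  qed
 qed
 then have ri: "integrable leb (%p. (cmod (fourier g p))^2 * exp (- t * (p \<bullet> p)))" unfolding c complex_of_real_integrable_eq .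
 have "nn_integral leb (%p. ennreal ((cmod (fourier g p))^2 * exp (- t * (p \<bullet> p)))) = ennreal (LINT p|leb. (cmod (fourier g p))^2 * exp (- t * (p \<bullet> p)))"
  by (rule nn_integral_eq_integral[OF ri]) simp
 also have "... <= ennreal (cmod (LINT p|leb. cnj (fourier g p) * (fourier g p * of_real (exp (- t * (p \<bullet> p))))))"
  unfolding c integral_complex_of_real norm_of_real by (rule ennreal_leI) simp
 also have "... = ennreal (cmod (LINT x|leb. cnj (g x) * (LINT y|leb. g y * of_real (heat_kernel t (x - y)))))"
  unfolding heat_identity(1)[OF g g t] ..
 also have "... <= nn_integral leb (%x. ennreal (cmod (cnj (g x) * (LINT y|leb. g y * of_real (heat_kernel t (x - y))))))"
  by (rule norm_integral_le_nn_integral)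
 also have "... <= nn_integral leb (%x. nn_integral leb (%y. ennreal (cmod (g x) * cmod (g y) * heat_kernel t (x - y))))"
 proof (intro nn_integral_mono)
  fix x
  have [measurable]: "(%y. heat_kernel t (x - y)) \<in> borel_measurable leb"
   unfolding heat_kernel_def using t by (intro continuous_measurable_lebesgue continuous_intros) auto
  have "ennreal (cmod (cnj (g x) * (LINT y|leb. g y * of_real (heat_kernel t (x - y)))))
    = ennreal (cmod (g x)) * ennreal (cmod (LINT y|leb. g y * of_real (heat_kernel t (x - y))))"
   by (simp add: norm_mult ennreal_mult)
  also have "... <= ennreal (cmod (g x)) * nn_integral leb (%y. ennreal (cmod (g y * of_real (heat_kernel t (x - y)))))"
   by (intro mult_left_mono norm_integral_le_nn_integral) simp
  also have "... = nn_integral leb (%y. ennreal (cmod (g x)) * ennreal (cmod (g y * of_real (heat_kernel t (x - y)))))"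
   by (rule nn_integral_cmult[symmetric]) measurable
  also have "... = nn_integral leb (%y. ennreal (cmod (g x) * cmod (g y) * heat_kernel t (x - y)))"
   using t by (intro nn_integral_cong) (simp add: norm_mult ennreal_mult mult.assoc)
  finally show "ennreal (cmod (cnj (g x) * (LINT y|leb. g y * of_real (heat_kernel t (x - y))))) <= ..." .
 qed
 finally show ?thesis .
qed

text \<open>1/|p|^2 is the time integral of exp(-t |p|^2), and the heat kernel integrates to a
  Newton potential. All integrands are nonnegative, so Tonelli applies before finiteness is
  known.\<close>

lemma fourier_newton_bound:
 assumes g: "integrable leb g"
 shows "nn_integral leb (%p. ennreal ((cmod (fourier g p))^2 / (norm p)^2))
  <= nn_integral leb (%x. nn_integral leb (%y. ennreal (cmod (g x) * cmod (g y) * (newton_const / norm (x - y)))))"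
proof -
 note [measurable] = borel_measurable_integrable[OF g] fourier_measurable[OF g]
 let ?N = "leb \<Otimes>\<^sub>M leb :: ((real^3) \<times> (real^3)) measure"
 interpret N: sigma_finite_measure ?N by (rule sigma_finite_pair_measure) unfold_locales
 interpret tN: pair_sigma_finite "lborel :: real measure" ?N ..
 interpret pt: pair_sigma_finite "leb :: (real^3) measure" "lborel :: real measure" ..
 have nm [measurable]: "(%p::real^3. p \<bullet> p) \<in> borel_measurable leb" by (intro continuous_measurable_lebesgue continuous_intros)
 have dm [measurable]: "(%z. fst z - snd z) \<in> borel_measurable ?N" by (intro continuous_pair_measurable continuous_intros)
 let ?F = "%(p, t). ennreal ((cmod (fourier g p))^2 * exp (- t * (p \<bullet> p))) * indicator {0<..} t"
 have Fm [measurable]: "?F \<in> borel_measurable (leb \<Otimes>\<^sub>M lborel)" unfolding case_prod_beta by measurable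
 let ?H = "%(t, z). ennreal (cmod (g (fst z)) * cmod (g (snd z)) * heat_kernel t (fst z - snd z)) * indicator {0<..} t"
 have Hm [measurable]: "?H \<in> borel_measurable (lborel \<Otimes>\<^sub>M ?N)" unfolding case_prod_beta heat_kernel_def by measurable
 have zm: "(%(x, y). ennreal (cmod (g x) * cmod (g y) * heat_kernel t (x - y))) \<in> borel_measurable ?N" for t
  unfolding case_prod_beta heat_kernel_def by measurable
 have nem: "(%(x, y). ennreal (cmod (g x) * cmod (g y) * (newton_const / norm (x - y)))) \<in> borel_measurable ?N"
  unfolding case_prod_beta by measurable
 have "nn_integral leb (%p. ennreal ((cmod (fourier g p))^2 / (norm p)^2)) <= nn_integral leb (%p. nn_integral lborel (%t. ?F (p, t)))"
  using quotient_le_Laplace by (intro nn_integral_mono) (simp add: dot_square_norm)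
 also have "... = nn_integral lborel (%t. nn_integral leb (%p. ?F (p, t)))"
  unfolding prod.case by (rule pt.Fubini'[OF Fm, symmetric])
 also have "... <= nn_integral lborel (%t. nn_integral ?N (%z. ?H (t, z)))"
 proof (intro nn_integral_mono)
  fix t :: real
  show "nn_integral leb (%p. ?F (p, t)) <= nn_integral ?N (%z. ?H (t, z))"
  proof (cases "t > 0")
   case True
   have "nn_integral leb (%p. ?F (p, t)) <= nn_integral leb (%x. nn_integral leb (%y. ennreal (cmod (g x) * cmod (g y) * heat_kernel t (x - y))))"
    using fourier_gaussian_weight_bound[OF g True] True by simp
   also have "... = nn_integral ?N (%z. (%(x, y). ennreal (cmod (g x) * cmod (g y) * heat_kernel t (x - y))) z)"
    using leb.nn_integral_fst[OF zm[of t]] by simp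
   also have "... = nn_integral ?N (%z. ?H (t, z))" using True by (simp add: case_prod_beta)
   finally show ?thesis .
  qed simp
 qed
 also have "... = nn_integral ?N (%z. nn_integral lborel (%t. ?H (t, z)))"
  unfolding prod.case by (rule tN.Fubini'[OF Hm, symmetric])
 also have "... <= nn_integral ?N (%z. (%(x, y). ennreal (cmod (g x) * cmod (g y) * (newton_const / norm (x - y)))) z)"
 proof (rule nn_integral_mono_AE)
  \<comment> \<open>\<open>heat_kernel_time_integral\<close> excludes the diagonal, which is a null
    set of the product.\<close>
  have ne: "AE z in ?N. fst z ~= snd z"
  proof (rule leb2.AE_pair_measure)
   have "{z \<in> space ?N. fst z ~= snd z} = {z \<in> space ?N. fst z - snd z ~= 0}" by auto
   also have "... \<in> sets ?N" by measurable
   finally show "{z \<in> space ?N. fst z ~= snd z} \<in> sets ?N" .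
   show "AE x in lebesgue. AE y in lebesgue. fst (x :: real^3, y) ~= snd (x, y)"
   proof (rule AE_I2)
    fix x :: "real^3"
    have "AE y in lborel. y ~= x" by (rule AE_lborel_singleton)
    then have "AE y in lebesgue. y ~= x" by (rule AE_completion)
    then show "AE y in lebesgue. fst (x, y) ~= snd (x, y)" by eventually_elim auto
   qed
  qed
  show "AE z in ?N. nn_integral lborel (%t. ?H (t, z)) <= (%(x, y). ennreal (cmod (g x) * cmod (g y) * (newton_const / norm (x - y)))) z"
   using ne
  proof eventually_elim
   case (elim z)
   have hm: "(%t. ennreal (heat_kernel t (fst z - snd z)) * indicator {0<..} t) \<in> borel_measurable lborel"
    unfolding heat_kernel_def by measurable
   have "nn_integral lborel (%t. ?H (t, z)) = nn_integral lborel (%t. ennreal (cmod (g (fst z)) * cmod (g (snd z))) * (ennreal (heat_kernel t (fst z - snd z)) * indicator {0<..} t))"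
    by (intro nn_integral_cong) (auto simp: ennreal_mult mult.assoc split: split_indicator)
   also have "... = ennreal (cmod (g (fst z)) * cmod (g (snd z))) * nn_integral lborel (%t. ennreal (heat_kernel t (fst z - snd z)) * indicator {0<..} t)"
    by (rule nn_integral_cmult[OF hm])
   also have "... <= ennreal (cmod (g (fst z)) * cmod (g (snd z))) * ennreal (newton_const / norm (fst z - snd z))"
    using elim by (intro mult_left_mono heat_kernel_time_integral) auto
   also have "... = ennreal (cmod (g (fst z)) * cmod (g (snd z)) * (newton_const / norm (fst z - snd z)))"
    using newton_const_pos by (intro ennreal_mult[symmetric]) auto
   finally show ?case by (simp only: case_prod_beta)
  qed
 qed
 also have "... = nn_integral leb (%x. nn_integral leb (%y. ennreal (cmod (g x) * cmod (g y) * (newton_const / norm (x - y)))))"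
  using leb.nn_integral_fst[OF nem] by simp
 finally show ?thesis .
qed

section \<open>Bounds on |V|^(1/2) relative to the gradient, by duality\<close>

locale potential =
 fixes V :: "real^3 => real"
 assumes V_integrable: "integrable leb V"
  and V_integrable_32: "integrable leb (%x. \<bar>V x\<bar> powr (3 / 2))"
begin

lemma V_measurable [measurable]: "V \<in> borel_measurable leb" using V_integrable by auto

definition X :: "real^3 => real" where "X x = sqrt \<bar>V x\<bar>"

lemma X_measurable [measurable]: "X \<in> borel_measurable leb" unfolding X_def[abs_def] by measurable

lemma X_nonneg [simp]: "0 <= X x" by (simp add: X_def)

lemma X_square: "(X x)^2 = \<bar>V x\<bar>" "X x * X x = \<bar>V x\<bar>" by (simp_all add: X_def)

definition mulX :: "(real^3 => complex) => real^3 => complex" where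
 "mulX w x = of_real (X x) * w x"

definition V_norm :: real where "V_norm = sqrt (LINT x|leb. \<bar>V x\<bar>)"

lemma V_norm_nonneg [simp]: "0 <= V_norm" by (simp add: V_norm_def)

lemma X_L2: "(%x. of_real (X x)) \<in> H" "nH (%x. of_real (X x)) = V_norm"
proof -
 show "(%x. of_real (X x)) \<in> H" by (rule L2_spaceI[of _ _ "%x. \<bar>V x\<bar>"]) (use V_integrable in \<open>auto simp: X_square\<close>)
 show "nH (%x. of_real (X x)) = V_norm" by (simp add: L2_norm_def V_norm_def X_square)
qed

text \<open>|V|^(1/2) is in L2 because V is integrable, so this is Cauchy--Schwarz. It makes the
  transform of \<open>mulX w\<close> continuous, hence defined on the Fermi sphere.\<close>

lemma mulX_integrable:
 assumes w: "w \<in> H"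
 shows "integrable leb (mulX w)" "(LINT x|leb. cmod (mulX w x)) <= V_norm * nH w"
proof -
 show "integrable leb (mulX w)" using L2_inner_integrable[OF X_L2(1) w] by (simp add: mulX_def[abs_def])
 have aw: "(%x. complex_of_real (cmod (w x))) \<in> H" using w by (auto simp: L2_space_def)
 have "(LINT x|leb. cmod (mulX w x)) <= cmod (of_real (LINT x|leb. cmod (mulX w x)))" by simp
 also have "complex_of_real (LINT x|leb. cmod (mulX w x)) = iH (%x. of_real (X x)) (%x. of_real (cmod (w x)))"
  unfolding L2_inner_def by (subst integral_complex_of_real[symmetric]) (simp add: mulX_def norm_mult)
 also have "cmod ... <= V_norm * nH w" using L2_Cauchy_Schwarz[OF X_L2(1) aw] by (simp add: X_L2(2)) (simp add: L2_norm_def)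
 finally show "(LINT x|leb. cmod (mulX w x)) <= V_norm * nH w" .
qed

lemma mulX_measurable: "w \<in> borel_measurable leb ==> mulX w \<in> borel_measurable leb" unfolding mulX_def[abs_def]
 by (intro borel_measurable_times borel_measurable_continuous_on[OF continuous_on_of_real[OF continuous_on_id] X_measurable])

lemma mulX_lincomb: "mulX (%x. c * w x + v x) = (%x. c * mulX w x + mulX v x)" by (auto simp: mulX_def algebra_simps)

definition I32 :: real where "I32 = (LINT x|leb. \<bar>V x\<bar> powr (3 / 2))"

text \<open>A predicate and not a fixed constant, because \<open>large_T_nonneg\<close> uses it with
  a prescribed small K for the unbounded part of V.\<close>

definition sobolev_bound :: "real => bool" where
 "sobolev_bound K \<longleftrightarrow> 0 < K & newton_const^2 * hls_const I32 <= K^2"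

lemma sobolev_bound_exists: "EX K. sobolev_bound K"
proof -
 have "0 <= I32" by (simp add: I32_def)
 then have h: "0 <= hls_const I32" by (simp add: hls_const_def)
 let ?K = "1 + newton_const^2 * hls_const I32"
 have 1: "1 <= ?K" using h by simp
 have "newton_const^2 * hls_const I32 <= ?K" by simp
 also have "?K <= ?K^2" using 1 by (rule self_le_power) simp
 finally have "sobolev_bound ?K" using 1 by (simp add: sobolev_bound_def)
 then show ?thesis by blast
qed

text \<open>The kernel |V(x)|^(1/2) |V(y)|^(1/2) / |x - y| has finite Hilbert--Schmidt norm by
  \<open>hls\<close>.\<close>

lemma Hilbert_Schmidt_bound:
 assumes K: "sobolev_bound K" and w: "w \<in> H" "nH w > 0"
 shows "nn_integral leb (%x. nn_integral leb (%y. ennreal (cmod (mulX w x) * cmod (mulX w y) * (newton_const / norm (x - y)))))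
  <= ennreal (K * (nH w)^2)"
proof -
 define n where "n = nH w"
 have n: "n > 0" using w by (simp add: n_def)
 have K0: "K > 0" and K2: "newton_const^2 * hls_const I32 <= K^2" using K by (auto simp: sobolev_bound_def)
 \<comment> \<open>\<theta> balances the two terms of 2 a b <= a^2/\<theta> + \<theta> b^2, so that
   each contributes K n^2/2.\<close>
 define \<theta> where "\<theta> = n^2 / K"
 have \<theta>: "\<theta> > 0" using n K0 by (simp add: \<theta>_def)
 note [measurable] = L2_measurable[OF w(1)]
 have dm: "(%y::real^3. norm (x - y)) \<in> borel_measurable leb" for x by (intro continuous_measurable_lebesgue continuous_intros)
 note [measurable] = dm
 have pm: "(%z::(real^3)\<times>(real^3). norm (fst z - snd z)) \<in> borel_measurable (leb \<Otimes>\<^sub>M leb)"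
  by (intro continuous_pair_measurable continuous_intros)
 note [measurable] = pm
 let ?A = "%x y. ennreal (1 / (2 * \<theta>)) * (ennreal ((cmod (w x))^2) * ennreal ((cmod (w y))^2))"
 let ?B = "%x y. ennreal (\<theta> / 2 * newton_const^2) * ennreal (\<bar>V x\<bar> * \<bar>V y\<bar> / (norm (x - y))^2)"
 have Bm: "(%(x, y). ?B x y) \<in> borel_measurable (leb \<Otimes>\<^sub>M leb)" unfolding case_prod_beta by measurable
 have hm: "(%(x, y). ennreal (\<bar>V x\<bar> * \<bar>V y\<bar> / (norm (x - y))^2)) \<in> borel_measurable (leb \<Otimes>\<^sub>M leb)"
  unfolding case_prod_beta by measurable
 have "nn_integral leb (%x. nn_integral leb (%y. ennreal (cmod (mulX w x) * cmod (mulX w y) * (newton_const / norm (x - y)))))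
   <= nn_integral leb (%x. nn_integral leb (%y. ?A x y + ?B x y))"
 proof (intro nn_integral_mono)
  fix x y
  define a where "a = cmod (w x) * cmod (w y)"
  define k where "k = X x * X y * (newton_const / norm (x - y))"
  have "2 * (a * (\<theta> * k)) <= a^2 + (\<theta> * k)^2" using sum_squares_bound[of a "\<theta> * k"] by (simp add: mult.assoc)
  then have "a * k <= 1 / (2 * \<theta>) * a^2 + \<theta> / 2 * k^2" using \<theta> by (simp add: field_simps power2_eq_square)
  also have "1 / (2 * \<theta>) * a^2 + \<theta> / 2 * k^2 = 1 / (2 * \<theta>) * ((cmod (w x))^2 * (cmod (w y))^2) + \<theta> / 2 * newton_const^2 * (\<bar>V x\<bar> * \<bar>V y\<bar> / (norm (x - y))^2)"
   by (simp add: a_def k_def power_mult_distrib power_divide X_square)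
  finally have "ennreal (a * k) <= ?A x y + ?B x y"
   using \<theta> by (simp add: ennreal_mult[symmetric] ennreal_plus[symmetric] ennreal_leI del: ennreal_plus)
  moreover have "cmod (mulX w x) * cmod (mulX w y) * (newton_const / norm (x - y)) = a * k"
   by (simp add: mulX_def norm_mult a_def k_def)
  ultimately show "ennreal (cmod (mulX w x) * cmod (mulX w y) * (newton_const / norm (x - y))) <= ?A x y + ?B x y" by simp
 qed
 also have "... = nn_integral leb (%x. nn_integral leb (%y. ?A x y)) + nn_integral leb (%x. nn_integral leb (%y. ?B x y))"
 proof -
  have "nn_integral leb (%y. ?A x y + ?B x y) = nn_integral leb (%y. ?A x y) + nn_integral leb (%y. ?B x y)" for x
   by (rule nn_integral_add) measurable
  moreover have "(%x. nn_integral leb (%y. ?B x y)) \<in> borel_measurable leb"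
   using leb.borel_measurable_nn_integral[OF Bm] by simp
  moreover have "(%x. nn_integral leb (%y. ?A x y)) \<in> borel_measurable leb"
   by (rule leb.borel_measurable_nn_integral) measurable
  ultimately show ?thesis by (simp add: nn_integral_add)
 qed
 also have "nn_integral leb (%x. nn_integral leb (%y. ?A x y)) = ennreal (K * n^2 / 2)"
 proof -
  have "nn_integral leb (%y. ?A x y) = ennreal (1 / (2 * \<theta>) * n^2) * ennreal ((cmod (w x))^2)" for x
  proof -
   have "nn_integral leb (%y. ?A x y) = (ennreal (1 / (2 * \<theta>)) * ennreal ((cmod (w x))^2)) * nn_integral leb (%y. ennreal ((cmod (w y))^2))"
    by (subst nn_integral_cmult[symmetric]) (simp_all add: mult.assoc)
   also have "... = ennreal (1 / (2 * \<theta>) * n^2) * ennreal ((cmod (w x))^2)"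
   proof -
    have "ennreal (1 / (2 * \<theta>) * n^2) = ennreal (1 / (2 * \<theta>)) * ennreal (n^2)" using \<theta> by (intro ennreal_mult) auto
    then show ?thesis unfolding L2_norm_ennreal[OF w(1)] n_def by (simp only: mult_ac)
   qed
   finally show ?thesis .
  qed
  then have "nn_integral leb (%x. nn_integral leb (%y. ?A x y)) = ennreal (1 / (2 * \<theta>) * n^2) * ennreal (n^2)"
   using L2_norm_ennreal[OF w(1)] by (simp add: nn_integral_cmult n_def)
  also have "... = ennreal (1 / (2 * \<theta>) * n^2 * n^2)" using \<theta> by (subst ennreal_mult) auto
  also have "1 / (2 * \<theta>) * n^2 * n^2 = K * n^2 / 2" using n K0 by (simp add: \<theta>_def)
  finally show ?thesis .
 qed
 also have "nn_integral leb (%x. nn_integral leb (%y. ?B x y)) <= ennreal (K * n^2 / 2)"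
 proof -
  have "nn_integral leb (%y. ?B x y) = ennreal (\<theta> / 2 * newton_const^2) * nn_integral leb (%y. ennreal (\<bar>V x\<bar> * \<bar>V y\<bar> / (norm (x - y))^2))" for x
   by (rule nn_integral_cmult) measurable
  then have "nn_integral leb (%x. nn_integral leb (%y. ?B x y)) = ennreal (\<theta> / 2 * newton_const^2) * nn_integral leb (%x. nn_integral leb (%y. ennreal (\<bar>V x\<bar> * \<bar>V y\<bar> / (norm (x - y))^2)))"
   using leb.borel_measurable_nn_integral[OF hm] by (simp add: nn_integral_cmult)
  also have "... <= ennreal (\<theta> / 2 * newton_const^2) * ennreal (hls_const I32)"
   unfolding I32_def by (intro mult_left_mono hls) (use V_integrable_32 in auto)
  also have "... = ennreal (\<theta> / 2 * newton_const^2 * hls_const I32)" using \<theta> by (subst ennreal_mult') auto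
  also have "... <= ennreal (\<theta> / 2 * K^2)"
   using mult_left_mono[OF K2, of "\<theta> / 2"] \<theta> by (intro ennreal_leI) (simp add: mult.assoc)
  also have "\<theta> / 2 * K^2 = K * n^2 / 2" using K0 by (simp add: \<theta>_def power2_eq_square)
  finally show ?thesis .
 qed
 also have "ennreal (K * n^2 / 2) + ennreal (K * n^2 / 2) = ennreal (K * n^2)" using K0 by (subst ennreal_plus[symmetric]) auto
 finally show ?thesis by (simp add: n_def add_mono)
qed

text \<open>The vector (-Laplacian)^(-1/2) |V|^(1/2) w in momentum space, with the value 0 at p = 0:
  the adjoint of the map that \<open>sobolev\<close> bounds.\<close>

definition Gw :: "(real^3 => complex) => real^3 => complex" where
 "Gw w p = fourier (mulX w) p / of_real (norm p)"

lemma Gw_L2: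
 assumes K: "sobolev_bound K" and w: "w \<in> H"
 shows "Gw w \<in> H" "(nH (Gw w))^2 <= K * (nH w)^2"
proof -
 have K0: "K > 0" using K by (auto simp: sobolev_bound_def)
 note [measurable] = L2_measurable[OF w] fourier_measurable[OF mulX_integrable(1)[OF w]]
 have [measurable]: "(%p::real^3. norm p) \<in> borel_measurable leb" by (intro continuous_measurable_lebesgue continuous_intros)
 have m: "Gw w \<in> borel_measurable leb" unfolding Gw_def[abs_def] by measurable
 have e: "(cmod (Gw w p))^2 = (cmod (fourier (mulX w) p))^2 / (norm p)^2" for p by (simp add: Gw_def norm_divide power_divide)
 have "nn_integral leb (%p. ennreal ((cmod (Gw w p))^2)) <= ennreal (K * (nH w)^2)"
 proof (cases "nH w = 0")
  case True
  then have "AE x in lebesgue. w x = 0" using L2_norm_eq_0[OF w] by simp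
  then have "AE x in lebesgue. mulX w x = (%x. 0) x" by eventually_elim (simp add: mulX_def)
  then have "fourier (mulX w) = fourier (%x. 0)" by (rule fourier_cong_AE) (auto intro: mulX_measurable)
  then have "fourier (mulX w) p = 0" for p by (simp add: fourier_eq)
  then show ?thesis by (simp add: e)
 next
  case False
  then have "nH w > 0" using L2_norm_nonneg[of leb w] by linarith
  from order_trans[OF fourier_newton_bound[OF mulX_integrable(1)[OF w]] Hilbert_Schmidt_bound[OF K w this]]
  show ?thesis unfolding e .
 qed
 also have "K * (nH w)^2 = (sqrt (K * (nH w)^2))^2" using K0 by simp
 finally have le: "nn_integral leb (%p. ennreal ((cmod (Gw w p))^2)) <= ennreal ((sqrt (K * (nH w)^2))^2)" .
 show "Gw w \<in> H" by (rule L2_nn_integralI(1)[OF m le]) (use K0 in simp)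
 have "nH (Gw w) <= sqrt (K * (nH w)^2)" by (rule L2_nn_integralI(2)[OF m le]) (use K0 in simp)
 then have "(nH (Gw w))^2 <= (sqrt (K * (nH w)^2))^2" by (rule power_mono) simp
 then show "(nH (Gw w))^2 <= K * (nH w)^2" using K0 by simp
qed

text \<open>Bounding |x|, |w| and |V|^(1/2) at once makes |V|^(1/2) times the cut-off bounded with
  bounded support, so that \<open>L2_fourier_inner\<close> applies to it.\<close>

definition cut :: "nat => (real^3 => complex) => real^3 => complex" where
 "cut n w x = (if norm x <= real n & cmod (w x) <= real n & X x <= real n then w x else 0)"

lemma cut_props:
 assumes w: "w \<in> borel_measurable leb"
 shows "cut n w \<in> H" "mulX (cut n w) \<in> H" "integrable leb (mulX (cut n w))"
  and "cmod (cut n w x) <= cmod (w x)" "(%n. cut n w x) \<longlonglongrightarrow> w x"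
proof -
 note [measurable] = w
 have [measurable]: "(%p::real^3. norm p) \<in> borel_measurable leb" by (intro continuous_measurable_lebesgue continuous_intros)
 have m: "cut n w \<in> borel_measurable leb" unfolding cut_def[abs_def] by measurable
 show "cut n w \<in> H" by (rule bounded_support_L2(2)[OF m, where B = "real n" and R = "real n"]) (auto simp: cut_def)
 have b: "cmod (mulX (cut n w) x) <= real n * real n" for x by (auto simp: cut_def mulX_def norm_mult intro!: mult_mono)
 have s: "real n < norm x ==> mulX (cut n w) x = 0" for x by (auto simp: cut_def mulX_def)
 show "mulX (cut n w) \<in> H" by (rule bounded_support_L2(2)[OF mulX_measurable[OF m] b]) (use s in blast)
 show "integrable leb (mulX (cut n w))" by (rule bounded_support_L2(1)[OF mulX_measurable[OF m] b]) (use s in blast)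
 show "cmod (cut n w x) <= cmod (w x)" by (simp add: cut_def)
 have "\<forall>\<^sub>F n in sequentially. cut n w x = w x" using eventually_ge_at_top[of "nat \<lceil>max (norm x) (max (cmod (w x)) (X x))\<rceil>"]
 proof eventually_elim
  case (elim n)
  then have "max (norm x) (max (cmod (w x)) (X x)) <= real n" by linarith
  then show ?case by (simp add: cut_def)
 qed
 then show "(%n. cut n w x) \<longlonglongrightarrow> w x" by (rule tendsto_eventually)
qed

lemma cut_tendsto:
 assumes w: "w \<in> H"
 shows "(%n. nH (%x. cut n w x - w x)) \<longlonglongrightarrow> 0"
proof -
 note wm [measurable] = L2_measurable[OF w]
 note [measurable] = L2_measurable[OF cut_props(1)[OF wm]]
 have "(%n. LINT x|leb. (cmod (cut n w x - w x))^2) \<longlonglongrightarrow> (LINT x|leb. 0)"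
 proof (rule integral_dominated_convergence[OF _ _ L2_square_integrable[OF w]])
  show "AE x in lebesgue. (%n. (cmod (cut n w x - w x))^2) \<longlonglongrightarrow> 0"
  proof (rule AE_I2)
   fix x
   have "(%n. (cmod (cut n w x - w x))^2) \<longlonglongrightarrow> (cmod (w x - w x))^2" by (intro tendsto_intros cut_props(5)[OF wm])
   then show "(%n. (cmod (cut n w x - w x))^2) \<longlonglongrightarrow> 0" by simp
  qed
  show "(%x. (cmod (cut n w x - w x))^2) \<in> borel_measurable leb" for n by measurable
  show "AE x in lebesgue. norm ((cmod (cut n w x - w x))^2) <= (cmod (w x))^2" for n by (simp add: cut_def)
 qed simp
 then have "(%n. sqrt (LINT x|leb. (cmod (cut n w x - w x))^2)) \<longlonglongrightarrow> sqrt 0" by (intro tendsto_intros) simp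
 then show ?thesis by (simp add: L2_norm_def)
qed

definition mulP :: "(real^3 => complex) => real^3 => complex" where
 "mulP \<phi> p = of_real (norm p) * \<phi> p"

lemma AE_nonzero: "AE p in leb. p ~= 0" by (rule AE_completion[OF AE_lborel_singleton])

lemma pairing_weight:
 assumes \<phi>: "\<phi> \<in> borel_measurable leb" and w: "w \<in> H"
 shows "iH \<phi> (fourier (mulX w)) = iH (mulP \<phi>) (Gw w)"
proof -
 note [measurable] = \<phi> L2_measurable[OF w] fourier_measurable[OF mulX_integrable(1)[OF w]]
 have [measurable]: "(%p::real^3. norm p) \<in> borel_measurable leb" by (intro continuous_measurable_lebesgue continuous_intros)
 show ?thesis unfolding L2_inner_def
 proof (rule integral_cong_AE)
  show "AE p in lebesgue. cnj (\<phi> p) * fourier (mulX w) p = cnj (mulP \<phi> p) * Gw w p"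
   using AE_nonzero by eventually_elim (simp add: mulP_def Gw_def)
  show "(%p. cnj (mulP \<phi> p) * Gw w p) \<in> borel_measurable leb" unfolding mulP_def Gw_def by measurable
 qed measurable
qed

lemma pairing_bounded:
 assumes p: "L2_fourier \<psi> \<phi>" and w: "w \<in> borel_measurable leb"
 shows "iH (mulX \<psi>) (cut n w) = iH (mulP \<phi>) (Gw (cut n w))"
proof -
 have \<phi>: "\<phi> \<in> borel_measurable leb" using p by (auto simp: L2_fourier_def L2_space_def)
 have "iH (mulX \<psi>) (cut n w) = iH \<psi> (mulX (cut n w))"
  unfolding L2_inner_def by (intro Bochner_Integration.integral_cong refl) (simp add: mulX_def)
 also have "... = iH \<phi> (fourier (mulX (cut n w)))" by (rule L2_fourier_inner[OF p cut_props(3,2)[OF w]])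
 finally show ?thesis using pairing_weight[OF \<phi> cut_props(1)[OF w]] by simp
qed

text \<open>Paired with its own cut-off c, |V|^(1/2) \<psi> gives that the squared norm of c is at
  most the product of the norms of \<open>mulP \<phi>\<close> and \<open>Gw c\<close>;
  \<open>Gw_L2\<close> lets one factor of the norm of c be divided out. Fatou's lemma removes the
  cut-off.\<close>

lemma sobolev:
 assumes K: "sobolev_bound K" and p: "L2_fourier \<psi> \<phi>" and P: "mulP \<phi> \<in> H"
 shows "mulX \<psi> \<in> H" "(nH (mulX \<psi>))^2 <= K * (nH (mulP \<phi>))^2"
proof -
 have K0: "K > 0" using K by (auto simp: sobolev_bound_def)
 have \<psi>: "\<psi> \<in> borel_measurable leb" using p by (auto simp: L2_fourier_def L2_space_def)
 note m = mulX_measurable[OF \<psi>]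
 let ?c = "%n. cut n (mulX \<psi>)"
 note c = cut_props[OF m]
 have b: "(nH (?c n))^2 <= K * (nH (mulP \<phi>))^2" for n
 proof -
  have "complex_of_real ((nH (?c n))^2) = iH (mulX \<psi>) (?c n)" unfolding L2_inner_self[symmetric] L2_inner_def
   by (intro Bochner_Integration.integral_cong refl) (simp add: cut_def)
  also have "... = iH (mulP \<phi>) (Gw (?c n))" by (rule pairing_bounded[OF p m])
  finally have "(nH (?c n))^2 = cmod (iH (mulP \<phi>) (Gw (?c n)))" by (metis abs_power2 norm_of_real)
  also have "... <= nH (mulP \<phi>) * nH (Gw (?c n))" by (rule L2_Cauchy_Schwarz[OF P Gw_L2(1)[OF K c(1)]])
  finally have "((nH (?c n))^2)^2 <= (nH (mulP \<phi>) * nH (Gw (?c n)))^2" by (rule power_mono) simp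
  also have "... = (nH (mulP \<phi>))^2 * (nH (Gw (?c n)))^2" by (rule power_mult_distrib)
  also have "... <= (nH (mulP \<phi>))^2 * (K * (nH (?c n))^2)" by (intro mult_left_mono Gw_L2[OF K c(1)]) simp
  finally have "(nH (?c n))^2 * (nH (?c n))^2 <= (K * (nH (mulP \<phi>))^2) * (nH (?c n))^2" by (simp add: power2_eq_square mult_ac)
  from mult_right_le_imp_le[OF this] show ?thesis using K0 by (cases "nH (?c n) = 0") simp_all
 qed
 define B where "B = sqrt (K * (nH (mulP \<phi>))^2)"
 have B: "B >= 0" "B^2 = K * (nH (mulP \<phi>))^2" using K0 by (auto simp: B_def)
 note [measurable] = L2_measurable[OF c(1)]
 have "nn_integral leb (%x. ennreal ((cmod (mulX \<psi> x))^2)) = nn_integral leb (%x. liminf (%n. ennreal ((cmod (?c n x))^2)))"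
 proof (intro nn_integral_cong)
  fix x
  have "(%n. ennreal ((cmod (?c n x))^2)) \<longlonglongrightarrow> ennreal ((cmod (mulX \<psi> x))^2)" by (intro tendsto_intros c(5))
  from lim_imp_Liminf[OF trivial_limit_sequentially this]
  show "ennreal ((cmod (mulX \<psi> x))^2) = liminf (%n. ennreal ((cmod (?c n x))^2))" by (rule sym)
 qed
 also have "... <= liminf (%n. nn_integral leb (%x. ennreal ((cmod (?c n x))^2)))" by (rule nn_integral_liminf) measurable
 also have "... <= liminf (%n::nat. ennreal (B^2))"
  unfolding L2_norm_ennreal[OF c(1)] B(2) by (intro Liminf_mono always_eventually allI ennreal_leI b)
 also have "... = ennreal (B^2)" by (simp add: Liminf_const)
 finally have le: "nn_integral leb (%x. ennreal ((cmod (mulX \<psi> x))^2)) <= ennreal (B^2)" .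
 show "mulX \<psi> \<in> H" by (rule L2_nn_integralI(1)[OF m le B(1)])
 have "nH (mulX \<psi>) <= B" by (rule L2_nn_integralI(2)[OF m le B(1)])
 then show "(nH (mulX \<psi>))^2 <= K * (nH (mulP \<phi>))^2" unfolding B(2)[symmetric] by (rule power_mono) simp
qed

lemma Gw_diff:
 assumes "w \<in> H" "v \<in> H"
 shows "Gw (%x. w x - v x) = (%p. Gw w p - Gw v p)"
proof -
 have "mulX (%x. w x - v x) = (%x. mulX w x - mulX v x)" by (auto simp: mulX_def algebra_simps)
 then show ?thesis using fourier_diff[OF mulX_integrable(1)[OF assms(1)] mulX_integrable(1)[OF assms(2)]]
  by (auto simp: Gw_def diff_divide_distrib)
qed

text \<open>By continuity from cut-offs of w: the left side is continuous because
  \<open>sobolev\<close> has put |V|^(1/2) \<psi> into L2, the right side because it is a pairing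
  with \<open>Gw\<close>.\<close>

lemma pairing:
 assumes p: "L2_fourier \<psi> \<phi>" and P: "mulP \<phi> \<in> H" and w: "w \<in> H"
 shows "iH (mulX \<psi>) w = iH \<phi> (fourier (mulX w))"
proof -
 obtain K where K: "sobolev_bound K" using sobolev_bound_exists by blast
 have K0: "K > 0" using K by (auto simp: sobolev_bound_def)
 have \<phi>: "\<phi> \<in> borel_measurable leb" using p by (auto simp: L2_fourier_def L2_space_def)
 note wm = L2_measurable[OF w]
 note c = cut_props[OF wm]
 note G = Gw_L2[OF K]
 have S: "mulX \<psi> \<in> H" by (rule sobolev(1)[OF K p P])
 have "(%n. nH (%p. Gw (cut n w) p - Gw w p)) \<longlonglongrightarrow> 0"
 proof (rule Lim_null_comparison[OF always_eventually tendsto_mult_right_zero[OF cut_tendsto[OF w], of "sqrt K"]])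
  show "ALL n. norm (nH (%p. Gw (cut n w) p - Gw w p)) <= sqrt K * nH (%x. cut n w x - w x)"
  proof
   fix n
   have "(nH (%p. Gw (cut n w) p - Gw w p))^2 <= K * (nH (%x. cut n w x - w x))^2"
    using G(2)[OF L2_diff[OF c(1)[of n] w]] unfolding Gw_diff[OF c(1) w] .
   then have "nH (%p. Gw (cut n w) p - Gw w p) <= sqrt (K * (nH (%x. cut n w x - w x))^2)" by (rule real_le_rsqrt)
   then show "norm (nH (%p. Gw (cut n w) p - Gw w p)) <= sqrt K * nH (%x. cut n w x - w x)" by (simp add: real_sqrt_mult)
  qed
 qed
 from L2_inner_tendsto_left[OF G(1)[OF c(1)] G(1)[OF w] P this]
 have "(%n. cnj (iH (Gw (cut n w)) (mulP \<phi>))) \<longlonglongrightarrow> cnj (iH (Gw w) (mulP \<phi>))" by (rule tendsto_cnj)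
 then have "(%n. iH (mulX \<psi>) (cut n w)) \<longlonglongrightarrow> iH \<phi> (fourier (mulX w))"
  unfolding L2_inner_cnj pairing_bounded[OF p wm] pairing_weight[OF \<phi> w] .
 moreover from L2_inner_tendsto_left[OF c(1) w S cut_tendsto[OF w]]
 have "(%n. cnj (iH (cut n w) (mulX \<psi>))) \<longlonglongrightarrow> cnj (iH w (mulX \<psi>))" by (rule tendsto_cnj)
 then have "(%n. iH (mulX \<psi>) (cut n w)) \<longlonglongrightarrow> iH (mulX \<psi>) w" unfolding L2_inner_cnj .
 ultimately show ?thesis by (rule LIMSEQ_unique[symmetric])
qed

end

lemma has_integral_norm_le:
 fixes f :: "real => real"
 assumes "(f has_integral i) S" "(g has_integral j) S" "!!x. x \<in> S ==> norm (f x) <= g x"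
 shows "norm i <= j"
 using integral_norm_bound_integral[OF has_integral_integrable[OF assms(1)] has_integral_integrable[OF assms(2)] assms(3)]
 by (simp add: integral_unique[OF assms(1)] integral_unique[OF assms(2)])

section \<open>The integral of \<open>tanh x / x\<close>\<close>

text \<open>The integrand of the entire exponential integral \<open>Ein\<close>, whose asymptotics
  carry Euler's constant.\<close>

definition expm1_quot :: "real => real" where
 "expm1_quot x = (if x = 0 then 1 else (1 - exp (- x)) / x)"

definition tanh_quot :: "real => real" where
 "tanh_quot x = (if x = 0 then 1 else tanh x / x)"

lemma continuous_expm1_quot: "continuous_on A expm1_quot"
proof (rule continuous_at_imp_continuous_on, rule ballI)
 fix x :: real
 show "isCont expm1_quot x"
 proof (cases "x = 0")
  case True
  have "((%x::real. (1 - exp (- x)) / x) \<longlongrightarrow> 1) (at 0)" by real_asymp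
  then have "(expm1_quot \<longlongrightarrow> 1) (at 0)" by (rule Lim_transform_eventually) (auto simp: expm1_quot_def eventually_at_filter)
  then show ?thesis using True by (simp add: isCont_def expm1_quot_def)
 next
  case False
  have "isCont (%x. (1 - exp (- x)) / x) x" using False by (intro continuous_intros) auto
  moreover have "\<forall>\<^sub>F y in nhds x. expm1_quot y = (1 - exp (- y)) / y"
   using t1_space_nhds[OF False] by eventually_elim (simp add: expm1_quot_def)
  ultimately show ?thesis by (simp only: isCont_cong)
 qed
qed

lemma continuous_tanh_quot: "continuous_on A tanh_quot"
proof (rule continuous_at_imp_continuous_on, rule ballI)
 fix x :: real
 show "isCont tanh_quot x"
 proof (cases "x = 0")
  case True
  have "((%x::real. (1 - exp (- 2 * x)) / (1 + exp (- 2 * x)) / x) \<longlongrightarrow> 1) (at 0)" by real_asymp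
  then have "(tanh_quot \<longlongrightarrow> 1) (at 0)"
   by (rule Lim_transform_eventually) (auto simp: tanh_quot_def tanh_real_altdef eventually_at_filter)
  then show ?thesis using True by (simp add: isCont_def tanh_quot_def)
 next
  case False
  have "cosh x ~= 0" using cosh_real_pos[of x] by simp
  then have "isCont (%x. tanh x / x) x" using False by (intro continuous_intros) auto
  moreover have "\<forall>\<^sub>F y in nhds x. tanh_quot y = tanh y / y"
   using t1_space_nhds[OF False] by eventually_elim (simp add: tanh_quot_def)
  ultimately show ?thesis by (simp only: isCont_cong)
 qed
qed

text \<open>The second bound is Bernoulli's inequality for (1 - (x/n)^2)^n = (1 - x/n)^n (1 +
  x/n)^n, where the last factor is at most exp x.\<close>

lemma one_minus_div_power_le_exp:
 fixes x :: real
 assumes "0 <= x" "x <= real n" "n > 0"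
 shows "(1 - x / n) ^ n <= exp (- x)" "exp (- x) - (1 - x / n) ^ n <= exp (- x) * (x^2 / n)"
proof -
 have n: "real n > 0" using assms by simp
 have y: "0 <= 1 - x / n" "x / n <= 1" using assms by (simp_all add: field_simps)
 have "(1 - x / n) ^ n <= exp (- (x / n)) ^ n" using y exp_ge_add_one_self[of "- (x / n)"] by (intro power_mono) auto
 also have "... = exp (- x)" using n by (simp add: exp_of_nat_mult[symmetric])
 finally show "(1 - x / n) ^ n <= exp (- x)" .
 have "(1 + x / n) ^ n <= exp (x / n) ^ n" using assms by (intro power_mono) auto
 also have "... = exp x" using n by (simp add: exp_of_nat_mult[symmetric])
 finally have e: "(1 + x / n) ^ n <= exp x" .
 have q: "(x / n)^2 <= 1" using y assms by (simp add: power_le_one)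
 have "1 - x^2 / n = 1 + real n * (- ((x / n)^2))" using n by (simp add: power2_eq_square field_simps)
 also have "... <= (1 + (- ((x / n)^2))) ^ n" using q by (intro Bernoulli_inequality) simp
 also have "1 + (- ((x / n)^2)) = (1 - x / n) * (1 + x / n)" by (simp add: power2_eq_square algebra_simps)
 also have "... ^ n <= (1 - x / n) ^ n * exp x" unfolding power_mult_distrib using e y by (intro mult_left_mono) auto
 finally have "exp (- x) * (1 - x^2 / n) <= exp (- x) * ((1 - x / n) ^ n * exp x)" by (intro mult_left_mono) auto
 also have "... = (1 - x / n) ^ n" by (simp add: exp_minus field_simps)
 finally show "exp (- x) - (1 - x / n) ^ n <= exp (- x) * (x^2 / n)" by (simp add: algebra_simps)
qed

definition Ein :: "real => real" where "Ein A = integral {0..A} expm1_quot"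

lemma expm1_quot_integrable: "expm1_quot integrable_on {a..b}" by (rule integrable_continuous_interval[OF continuous_expm1_quot])

lemma expm1_quot_nonneg: "x >= 0 ==> 0 <= expm1_quot x" by (simp add: expm1_quot_def)

text \<open>The geometric sum P x = (1 - (1 - x/n)^n)/x integrates over [0, n] to the harmonic
  number exactly, and it differs from the integrand of \<open>Ein\<close> by at most x exp(-x)/n,
  whose integral is below 1/n.\<close>

lemma Ein_nat:
 assumes n: "n > 0"
 shows "\<bar>Ein (real n) - harm n\<bar> <= 1 / real n"
proof -
 define P where "P x = (\<Sum>k<n. (1 - x / n) ^ k / n)" for x :: real
 have "(P has_integral (\<Sum>k<n. 1 / real (Suc k))) {0..real n}" unfolding P_def
 proof (rule has_integral_sum)
  fix k
  have "((%x. (1 - x / n) ^ k / n) has_integral (- ((1 - real n / n) ^ Suc k) / Suc k - (- ((1 - 0 / n) ^ Suc k) / Suc k))) {0..real n}"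
  proof (intro fundamental_theorem_of_calculus)
   fix x
   have "((%x. (1 - x / n) ^ Suc k) has_real_derivative (real (Suc k) * (1 - x / n) ^ k * (- (1 / n)))) (at x within {0..real n})"
    using n by (auto intro!: derivative_eq_intros simp del: power_Suc)
   moreover have "- (1 / real (Suc k)) * (real (Suc k) * y * (- (1 / n))) = y / n" for y by (simp del: of_nat_Suc)
   ultimately have "((%x. - (1 / real (Suc k)) * (1 - x / n) ^ Suc k) has_real_derivative (1 - x / n) ^ k / n) (at x within {0..real n})"
    using DERIV_cmult[of "%x. (1 - x / n) ^ Suc k" _ x "{0..real n}" "- (1 / real (Suc k))"] by metis
   then show "((%x. - ((1 - x / n) ^ Suc k) / Suc k) has_vector_derivative (1 - x / n) ^ k / n) (at x within {0..real n})"
    unfolding has_real_derivative_iff_has_vector_derivative[symmetric] by simp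
  qed simp
  then show "((%x. (1 - x / n) ^ k / n) has_integral 1 / real (Suc k)) {0..real n}" using n by simp
 qed simp
 moreover have "(\<Sum>k<n. 1 / real (Suc k)) = harm n" unfolding harm_def by (simp add: sum.atLeast1_atMost_eq inverse_eq_divide)
 ultimately have P: "(P has_integral harm n) {0..real n}" by simp
 have E: "(expm1_quot has_integral Ein n) {0..real n}" unfolding Ein_def by (intro integrable_integral expm1_quot_integrable)
 have "((%x. x * exp (- x) / n) has_integral (- (real n + 1) * exp (- real n) / n - (- (0 + 1) * exp (- 0) / n))) {0..real n}"
  using n by (intro fundamental_theorem_of_calculus)
   (auto simp: has_real_derivative_iff_has_vector_derivative[symmetric] field_simps intro!: derivative_eq_intros)
 then have D: "((%x. x * exp (- x) / n) has_integral (1 / n - (real n + 1) * exp (- real n) / n)) {0..real n}"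
  by (simp add: algebra_simps diff_divide_distrib add_divide_distrib)
 have pt: "norm (expm1_quot x - P x) <= x * exp (- x) / n" if "x \<in> {0..real n}" for x
 proof (cases "x = 0")
  case True
  then show ?thesis using n by (simp add: P_def expm1_quot_def)
 next
  case False
  then have x: "0 < x" "x <= real n" using that by auto
  have "x * P x = (1 - (1 - x / n)) * (\<Sum>k<n. (1 - x / n) ^ k)" using n by (simp add: P_def sum_divide_distrib[symmetric])
  also have "... = 1 - (1 - x / n) ^ n" by (rule one_diff_power_eq[symmetric])
  finally have "P x = (1 - (1 - x / n) ^ n) / x" using x by (simp only: eq_divide_eq mult.commute) simp
  then have "expm1_quot x - P x = ((1 - x / n) ^ n - exp (- x)) / x" using x by (simp add: expm1_quot_def diff_divide_distrib)
  then have "norm (expm1_quot x - P x) = (exp (- x) - (1 - x / n) ^ n) / x"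
   using one_minus_div_power_le_exp(1)[of x n] x n by (simp add: abs_divide abs_minus_commute abs_of_nonneg)
  also have "... <= exp (- x) * (x^2 / n) / x" using one_minus_div_power_le_exp(2)[of x n] x n by (intro divide_right_mono) auto
  also have "... = x * exp (- x) / n" using x by (simp add: power2_eq_square)
  finally show ?thesis .
 qed
 have "norm (Ein n - harm n) <= 1 / n - (real n + 1) * exp (- real n) / n"
  by (rule has_integral_norm_le[OF has_integral_diff[OF E P] D pt])
 also have "... <= 1 / n" by simp
 finally show ?thesis by simp
qed

lemma Ein_mono: "0 <= a ==> a <= b ==> Ein a <= Ein b" unfolding Ein_def
 by (rule integral_subset_le) (auto intro: expm1_quot_integrable expm1_quot_nonneg)

text \<open>Integers first, from \<open>Ein_nat\<close> and the limit defining Euler's constant;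
  monotonicity of \<open>Ein\<close> and ln then fills in between consecutive integers.\<close>

lemma Ein_asymptotics: "((%A. Ein A - ln A) \<longlongrightarrow> euler_mascheroni) at_top"
proof -
 have nat: "(%n. Ein (real n) - ln (real n)) \<longlonglongrightarrow> euler_mascheroni"
 proof -
  have "(%n. Ein (real n) - harm n) \<longlonglongrightarrow> 0"
  proof (rule Lim_null_comparison)
   show "\<forall>\<^sub>F n in sequentially. norm (Ein (real n) - harm n) <= 1 / real n"
    using eventually_gt_at_top[of 0] by eventually_elim (use Ein_nat in simp)
  qed (rule lim_1_over_n)
  from tendsto_add[OF this euler_mascheroni_LIMSEQ] show ?thesis by simp
 qed
 have l: "(%n. ln (real (Suc n)) - ln (real n)) \<longlonglongrightarrow> 0" by real_asymp
 have lo: "(%n. Ein (real n) - ln (real (Suc n))) \<longlonglongrightarrow> euler_mascheroni" using tendsto_diff[OF nat l] by simp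
 have hi: "(%n. Ein (real (Suc n)) - ln (real n)) \<longlonglongrightarrow> euler_mascheroni" using tendsto_add[OF LIMSEQ_Suc[OF nat] l] by simp
 have fl: "filterlim (%A::real. nat \<lfloor>A\<rfloor>) sequentially at_top"
  by (rule filterlim_compose[OF filterlim_nat_sequentially filterlim_floor_sequentially])
 show ?thesis
 proof (rule tendsto_sandwich[OF _ _ filterlim_compose[OF lo fl] filterlim_compose[OF hi fl]])
  show "\<forall>\<^sub>F A in at_top. Ein (real (nat \<lfloor>A\<rfloor>)) - ln (real (Suc (nat \<lfloor>A\<rfloor>))) <= Ein A - ln A" using eventually_ge_at_top[of 1]
  proof eventually_elim
   case (elim A)
   then have "real (nat \<lfloor>A\<rfloor>) <= A" "A <= real (Suc (nat \<lfloor>A\<rfloor>))" by linarith+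
   then show ?case using elim by (intro diff_mono Ein_mono) auto
  qed
  show "\<forall>\<^sub>F A in at_top. Ein A - ln A <= Ein (real (Suc (nat \<lfloor>A\<rfloor>))) - ln (real (nat \<lfloor>A\<rfloor>))" using eventually_ge_at_top[of 1]
  proof eventually_elim
   case (elim A)
   then have "real (nat \<lfloor>A\<rfloor>) <= A" "A <= real (Suc (nat \<lfloor>A\<rfloor>))" "1 <= real (nat \<lfloor>A\<rfloor>)" by (simp_all add: le_nat_iff) linarith+
   then show ?case using elim by (intro diff_mono Ein_mono) auto
  qed
 qed
qed

lemma Ein_scaled:
 assumes "c >= 0" "B >= 0"
 shows "((%x. c * expm1_quot (c * x)) has_integral Ein (c * B)) {0..B}"
proof (cases "c = 0")
 case False
 then have c: "c > 0" using assms by simp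
 have "(expm1_quot has_integral Ein (c * B)) {0..c * B}" unfolding Ein_def by (intro integrable_integral expm1_quot_integrable)
 from has_integral_stretch_real[OF this, of c]
 have "((%x. expm1_quot (c * x)) has_integral (1 / c) * Ein (c * B)) ((%x. x / c) ` {0..c * B})" using c by simp
 also have "(%x. x / c) ` {0..c * B} = {0..B}" using c by (auto simp: image_iff field_simps intro!: bexI[of _ "c * _"])
 finally have "((%x. expm1_quot (c * x)) has_integral (1 / c) * Ein (c * B)) {0..B}" .
 from has_integral_mult_right[OF this, of c] show ?thesis using c by simp
qed (simp add: Ein_def)

definition tanh_int :: "real => real" where "tanh_int B = integral {0..B} tanh_quot"

lemma tanh_quot_integrable: "tanh_quot integrable_on {a..b}" by (rule integrable_continuous_interval[OF continuous_tanh_quot])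

lemma tanh_le_self:
 assumes "x >= 0"
 shows "tanh x <= (x::real)"
proof -
 have "(%x. x - tanh x) 0 <= (%x. x - tanh x) x"
 proof (rule DERIV_nonneg_imp_nondecreasing[OF assms])
  fix y :: real
  have "((%x. x - tanh x) has_real_derivative (1 - (1 - (tanh y)^2))) (at y)"
   using cosh_real_pos[of y] by (auto intro!: derivative_eq_intros)
  then show "EX d. ((%x. x - tanh x) has_real_derivative d) (at y) & 0 <= d" by fastforce
 qed
 then show ?thesis by simp
qed

lemma tanh_quot_le_1: "x >= 0 ==> tanh_quot x <= 1" using tanh_le_self[of x] by (simp add: tanh_quot_def)

text \<open>Truncating \<open>tanh x = \<Sum> (- 1)\<^sup>n (e\<^sup>-\<^sup>2\<^sup>n\<^sup>x - e\<^sup>-\<^sup>2\<^sup>(\<^sup>n\<^sup>+\<^sup>1\<^sup>)\<^sup>x)\<close> after \<open>N\<close> terms leaves \<open>\<plusminus> e\<^sup>-\<^sup>2\<^sup>N\<^sup>x tanh x\<close>.\<close>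

lemma tanh_quot_expansion:
 assumes "x >= 0"
 shows "tanh_quot x - (\<Sum>n<N. (- 1) ^ n * ((2 * real (Suc n)) * expm1_quot (2 * real (Suc n) * x) - (2 * real n) * expm1_quot (2 * real n * x)))
   = (- 1) ^ N * (exp (- 2 * real N * x) * tanh_quot x)"
proof (cases "x = 0")
 case True
 have "1 - (\<Sum>n<N. (- 1) ^ n * (2::real)) = (- 1) ^ N" by (induction N) auto
 then show ?thesis using True by (simp add: tanh_quot_def expm1_quot_def algebra_simps)
next
 case False
 then have x: "x > 0" using assms by simp
 define q where "q = exp (- 2 * x)"
 have q: "q > 0" by (simp add: q_def)
 have qn: "exp (- (2 * real n * x)) = q ^ n" for n by (simp add: q_def exp_of_nat_mult[symmetric] algebra_simps)
 have t: "tanh x = (1 - q) / (1 + q)" by (simp add: tanh_real_altdef q_def)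
 have trm: "(2 * real n) * expm1_quot (2 * real n * x) = (1 - q ^ n) / x" for n
  using x by (cases "n = 0") (auto simp: expm1_quot_def qn)
 have "(\<Sum>n<N. (- 1) ^ n * ((2 * real (Suc n)) * expm1_quot (2 * real (Suc n) * x) - (2 * real n) * expm1_quot (2 * real n * x)))
   = (\<Sum>n<N. (- q) ^ n * (1 - q)) / x" unfolding trm sum_divide_distrib
  by (intro sum.cong refl) (use x in \<open>simp add: field_simps power_minus[of q]\<close>)
 also have "(\<Sum>n<N. (- q) ^ n * (1 - q)) = (1 - q) / (1 + q) * (1 - (- q) ^ N)"
 proof -
  have "(1 + q) * (\<Sum>n<N. (- q) ^ n) = 1 - (- q) ^ N" using one_diff_power_eq[of "- q" N] by simp
  then have "(\<Sum>n<N. (- q) ^ n) = (1 - (- q) ^ N) / (1 + q)" using q by (simp add: field_simps)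
  then show ?thesis by (simp add: sum_distrib_right[symmetric])
 qed
 finally have S: "(\<Sum>n<N. (- 1) ^ n * ((2 * real (Suc n)) * expm1_quot (2 * real (Suc n) * x) - (2 * real n) * expm1_quot (2 * real n * x)))
   = tanh x / x * (1 - (- q) ^ N)" unfolding t by simp
 have "exp (- 2 * real N * x) = q ^ N" using qn[of N] by simp
 then show ?thesis unfolding S using x by (simp add: tanh_quot_def algebra_simps power_minus[of q])
qed

text \<open>The remainder is dominated by exp(-2 N x), so the truncation error is uniform in B; this
  allows B to go to infinity with N fixed.\<close>

lemma tanh_int_truncation:
 assumes B: "B >= 0" and N: "N > 0"
 shows "\<bar>tanh_int B - (\<Sum>n<N. (- 1) ^ n * (Ein (2 * real (Suc n) * B) - Ein (2 * real n * B)))\<bar> <= 1 / (2 * real N)"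
proof -
 let ?S = "%x. \<Sum>n<N. (- 1) ^ n * ((2 * real (Suc n)) * expm1_quot (2 * real (Suc n) * x) - (2 * real n) * expm1_quot (2 * real n * x))"
 have S: "(?S has_integral (\<Sum>n<N. (- 1) ^ n * (Ein (2 * real (Suc n) * B) - Ein (2 * real n * B)))) {0..B}"
  using B by (intro has_integral_sum has_integral_mult_right has_integral_diff Ein_scaled) auto
 have T: "(tanh_quot has_integral tanh_int B) {0..B}" unfolding tanh_int_def by (intro integrable_integral tanh_quot_integrable)
 have "((%x. exp (- 2 * real N * x)) has_integral (- exp (- 2 * real N * B) / (2 * N) - (- exp (- 2 * real N * 0) / (2 * N)))) {0..B}"
  using B N by (intro fundamental_theorem_of_calculus)
   (auto simp: has_real_derivative_iff_has_vector_derivative[symmetric] intro!: derivative_eq_intros)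
 then have D: "((%x. exp (- 2 * real N * x)) has_integral (1 / (2 * N) - exp (- 2 * real N * B) / (2 * N))) {0..B}" by simp
 have "norm (tanh_int B - (\<Sum>n<N. (- 1) ^ n * (Ein (2 * real (Suc n) * B) - Ein (2 * real n * B)))) <= 1 / (2 * N) - exp (- 2 * real N * B) / (2 * N)"
 proof (rule has_integral_norm_le[OF has_integral_diff[OF T S] D])
  fix x assume "x \<in> {0..B}"
  then have x: "x >= 0" by simp
  have "0 <= tanh_quot x" using x by (simp add: tanh_quot_def)
  then show "norm (tanh_quot x - ?S x) <= exp (- 2 * real N * x)"
   unfolding tanh_quot_expansion[OF x] using tanh_quot_le_1[OF x] by (simp add: abs_mult power_abs mult_left_le)
 qed
 also have "... <= 1 / (2 * N)" by simp
 finally show ?thesis by simp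
qed

text \<open>The terms n = 2k - 1 and n = 2k combine to minus the logarithm of the k-th Wallis
  factor.\<close>

lemma alternating_log_sum:
 "(\<Sum>n=1..<2 * m + 1. (- 1) ^ n * ln (real (Suc n) / real n)) = - ln (\<Prod>k=1..m. (4 * real k ^ 2) / (4 * real k ^ 2 - 1))"
proof (induction m)
 case (Suc m)
 have pos: "(\<Prod>k=1..m. (4 * real k ^ 2) / (4 * real k ^ 2 - 1)) > 0"
 proof (intro prod_pos ballI)
  fix k assume "k \<in> {1..m}"
  then have "1 <= real k" by simp
  then have "1 <= (real k)^2" by simp
  moreover have "0 < (real k)^2" using \<open>1 <= real k\<close> by simp
  ultimately show "0 < (4 * real k ^ 2) / (4 * real k ^ 2 - 1)" by (intro divide_pos_pos) linarith+
 qed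
 define a where "a = real (2 * m + 1)"
 have a: "a >= 1" by (simp add: a_def)
 have "(\<Sum>n=1..<2 * Suc m + 1. (- 1) ^ n * ln (real (Suc n) / real n)) =
   (\<Sum>n=1..<2 * m + 1. (- 1) ^ n * ln (real (Suc n) / real n)) + (- ln ((a + 1) / a) + ln ((a + 2) / (a + 1)))"
  by (simp add: a_def add_ac)
 also have "- ln ((a + 1) / a) + ln ((a + 2) / (a + 1)) = - ln ((a + 1)^2 / (a * (a + 2)))"
  using a by (simp add: ln_div ln_mult ln_realpow)
 also have "(a + 1)^2 / (a * (a + 2)) = (4 * real (Suc m) ^ 2) / (4 * real (Suc m) ^ 2 - 1)"
  by (simp add: a_def power2_eq_square algebra_simps)
 finally have "(\<Sum>n=1..<2 * Suc m + 1. (- 1) ^ n * ln (real (Suc n) / real n)) =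
   - ln (\<Prod>k=1..m. (4 * real k ^ 2) / (4 * real k ^ 2 - 1)) - ln ((4 * real (Suc m) ^ 2) / (4 * real (Suc m) ^ 2 - 1))"
  using Suc by simp
 also have "... = - ln ((\<Prod>k=1..m. (4 * real k ^ 2) / (4 * real k ^ 2 - 1)) * ((4 * real (Suc m) ^ 2) / (4 * real (Suc m) ^ 2 - 1)))"
 proof -
  have "1 <= (real (Suc m))^2" using power_mono[of 1 "real (Suc m)" 2] by simp
  then have "0 < (4 * real (Suc m) ^ 2) / (4 * real (Suc m) ^ 2 - 1)" by (intro divide_pos_pos) linarith+
  from ln_mult_pos[OF pos this] show ?thesis by linarith
 qed
 finally show ?case by (simp add: prod.nat_ivl_Suc')
qed simp

text \<open>For fixed N and n > 0 the difference of the two values of \<open>Ein\<close> tends to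
  ln((n+1)/n) as B grows. As the truncation error is uniform in B, N can be fixed beforehand within
  e/3.\<close>

lemma tanh_int_asymptotics: "((%B. tanh_int B - ln B) \<longlongrightarrow> ln (4 / pi) + euler_mascheroni) at_top"
proof (rule tendstoI)
 fix e :: real assume e: "e > 0"
 define L where "L = ln (4 / pi) + (euler_mascheroni::real)"
 define l where "l m = ln 2 + euler_mascheroni + (\<Sum>n=1..<2 * m + 1. (- 1) ^ n * ln (real (Suc n) / real n))" for m
 have "(%m. - ln (\<Prod>k=1..m. (4 * real k ^ 2) / (4 * real k ^ 2 - 1))) \<longlonglongrightarrow> - ln (pi / 2)"
  by (intro tendsto_minus tendsto_ln wallis) simp
 then have "l \<longlonglongrightarrow> ln 2 + euler_mascheroni + - ln (pi / 2)" unfolding l_def alternating_log_sum by (intro tendsto_add tendsto_const)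
 also have "ln 2 + euler_mascheroni + - ln (pi / 2) = L" unfolding L_def by (simp add: ln_div ln_mult[of 2 2, simplified])
 finally have "\<forall>\<^sub>F m in sequentially. dist (l m) L < e / 3" using e by (intro tendstoD) auto
 moreover have "\<forall>\<^sub>F m in sequentially. 1 / (2 * real (2 * m + 1)) < e / 3"
 proof (rule order_tendstoD)
  show "(%m. 1 / (2 * real (2 * m + 1))) \<longlonglongrightarrow> 0" by real_asymp
 qed (use e in simp)
 ultimately have "\<forall>\<^sub>F m in sequentially. dist (l m) L < e / 3 & 1 / (2 * real (2 * m + 1)) < e / 3" by (rule eventually_conj)
 then obtain m where m: "dist (l m) L < e / 3" "1 / (2 * real (2 * m + 1)) < e / 3" unfolding eventually_sequentially by blast
 \<comment> \<open>Odd, so that after n = 0 the remaining 2m terms pair off into Wallis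
   factors.\<close>
 define N where "N = 2 * m + 1"
 define S where "S B = (\<Sum>n<N. (- 1) ^ n * (Ein (2 * real (Suc n) * B) - Ein (2 * real n * B)))" for B
 have c: "((%B. Ein (c * B) - ln B) \<longlongrightarrow> ln c + euler_mascheroni) at_top" if "c > 0" for c
 proof -
  have "filterlim (%B. c * B) at_top at_top" using that by real_asymp
  from tendsto_add[OF filterlim_compose[OF Ein_asymptotics this] tendsto_const[of "ln c"]]
  have "((%B. Ein (c * B) - ln (c * B) + ln c) \<longlongrightarrow> euler_mascheroni + ln c) at_top" .
  moreover have "\<forall>\<^sub>F B in at_top. Ein (c * B) - ln (c * B) + ln c = Ein (c * B) - ln B"
   using eventually_gt_at_top[of 0] by eventually_elim (use that in \<open>simp add: ln_mult\<close>)
  ultimately show ?thesis by (simp add: Lim_transform_eventually add.commute)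
 qed
 \<comment> \<open>The term n = 0 is split off because the asymptotics \<open>c\<close> need a
   positive factor of B; its second part is \<open>Ein\<close> at 0, which is 0.\<close>
 have Sdec: "S B = Ein (2 * B) + (\<Sum>n=1..<N. (- 1) ^ n * (Ein (2 * real (Suc n) * B) - Ein (2 * real n * B)))" for B
 proof -
  have "{..<N} = insert 0 {1..<N}" by (auto simp: N_def)
  then show ?thesis by (simp add: S_def Ein_def)
 qed
 have "((%B. S B - ln B) \<longlongrightarrow> l m) at_top"
 proof -
  have "((%B. (Ein (2 * B) - ln B) + (\<Sum>n=1..<N. (- 1) ^ n * ((Ein (2 * real (Suc n) * B) - ln B) - (Ein (2 * real n * B) - ln B))))
    \<longlongrightarrow> (ln 2 + euler_mascheroni) + (\<Sum>n=1..<N. (- 1) ^ n * ((ln (2 * real (Suc n)) + euler_mascheroni) - (ln (2 * real n) + euler_mascheroni)))) at_top"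
   by (intro tendsto_add tendsto_sum tendsto_mult tendsto_diff tendsto_const c) auto
  moreover have "(\<Sum>n=1..<N. (- 1) ^ n * ((ln (2 * real (Suc n)) + euler_mascheroni) - (ln (2 * real n) + euler_mascheroni)))
    = (\<Sum>n=1..<N. (- 1) ^ n * ln (real (Suc n) / real n))"
  proof (intro sum.cong refl)
   fix n assume "n \<in> {1..<N}"
   then have n: "real n > 0" by simp
   have "ln (2 * real (Suc n)) = ln 2 + ln (real (Suc n))" "ln (2 * real n) = ln 2 + ln (real n)"
    "ln (real (Suc n) / real n) = ln (real (Suc n)) - ln (real n)"
    using n by (simp_all only: ln_mult_pos[OF zero_less_numeral] ln_divide_pos of_nat_0_less_iff zero_less_Suc)
   then show "(- 1) ^ n * ((ln (2 * real (Suc n)) + euler_mascheroni) - (ln (2 * real n) + euler_mascheroni)) = (- 1) ^ n * ln (real (Suc n) / real n)"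
    by simp
  qed
  ultimately show ?thesis unfolding Sdec l_def N_def by (simp add: algebra_simps)
 qed
 then have "\<forall>\<^sub>F B in at_top. dist (S B - ln B) (l m) < e / 3" using e by (intro tendstoD) auto
 then show "\<forall>\<^sub>F B in at_top. dist (tanh_int B - ln B) (ln (4 / pi) + euler_mascheroni) < e" using eventually_ge_at_top[of 0]
 proof eventually_elim
  case (elim B)
  have "\<bar>tanh_int B - S B\<bar> <= 1 / (2 * real N)" unfolding S_def using elim by (intro tanh_int_truncation) (auto simp: N_def)
  then show ?case using elim m unfolding L_def[symmetric] N_def dist_real_def by linarith
 qed
qed

section \<open>The kinetic symbol\<close>

definition ray :: "real measure" where "ray = density lborel (indicator {0<..})"

lemma sets_ray [measurable_cong, simp]: "sets ray = sets borel" by (simp add: ray_def)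

lemma AE_ray: "(AE r in lborel. 0 < r --> P r) ==> AE r in ray. P r"
 unfolding ray_def by (subst AE_density) (auto split: split_indicator)

lemma AE_ray_pos: "AE r in ray. 0 < r & r ~= a" by (rule AE_ray) (use AE_lborel_singleton[of a] in \<open>auto elim: eventually_mono\<close>)

lemma nn_integral_ray:
 "f \<in> borel_measurable borel ==> nn_integral ray (%r. f r) = nn_integral lborel (%r. f r * indicator {0<..} r)"
 unfolding ray_def by (subst nn_integral_density) (auto simp: mult.commute)

lemma radial_ray: "radial_measure = density ray (%r. ennreal (r^2))"
 unfolding radial_measure_def ray_def by (subst density_density_eq) (auto simp: mult.commute)

lemma integral_radial_ray:
 fixes f :: "real => 'b::{banach, second_countable_topology}"
 assumes [measurable]: "f \<in> borel_measurable borel"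
 shows "integrable radial_measure f \<longleftrightarrow> integrable ray (%r. r^2 *\<^sub>R f r)"
  and "(LINT r|radial_measure. f r) = (LINT r|ray. r^2 *\<^sub>R f r)"
 unfolding radial_ray by (subst integrable_density integral_density; simp)+

lemma ray_integrable_lborel:
 fixes f :: "real => 'b::{banach, second_countable_topology}"
 assumes [measurable]: "f \<in> borel_measurable borel"
 shows "integrable ray f \<longleftrightarrow> integrable lborel (%r. indicator {0<..} r *\<^sub>R f r)"
  and "(LINT r|ray. f r) = (LINT r|lborel. indicator {0<..} r *\<^sub>R f r)"
proof -
 have r: "ray = density lborel (%r. ennreal (indicator {0<..} r))"
  unfolding ray_def by (intro density_cong) (auto split: split_indicator)
 show "integrable ray f \<longleftrightarrow> integrable lborel (%r. indicator {0<..} r *\<^sub>R f r)" unfolding r by (rule integrable_density) auto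
 show "(LINT r|ray. f r) = (LINT r|lborel. indicator {0<..} r *\<^sub>R f r)" unfolding r by (rule integral_density) auto
qed

lemma ray_dominating: "integrable ray (%r. C / (1 + r^2))"
proof -
 have "nn_integral ray (%r. ennreal (1 / (1 + r^2))) <= nn_integral lborel (%r. ennreal (1 / (1 + r^2)) * indicator {0..} r)"
  by (subst nn_integral_ray) (auto intro!: nn_integral_mono split: split_indicator)
 also have "... = ennreal (pi / 2 - arctan 0)"
 proof (rule nn_integral_FTC_atLeast)
  show "(arctan has_real_derivative 1 / (1 + x^2)) (at x)" for x using DERIV_arctan[of x] by (simp add: inverse_eq_divide)
 qed (auto intro: tendsto_arctan_at_top)
 finally have "nn_integral ray (%r. ennreal (norm (1 / (1 + r^2)))) < \<infinity>"
  by (simp add: abs_of_nonneg order_le_less_trans[OF _ ennreal_less_top])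
 then have "integrable ray (%r. 1 / (1 + r^2))" by (intro integrableI_bounded) auto
 from integrable_mult_right[OF this, of C] show ?thesis by simp
qed

section \<open>Elementary bounds for the symbol as a function of p^2\<close>

definition Kf :: "real => real => real => real" where
 "Kf \<mu> T s = (if s = \<mu> then 2 * T else (s - \<mu>) / tanh ((s - \<mu>) / (2 * T)))"

lemma K_symbol_eq: "K_symbol \<mu> T p = Kf \<mu> T (p \<bullet> p)" by (simp add: K_symbol_def Kf_def)

lemma Kf_tanh_quot: "T > 0 ==> 1 / Kf \<mu> T s = tanh_quot ((s - \<mu>) / (2 * T)) / (2 * T)" by (simp add: Kf_def tanh_quot_def)

lemma Kf_abs:
 assumes "T > 0" "s ~= \<mu>"
 shows "Kf \<mu> T s = \<bar>s - \<mu>\<bar> / tanh (\<bar>s - \<mu>\<bar> / (2 * T))"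
proof (cases "s < \<mu>")
 case True
 have e: "(s - \<mu>) / (2 * T) = - ((\<mu> - s) / (2 * T))" by (simp add: minus_divide_left)
 have "Kf \<mu> T s = - (\<mu> - s) / - tanh ((\<mu> - s) / (2 * T))" using True by (simp only: Kf_def e tanh_minus) simp
 then show ?thesis unfolding minus_divide_divide using True by (simp add: abs_minus_commute[of s])
qed (use assms in \<open>simp add: Kf_def\<close>)

text \<open>From y/(1+y) <= tanh y <= min(1, y) with y = |s - \<mu>|/(2T). Together the bounds make
  the convergence to |s - \<mu>| uniform in s as T -> 0.\<close>

lemma Kf_bounds:
 assumes T: "T > 0"
 shows "\<bar>s - \<mu>\<bar> <= Kf \<mu> T s" "2 * T <= Kf \<mu> T s" "Kf \<mu> T s <= \<bar>s - \<mu>\<bar> + 2 * T"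
proof -
 have "\<bar>s - \<mu>\<bar> <= Kf \<mu> T s & 2 * T <= Kf \<mu> T s & Kf \<mu> T s <= \<bar>s - \<mu>\<bar> + 2 * T"
 proof (cases "s = \<mu>")
  case False
  define x where "x = \<bar>s - \<mu>\<bar>"
  define y where "y = x / (2 * T)"
  have x: "x > 0" and y: "y > 0" "x = 2 * T * y" using False T by (auto simp: x_def y_def)
  have t: "0 < tanh y" "tanh y <= 1" "tanh y <= y" using y tanh_real_lt_1[of y] tanh_le_self[of y] by simp_all
  have "y / (1 + y) <= tanh y"
  proof -
   have "1 + 2 * y <= exp (2 * y)" by (rule exp_ge_add_one_self)
   then have "exp (- 2 * y) * (1 + 2 * y) <= exp (- 2 * y) * exp (2 * y)" by (intro mult_left_mono) auto
   also have "... = 1" by (simp add: exp_add[symmetric])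
   finally have "y * (1 + exp (- 2 * y)) <= (1 - exp (- 2 * y)) * (1 + y)" by (simp add: algebra_simps)
   then show ?thesis using y by (simp add: tanh_real_altdef divide_le_eq pos_le_divide_eq add_pos_pos)
  qed
  then have "y <= tanh y * (1 + y)" using y by (simp add: pos_divide_le_eq)
  then have "y / tanh y <= 1 + y" using t by (simp add: pos_divide_le_eq mult.commute)
  then have 3: "x / tanh y <= x + 2 * T" using T mult_left_mono[of "y / tanh y" "1 + y" "2 * T"]
   unfolding y(2) by (simp add: algebra_simps)
  have 1: "x <= x / tanh y" using t x by (simp add: pos_le_divide_eq mult_left_le)
  have 2: "2 * T <= x / tanh y" using t T unfolding y(2) by (simp add: pos_le_divide_eq)
  show ?thesis using 1 2 3 unfolding Kf_abs[OF T False] x_def[symmetric] y_def[symmetric] by simp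
 qed (use T in \<open>simp add: Kf_def\<close>)
 then show "\<bar>s - \<mu>\<bar> <= Kf \<mu> T s" "2 * T <= Kf \<mu> T s" "Kf \<mu> T s <= \<bar>s - \<mu>\<bar> + 2 * T" by blast+
qed

lemma Kf_pos: "T > 0 ==> Kf \<mu> T s > 0" using Kf_bounds(2)[of T \<mu> s] by linarith

lemma Kf_mono:
 assumes "0 < T" "T <= T'"
 shows "Kf \<mu> T s <= Kf \<mu> T' s"
proof (cases "s = \<mu>")
 case False
 then have x: "\<bar>s - \<mu>\<bar> > 0" by simp
 have "\<bar>s - \<mu>\<bar> / (2 * T') <= \<bar>s - \<mu>\<bar> / (2 * T)" using assms by (intro divide_left_mono) auto
 then have "tanh (\<bar>s - \<mu>\<bar> / (2 * T')) <= tanh (\<bar>s - \<mu>\<bar> / (2 * T))" by simp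
 then show ?thesis using assms x False by (simp add: Kf_abs divide_left_mono zero_less_mult_iff)
qed (use assms in \<open>simp add: Kf_def\<close>)

lemma Kf_inverse_continuous:
 assumes "T > 0"
 shows "continuous_on UNIV (%s. 1 / Kf \<mu> T s)" unfolding Kf_tanh_quot[OF assms]
 using assms by (intro continuous_intros continuous_on_compose2[OF continuous_tanh_quot]) auto

lemma Kf_continuous:
 assumes "T > 0"
 shows "continuous_on UNIV (%s. Kf \<mu> T s)"
 using continuous_on_divide[OF continuous_on_const[of UNIV 1] Kf_inverse_continuous[OF assms, of \<mu>]] Kf_pos[OF assms, of \<mu>]
 by (simp add: less_imp_neq[symmetric])

lemma Kf_measurable [measurable]: "T > 0 ==> Kf \<mu> T \<in> borel_measurable borel"
 by (intro borel_measurable_continuous_onI Kf_continuous)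

text \<open>r^2 (1/K_T - 1/r^2), the integrand of \<open>m_mu\<close> in polar coordinates. Its
  limit \<open>q0\<close> has a nonintegrable singularity 1/|r - sqrt \<mu>|, the source of the
  logarithm.\<close>

definition q :: "real => real => real => real" where "q \<mu> T r = r^2 / Kf \<mu> T (r^2) - 1"

definition q0 :: "real => real => real" where "q0 \<mu> r = r^2 / \<bar>r^2 - \<mu>\<bar> - 1"

lemma q_measurable [measurable]: "T > 0 ==> q \<mu> T \<in> borel_measurable borel" "q0 \<mu> \<in> borel_measurable borel"
 unfolding q_def[abs_def] q0_def[abs_def] by measurable

lemma Kf_tendsto:
 assumes S: "S \<longlonglongrightarrow> 0" "!!n. 0 < S n"
 shows "(%n. Kf \<mu> (S n) s) \<longlonglongrightarrow> \<bar>s - \<mu>\<bar>"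
proof (rule tendsto_sandwich[where f = "%_. \<bar>s - \<mu>\<bar>" and h = "%n. \<bar>s - \<mu>\<bar> + 2 * S n"])
 have "(%n. \<bar>s - \<mu>\<bar> + 2 * S n) \<longlonglongrightarrow> \<bar>s - \<mu>\<bar> + 2 * 0" by (intro tendsto_intros S)
 then show "(%n. \<bar>s - \<mu>\<bar> + 2 * S n) \<longlonglongrightarrow> \<bar>s - \<mu>\<bar>" by simp
qed (use Kf_bounds S in \<open>auto intro!: always_eventually\<close>)

lemma q_tendsto:
 assumes "S \<longlonglongrightarrow> 0" "!!n. 0 < S n" "r^2 ~= \<mu>"
 shows "(%n. q \<mu> (S n) r) \<longlonglongrightarrow> q0 \<mu> r" unfolding q_def q0_def using assms by (intro tendsto_intros Kf_tendsto) auto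

lemma inverse_Kf_le: "T > 0 ==> s ~= \<mu> ==> 1 / Kf \<mu> T s <= 1 / \<bar>s - \<mu>\<bar>"
 using Kf_bounds(1)[of T s \<mu>] by (intro divide_left_mono) (auto intro!: mult_pos_pos Kf_pos)

lemma q_tail:
 assumes T: "0 < T" "T <= 1" and \<mu>: "\<mu> > 0" and r: "2 * \<mu> <= r^2"
 shows "\<bar>q \<mu> T r\<bar> <= 2 * (\<mu> + 2) / r^2"
proof -
 define k where "k = Kf \<mu> T (r^2)"
 have r0: "r^2 > 0" using r \<mu> by linarith
 have k: "r^2 - \<mu> <= k" "k <= r^2 - \<mu> + 2 * T" "k > 0"
  using Kf_bounds(1)[OF T(1), of "r^2" \<mu>] Kf_bounds(3)[OF T(1), of \<mu> "r^2"] Kf_pos[OF T(1), of \<mu> "r^2"] r \<mu> unfolding k_def by auto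
 have "\<bar>r^2 - k\<bar> <= \<mu> + 2" using k T \<mu> by auto
 then have "\<bar>q \<mu> T r\<bar> <= (\<mu> + 2) / k" using k by (simp add: q_def k_def[symmetric] field_simps abs_divide)
 also have "... <= (\<mu> + 2) / (r^2 / 2)" using k r r0 \<mu> by (intro divide_left_mono) auto
 also have "... = 2 * (\<mu> + 2) / r^2" by simp
 finally show ?thesis .
qed

text \<open>One constant for two regimes: the first summand turns the bound 5 for r^2 <= 2 \<mu>
  into a multiple of 1/(1 + r^2), the second does the same for the tail bound 4 (\<mu> +
  2)/r^2.\<close>

definition Cq :: "real => real" where "Cq \<mu> = 5 * (1 + 2 * \<mu>) + 4 * (\<mu> + 2) * (1 + 1 / (2 * \<mu>))"

lemma tail_to_dominating:
 assumes \<mu>: "\<mu> > 0" and r: "2 * \<mu> <= r^2"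
 shows "4 * (\<mu> + 2) / r^2 <= Cq \<mu> / (1 + r^2)"
proof -
 have r0: "r^2 > 0" using r \<mu> by linarith
 have "1 / r^2 <= 1 / (2 * \<mu>)" using r \<mu> r0 by (intro divide_left_mono) auto
 then have "(1 + r^2) / r^2 <= 1 + 1 / (2 * \<mu>)" using r0 by (simp add: add_divide_distrib)
 then have "4 * (\<mu> + 2) * ((1 + r^2) / r^2) <= 4 * (\<mu> + 2) * (1 + 1 / (2 * \<mu>))" using \<mu> by (intro mult_left_mono) auto
 also have "... <= Cq \<mu>" using \<mu> by (simp add: Cq_def)
 finally have "4 * (\<mu> + 2) / r^2 * (1 + r^2) <= Cq \<mu>" by simp
 then show ?thesis by (simp only: pos_le_divide_eq add_pos_nonneg zero_less_one zero_le_power2)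
qed

lemma head_to_dominating:
 assumes \<mu>: "\<mu> > 0" and r: "r^2 <= 2 * \<mu>"
 shows "5 <= Cq \<mu> / (1 + r^2)"
proof -
 have "5 * (1 + r^2) <= 5 * (1 + 2 * \<mu>)" using r by simp
 also have "... <= Cq \<mu>" using \<mu> by (simp add: Cq_def)
 finally show ?thesis by (simp add: pos_le_divide_eq add_pos_nonneg)
qed

text \<open>The singularity of \<open>1 / K\<^sub>T\<close> on the Fermi sphere is tamed by the logarithmic modulus of continuity.\<close>

definition Lq :: "real => real => real" where "Lq \<mu> r = min 2 (2 * \<bar>ln (r / sqrt \<mu>)\<bar>)"

lemma Lq_nonneg: "0 <= Lq \<mu> r" by (simp add: Lq_def)

lemma Lq_measurable [measurable]: "Lq \<mu> \<in> borel_measurable borel" unfolding Lq_def[abs_def] by measurable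

lemma abs_ln_le:
 assumes "x > (0::real)"
 shows "x * \<bar>ln x\<bar> <= \<bar>x - 1\<bar> * max x 1"
proof (cases "x >= 1")
 case True
 then show ?thesis using ln_le_minus_one[of x] by (simp add: max_def)
next
 case False
 have "- ln x <= 1 / x - 1" using ln_le_minus_one[of "1 / x"] assms by (simp add: ln_div)
 then have "x * (- ln x) <= x * (1 / x - 1)" using assms by (intro mult_left_mono) auto
 then show ?thesis using assms False by (simp add: algebra_simps max_def abs_if)
qed

text \<open>With x = r/sqrt \<mu> the singular part is at most 2 x max(x, 1)/(x + 1) <= 2 x, because
  \<open>Lq\<close> and x^2 - 1 both vanish to first order at x = 1. The bound is uniform in T since
  1/K_T <= 1/|p^2 - \<mu>|.\<close>

lemma q_dominated:
 assumes T: "0 < T" "T <= 1" and \<mu>: "\<mu> > 0" and r: "0 < r" "r ~= sqrt \<mu>"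
 shows "\<bar>q \<mu> T r\<bar> * Lq \<mu> r <= Cq \<mu> / (1 + r^2)"
proof (cases "2 * \<mu> <= r^2")
 case True
 have "\<bar>q \<mu> T r\<bar> * Lq \<mu> r <= 2 * (\<mu> + 2) / r^2 * 2" using q_tail[OF T \<mu> True] \<mu> by (intro mult_mono) (auto simp: Lq_def)
 then show ?thesis using tail_to_dominating[OF \<mu> True] by simp
next
 case False
 define x where "x = r / sqrt \<mu>"
 have x: "x > 0" "x ~= 1" using r \<mu> by (auto simp: x_def)
 have rx: "r^2 = \<mu> * x^2" using \<mu> by (simp add: x_def power_divide)
 have "x^2 < 2" using False \<mu> unfolding rx by simp
 \<comment> \<open>Hence 2 x <= 3 for the singular part; the remaining 1 times \<open>Lq\<close>
   adds at most 2, whence the 5.\<close>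
 then have x3: "x < 3 / 2" using power2_less_imp_less[of x "3/2"] by (simp add: power2_eq_square)
 have ne: "x^2 ~= 1" using x by (simp add: power2_eq_1_iff)
 have "r^2 / Kf \<mu> T (r^2) <= r^2 / \<bar>r^2 - \<mu>\<bar>"
  using mult_left_mono[OF inverse_Kf_le[OF T(1), of "r^2" \<mu>], of "r^2"] ne \<mu> unfolding rx by simp
 also have "... = x^2 / \<bar>x^2 - 1\<bar>"
 proof -
  have "\<mu> * x^2 - \<mu> = \<mu> * (x^2 - 1)" by (simp add: algebra_simps)
  then show ?thesis unfolding rx using \<mu> by (simp add: abs_mult)
 qed
 finally have 1: "\<bar>q \<mu> T r\<bar> <= 1 + x^2 / \<bar>x^2 - 1\<bar>"
  using Kf_pos[OF T(1), of \<mu> "r^2"] unfolding q_def by (simp add: abs_le_iff add_increasing2)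
 have "x^2 / \<bar>x^2 - 1\<bar> * Lq \<mu> r <= x^2 / \<bar>x^2 - 1\<bar> * (2 * \<bar>ln x\<bar>)" by (intro mult_left_mono) (auto simp: Lq_def x_def)
 also have "... = 2 * x * (x * \<bar>ln x\<bar>) / \<bar>x^2 - 1\<bar>" by (simp add: power2_eq_square)
 also have "... <= 2 * x * (\<bar>x - 1\<bar> * max x 1) / \<bar>x^2 - 1\<bar>" using x by (intro divide_right_mono mult_left_mono abs_ln_le) auto
 also have "... = 2 * x * (max x 1 / (x + 1))"
 proof -
  have "\<bar>x^2 - 1\<bar> = \<bar>x - 1\<bar> * (x + 1)" using x by (simp add: power2_eq_square square_diff_one_factored abs_mult mult.commute)
  then show ?thesis using x by simp
 qed
 also have "... <= 2 * x * 1" using x by (intro mult_left_mono) (auto simp: divide_le_eq)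
 finally have 2: "x^2 / \<bar>x^2 - 1\<bar> * Lq \<mu> r <= 3" using x3 by linarith
 have "\<bar>q \<mu> T r\<bar> * Lq \<mu> r <= (1 + x^2 / \<bar>x^2 - 1\<bar>) * Lq \<mu> r" by (rule mult_right_mono[OF 1 Lq_nonneg])
 also have "... <= 5" using 2 by (simp add: distrib_right Lq_def min_def split: if_splits)
 finally show ?thesis using head_to_dominating[OF \<mu>, of r] False by linarith
qed

lemma q0_dominated:
 assumes \<mu>: "\<mu> > 0" and r: "0 < r" "r ~= sqrt \<mu>"
 shows "\<bar>q0 \<mu> r\<bar> * Lq \<mu> r <= Cq \<mu> / (1 + r^2)"
proof (rule LIMSEQ_le_const2)
 let ?S = "%n. inverse (real (Suc n))"
 have "r^2 ~= \<mu>" using r \<mu> real_sqrt_unique by fastforce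
 then show "(%n. \<bar>q \<mu> (?S n) r\<bar> * Lq \<mu> r) \<longlonglongrightarrow> \<bar>q0 \<mu> r\<bar> * Lq \<mu> r"
  by (intro tendsto_intros q_tendsto LIMSEQ_inverse_real_of_nat) auto
 show "EX N. ALL n>=N. \<bar>q \<mu> (?S n) r\<bar> * Lq \<mu> r <= Cq \<mu> / (1 + r^2)"
  using q_dominated[OF _ _ \<mu> r] by (intro exI[of _ 0] allI impI) (auto simp: inverse_le_1_iff)
qed

lemma AE_ray_sqrt:
 assumes "\<mu> > 0"
 shows "AE r in ray. 0 < r & r ~= sqrt \<mu> & r^2 ~= \<mu>"
 using AE_ray_pos[of "sqrt \<mu>"] by eventually_elim (use assms real_sqrt_unique in fastforce)

text \<open>A weighted L1 distance between the radial densities at T and at 0. Through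
  \<open>rf_diff\<close> it controls the convergence of the regular part for all vectors at once; it
  tends to 0 by dominated convergence.\<close>

definition eta :: "real => real => real" where
 "eta \<mu> T = (LINT r|ray. \<bar>q \<mu> T r - q0 \<mu> r\<bar> * Lq \<mu> r)"

lemma eta_props:
 assumes \<mu>: "\<mu> > 0"
 shows "0 < T ==> T <= 1 ==> integrable ray (%r. \<bar>q \<mu> T r - q0 \<mu> r\<bar> * Lq \<mu> r)" and "(eta \<mu> \<longlongrightarrow> 0) (at_right 0)" "0 <= eta \<mu> T"
proof -
 have b: "AE r in ray. norm (\<bar>q \<mu> T r - q0 \<mu> r\<bar> * Lq \<mu> r) <= 2 * Cq \<mu> / (1 + r^2)" if "0 < T" "T <= 1" for T
  using AE_ray_sqrt[OF \<mu>]
 proof eventually_elim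
  case (elim r)
  have "\<bar>q \<mu> T r - q0 \<mu> r\<bar> * Lq \<mu> r <= (\<bar>q \<mu> T r\<bar> + \<bar>q0 \<mu> r\<bar>) * Lq \<mu> r"
   by (intro mult_right_mono Lq_nonneg) (rule abs_triangle_ineq4)
  also have "... <= Cq \<mu> / (1 + r^2) + Cq \<mu> / (1 + r^2)"
   unfolding distrib_right using elim by (intro add_mono q_dominated q0_dominated that \<mu>) auto
  finally show ?case using Lq_nonneg[of \<mu> r] by (simp add: abs_mult)
 qed
 show "integrable ray (%r. \<bar>q \<mu> T r - q0 \<mu> r\<bar> * Lq \<mu> r)" if T: "0 < T" "T <= 1"
 proof (rule Bochner_Integration.integrable_bound[OF ray_dominating[of "2 * Cq \<mu>"]])
  show "(%r. \<bar>q \<mu> T r - q0 \<mu> r\<bar> * Lq \<mu> r) \<in> borel_measurable ray" using T by measurable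
  show "AE r in ray. norm (\<bar>q \<mu> T r - q0 \<mu> r\<bar> * Lq \<mu> r) <= norm (2 * Cq \<mu> / (1 + r^2))" using b[OF T]
  proof eventually_elim
   case (elim r)
   then show ?case using abs_ge_self[of "2 * Cq \<mu> / (1 + r^2)"] by simp
  qed
 qed
 show "(eta \<mu> \<longlongrightarrow> 0) (at_right 0)"
 proof (rule tendsto_at_right_sequentially[of 0 1])
  fix S :: "nat => real" assume S: "!!n. 0 < S n" "!!n. S n < 1" "S \<longlonglongrightarrow> 0"
  have "(%n. eta \<mu> (S n)) \<longlonglongrightarrow> (LINT r|ray. 0)" unfolding eta_def
  proof (rule integral_dominated_convergence[OF _ _ ray_dominating[of "2 * Cq \<mu>"]])
   show "(%r. \<bar>q \<mu> (S n) r - q0 \<mu> r\<bar> * Lq \<mu> r) \<in> borel_measurable ray" for n using S(1)[of n] by measurable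
   show "AE r in ray. (%n. \<bar>q \<mu> (S n) r - q0 \<mu> r\<bar> * Lq \<mu> r) \<longlonglongrightarrow> 0" using AE_ray_sqrt[OF \<mu>]
   proof eventually_elim
    case (elim r)
    have "(%n. \<bar>q \<mu> (S n) r - q0 \<mu> r\<bar> * Lq \<mu> r) \<longlonglongrightarrow> \<bar>q0 \<mu> r - q0 \<mu> r\<bar> * Lq \<mu> r"
     using elim by (intro tendsto_intros q_tendsto S) auto
    then show ?case by simp
   qed
   show "AE r in ray. norm (\<bar>q \<mu> (S n) r - q0 \<mu> r\<bar> * Lq \<mu> r) <= 2 * Cq \<mu> / (1 + r^2)" for n
    using S(1,2)[of n] by (intro b) auto
  qed simp
  then show "(%n. eta \<mu> (S n)) \<longlonglongrightarrow> 0" by simp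
 qed simp
 show "0 <= eta \<mu> T" unfolding eta_def by (intro Bochner_Integration.integral_nonneg) (simp add: Lq_nonneg)
qed

text \<open>For fixed T > 0 the symbol is at least 2T, so there is no singularity; the dominating
  constant used here blows up as T -> 0.\<close>

lemma q_integrable:
 assumes T: "0 < T" "T <= 1" and \<mu>: "\<mu> > 0"
 shows "integrable ray (q \<mu> T)"
proof (rule Bochner_Integration.integrable_bound[OF ray_dominating[of "(1 + 2 * \<mu> / (2 * T)) * Cq \<mu>"]])
 show "q \<mu> T \<in> borel_measurable ray" using T by measurable
 show "AE r in ray. norm (q \<mu> T r) <= norm ((1 + 2 * \<mu> / (2 * T)) * Cq \<mu> / (1 + r^2))"
 proof (rule AE_I2)
  fix r
  have C: "Cq \<mu> / (1 + r^2) >= 0" using \<mu> by (auto simp: Cq_def intro!: divide_nonneg_pos add_pos_nonneg)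
  have "\<bar>q \<mu> T r\<bar> <= (1 + 2 * \<mu> / (2 * T)) * (Cq \<mu> / (1 + r^2))"
  proof (cases "2 * \<mu> <= r^2")
   case True
   have "2 * (\<mu> + 2) / r^2 <= 4 * (\<mu> + 2) / r^2" using \<mu> by (intro divide_right_mono) auto
   then have "\<bar>q \<mu> T r\<bar> <= 1 * (Cq \<mu> / (1 + r^2))" using q_tail[OF T \<mu> True] tail_to_dominating[OF \<mu> True] by linarith
   also have "... <= (1 + 2 * \<mu> / (2 * T)) * (Cq \<mu> / (1 + r^2))" using C T \<mu> by (intro mult_right_mono) auto
   finally show ?thesis .
  next
   case False
   have k: "2 * T <= Kf \<mu> T (r^2)" by (rule Kf_bounds[OF T(1)])
   have "r^2 / Kf \<mu> T (r^2) <= 2 * \<mu> / (2 * T)" using k T \<mu> False by (intro frac_le) auto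
   moreover have "0 <= r^2 / Kf \<mu> T (r^2)" using k T by simp
   moreover have "\<bar>a - 1\<bar> <= 1 + b" if "0 <= a" "a <= b" for a b :: real using that by linarith
   ultimately have "\<bar>q \<mu> T r\<bar> <= (1 + 2 * \<mu> / (2 * T)) * 1" unfolding q_def by simp
   also have "... <= (1 + 2 * \<mu> / (2 * T)) * (Cq \<mu> / (1 + r^2))"
    using head_to_dominating[OF \<mu>, of r] False T \<mu> by (intro mult_left_mono) auto
   finally show ?thesis .
  qed
  then have "\<bar>q \<mu> T r\<bar> <= (1 + 2 * \<mu> / (2 * T)) * Cq \<mu> / (1 + r^2)" by (simp only: times_divide_eq_right)
  then show "norm (q \<mu> T r) <= norm ((1 + 2 * \<mu> / (2 * T)) * Cq \<mu> / (1 + r^2))"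
   unfolding real_norm_def using abs_ge_self by (rule order_trans)
 qed
qed

lemma m_mu_eq:
 assumes T: "0 < T" "T <= 1" and \<mu>: "\<mu> > 0"
 shows "m_mu \<mu> T = (LINT r|ray. q \<mu> T r)"
proof -
 define F where "F r = 1 / Kf \<mu> T (r^2) - 1 / r^2" for r
 have [measurable]: "F \<in> borel_measurable borel" unfolding F_def[abs_def] using T by measurable
 have Fq: "r^2 * F r = q \<mu> T r" if "r > 0" for r using that by (simp add: F_def q_def right_diff_distrib)
 have f: "1 / K_symbol \<mu> T p - 1 / (p \<bullet> p) = F (norm p)" for p by (simp add: K_symbol_eq F_def power2_norm_eq_inner)
 have "nn_integral lborel (%p. ennreal \<bar>F (norm (p::real^3))\<bar>) = ennreal (4 * pi) * nn_integral lborel (%r. ennreal (r^2 * \<bar>F r\<bar>) * indicator {0<..} r)"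
  by (rule nn_integral_radial_const) auto
 also have "nn_integral lborel (%r. ennreal (r^2 * \<bar>F r\<bar>) * indicator {0<..} r) = nn_integral ray (%r. ennreal (norm (q \<mu> T r)))"
  using T by (subst nn_integral_ray) (auto intro!: nn_integral_cong simp: Fq[symmetric] abs_mult split: split_indicator)
 finally have e: "nn_integral lborel (%p. ennreal \<bar>F (norm (p::real^3))\<bar>) = ennreal (4 * pi) * nn_integral ray (%r. ennreal (norm (q \<mu> T r)))" .
 have "nn_integral ray (%r. ennreal (norm (q \<mu> T r))) < \<infinity>" using q_integrable[OF T \<mu>] unfolding integrable_iff_bounded by simp
 then have "nn_integral lborel (%p. ennreal (norm (F (norm (p::real^3))))) < \<infinity>"
  unfolding real_norm_def e by (simp add: ennreal_mult_less_top)
 then have i: "integrable lborel (%p::real^3. F (norm p))" by (intro integrableI_bounded) auto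
 have "(LINT p|leb. (1 / K_symbol \<mu> T p - 1 / (p \<bullet> p))) = (LINT p|lborel. F (norm (p::real^3)))"
  unfolding f by (rule integral_completion) simp
 also have "... = (LINT r|radial_measure. (LINT \<omega>|sph. F (norm (r *\<^sub>R (\<omega>::real^3)))))" by (rule integral_polar(1)[OF i])
 also have "... = (LINT r|radial_measure. 4 * pi * F \<bar>r\<bar>)"
 proof (intro Bochner_Integration.integral_cong refl)
  fix r
  have "(LINT \<omega>|sph. F (norm (r *\<^sub>R (\<omega>::real^3)))) = (LINT \<omega>|sph. F \<bar>r\<bar>)" by (intro Bochner_Integration.integral_cong) auto
  then show "(LINT \<omega>|sph. F (norm (r *\<^sub>R (\<omega>::real^3)))) = 4 * pi * F \<bar>r\<bar>" by (simp add: measure_sphere)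
 qed
 also have "... = (LINT r|ray. r^2 *\<^sub>R (4 * pi * F \<bar>r\<bar>))" by (rule integral_radial_ray(2)) measurable
 also have "... = (LINT r|ray. 4 * pi * q \<mu> T r)"
  using T AE_ray_pos[of 0] by (intro integral_cong_AE) (auto elim!: eventually_mono simp: Fq[symmetric])
 finally show ?thesis unfolding m_mu_def by simp
qed

section \<open>Low-temperature asymptotics of \<open>m\<^sub>\<mu>\<close>\<close>

lemma integral_Icc_FTC:
 fixes F f :: "real => real"
 assumes ab: "a <= b" and d: "!!x. a <= x ==> x <= b ==> (F has_real_derivative f x) (at x)" and c: "continuous_on {a..b} f"
 shows "integrable lborel (%x. indicator {a..b} x * f x)" "(LINT x|lborel. indicator {a..b} x * f x) = F b - F a"
proof -
 show "integrable lborel (%x. indicator {a..b} x * f x)"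
  using borel_integrable_atLeastAtMost'[OF c] by (simp add: set_integrable_def)
 have "(f has_integral F b - F a) {a..b}" using ab d by (intro fundamental_theorem_of_calculus)
   (auto simp: has_real_derivative_iff_has_vector_derivative[symmetric] intro: has_field_derivative_at_within)
 then show "(LINT x|lborel. indicator {a..b} x * f x) = F b - F a"
  using set_borel_integral_eq_integral(2)[OF borel_integrable_atLeastAtMost'[OF c]]
  by (simp add: set_lebesgue_integral_def integral_unique)
qed

lemma tanh_quot_integral_symmetric:
 assumes "B >= 0"
 shows "integral {- B..B} tanh_quot = 2 * tanh_int B"
proof -
 have "integral {- B..0} (%x. tanh_quot (- x)) = integral {0..B} tanh_quot"
  using Henstock_Kurzweil_Integration.integral_reflect_real[of B 0 tanh_quot] by simp
 moreover have "tanh_quot (- x) = tanh_quot x" for x by (simp add: tanh_quot_def)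
 ultimately show ?thesis using Henstock_Kurzweil_Integration.integral_combine[of "- B" 0 B tanh_quot] assms tanh_quot_integrable
  by (simp add: tanh_int_def)
qed

text \<open>Substituting (r^2 - \<mu>)/(2T) maps [0, sqrt (2 \<mu>)] onto an interval symmetric
  about 0 and turns the integrand into \<open>tanh_quot\<close>; this is why the cut is made at sqrt
  (2 \<mu>).\<close>

lemma resonant_integral:
 assumes T: "T > 0" and \<mu>: "\<mu> > 0"
 shows "(LINT r|lborel. indicator {0..sqrt (2 * \<mu>)} r * (r / Kf \<mu> T (r^2))) = tanh_int (\<mu> / (2 * T))"
  and "integrable lborel (%r. indicator {0..sqrt (2 * \<mu>)} r * (r / Kf \<mu> T (r^2)))"
proof -
 define b where "b = sqrt (2 * \<mu>)"
 have b: "b >= 0" "b^2 = 2 * \<mu>" using \<mu> by (auto simp: b_def)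
 define g where "g r = (r^2 - \<mu>) / (2 * T)" for r
 have g: "g 0 = - (\<mu> / (2 * T))" "g b = \<mu> / (2 * T)" using b by (auto simp: g_def)
 have B: "\<mu> / (2 * T) >= 0" using \<mu> T by simp
 have e: "r / Kf \<mu> T (r^2) = (1 / 2) * ((r / T) *\<^sub>R tanh_quot (g r))" for r
 proof -
  have "r / Kf \<mu> T (r^2) = r * (1 / Kf \<mu> T (r^2))" by simp
  also have "... = (1 / 2) * ((r / T) *\<^sub>R tanh_quot (g r))" by (simp only: Kf_tanh_quot[OF T] g_def) simp
  finally show ?thesis .
 qed
 have "((%r. (r / T) *\<^sub>R tanh_quot (g r)) has_integral integral {g 0..g b} tanh_quot) {0..b}"
 proof (rule has_integral_substitution[where c = "g 0" and d = "g b"])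
  show "g ` {0..b} \<subseteq> {g 0..g b}"
  proof -
   have "- \<mu> / (2 * T) <= g x" "g x <= g b" if "0 <= x" "x <= b" for x
    unfolding g_def using T that by (auto intro!: divide_right_mono power_mono simp del: divide_minus_left minus_divide_left)
   then show ?thesis unfolding g(1) by auto
  qed
  show "(g has_real_derivative r / T) (at r within {0..b})" for r
   unfolding g_def using T by (auto intro!: derivative_eq_intros simp: field_simps)
 qed (use b B g continuous_tanh_quot in auto)
 also have "integral {g 0..g b} tanh_quot = 2 * tanh_int (\<mu> / (2 * T))" unfolding g by (rule tanh_quot_integral_symmetric[OF B])
 finally have "((%r. r / Kf \<mu> T (r^2)) has_integral (1 / 2) * (2 * tanh_int (\<mu> / (2 * T)))) {0..b}"
  unfolding e by (rule has_integral_mult_right)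
 then have hi: "integral {0..b} (%r. r / Kf \<mu> T (r^2)) = tanh_int (\<mu> / (2 * T))" by (simp add: integral_unique)
 have "continuous_on {0..b} (%r. r * (1 / Kf \<mu> T (r^2)))"
  by (intro continuous_intros continuous_on_compose2[OF Kf_inverse_continuous[OF T]]) auto
 then have c: "continuous_on {0..b} (%r. r / Kf \<mu> T (r^2))" by simp
 show "integrable lborel (%r. indicator {0..sqrt (2 * \<mu>)} r * (r / Kf \<mu> T (r^2)))"
  using borel_integrable_atLeastAtMost'[OF c] by (simp add: set_integrable_def b_def)
 show "(LINT r|lborel. indicator {0..sqrt (2 * \<mu>)} r * (r / Kf \<mu> T (r^2))) = tanh_int (\<mu> / (2 * T))"
  using set_borel_integral_eq_integral(2)[OF borel_integrable_atLeastAtMost'[OF c]] hi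
  by (simp add: set_lebesgue_integral_def b_def)
qed

text \<open>r^2 and r sqrt \<mu> agree on the Fermi sphere, so the subtracted term carries the whole
  logarithmic singularity and the remainder stays dominated as T -> 0.\<close>

definition hreg :: "real => real => real => real" where
 "hreg \<mu> T r = q \<mu> T r - sqrt \<mu> * (indicator {0..sqrt (2 * \<mu>)} r * (r / Kf \<mu> T (r^2)))"

definition hreg0 :: "real => real => real" where
 "hreg0 \<mu> r = q0 \<mu> r - sqrt \<mu> * (indicator {0..sqrt (2 * \<mu>)} r * (r / \<bar>r^2 - \<mu>\<bar>))"

text \<open>Elementary primitives on [0, a], [a, s a] and [s a, infinity) with a = sqrt \<mu> and s
  = sqrt 2. The terms in ln(s + 1) cancel because (s + 1)(s - 1) = 1.\<close>

lemma hreg0_integral: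
 assumes \<mu>: "\<mu> > 0"
 shows "(LINT r|ray. hreg0 \<mu> r) = sqrt \<mu> * (2 * ln 2 - 2)"
proof -
 define a where "a = sqrt \<mu>"
 define s where "s = sqrt (2::real)"
 have a: "a > 0" "\<mu> = a^2" using \<mu> by (auto simp: a_def)
 have s: "s > 1" "s^2 = 2" by (auto simp: s_def)
 have b: "sqrt (2 * \<mu>) = s * a" by (simp add: s_def a_def real_sqrt_mult)
 have sa: "a < s * a" using a s by simp
 let ?f1 = "%r. - r / (r + a) - 1" and ?f2 = "%r. r / (r + a) - 1" and ?f3 = "%r. a^2 / (r^2 - a^2)"
 let ?F1 = "%r. a * ln (r + a) - 2 * r" and ?F2 = "%r. - a * ln (r + a)"
 have 1: "integrable lborel (%r. indicator {0..a} r * ?f1 r)" "(LINT r|lborel. indicator {0..a} r * ?f1 r) = ?F1 a - ?F1 0"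
 proof -
  have "(?F1 has_real_derivative ?f1 r) (at r)" if "0 <= r" for r
   using a that by (auto intro!: derivative_eq_intros) (simp add: divide_simps)
  moreover have "continuous_on {0..a} ?f1" using a by (intro continuous_intros) auto
  ultimately show "integrable lborel (%r. indicator {0..a} r * ?f1 r)" "(LINT r|lborel. indicator {0..a} r * ?f1 r) = ?F1 a - ?F1 0"
   using a by (intro integral_Icc_FTC[where F = ?F1]; simp)+
 qed
 have 2: "integrable lborel (%r. indicator {a..s * a} r * ?f2 r)" "(LINT r|lborel. indicator {a..s * a} r * ?f2 r) = ?F2 (s * a) - ?F2 a"
 proof -
  have "(?F2 has_real_derivative ?f2 r) (at r)" if "a <= r" for r
   using a that by (auto intro!: derivative_eq_intros) (simp add: divide_simps)
  moreover have "continuous_on {a..s * a} ?f2" using a by (intro continuous_intros) auto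
  ultimately show "integrable lborel (%r. indicator {a..s * a} r * ?f2 r)" "(LINT r|lborel. indicator {a..s * a} r * ?f2 r) = ?F2 (s * a) - ?F2 a"
   using a sa by (intro integral_Icc_FTC[where F = ?F2]; simp)+
 qed
 have 3: "has_bochner_integral lborel (%r. indicator {s * a..} r * ?f3 r) (a / 2 * ln ((s + 1) / (s - 1)))"
 proof (rule has_bochner_integral_nn_integral)
  have "nn_integral lborel (%r. ennreal (indicator {s * a..} r * ?f3 r)) = nn_integral lborel (%r. ennreal (?f3 r) * indicator {s * a..} r)"
   by (intro nn_integral_cong) (auto split: split_indicator)
  also have "... = ennreal (0 - a / 2 * (ln (s * a - a) - ln (s * a + a)))"
  proof (rule nn_integral_FTC_atLeast)
   fix r assume "s * a <= r"
   then have r: "r > a" using sa by linarith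
   then have nz: "r^2 - a^2 = (r - a) * (r + a)" by (simp add: power2_eq_square algebra_simps)
   show "((%r. a / 2 * (ln (r - a) - ln (r + a))) has_real_derivative ?f3 r) (at r)"
    unfolding nz using r a by (auto intro!: derivative_eq_intros) (simp add: diff_frac_eq power2_eq_square)
   show "0 <= ?f3 r" unfolding nz using r a by simp
  next
   show "((%r. a / 2 * (ln (r - a) - ln (r + a))) \<longlongrightarrow> 0) at_top" using a by real_asymp
  qed auto
  also have "0 - a / 2 * (ln (s * a - a) - ln (s * a + a)) = a / 2 * ln ((s + 1) / (s - 1))"
  proof -
   have "s * a - a = (s - 1) * a" "s * a + a = (s + 1) * a" by (simp_all add: algebra_simps)
   moreover have "ln ((s - 1) * a) = ln (s - 1) + ln a" "ln ((s + 1) * a) = ln (s + 1) + ln a"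
    "ln ((s + 1) / (s - 1)) = ln (s + 1) - ln (s - 1)" using a s by (simp_all add: ln_mult_pos ln_divide_pos)
   ultimately show ?thesis by (simp only:) (simp add: algebra_simps)
  qed
  finally show "nn_integral lborel (%r. ennreal (indicator {s * a..} r * ?f3 r)) = ennreal (a / 2 * ln ((s + 1) / (s - 1)))" .
  have "1 <= (s + 1) / (s - 1)" using s by simp
  then show "0 <= a / 2 * ln ((s + 1) / (s - 1))" using a by simp
  show "AE r in lborel. 0 <= indicator {s * a..} r * ?f3 r"
   using a less_le_trans[OF sa] by (intro AE_I2) (auto split: split_indicator simp: less_imp_le power_mono)
 qed auto
 have [measurable]: "hreg0 \<mu> \<in> borel_measurable borel" unfolding hreg0_def[abs_def] by measurable
 have "(LINT r|ray. hreg0 \<mu> r) = (LINT r|lborel. indicator {0<..} r *\<^sub>R hreg0 \<mu> r)" by (rule ray_integrable_lborel(2)) measurable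
 also have "... = (LINT r|lborel. (indicator {0..a} r * ?f1 r + indicator {a..s * a} r * ?f2 r) + indicator {s * a..} r * ?f3 r)"
 proof (rule integral_cong_AE)
  show "AE r in lborel. indicator {0<..} r *\<^sub>R hreg0 \<mu> r = (indicator {0..a} r * ?f1 r + indicator {a..s * a} r * ?f2 r) + indicator {s * a..} r * ?f3 r"
   using AE_lborel_singleton[of a] AE_lborel_singleton[of "0::real"] AE_lborel_singleton[of "s * a"]
  proof eventually_elim
   case (elim r)
   have nz: "r^2 - a^2 = (r - a) * (r + a)" by (simp add: power2_eq_square algebra_simps)
   have h: "hreg0 \<mu> r = r^2 / (\<bar>r - a\<bar> * (r + a)) - 1 - a * (indicator {0..s * a} r * (r / (\<bar>r - a\<bar> * (r + a))))" if "r > 0"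
    unfolding hreg0_def q0_def b unfolding a(2) nz using a that by (simp add: abs_mult)
   consider "r < 0" | "0 < r" "r < a" | "a < r" "r < s * a" | "s * a < r" using elim by linarith
   then show ?case
   proof cases
    case 1
    then have "r < s * a" "r < a" using a sa by linarith+
    then show ?thesis using 1 by simp
   next
    case 2
    then have "r \<in> {0..s * a}" using less_trans[OF 2(2) sa] by simp
    with 2 have "hreg0 \<mu> r = r * (r - a) / ((a - r) * (r + a)) - 1"
     using sa by (simp add: h power2_eq_square diff_divide_distrib right_diff_distrib mult_ac)
    also have "... = ?f1 r" using 2 a by (simp add: divide_simps) (simp add: algebra_simps)
    finally show ?thesis using 2 less_trans[OF 2(2) sa] by simp
   next
    case 3
    then have "r \<in> {0..s * a}" using a by auto
    with 3 a(1) have "hreg0 \<mu> r = r * (r - a) / ((r - a) * (r + a)) - 1"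
     by (simp add: h power2_eq_square diff_divide_distrib right_diff_distrib mult_ac)
    also have "... = ?f2 r" using 3 by simp
    finally show ?thesis using 3 a by simp
   next
    case 4
    then have r: "a < r" "0 < r" using sa a by linarith+
    then have "hreg0 \<mu> r = r^2 / (r^2 - a^2) - 1" using 4 by (simp add: h nz)
    moreover have "r^2 - a^2 ~= 0" unfolding nz using r a(1) by simp
    ultimately have "hreg0 \<mu> r = ?f3 r" by (simp add: divide_simps)
    then show ?thesis using 4 r by simp
   qed
  qed
 qed (use a in measurable)
 also have "... = (?F1 a - ?F1 0) + (?F2 (s * a) - ?F2 a) + a / 2 * ln ((s + 1) / (s - 1))"
  using 1 2 3 by (simp add: has_bochner_integral_iff)
 also have "... = a * (2 * ln 2 - 2)"
 proof -
  have "ln (a + a) = ln 2 + ln a" using a ln_mult_pos[of 2 a] by (simp add: mult_2[symmetric])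
  moreover have "ln (s * a + a) = ln (s + 1) + ln a" using a s ln_mult_pos[of "s + 1" a] by (simp add: algebra_simps)
  moreover have "ln ((s + 1) / (s - 1)) = 2 * ln (s + 1)"
  proof -
   have "(s + 1) * (s - 1) = 1" using s by (simp add: power2_eq_square algebra_simps)
   then have "(s + 1) / (s - 1) = (s + 1)^2" using s by (simp add: divide_eq_eq power2_eq_square mult.assoc)
   then show ?thesis using s by (simp add: ln_realpow)
  qed
  ultimately show ?thesis by (simp add: algebra_simps)
 qed
 finally show ?thesis unfolding a_def .
qed

text \<open>In units of sqrt \<mu>, \<open>tanh_int\<close> at \<mu>/(2T) supplies ln(\<mu>/(2T)) +
  ln(4/pi) + \<gamma> and the regular remainder supplies 2 ln 2 - 2; two ln 2 turn \<mu>/(2T) into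
  \<mu>/T and 4/pi into 8/pi.\<close>

theorem m_mu_asymptotics:
 assumes \<mu>: "\<mu> > 0"
 shows "((%T. m_mu \<mu> T - sqrt \<mu> * (ln (\<mu> / T) + (euler_mascheroni - 2 + ln (8 / pi)))) \<longlongrightarrow> 0) (at_right 0)"
proof -
 have ind: "indicator {0<..} r *\<^sub>R (indicator {0..sqrt (2 * \<mu>)} r * (r / k)) = indicator {0..sqrt (2 * \<mu>)} r * (r / k)" for r k :: real
  by (auto split: split_indicator)
 have m: "m_mu \<mu> T - sqrt \<mu> * tanh_int (\<mu> / (2 * T)) = (LINT r|ray. hreg \<mu> T r)" if T: "0 < T" "T <= 1" for T
 proof -
  have [measurable]: "(%r. indicator {0..sqrt (2 * \<mu>)} r * (r / Kf \<mu> T (r^2))) \<in> borel_measurable borel" using T by measurable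
  have "integrable ray (%r. indicator {0..sqrt (2 * \<mu>)} r * (r / Kf \<mu> T (r^2)))"
   "(LINT r|ray. indicator {0..sqrt (2 * \<mu>)} r * (r / Kf \<mu> T (r^2))) = tanh_int (\<mu> / (2 * T))"
   using resonant_integral[OF T(1) \<mu>] by (simp_all only: ray_integrable_lborel[OF \<open>_ \<in> _\<close>] ind)
  then show ?thesis unfolding hreg_def m_mu_eq[OF T \<mu>] using q_integrable[OF T \<mu>] by (simp del: times_divide_eq_right)
 qed
 have lim: "((%T. m_mu \<mu> T - sqrt \<mu> * tanh_int (\<mu> / (2 * T))) \<longlongrightarrow> sqrt \<mu> * (2 * ln 2 - 2)) (at_right 0)"
 proof (rule tendsto_at_right_sequentially[of 0 1])
  fix S :: "nat => real" assume S: "!!n. 0 < S n" "!!n. S n < 1" "S \<longlonglongrightarrow> 0"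
  have "(%n. LINT r|ray. hreg \<mu> (S n) r) \<longlonglongrightarrow> (LINT r|ray. hreg0 \<mu> r)"
  proof (rule integral_dominated_convergence[OF _ _ ray_dominating[of "Cq \<mu>"]])
   show "hreg0 \<mu> \<in> borel_measurable ray" unfolding hreg0_def[abs_def] by measurable
   show "hreg \<mu> (S n) \<in> borel_measurable ray" for n unfolding hreg_def[abs_def] using S(1)[of n] by measurable
   show "AE r in ray. (%n. hreg \<mu> (S n) r) \<longlonglongrightarrow> hreg0 \<mu> r" using AE_ray_sqrt[OF \<mu>]
    by eventually_elim (auto simp: hreg_def hreg0_def intro!: tendsto_intros q_tendsto Kf_tendsto S)
   show "AE r in ray. norm (hreg \<mu> (S n) r) <= Cq \<mu> / (1 + r^2)" for n using AE_ray_sqrt[OF \<mu>]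
   proof eventually_elim
    case (elim r)
    have T: "0 < S n" "S n <= 1" using S(1,2)[of n] by auto
    show ?case
    proof (cases "r <= sqrt (2 * \<mu>)")
     case True
     have r2: "r^2 <= 2 * \<mu>" using True elim \<mu> by (metis less_imp_le real_sqrt_le_iff real_sqrt_unique)
     define k where "k = Kf \<mu> (S n) (r^2)"
     have k: "\<bar>r^2 - \<mu>\<bar> <= k" "k > 0" unfolding k_def using Kf_bounds(1)[OF T(1)] Kf_pos[OF T(1)] by auto
     \<comment> \<open>Below the cut \<open>hreg\<close> equals r (r - sqrt \<mu>)/K_T - 1, and the
       numerator is at most |r^2 - \<mu>| in modulus, hence at most K_T.\<close>
     have "\<bar>r^2 - \<mu>\<bar> = \<bar>r - sqrt \<mu>\<bar> * (r + sqrt \<mu>)"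
     proof -
      have "r^2 - \<mu> = (r - sqrt \<mu>) * (r + sqrt \<mu>)" using \<mu> by (simp add: algebra_simps power2_eq_square)
      then show ?thesis using elim \<mu> by (simp add: abs_mult)
     qed
     moreover have "\<bar>r - sqrt \<mu>\<bar> * r <= \<bar>r - sqrt \<mu>\<bar> * (r + sqrt \<mu>)" using \<mu> by (intro mult_left_mono) auto
     moreover have "\<bar>r * (r - sqrt \<mu>)\<bar> = \<bar>r - sqrt \<mu>\<bar> * r" using elim by (simp add: abs_mult)
     ultimately have "\<bar>r * (r - sqrt \<mu>)\<bar> <= k" using k by linarith
     then have "- 1 <= r * (r - sqrt \<mu>) / k & r * (r - sqrt \<mu>) / k <= 1" using k by (simp add: abs_le_iff pos_divide_le_eq pos_le_divide_eq)
     moreover have "hreg \<mu> (S n) r = r * (r - sqrt \<mu>) / k - 1"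
      using True elim by (simp add: hreg_def q_def k_def power2_eq_square right_diff_distrib diff_divide_distrib)
     ultimately have "norm (hreg \<mu> (S n) r) <= 5" unfolding real_norm_def by linarith
     then show ?thesis using head_to_dominating[OF \<mu> r2] by linarith
    next
     case False
     then have r2: "2 * \<mu> <= r^2" using sqrt_le_D[of "2 * \<mu>" r] by simp
     have "2 * (\<mu> + 2) / r^2 <= 4 * (\<mu> + 2) / r^2" using \<mu> by (intro divide_right_mono) auto
     then show ?thesis using q_tail[OF T \<mu> r2] tail_to_dominating[OF \<mu> r2] False by (simp add: hreg_def)
    qed
   qed
  qed
  then show "(%n. m_mu \<mu> (S n) - sqrt \<mu> * tanh_int (\<mu> / (2 * S n))) \<longlonglongrightarrow> sqrt \<mu> * (2 * ln 2 - 2)"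
   using m[OF S(1) less_imp_le[OF S(2)]] by (simp add: hreg0_integral[OF \<mu>])
 qed simp
 have "filterlim (%T. \<mu> / (2 * T)) at_top (at_right 0)" using \<mu> by real_asymp
 from tendsto_mult_left[OF filterlim_compose[OF tanh_int_asymptotics this], of "sqrt \<mu>"]
 have "((%T. m_mu \<mu> T - sqrt \<mu> * tanh_int (\<mu> / (2 * T)) + sqrt \<mu> * (tanh_int (\<mu> / (2 * T)) - ln (\<mu> / (2 * T))))
   \<longlongrightarrow> sqrt \<mu> * (2 * ln 2 - 2) + sqrt \<mu> * (ln (4 / pi) + euler_mascheroni)) (at_right 0)" by (rule tendsto_add[OF lim])
 then have "((%T. (m_mu \<mu> T - sqrt \<mu> * tanh_int (\<mu> / (2 * T)) + sqrt \<mu> * (tanh_int (\<mu> / (2 * T)) - ln (\<mu> / (2 * T))))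
   - (sqrt \<mu> * (2 * ln 2 - 2) + sqrt \<mu> * (ln (4 / pi) + euler_mascheroni))) \<longlongrightarrow> 0) (at_right 0)" by (rule LIM_zero)
 moreover have "\<forall>\<^sub>F T in at_right 0. (m_mu \<mu> T - sqrt \<mu> * tanh_int (\<mu> / (2 * T)) + sqrt \<mu> * (tanh_int (\<mu> / (2 * T)) - ln (\<mu> / (2 * T))))
   - (sqrt \<mu> * (2 * ln 2 - 2) + sqrt \<mu> * (ln (4 / pi) + euler_mascheroni))
   = m_mu \<mu> T - sqrt \<mu> * (ln (\<mu> / T) + (euler_mascheroni - 2 + ln (8 / pi)))" using eventually_at_right_less[of 0]
 proof eventually_elim
  case (elim T)
  have "ln (\<mu> / T) = ln 2 + ln (\<mu> / (2 * T))" "ln (8 / pi) = ln 2 + ln (4 / pi)"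
   using elim \<mu> ln_mult_pos[of 2 "\<mu> / (2 * T)"] ln_mult_pos[of 2 "4 / pi"] by simp_all
  then show ?case by (simp only:) (simp add: algebra_simps)
 qed
 ultimately show ?thesis by (rule Lim_transform_eventually)
qed

section \<open>Separation of the singularity on the Fermi sphere\<close>

definition corr :: "(real^3 => complex) => (real^3 => complex) => real => complex" where
 "corr g h r = (LINT \<omega>|sph. cnj (fourier g (r *\<^sub>R \<omega>)) * fourier h (r *\<^sub>R \<omega>))"

text \<open>By Fubini and \<open>sphere_fourier\<close> the radius enters only through sinc(|r| |x -
  y|), so the regularity of the correlation in r is that of sinc and asks for no moments of g and
  h.\<close>

lemma corr_eq:
 assumes g: "integrable leb g" and h: "integrable leb h"
 shows "corr g h r = of_real (4 * pi * (ft_const * ft_const)) *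
   (LINT z|(leb \<Otimes>\<^sub>M leb). cnj (g (fst z)) * h (snd z) * of_real (sinc (\<bar>r\<bar> * norm (fst z - snd z))))"
  and "integrable (leb \<Otimes>\<^sub>M leb) (%z. cnj (g (fst z)) * h (snd z) * of_real (sinc (\<bar>r\<bar> * norm (fst z - snd z))))"
proof -
 let ?c = "complex_of_real ft_const"
 have cg: "integrable leb (%x. cnj (g x))" using g by simp
 have hs: "(%\<omega>. fourier h (r *\<^sub>R \<omega>)) \<in> borel_measurable sph"
  by (intro continuous_measurable_sphere continuous_on_compose2[OF fourier_continuous[OF h]] continuous_intros) auto
 have hi: "integrable sph (%\<omega>. fourier h (r *\<^sub>R \<omega>))" by (rule sphere_bounded_integrable[OF hs fourier_bound[OF h]])
 have ei: "integrable sph (%\<omega>. exp (\<i> * of_real (r * (x \<bullet> \<omega>))))" for x :: "real^3"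
  by (rule sphere_bounded_integrable[where C = 1]) (auto intro!: continuous_measurable_sphere continuous_intros)
 have cf: "cnj (fourier g p) = ?c * (LINT x|leb. cnj (g x) * exp (\<i> * of_real (p \<bullet> x)))" for p
  unfolding fourier_eq by (simp add: Bochner_Integration.integral_cnj[symmetric] exp_cnj)
 have k: "(LINT \<omega>|sph. fourier h (r *\<^sub>R \<omega>) * exp (\<i> * of_real (r * (x \<bullet> \<omega>))))
   = ?c * (LINT y|leb. h y * of_real (4 * pi * sinc (\<bar>r\<bar> * norm (x - y))))" for x
 proof -
  have "(LINT \<omega>|sph. fourier h (r *\<^sub>R \<omega>) * exp (\<i> * of_real (r * (x \<bullet> \<omega>))))
    = ?c * (LINT \<omega>|sph. exp (\<i> * of_real (r * (x \<bullet> \<omega>))) * (LINT y|leb. h y * exp (- \<i> * of_real (r * (y \<bullet> \<omega>)))))"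
   unfolding fourier_eq by (subst integral_mult_right_zero[symmetric]) (simp add: inner_commute mult_ac)
  also have "(LINT \<omega>|sph. exp (\<i> * of_real (r * (x \<bullet> \<omega>))) * (LINT y|leb. h y * exp (- \<i> * of_real (r * (y \<bullet> \<omega>)))))
    = (LINT y|leb. h y * (LINT \<omega>|sph. exp (\<i> * of_real (r * (x \<bullet> \<omega>))) * exp (- \<i> * of_real (r * (y \<bullet> \<omega>)))))"
  proof (rule leb_sphere.kernel_Fubini[OF h ei, symmetric, where C = 1])
   show "(%(y, \<omega>). exp (- \<i> * complex_of_real (r * (y \<bullet> \<omega>)))) \<in> borel_measurable (leb \<Otimes>\<^sub>M sph)"
    unfolding case_prod_beta by (intro continuous_pair_measurable_sphere continuous_intros)
  qed simp
  also have "... = (LINT y|leb. h y * of_real (4 * pi * sinc (\<bar>r\<bar> * norm (x - y))))"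
  proof -
   have "(LINT \<omega>|sph. exp (\<i> * of_real (r * (x \<bullet> \<omega>))) * exp (- \<i> * of_real (r * (y \<bullet> \<omega>))))
     = of_real (4 * pi * sinc (\<bar>r\<bar> * norm (x - y)))" for y using sphere_fourier[of "r *\<^sub>R (x - y)"]
    by (simp add: exp_add[symmetric] inner_diff_left right_diff_distrib)
   then show ?thesis by simp
  qed
  finally show ?thesis .
 qed
 have 1: "corr g h r = ?c * (LINT \<omega>|sph. fourier h (r *\<^sub>R \<omega>) * (LINT x|leb. cnj (g x) * exp (\<i> * of_real (r * (x \<bullet> \<omega>)))))"
  unfolding corr_def cf by (subst integral_mult_right_zero[symmetric]) (simp add: inner_commute mult_ac)
 have 2: "(LINT \<omega>|sph. fourier h (r *\<^sub>R \<omega>) * (LINT x|leb. cnj (g x) * exp (\<i> * of_real (r * (x \<bullet> \<omega>)))))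
   = (LINT x|leb. cnj (g x) * (LINT \<omega>|sph. fourier h (r *\<^sub>R \<omega>) * exp (\<i> * of_real (r * (x \<bullet> \<omega>)))))"
 proof (rule leb_sphere.kernel_Fubini[OF cg hi, symmetric, where C = 1])
  show "(%(x, \<omega>). exp (\<i> * complex_of_real (r * (x \<bullet> \<omega>)))) \<in> borel_measurable (leb \<Otimes>\<^sub>M sph)"
   unfolding case_prod_beta by (intro continuous_pair_measurable_sphere continuous_intros)
 qed simp
 have 3: "(LINT x|leb. cnj (g x) * (LINT \<omega>|sph. fourier h (r *\<^sub>R \<omega>) * exp (\<i> * of_real (r * (x \<bullet> \<omega>))))) = (LINT x|leb. (?c * of_real (4 * pi)) * (LINT y|leb. cnj (g x) * h y * of_real (sinc (\<bar>r\<bar> * norm (x - y)))))"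
 proof (rule Bochner_Integration.integral_cong[OF refl])
  fix x
  show "cnj (g x) * (LINT \<omega>|sph. fourier h (r *\<^sub>R \<omega>) * exp (\<i> * of_real (r * (x \<bullet> \<omega>))))
   = (?c * of_real (4 * pi)) * (LINT y|leb. cnj (g x) * h y * of_real (sinc (\<bar>r\<bar> * norm (x - y))))"
   unfolding k by (subst (1 2) integral_mult_right_zero[symmetric])
    (subst integral_mult_right_zero[symmetric], simp add: mult_ac)
 qed
 have i: "integrable (leb \<Otimes>\<^sub>M leb) (%(x, y). cnj (g x) * h y * complex_of_real (sinc (\<bar>r\<bar> * norm (x - y))))"
 proof (rule leb2.integrable_kernel[OF cg h, where C = 1])
  show "(%(x, y). complex_of_real (sinc (\<bar>r\<bar> * norm (x - y)))) \<in> borel_measurable (leb \<Otimes>\<^sub>M leb)" unfolding case_prod_beta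
   by (intro continuous_pair_measurable continuous_on_of_real continuous_on_compose2[OF continuous_on_sinc[OF continuous_on_id]] continuous_intros) auto
 qed (simp only: norm_of_real abs_sinc_le_1)
 have J: "(LINT x|leb. (LINT y|leb. cnj (g x) * h y * complex_of_real (sinc (\<bar>r\<bar> * norm (x - y)))))
   = (LINT z|(leb \<Otimes>\<^sub>M leb). cnj (g (fst z)) * h (snd z) * of_real (sinc (\<bar>r\<bar> * norm (fst z - snd z))))"
  using leb2.integral_fst'[OF i] unfolding case_prod_beta fst_conv snd_conv .
 show "corr g h r = of_real (4 * pi * (ft_const * ft_const)) *
   (LINT z|(leb \<Otimes>\<^sub>M leb). cnj (g (fst z)) * h (snd z) * of_real (sinc (\<bar>r\<bar> * norm (fst z - snd z))))"
  unfolding 1 2 3 integral_mult_right_zero J by (simp only: of_real_mult mult_ac)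
 show "integrable (leb \<Otimes>\<^sub>M leb) (%z. cnj (g (fst z)) * h (snd z) * of_real (sinc (\<bar>r\<bar> * norm (fst z - snd z))))"
  using i unfolding case_prod_beta .
qed

text \<open>Both bounds are those of the sinc kernel, integrated against |g(x)| |h(y)|; the minimum
  with 2 keeps the modulus of continuity bounded for distant radii.\<close>

lemma corr_bounds:
 assumes g: "integrable leb g" and h: "integrable leb h"
 defines "B == 4 * pi * (ft_const * ft_const) * ((LINT x|leb. cmod (g x)) * (LINT x|leb. cmod (h x)))"
 shows "cmod (corr g h r) <= B" and "0 < r ==> 0 < s ==> cmod (corr g h r - corr g h s) <= B * min 2 (2 * \<bar>ln (r / s)\<bar>)"
proof -
 let ?N = "leb \<Otimes>\<^sub>M leb :: ((real^3) \<times> (real^3)) measure"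
 define P where "P r z = cnj (g (fst z)) * h (snd z) * of_real (sinc (\<bar>r\<bar> * norm (fst z - snd z)))" for r z
 have P: "corr g h r = of_real (4 * pi * (ft_const * ft_const)) * (LINT z|?N. P r z)" "integrable ?N (P r)" for r
  using corr_eq[OF g h, of r] by (simp_all add: P_def[abs_def])
 have gh: "integrable ?N (%(x, y). cmod (g x) * cmod (h y))"
  using leb2.integrable_kernel[OF g h, of "%x y. 1" 1, THEN integrable_norm] unfolding case_prod_beta by (simp add: norm_mult)
 have e: "(LINT z|?N. cmod (g (fst z)) * cmod (h (snd z))) = (LINT x|leb. cmod (g x)) * (LINT x|leb. cmod (h x))"
  using leb2.integral_fst'[OF gh] unfolding case_prod_beta by simp
 have gi: "integrable ?N (%z. cmod (g (fst z)) * cmod (h (snd z)))" using gh unfolding case_prod_beta .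
 have bound: "cmod (of_real (4 * pi * (ft_const * ft_const)) * (LINT z|?N. F z)) <= B * L"
  if F: "integrable ?N F" "!!z. cmod (F z) <= cmod (g (fst z)) * cmod (h (snd z)) * L" for F L
 proof -
  have "cmod (LINT z|?N. F z) <= (LINT z|?N. cmod (F z))" by simp
  also have "... <= (LINT z|?N. cmod (g (fst z)) * cmod (h (snd z)) * L)" using F gi by (intro integral_mono) auto
  also have "... = (LINT x|leb. cmod (g x)) * (LINT x|leb. cmod (h x)) * L" using e by simp
  finally have "4 * pi * (ft_const * ft_const) * cmod (LINT z|?N. F z) <= 4 * pi * (ft_const * ft_const) * ((LINT x|leb. cmod (g x)) * (LINT x|leb. cmod (h x)) * L)"
   by (intro mult_left_mono) auto
  then show ?thesis by (simp add: B_def norm_mult mult_ac)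
 qed
 have "cmod (P r z) <= cmod (g (fst z)) * cmod (h (snd z)) * 1" for z
  unfolding P_def norm_mult complex_mod_cnj norm_of_real by (intro mult_left_mono abs_sinc_le_1) auto
 from bound[OF P(2) this] show "cmod (corr g h r) <= B" by (simp add: P(1))
 assume rs: "0 < r" "0 < s"
 have "cmod (P r z - P s z) <= cmod (g (fst z)) * cmod (h (snd z)) * min 2 (2 * \<bar>ln (r / s)\<bar>)" for z
 proof -
  let ?d = "norm (fst z - snd z)"
  have "P r z - P s z = cnj (g (fst z)) * h (snd z) * of_real (sinc (r * ?d) - sinc (s * ?d))"
   using rs by (simp add: P_def right_diff_distrib)
  moreover have "\<bar>sinc (r * ?d) - sinc (s * ?d)\<bar> <= min 2 (2 * \<bar>ln (r / s)\<bar>)"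
   using sinc_log_Lipschitz[OF rs, of ?d] abs_sinc_le_1[of "r * ?d"] abs_sinc_le_1[of "s * ?d"] by linarith
  ultimately show ?thesis by (simp add: norm_mult mult_left_mono del: of_real_diff)
 qed
 from bound[OF Bochner_Integration.integrable_diff[OF P(2) P(2)] this]
 show "cmod (corr g h r - corr g h s) <= B * min 2 (2 * \<bar>ln (r / s)\<bar>)" using P(2) by (simp add: P(1) right_diff_distrib)
qed

lemma le_of_square_le: "x * x <= c * x ==> 0 <= x ==> 0 <= c ==> x <= (c::real)" by (cases "x = 0") (auto simp: less_le)

section \<open>The weighted operators between L2 of space and L2 of the sphere\<close>

locale bcs = potential V for V +
 fixes \<mu> :: real
 assumes mu_pos: "\<mu> > 0"
begin

abbreviation "U == L2_space sph"
abbreviation "nU == L2_norm sph"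
abbreviation "iU == L2_inner sph"

text \<open>Combined with the weight |V|^(1/2), restriction to the Fermi sphere and its adjoint
  \<open>Fa\<close> become bounded maps between the two L2 spaces.\<close>

definition Ft :: "(real^3 => complex) => real^3 => complex" where
 "Ft w = frakF \<mu> (mulX w)"

definition Fa :: "(real^3 => complex) => real^3 => complex" where
 "Fa u = mulX (frakF_adj \<mu> u)"

text \<open>The sign in V = |V|^(1/2) sgn(V) |V|^(1/2); it is 0 where V vanishes.\<close>

definition Sg :: "(real^3 => complex) => real^3 => complex" where
 "Sg w x = of_real (sgn (V x)) * w x"

definition B0 :: real where "B0 = 4 * pi * (ft_const * ft_const) * V_norm^2"

lemma B0_nonneg: "0 <= B0" by (simp add: B0_def)

lemma corr_mulX:
 assumes w: "w \<in> H" "w' \<in> H"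
 shows "cmod (corr (mulX w) (mulX w') r) <= B0 * (nH w * nH w')"
  and "0 < r ==> cmod (corr (mulX w) (mulX w') r - corr (mulX w) (mulX w') (sqrt \<mu>)) <= B0 * (nH w * nH w') * Lq \<mu> r"
proof -
 let ?B = "4 * pi * (ft_const * ft_const) * ((LINT x|leb. cmod (mulX w x)) * (LINT x|leb. cmod (mulX w' x)))"
 have "(LINT x|leb. cmod (mulX w x)) * (LINT x|leb. cmod (mulX w' x)) <= (V_norm * nH w) * (V_norm * nH w')"
  by (intro mult_mono mulX_integrable(2) w) auto
 then have "?B <= 4 * pi * (ft_const * ft_const) * ((V_norm * nH w) * (V_norm * nH w'))" by (intro mult_left_mono) auto
 then have B: "?B <= B0 * (nH w * nH w')" by (simp add: B0_def power2_eq_square mult_ac)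
 note c = corr_bounds[OF mulX_integrable(1)[OF w(1)] mulX_integrable(1)[OF w(2)]]
 show "cmod (corr (mulX w) (mulX w') r) <= B0 * (nH w * nH w')" using c(1) B by (rule order_trans)
 assume r: "0 < r"
 have "?B * Lq \<mu> r <= B0 * (nH w * nH w') * Lq \<mu> r" by (rule mult_right_mono[OF B Lq_nonneg])
 then show "cmod (corr (mulX w) (mulX w') r - corr (mulX w) (mulX w') (sqrt \<mu>)) <= B0 * (nH w * nH w') * Lq \<mu> r"
  using c(2)[OF r real_sqrt_gt_zero[OF mu_pos]] unfolding Lq_def by (rule order_trans[rotated])
qed

lemma Ft_eq: "Ft w \<omega> = fourier (mulX w) ((- sqrt \<mu>) *\<^sub>R \<omega>)" by (simp add: Ft_def frakF_eq_fourier)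

lemma Ft_U:
 assumes w: "w \<in> H"
 shows "Ft w \<in> U"
proof (rule L2_spaceI)
 note i = mulX_integrable(1)[OF w]
 show "Ft w \<in> borel_measurable sph" unfolding Ft_eq[abs_def]
  by (intro continuous_measurable_sphere continuous_on_compose2[OF fourier_continuous[OF i]] continuous_intros) auto
 show "AE \<omega> in sphere_measure. (cmod (Ft w \<omega>))^2 <= (ft_const * (LINT x|leb. cmod (mulX w x)))^2"
  unfolding Ft_eq by (intro AE_I2 power_mono fourier_bound[OF i]) auto
qed simp

text \<open>\<open>frakF\<close> evaluates the transform at -sqrt \<mu> times \<omega>; the
  correlation depends on |r| only, so the sign disappears.\<close>

lemma Ft_inner:
 assumes w: "w \<in> H" "w' \<in> H"
 shows "iU (Ft w) (Ft w') = corr (mulX w) (mulX w') (sqrt \<mu>)"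
 using corr_eq(1)[OF mulX_integrable(1)[OF w(1)] mulX_integrable(1)[OF w(2)], of "sqrt \<mu>"]
  corr_eq(1)[OF mulX_integrable(1)[OF w(1)] mulX_integrable(1)[OF w(2)], of "- sqrt \<mu>"]
 by (simp only: abs_minus_cancel) (simp add: L2_inner_def corr_def Ft_eq)

lemma Ft_norm:
 assumes w: "w \<in> H"
 shows "nU (Ft w) <= sqrt B0 * nH w"
proof -
 have "(nU (Ft w))^2 = cmod (iU (Ft w) (Ft w))" by (simp add: L2_inner_self norm_power)
 also have "... <= B0 * (nH w * nH w)" unfolding Ft_inner[OF w w] by (rule corr_mulX(1)[OF w w])
 also have "... = (sqrt B0 * nH w)^2" using B0_nonneg by (simp add: power2_eq_square mult_ac)
 finally show ?thesis by (rule power2_le_imp_le) (use B0_nonneg in simp)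
qed

lemma Fa_H:
 assumes u: "u \<in> U"
 shows "Fa u \<in> H"
proof (rule L2_spaceI)
 note ui = L2_sphere_integrable[OF u]
 note [measurable] = borel_measurable_integrable[OF ui]
 have "(%(x, p). u p * exp (- \<i> * complex_of_real (sqrt \<mu> * (x \<bullet> p)))) \<in> borel_measurable (leb \<Otimes>\<^sub>M sph)"
  using inner_measurable_pair unfolding case_prod_beta by measurable
 then have "(%x. LINT p|sph. u p * exp (- \<i> * complex_of_real (sqrt \<mu> * (x \<bullet> p)))) \<in> borel_measurable leb"
  by (rule sphere_measure.borel_measurable_lebesgue_integral)
 then have "frakF_adj \<mu> u \<in> borel_measurable leb" unfolding frakF_adj_def[abs_def] by measurable
 then show "Fa u \<in> borel_measurable leb" unfolding Fa_def by (rule mulX_measurable)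
 let ?C = "ft_const * (LINT p|sph. cmod (u p))"
 have "cmod (frakF_adj \<mu> u x) <= ?C" for x
 proof -
  have "cmod (LINT p|sph. u p * exp (- \<i> * complex_of_real (sqrt \<mu> * (x \<bullet> p))))
    <= (LINT p|sph. cmod (u p * exp (- \<i> * complex_of_real (sqrt \<mu> * (x \<bullet> p)))))" by simp
  also have "... = (LINT p|sph. cmod (u p))" by (simp add: norm_mult)
  finally show ?thesis by (simp add: frakF_adj_def norm_mult mult_left_mono)
 qed
 then have "(cmod (Fa u x))^2 <= \<bar>V x\<bar> * ?C^2" for x
  using mult_left_mono[OF power_mono[of "cmod (frakF_adj \<mu> u x)" ?C 2], of "\<bar>V x\<bar>"]
  by (simp add: Fa_def mulX_def norm_mult power_mult_distrib[of "X x"] X_square)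
 then show "AE x in lebesgue. (cmod (Fa u x))^2 <= \<bar>V x\<bar> * ?C^2" by simp
qed (use V_integrable in simp)

lemma Ft_adjoint:
 assumes "w \<in> H" "u \<in> U"
 shows "iU (Ft w) u = iH w (Fa u)" using frakF_adjoint[OF mulX_integrable(1)[OF assms(1)] assms(2), of \<mu>]
 by (simp add: Ft_def Fa_def L2_inner_def mulX_def mult_ac)

lemma Fa_norm:
 assumes u: "u \<in> U"
 shows "nH (Fa u) <= sqrt B0 * nU u"
proof -
 note Fa_H[OF u, simp]
 have "(nH (Fa u))^2 = cmod (iU (Ft (Fa u)) u)" by (simp add: Ft_adjoint u L2_inner_self norm_power)
 also have "... <= nU (Ft (Fa u)) * nU u" by (rule L2_Cauchy_Schwarz[OF Ft_U u]) simp
 also have "... <= (sqrt B0 * nH (Fa u)) * nU u" by (intro mult_right_mono Ft_norm) auto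
 finally have "nH (Fa u) * nH (Fa u) <= (sqrt B0 * nU u) * nH (Fa u)" by (simp add: power2_eq_square mult_ac)
 then show ?thesis by (rule le_of_square_le) (use B0_nonneg in auto)
qed

lemma Sg_H: "w \<in> H ==> Sg w \<in> H" unfolding Sg_def[abs_def] by (rule L2_spaceI[OF _ L2_square_integrable])
  (auto intro!: borel_measurable_times borel_measurable_of_real simp: norm_mult sgn_if dest: L2_measurable)

lemma Sg_norm:
 assumes "w \<in> H"
 shows "nH (Sg w) <= nH w" unfolding L2_norm_def
 by (intro real_sqrt_le_mono integral_mono L2_square_integrable Sg_H assms) (auto simp: Sg_def norm_mult sgn_if)

lemma Sg_adjoint: "iH (Sg w) w' = iH w (Sg w')" by (simp add: L2_inner_def Sg_def mult_ac)

lemma lincombs: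
 shows "w \<in> H ==> v \<in> H ==> Ft (%x. c * w x + v x) = (%p. c * Ft w p + Ft v p)"
  and "u \<in> U ==> u' \<in> U ==> Fa (%x. c * u x + u' x) = (%p. c * Fa u p + Fa u' p)"
  and "Sg (%x. c * w x + v x) = (%p. c * Sg w p + Sg v p)"
proof -
 show "w \<in> H ==> v \<in> H ==> Ft (%x. c * w x + v x) = (%p. c * Ft w p + Ft v p)"
  by (simp add: fun_eq_iff Ft_eq mulX_lincomb fourier_lincomb mulX_integrable)
 show "Sg (%x. c * w x + v x) = (%p. c * Sg w p + Sg v p)" by (simp add: fun_eq_iff Sg_def algebra_simps)
 assume u: "u \<in> U" "u' \<in> U"
 have "integrable sph (%p. v p * exp (- \<i> * complex_of_real (sqrt \<mu> * (x \<bullet> p))))" if "v \<in> U" for v x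
 proof (rule Bochner_Integration.integrable_bound[OF L2_sphere_integrable[OF that]])
  show "(%p. v p * exp (- \<i> * complex_of_real (sqrt \<mu> * (x \<bullet> p)))) \<in> borel_measurable sph"
   by (rule borel_measurable_times[OF L2_measurable[OF that]]) (intro continuous_measurable_sphere continuous_intros)
 qed (simp add: norm_mult)
 note i = this[OF u(1)] this[OF u(2)]
 have "frakF_adj \<mu> (%x. c * u x + u' x) x = c * frakF_adj \<mu> u x + frakF_adj \<mu> u' x" for x
  using i[of x] by (simp add: frakF_adj_def distrib_right distrib_left mult.assoc mult.left_commute)
 then show "Fa (%x. c * u x + u' x) = (%p. c * Fa u p + Fa u' p)" by (simp add: fun_eq_iff Fa_def mulX_def algebra_simps)
qed

text \<open>Chosen so that |V|^(1/2) times \<open>sg u\<close> is V times the adjoint of F applied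
  to u (\<open>mulX_sg\<close>), whence A is \<open>Ft\<close> after \<open>sg\<close>.\<close>

definition sg :: "(real^3 => complex) => real^3 => complex" where "sg u = Sg (Fa u)"

lemma mulX_sg: "mulX (sg u) x = of_real (V x) * frakF_adj \<mu> u x"
proof -
 have "complex_of_real (X x) * (of_real (sgn (V x)) * (of_real (X x) * z)) = of_real (sgn (V x) * (X x * X x)) * z" for z by simp
 then show ?thesis by (simp only: sg_def Sg_def Fa_def mulX_def X_square) (simp add: mult_sgn_abs)
qed

lemma FVF_eq: "FVF \<mu> V u = Ft (sg u)" by (simp add: FVF_def Ft_def mulX_sg[abs_def])

lemma sg_H: "u \<in> U ==> sg u \<in> H" by (simp add: sg_def Sg_H Fa_H)

lemma sg_norm: "u \<in> U ==> nH (sg u) <= sqrt B0 * nU u" unfolding sg_def by (rule order_trans[OF Sg_norm[OF Fa_H] Fa_norm])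

lemma sg_lincomb: "u \<in> U ==> u' \<in> U ==> sg (%x. c * u x + u' x) = (%p. c * sg u p + sg u' p)" by (simp add: sg_def lincombs)

abbreviation "A == FVF \<mu> V"

lemma A_norm: "u \<in> U ==> nU (A u) <= B0 * nU u"
proof -
 assume u: "u \<in> U"
 have "nU (Ft (sg u)) <= sqrt B0 * (sqrt B0 * nU u)"
  using B0_nonneg by (intro order_trans[OF Ft_norm[OF sg_H[OF u]]] mult_left_mono sg_norm u) auto
 then show "nU (A u) <= B0 * nU u" using B0_nonneg by (simp add: FVF_eq flip: mult.assoc)
qed

lemma A_bounded: "bounded_operator sph A" unfolding bounded_operator_def
proof (intro conjI ballI allI exI[of _ B0])
 fix u v :: "real^3 => complex" and c assume u: "u \<in> U" "v \<in> U"
 show "AE x in sphere_measure. A (%y. c * u y + v y) x = c * A u x + A v x" by (simp add: FVF_eq sg_lincomb u lincombs sg_H)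
next
 fix u :: "real^3 => complex" assume u: "u \<in> U"
 show "A u \<in> U" by (simp add: FVF_eq Ft_U sg_H u)
 show "nU (A u) <= B0 * nU u" by (rule A_norm[OF u])
qed

lemma A_symmetric:
 assumes "u \<in> U" "u' \<in> U"
 shows "iU (A u) u' = iH (sg u) (Fa u')" "iU u (A u') = iU (A u) u'"
proof -
 show *: "iU (A u) u' = iH (sg u) (Fa u')" using assms by (simp add: FVF_eq Ft_adjoint sg_H)
 have "iU u (A u') = cnj (iH (sg u') (Fa u))"
  using assms by (simp add: FVF_eq Ft_adjoint sg_H flip: L2_inner_cnj[of _ "Ft (sg u')"])
 also have "... = iH (sg u) (Fa u')" by (simp add: L2_inner_cnj sg_def Sg_adjoint)
 finally show "iU u (A u') = iU (A u) u'" using * by simp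
qed

end

lemma corr_measurable:
 assumes g: "integrable leb g" and h: "integrable leb h"
 shows "corr g h \<in> borel_measurable borel"
proof -
 note [measurable] = fourier_measurable(1)[OF g] fourier_measurable(1)[OF h]
 have [measurable]: "(%z. fst z *\<^sub>R snd z) \<in> borel_measurable (borel \<Otimes>\<^sub>M sph)"
  using polar_measurable unfolding case_prod_beta by (simp cong: measurable_cong_sets)
 have "(%(r, \<omega>). cnj (fourier g (r *\<^sub>R \<omega>)) * fourier h (r *\<^sub>R \<omega>)) \<in> borel_measurable (borel \<Otimes>\<^sub>M sph)"
  unfolding case_prod_beta by measurable
 then show ?thesis unfolding corr_def[abs_def] by (rule sphere_measure.borel_measurable_lebesgue_integral)
qed

lemma L2_weight:
 assumes f: "f \<in> L2_space M" and m: "g \<in> borel_measurable M" and b: "AE x in M. cmod (g x) <= C * cmod (f x)"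
 shows "g \<in> L2_space M"
proof (rule L2_spaceI[OF m])
 show "integrable M (%x. C^2 * (cmod (f x))^2)" using L2_square_integrable[OF f] by simp
 show "AE x in M. (cmod (g x))^2 <= C^2 * (cmod (f x))^2"
  using b by eventually_elim (simp add: power_mono flip: power_mult_distrib)
qed

section \<open>Singular and regular part of the inverse kinetic energy\<close>

context bcs begin

definition K0 :: real where "K0 = (SOME K. sobolev_bound K)"

lemma K0: "sobolev_bound K0" "K0 > 0"
proof -
 show *: "sobolev_bound K0" unfolding K0_def by (rule someI_ex[OF sobolev_bound_exists])
 show "K0 > 0" using * by (simp add: sobolev_bound_def)
qed

lemma Gw_norm:
 assumes w: "w \<in> H"
 shows "nH (Gw w) <= sqrt K0 * nH w" using real_sqrt_le_mono[OF Gw_L2(2)[OF K0(1) w]] by (simp add: real_sqrt_mult)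

text \<open>From p^2 <= K_T + \<mu> and 1 <= K_T/(2T). It shows that finite kinetic energy implies a
  square integrable gradient, and it may blow up as T -> 0.\<close>

definition CT :: "real => real" where "CT T = 1 + (1 + \<mu>) / (2 * T)"

lemma K_symbol_lower:
 assumes "T > 0"
 shows "1 + p \<bullet> p <= CT T * K_symbol \<mu> T p" "K_symbol \<mu> T p > 0" "CT T > 0"
proof -
 have k: "\<bar>p \<bullet> p - \<mu>\<bar> <= K_symbol \<mu> T p" "2 * T <= K_symbol \<mu> T p"
  using Kf_bounds(1)[OF assms, of "p \<bullet> p" \<mu>] Kf_bounds(2)[OF assms] by (auto simp: K_symbol_eq)
 have "1 + \<mu> = ((1 + \<mu>) / (2 * T)) * (2 * T)" using assms by simp
 also have "... <= ((1 + \<mu>) / (2 * T)) * K_symbol \<mu> T p" using assms mu_pos k by (intro mult_left_mono) auto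
 finally show "1 + p \<bullet> p <= CT T * K_symbol \<mu> T p" using k(1) by (simp add: CT_def distrib_right)
 show "K_symbol \<mu> T p > 0" using k(2) assms by linarith
 have "0 <= (1 + \<mu>) / (2 * T)" using assms mu_pos by simp
 then show "CT T > 0" unfolding CT_def by linarith
qed

text \<open>The transform of K_T^(-1) |V|^(1/2) w.\<close>

definition pK :: "real => (real^3 => complex) => real^3 => complex" where
 "pK T w p = fourier (mulX w) p / of_real (K_symbol \<mu> T p)"

lemma pK_L2:
 assumes T: "T > 0" and w: "w \<in> H"
 shows "pK T w \<in> H" "mulP (pK T w) \<in> H"
proof -
 note G = Gw_L2(1)[OF K0(1) w]
 have [measurable]: "(%p. complex_of_real (K_symbol \<mu> T p)) \<in> borel_measurable leb" unfolding K_symbol_eq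
  by (intro continuous_measurable_lebesgue continuous_on_of_real continuous_on_compose2[OF Kf_continuous[OF T]] continuous_intros) auto
 note [measurable] = fourier_measurable(2)[OF mulX_integrable(1)[OF w]]
 have m [measurable]: "pK T w \<in> borel_measurable leb" unfolding pK_def[abs_def] by measurable
 have [measurable]: "(%p::real^3. complex_of_real (norm p)) \<in> borel_measurable leb"
  by (intro continuous_measurable_lebesgue continuous_intros)
 have b: "cmod (pK T w p) <= CT T * cmod (Gw w p) & cmod (mulP (pK T w) p) <= CT T * cmod (Gw w p)" if p: "p ~= 0" for p
 proof -
  define k where "k = K_symbol \<mu> T p"
  have k: "1 + p \<bullet> p <= CT T * k" "k > 0" using K_symbol_lower(1,2)[OF T, of p] by (simp_all add: k_def)
  have n2: "norm p * norm p = p \<bullet> p" by (simp add: dot_square_norm power2_eq_square)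
  have "0 <= 1 - 2 * norm p + norm p * norm p"
   using zero_le_power2[of "norm p - 1"] by (simp add: power2_eq_square algebra_simps)
  then have "norm p <= CT T * k" "norm p * norm p <= CT T * k" using norm_ge_zero[of p] n2 k(1) by linarith+
  then have "norm p / k <= CT T" "(norm p * norm p) / k <= CT T" using k(2) by (simp_all only: pos_divide_le_eq)
  moreover have "cmod (pK T w p) = (norm p / k) * cmod (Gw w p)" "cmod (mulP (pK T w) p) = ((norm p * norm p) / k) * cmod (Gw w p)"
   using p k by (simp_all add: mulP_def pK_def Gw_def norm_divide norm_mult flip: k_def)
  ultimately show ?thesis by (simp only:) (intro conjI mult_right_mono; simp)
 qed
 show "pK T w \<in> H" by (rule L2_weight[OF G m, of "CT T"]) (use AE_nonzero in eventually_elim, use b in blast)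
 show "mulP (pK T w) \<in> H"
 proof (rule L2_weight[OF G, of _ "CT T"])
  show "mulP (pK T w) \<in> borel_measurable leb" unfolding mulP_def[abs_def] by measurable
  show "AE p in lebesgue. cmod (mulP (pK T w) p) <= CT T * cmod (Gw w p)" using AE_nonzero by eventually_elim (use b in blast)
 qed
qed

text \<open>The form of |V|^(1/2) K_T^(-1) |V|^(1/2), the Birman--Schwinger operator without the
  sign of V.\<close>

definition kT :: "real => (real^3 => complex) => (real^3 => complex) => complex" where
 "kT T w w' = iH (pK T w) (fourier (mulX w'))"

abbreviation "cX w w' == corr (mulX w) (mulX w')"

text \<open>For Q = \<open>q \<mu> T\<close> the form of |V|^(1/2) M_T |V|^(1/2), for Q =
  \<open>q0 \<mu>\<close> its limit. The first term is the part 1/p^2 of 1/K_T; subtracting the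
  value on the Fermi sphere makes the integral converge even for \<open>q0\<close>.\<close>

definition rf :: "(real => real) => (real^3 => complex) => (real^3 => complex) => complex" where
 "rf Q w w' = iH (Gw w) (Gw w') + (LINT r|ray. of_real (Q r) * (cX w w' r - cX w w' (sqrt \<mu>)))"

lemma cX_measurable: "w \<in> H ==> w' \<in> H ==> cX w w' \<in> borel_measurable borel" by (intro corr_measurable mulX_integrable)

text \<open>1/K_T = 1/p^2 + (1/K_T - 1/p^2). The difference is radial and pairs q with the
  correlation; splitting off the value of the correlation on the Fermi sphere produces
  \<open>m_mu\<close>, the integral of q.\<close>

lemma kT_decomposition:
 assumes T: "0 < T" "T <= 1" and w: "w \<in> H" "w' \<in> H"
 shows "kT T w w' = of_real (m_mu \<mu> T) * iU (Ft w) (Ft w') + rf (q \<mu> T) w w'"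
  and "integrable ray (%r. of_real (q \<mu> T r) * (cX w w' r - cX w w' (sqrt \<mu>)))"
proof -
 let ?g = "fourier (mulX w)" and ?h = "fourier (mulX w')"
 define f where "f p = of_real (1 / Kf \<mu> T (p \<bullet> p) - 1 / (p \<bullet> p)) * (cnj (?g p) * ?h p)" for p
 note [measurable] = fourier_measurable(1)[OF mulX_integrable(1)[OF w(1)]] fourier_measurable(1)[OF mulX_integrable(1)[OF w(2)]]
  Kf_measurable[OF T(1), of \<mu>]
 have fm [measurable]: "f \<in> borel_measurable borel" unfolding f_def[abs_def] by measurable
 note G = Gw_L2(1)[OF K0(1) w(1)] Gw_L2(1)[OF K0(1) w(2)]
 note P = pK_L2[OF T(1) w(1)]
 \<comment> \<open>Written as a pairing of two L2 functions, the integrand f is known to be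
   integrable before polar coordinates are used.\<close>
 have eq: "AE p in lebesgue. cnj (mulP (pK T w) p - Gw w p) * Gw w' p = f p" using AE_nonzero
 proof eventually_elim
  case (elim p)
  define k where "k = Kf \<mu> T (p \<bullet> p)"
  have k: "k > 0" using Kf_pos[OF T(1)] by (simp add: k_def)
  have n: "complex_of_real (norm p) * of_real (norm p) = of_real (p \<bullet> p)" by (simp add: dot_square_norm power2_eq_square)
  define N where "N = complex_of_real (norm p)"
  have N: "N ~= 0" "complex_of_real (p \<bullet> p) = N * N" "cnj N = N" using elim n by (simp_all add: N_def)
  show ?case unfolding f_def mulP_def pK_def Gw_def K_symbol_eq k_def[symmetric] N_def[symmetric]
    of_real_diff of_real_divide of_real_1 N(2) using N(1,3) k by (simp add: divide_simps) (simp add: algebra_simps)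
 qed
 have i: "integrable leb (%p. cnj (mulP (pK T w) p - Gw w p) * Gw w' p)"
  using L2_inner_integrable[OF L2_diff[OF P(2) G(1)] G(2)] .
 have fL: "f \<in> borel_measurable leb" by (intro measurable_completion) simp
 have "integrable leb f" using i by (rule integrable_cong_AE_imp[OF _ fL]) (use eq in \<open>eventually_elim, simp\<close>)
 then have fi: "integrable lborel f" by (simp add: integrable_completion)
 have sph: "(LINT \<omega>|sph. f (r *\<^sub>R \<omega>)) = of_real (1 / Kf \<mu> T (r^2) - 1 / r^2) * cX w w' r" for r
 proof -
  have "(LINT \<omega>|sph. f (r *\<^sub>R \<omega>)) = (LINT \<omega>|sph. of_real (1 / Kf \<mu> T (r^2) - 1 / r^2) * (cnj (?g (r *\<^sub>R \<omega>)) * ?h (r *\<^sub>R \<omega>)))"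
  proof (rule Bochner_Integration.integral_cong[OF refl])
   fix \<omega> :: "real^3" assume "\<omega> \<in> space sph"
   then have "norm \<omega> = 1" by simp
   then have "(r *\<^sub>R \<omega>) \<bullet> (r *\<^sub>R \<omega>) = r^2" by (simp add: dot_square_norm power2_eq_square)
   then show "f (r *\<^sub>R \<omega>) = of_real (1 / Kf \<mu> T (r^2) - 1 / r^2) * (cnj (?g (r *\<^sub>R \<omega>)) * ?h (r *\<^sub>R \<omega>))"
    unfolding f_def by (simp only:)
  qed
  then show ?thesis unfolding corr_def by (simp only: integral_mult_right_zero)
 qed
 note [measurable] = cX_measurable[OF w]
 have [measurable]: "(%r. of_real (1 / Kf \<mu> T (r^2) - 1 / r^2) * cX w w' r) \<in> borel_measurable borel" by measurable
 have qr: "AE r in ray. r^2 *\<^sub>R (of_real (1 / Kf \<mu> T (r^2) - 1 / r^2) * cX w w' r) = of_real (q \<mu> T r) * cX w w' r"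
  using AE_ray_pos[of 0]
 proof eventually_elim
  case (elim r)
  then have "r^2 * (1 / Kf \<mu> T (r^2) - 1 / r^2) = q \<mu> T r" by (simp add: q_def right_diff_distrib)
  then show ?case by (simp only: scaleR_conv_of_real mult.assoc[symmetric] of_real_mult[symmetric])
 qed
 have qm: "(%r. of_real (q \<mu> T r) * cX w w' r) \<in> borel_measurable ray" using T(1) by measurable
 have qi: "integrable ray (%r. of_real (q \<mu> T r) * cX w w' r)" using integral_polar(2)[OF fi] qr unfolding sph
  by (subst (asm) integral_radial_ray(1)) (auto intro: integrable_cong_AE_imp[OF _ qm])
 have "(LINT p|leb. f p) = (LINT p|lborel. f p)" by (rule integral_completion) simp
 also have "... = (LINT r|radial_measure. of_real (1 / Kf \<mu> T (r^2) - 1 / r^2) * cX w w' r)"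
  unfolding integral_polar(1)[OF fi] sph ..
 also have "... = (LINT r|ray. r^2 *\<^sub>R (of_real (1 / Kf \<mu> T (r^2) - 1 / r^2) * cX w w' r))"
  by (rule integral_radial_ray(2)) measurable
 also have "... = (LINT r|ray. of_real (q \<mu> T r) * cX w w' r)" by (rule integral_cong_AE[OF _ qm qr]) measurable
 finally have F: "(LINT p|leb. f p) = (LINT r|ray. of_real (q \<mu> T r) * cX w w' r)" .
 have qc: "integrable ray (%r. complex_of_real (q \<mu> T r) * cX w w' (sqrt \<mu>))" using q_integrable[OF T mu_pos] by simp
 show di: "integrable ray (%r. of_real (q \<mu> T r) * (cX w w' r - cX w w' (sqrt \<mu>)))"
  using Bochner_Integration.integrable_diff[OF qi qc] by (simp add: right_diff_distrib)
 have "(LINT r|ray. of_real (q \<mu> T r) * (cX w w' r - cX w w' (sqrt \<mu>)))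
   = (LINT r|ray. of_real (q \<mu> T r) * cX w w' r) - of_real (m_mu \<mu> T) * cX w w' (sqrt \<mu>)"
  using Bochner_Integration.integral_diff[OF qi qc] m_mu_eq[OF T mu_pos] by (simp add: right_diff_distrib)
 moreover have "kT T w w' - iH (Gw w) (Gw w') = (LINT p|leb. f p)"
 proof -
  have "kT T w w' - iH (Gw w) (Gw w') = iH (%p. mulP (pK T w) p - Gw w p) (Gw w')"
   unfolding kT_def pairing_weight[OF L2_measurable[OF P(1)] w(2)] by (rule L2_inner_diff_left[OF P(2) G, symmetric])
  also have "... = (LINT p|leb. f p)"
   unfolding L2_inner_def by (rule integral_cong_AE[OF borel_measurable_integrable[OF i] fL eq])
  finally show ?thesis .
 qed
 ultimately show "kT T w w' = of_real (m_mu \<mu> T) * iU (Ft w) (Ft w') + rf (q \<mu> T) w w'"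
  unfolding rf_def Ft_inner[OF w] F by (simp add: algebra_simps)
qed

definition C1 :: real where "C1 = K0 + B0 * (LINT r|ray. Cq \<mu> / (1 + r^2))"

lemma C1_nonneg: "0 <= C1" unfolding C1_def using K0(2) B0_nonneg mu_pos
 by (intro add_nonneg_nonneg mult_nonneg_nonneg integral_nonneg_AE) (auto simp: Cq_def)

lemma ray_integral_bound:
 fixes Q :: "real => real"
 assumes w: "w \<in> H" "w' \<in> H" and [measurable]: "Q \<in> borel_measurable borel"
  and G: "integrable ray G" "AE r in ray. \<bar>Q r\<bar> * Lq \<mu> r <= G r"
 shows "integrable ray (%r. of_real (Q r) * (cX w w' r - cX w w' (sqrt \<mu>)))"
  and "cmod (LINT r|ray. of_real (Q r) * (cX w w' r - cX w w' (sqrt \<mu>))) <= B0 * (LINT r|ray. G r) * (nH w * nH w')"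
proof -
 note [measurable] = cX_measurable[OF w]
 let ?F = "%r. complex_of_real (Q r) * (cX w w' r - cX w w' (sqrt \<mu>))"
 let ?D = "%r. B0 * (nH w * nH w') * G r"
 have b: "AE r in ray. cmod (?F r) <= ?D r" using G(2) AE_ray_pos[of 0]
 proof eventually_elim
  case (elim r)
  have "cmod (?F r) <= \<bar>Q r\<bar> * (B0 * (nH w * nH w') * Lq \<mu> r)"
   unfolding norm_mult norm_of_real by (intro mult_left_mono corr_mulX(2)[OF w]) (use elim in auto)
  also have "... = B0 * (nH w * nH w') * (\<bar>Q r\<bar> * Lq \<mu> r)" by (simp add: mult_ac)
  also have "... <= ?D r" using elim B0_nonneg by (intro mult_left_mono) auto
  finally show ?case .
 qed
 have Di: "integrable ray ?D" using G(1) by simp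
 show i: "integrable ray ?F" by (rule Bochner_Integration.integrable_bound[OF Di]) (measurable, use b in \<open>eventually_elim, simp\<close>)
 have "cmod (LINT r|ray. ?F r) <= (LINT r|ray. cmod (?F r))" by simp
 also have "... <= (LINT r|ray. ?D r)" using i Di b by (intro integral_mono_AE) auto
 finally show "cmod (LINT r|ray. ?F r) <= B0 * (LINT r|ray. G r) * (nH w * nH w')" by (simp add: mult_ac)
qed

lemma rf_bound_dominated:
 assumes w: "w \<in> H" "w' \<in> H" and Q: "Q \<in> borel_measurable borel"
  and d: "!!r. 0 < r ==> r ~= sqrt \<mu> ==> \<bar>Q r\<bar> * Lq \<mu> r <= Cq \<mu> / (1 + r^2)"
 shows "cmod (rf Q w w') <= C1 * (nH w * nH w')"
proof -
 have "AE r in ray. \<bar>Q r\<bar> * Lq \<mu> r <= Cq \<mu> / (1 + r^2)" using AE_ray_sqrt[OF mu_pos] by eventually_elim (use d in blast)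
 from ray_integral_bound(2)[OF w Q ray_dominating this]
 have "cmod (LINT r|ray. of_real (Q r) * (cX w w' r - cX w w' (sqrt \<mu>))) <= B0 * (LINT r|ray. Cq \<mu> / (1 + r^2)) * (nH w * nH w')" .
 moreover have "cmod (iH (Gw w) (Gw w')) <= K0 * (nH w * nH w')"
 proof -
  have "cmod (iH (Gw w) (Gw w')) <= nH (Gw w) * nH (Gw w')" by (intro L2_Cauchy_Schwarz Gw_L2[OF K0(1)] w)
  also have "... <= (sqrt K0 * nH w) * (sqrt K0 * nH w')" using K0(2) by (intro mult_mono Gw_norm w) auto
  also have "... = (sqrt K0 * sqrt K0) * (nH w * nH w')" by (simp only: mult_ac)
  also have "... = K0 * (nH w * nH w')" using K0(2) by simp
  finally show ?thesis .
 qed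
 ultimately show ?thesis unfolding rf_def C1_def distrib_right by (intro order_trans[OF norm_triangle_ineq add_mono])
qed

lemma rf_bound:
 assumes w: "w \<in> H" "w' \<in> H"
 shows "0 < T ==> T <= 1 ==> cmod (rf (q \<mu> T) w w') <= C1 * (nH w * nH w')" and "cmod (rf (q0 \<mu>) w w') <= C1 * (nH w * nH w')"
 by (rule rf_bound_dominated[OF w q_measurable(1) q_dominated[OF _ _ mu_pos]]; assumption)
  (rule rf_bound_dominated[OF w q_measurable(2) q0_dominated[OF mu_pos]]; assumption)

text \<open>Only the radial weight depends on T, so the difference of the two forms is controlled by
  \<open>eta\<close> for all w and w' simultaneously.\<close>

lemma rf_diff:
 assumes T: "0 < T" "T <= 1" and w: "w \<in> H" "w' \<in> H"
 shows "cmod (rf (q \<mu> T) w w' - rf (q0 \<mu>) w w') <= B0 * eta \<mu> T * (nH w * nH w')"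
proof -
 have m: "(%r. q \<mu> T r - q0 \<mu> r) \<in> borel_measurable borel" using T(1) by measurable
 have "AE r in ray. \<bar>q0 \<mu> r\<bar> * Lq \<mu> r <= Cq \<mu> / (1 + r^2)"
  using AE_ray_sqrt[OF mu_pos] by eventually_elim (use q0_dominated[OF mu_pos] in blast)
 note i0 = ray_integral_bound(1)[OF w q_measurable(2) ray_dominating this]
 have "AE r in ray. \<bar>q \<mu> T r - q0 \<mu> r\<bar> * Lq \<mu> r <= \<bar>q \<mu> T r - q0 \<mu> r\<bar> * Lq \<mu> r" by simp
 note b = ray_integral_bound(2)[OF w m eta_props(1)[OF mu_pos T] this]
 have "rf (q \<mu> T) w w' - rf (q0 \<mu>) w w' = (LINT r|ray. of_real (q \<mu> T r - q0 \<mu> r) * (cX w w' r - cX w w' (sqrt \<mu>)))"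
  unfolding rf_def using Bochner_Integration.integral_diff[OF kT_decomposition(2)[OF T w] i0] by (simp add: left_diff_distrib)
 then show ?thesis using b unfolding eta_def by (simp only:)
qed

end

section \<open>Construction of the operator W\<close>

context bcs begin

lemma rf_tendsto:
 assumes w: "w \<in> H" "w' \<in> H"
 shows "((%T. rf (q \<mu> T) w w') \<longlongrightarrow> rf (q0 \<mu>) w w') (at_right 0)"
proof (rule LIM_zero_cancel, rule Lim_null_comparison)
 show "\<forall>\<^sub>F T in at_right 0. norm (rf (q \<mu> T) w w' - rf (q0 \<mu>) w w') <= B0 * eta \<mu> T * (nH w * nH w')"
  using eventually_at_right_real[OF zero_less_one] by eventually_elim (auto intro: rf_diff[OF _ _ w])
 show "((%T. B0 * eta \<mu> T * (nH w * nH w')) \<longlongrightarrow> 0) (at_right 0)"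
  by (intro tendsto_mult_left_zero tendsto_mult_right_zero eta_props(2) mu_pos)
qed

lemma trial_function:
 assumes T: "0 < T" and w: "w \<in> H"
 obtains \<psi> where "L2_fourier \<psi> (pK T w)" "mulX \<psi> \<in> H" "!!w'. w' \<in> H ==> iH (mulX \<psi>) w' = kT T w w'"
proof -
 obtain \<psi> where p: "L2_fourier \<psi> (pK T w)" using L2_fourier_surjective[OF pK_L2(1)[OF T w]] by blast
 show ?thesis using that[OF p sobolev(1)[OF K0(1) p pK_L2(2)[OF T w]]] pairing[OF p pK_L2(2)[OF T w]] by (simp add: kT_def)
qed

text \<open>The vector \<zeta> represents the regular form at w. It is obtained by subtracting the
  singular part from |V|^(1/2) K_T^(-1) |V|^(1/2) w, and testing it on itself bounds it uniformly in
  T.\<close>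

lemma regular_part:
 assumes T: "0 < T" "T <= 1" and w: "w \<in> H"
 obtains \<psi> \<zeta> where "L2_fourier \<psi> (pK T w)" "!!x. mulX \<psi> x = of_real (m_mu \<mu> T) * Fa (Ft w) x + \<zeta> x"
  "\<zeta> \<in> H" "!!w'. w' \<in> H ==> iH \<zeta> w' = rf (q \<mu> T) w w'" "nH \<zeta> <= C1 * nH w"
proof -
 obtain \<psi> where p: "L2_fourier \<psi> (pK T w)" "mulX \<psi> \<in> H" "!!w'. w' \<in> H ==> iH (mulX \<psi>) w' = kT T w w'"
  using trial_function[OF T(1) w] by blast
 define \<zeta> where "\<zeta> x = (- of_real (m_mu \<mu> T)) * Fa (Ft w) x + mulX \<psi> x" for x
 have F: "Fa (Ft w) \<in> H" by (intro Fa_H Ft_U w)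
 have z: "\<zeta> \<in> H" unfolding \<zeta>_def[abs_def] by (rule L2_lincomb[OF F p(2)])
 have i: "iH \<zeta> w' = rf (q \<mu> T) w w'" if w': "w' \<in> H" for w'
 proof -
  have "iH (Fa (Ft w)) w' = iU (Ft w) (Ft w')" using Ft_adjoint[OF w' Ft_U[OF w]] L2_inner_cnj by metis
  then show ?thesis
   unfolding \<zeta>_def[abs_def] L2_inner_lincomb_left[OF F p(2) w'] p(3)[OF w'] kT_decomposition(1)[OF T w w'] by simp
 qed
 have "nH \<zeta> * nH \<zeta> = cmod (iH \<zeta> \<zeta>)" by (simp add: L2_inner_self norm_mult power2_eq_square)
 then have "nH \<zeta> * nH \<zeta> <= C1 * nH w * nH \<zeta>" using rf_bound(1)[OF w z T] unfolding i[OF z] mult.assoc by (simp only:)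
 then have "nH \<zeta> <= C1 * nH w" by (rule le_of_square_le) (use C1_nonneg in auto)
 then show ?thesis using that[OF p(1) _ z i] by (simp add: \<zeta>_def)
qed

text \<open>Linearity is inherited in the limit T -> 0 from \<open>kT\<close>, where it is that of
  an inner product.\<close>

lemma rf_lincomb_left:
 assumes w: "w \<in> H" "v \<in> H" "w' \<in> H"
 shows "rf (q0 \<mu>) (%x. c * w x + v x) w' = cnj c * rf (q0 \<mu>) w w' + rf (q0 \<mu>) v w'"
proof -
 have l: "(%x. c * w x + v x) \<in> H" by (rule L2_lincomb[OF w(1,2)])
 have "rf (q \<mu> T) (%x. c * w x + v x) w' = cnj c * rf (q \<mu> T) w w' + rf (q \<mu> T) v w'" if T: "0 < T" "T <= 1" for T
 proof -
  have "pK T (%x. c * w x + v x) = (%p. c * pK T w p + pK T v p)"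
   by (simp add: fun_eq_iff pK_def mulX_lincomb fourier_lincomb mulX_integrable w add_divide_distrib)
  moreover obtain \<psi> where "L2_fourier \<psi> (pK T w)" "mulX \<psi> \<in> H" "!!w'. w' \<in> H ==> iH (mulX \<psi>) w' = kT T w w'"
   using trial_function[OF T(1) w(1)] by blast
  moreover obtain \<psi>' where "L2_fourier \<psi>' (pK T v)" "mulX \<psi>' \<in> H" "!!w'. w' \<in> H ==> iH (mulX \<psi>') w' = kT T v w'"
   using trial_function[OF T(1) w(2)] by blast
  ultimately have "kT T (%x. c * w x + v x) w' = cnj c * kT T w w' + kT T v w'"
   using pairing[OF L2_fourier_lincomb[of \<psi> _ \<psi>' _ c], of "pK T w" "pK T v" w'] pK_L2(2)[OF T(1) l] w
    L2_inner_lincomb_left[of "mulX \<psi>" leb "mulX \<psi>'" w' c] by (simp add: kT_def mulX_lincomb)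
  moreover have "iU (Ft (%x. c * w x + v x)) (Ft w') = cnj c * iU (Ft w) (Ft w') + iU (Ft v) (Ft w')"
   unfolding lincombs(1)[OF w(1,2)] by (intro L2_inner_lincomb_left Ft_U w)
  ultimately show ?thesis
   using kT_decomposition(1)[OF T l w(3)] kT_decomposition(1)[OF T w(1,3)] kT_decomposition(1)[OF T w(2,3)]
   by (simp add: algebra_simps)
 qed
 then have "\<forall>\<^sub>F T in at_right 0. cnj c * rf (q \<mu> T) w w' + rf (q \<mu> T) v w' = rf (q \<mu> T) (%x. c * w x + v x) w'"
  using eventually_at_right_real[of 0 1] by (auto elim!: eventually_mono)
 then have "((%T. rf (q \<mu> T) (%x. c * w x + v x) w') \<longlongrightarrow> cnj c * rf (q0 \<mu>) w w' + rf (q0 \<mu>) v w') (at_right 0)"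
  by (rule Lim_transform_eventually[rotated]) (intro tendsto_intros rf_tendsto w)
 from tendsto_unique[OF _ rf_tendsto[OF l w(3)] this] show ?thesis by simp
qed

definition seqT :: "nat => real" where "seqT n = 1 / real (Suc n)"

lemma seqT: "0 < seqT n" "seqT n <= 1" "filterlim seqT (at_right 0) sequentially"
proof -
 show "0 < seqT n" for n by (simp add: seqT_def)
 then show "filterlim seqT (at_right 0) sequentially"
  using LIMSEQ_inverse_real_of_nat unfolding filterlim_at seqT_def[abs_def] inverse_eq_divide by auto
 show "seqT n <= 1" by (simp add: seqT_def)
qed

text \<open>The vector is the limit of \<open>Ft (Sg (\<zeta> n))\<close>, where \<zeta> n
  represents the regular form at temperatures tending to 0. \<open>rf_diff\<close> makes the
  sequence Cauchy in norm, so completeness takes the place of a representation theorem.\<close>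

lemma calW_exists:
 assumes u: "u \<in> U"
 shows "EX W:U. ALL u':U. iU W u' = rf (q0 \<mu>) (sg u) (sg u')"
proof -
 note s = sg_H[OF u]
 have "EX \<zeta>. ALL n. \<zeta> n \<in> H & (ALL w':H. iH (\<zeta> n) w' = rf (q \<mu> (seqT n)) (sg u) w')"
  by (rule choice) (metis regular_part[OF seqT(1,2) s])
 then obtain \<zeta> where z: "!!n. \<zeta> n \<in> H" "!!n w'. w' \<in> H ==> iH (\<zeta> n) w' = rf (q \<mu> (seqT n)) (sg u) w'" by blast
 define W where "W n = Ft (Sg (\<zeta> n))" for n
 have W: "W n \<in> U" for n unfolding W_def by (intro Ft_U Sg_H z)
 have i: "iU (W n) u' = rf (q \<mu> (seqT n)) (sg u) (sg u')" if u': "u' \<in> U" for n u'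
  unfolding W_def Ft_adjoint[OF Sg_H[OF z(1)] u'] Sg_adjoint z(2)[OF Sg_H[OF Fa_H[OF u']]] sg_def ..
 have et: "(%n. eta \<mu> (seqT n)) \<longlonglongrightarrow> 0" using filterlim_compose[OF eta_props(2)[OF mu_pos] seqT(3)] .
 define C where "C = B0 * (nH (sg u) * sqrt B0)"
 have C: "C >= 0" using B0_nonneg by (simp add: C_def)
 have d: "nU (%x. W m x - W n x) <= C * (eta \<mu> (seqT m) + eta \<mu> (seqT n))" for m n
 proof -
  define D where "D = (%x. W m x - W n x)"
  have D: "D \<in> U" unfolding D_def by (intro L2_diff W)
  note sD = sg_H[OF D]
  \<comment> \<open>Testing the difference on itself turns the bound on forms into one on
    norms.\<close>
  have "(nU D)^2 = cmod (iU D D)" by (simp add: L2_inner_self norm_power)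
  also have "iU D D = iU (W m) D - iU (W n) D" by (subst (1) D_def) (intro L2_inner_diff_left W D)
  also have "... = (rf (q \<mu> (seqT m)) (sg u) (sg D) - rf (q0 \<mu>) (sg u) (sg D)) - (rf (q \<mu> (seqT n)) (sg u) (sg D) - rf (q0 \<mu>) (sg u) (sg D))"
   by (simp add: i D)
  also have "cmod ... <= B0 * eta \<mu> (seqT m) * (nH (sg u) * nH (sg D)) + B0 * eta \<mu> (seqT n) * (nH (sg u) * nH (sg D))"
   by (intro order_trans[OF norm_triangle_ineq4 add_mono] rf_diff s sD seqT)
  also have "... = B0 * nH (sg u) * (eta \<mu> (seqT m) + eta \<mu> (seqT n)) * nH (sg D)" by (simp add: algebra_simps)
  also have "... <= B0 * nH (sg u) * (eta \<mu> (seqT m) + eta \<mu> (seqT n)) * (sqrt B0 * nU D)"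
   using B0_nonneg eta_props(3)[OF mu_pos] by (intro mult_left_mono sg_norm D) auto
  finally have "nU D * nU D <= (C * (eta \<mu> (seqT m) + eta \<mu> (seqT n))) * nU D" by (simp add: C_def power2_eq_square mult_ac)
  then have "nU D <= C * (eta \<mu> (seqT m) + eta \<mu> (seqT n))"
   using C eta_props(3)[OF mu_pos] by (cases "nU D = 0") (auto simp: less_le)
  then show ?thesis by (simp add: D_def)
 qed
 have "EX g:U. (%n. nU (%x. W n x - g x)) \<longlonglongrightarrow> 0"
 proof (rule L2_complete[OF W])
  fix e :: real assume e: "e > 0"
  have "(%n. C * (2 * eta \<mu> (seqT n))) \<longlonglongrightarrow> C * (2 * 0)" by (intro tendsto_intros et)
  then have "\<forall>\<^sub>F n in sequentially. C * (2 * eta \<mu> (seqT n)) < e" by (rule order_tendstoD) (use e in simp)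
  then obtain N where N: "!!n. n >= N ==> C * (2 * eta \<mu> (seqT n)) < e" by (auto simp: eventually_sequentially)
  show "EX N. ALL m>=N. ALL n>=N. nU (%x. W m x - W n x) < e"
  proof (intro exI[of _ N] allI impI)
   fix m n assume "N <= m" "N <= n"
   from N[OF this(1)] N[OF this(2)] d[of m n] show "nU (%x. W m x - W n x) < e" by (simp add: distrib_left)
  qed
 qed
 then obtain g where g: "g \<in> U" "(%n. nU (%x. W n x - g x)) \<longlonglongrightarrow> 0" by blast
 have "iU g u' = rf (q0 \<mu>) (sg u) (sg u')" if u': "u' \<in> U" for u'
 proof (rule LIMSEQ_unique)
  show "(%n. iU (W n) u') \<longlonglongrightarrow> iU g u'" by (rule L2_inner_tendsto_left[OF W g(1) u' g(2)])
  show "(%n. iU (W n) u') \<longlonglongrightarrow> rf (q0 \<mu>) (sg u) (sg u')"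
   using filterlim_compose[OF rf_tendsto[OF s sg_H[OF u']] seqT(3)] by (simp add: i u')
 qed
 then show ?thesis using g(1) by blast
qed

text \<open>\<open>M_form\<close> subtracts exactly the singular part that
  \<open>kT_decomposition\<close> isolates.\<close>

lemma M_form_eq:
 assumes T: "0 < T" "T <= 1" and u: "u \<in> U"
 shows "complex_of_real (M_form \<mu> T (%x. of_real (V x) * frakF_adj \<mu> u x)) = rf (q \<mu> T) (sg u) (sg u)"
proof -
 have "kT T (sg u) (sg u) = (LINT p|leb. complex_of_real ((cmod (fourier (mulX (sg u)) p))^2 / K_symbol \<mu> T p))"
  unfolding kT_def L2_inner_def pK_def by (intro Bochner_Integration.integral_cong refl)
   (simp only: complex_cnj_divide complex_cnj_complex_of_real times_divide_eq_left times_divide_eq_right of_real_divide complex_norm_square mult.commute)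
 also have "... = of_real (LINT p|leb. (cmod (fourier (mulX (sg u)) p))^2 / K_symbol \<mu> T p)" by (rule integral_complex_of_real)
 finally show ?thesis using kT_decomposition(1)[OF T sg_H[OF u] sg_H[OF u]]
  by (simp add: M_form_def Ft_def L2_inner_self diff_eq_eq add.commute flip: mulX_sg[abs_def])
qed

lemma is_calW_exists: "EX W. is_calW \<mu> V W"
proof -
 obtain W where W: "!!u. u \<in> U ==> W u \<in> U" "!!u u'. u \<in> U ==> u' \<in> U ==> iU (W u) u' = rf (q0 \<mu>) (sg u) (sg u')"
  using bchoice[of U "%u g. g \<in> U & (ALL u':U. iU g u' = rf (q0 \<mu>) (sg u) (sg u'))"] calW_exists by blast
 have "is_calW \<mu> V W" unfolding is_calW_def bounded_operator_def
 proof (intro conjI ballI allI exI[of _ "C1 * B0"])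
  fix u assume u: "u \<in> U"
  show "W u \<in> U" by (rule W(1)[OF u])
  have "(nU (W u))^2 = cmod (iU (W u) (W u))" by (simp add: L2_inner_self norm_power)
  also have "... <= C1 * (nH (sg u) * nH (sg (W u)))" unfolding W(2)[OF u W(1)[OF u]] by (intro rf_bound(2) sg_H u W)
  also have "... <= C1 * ((sqrt B0 * nU u) * (sqrt B0 * nU (W u)))"
   using C1_nonneg B0_nonneg by (intro mult_left_mono mult_mono sg_norm u W) auto
  also have "... = C1 * (sqrt B0 * sqrt B0) * nU u * nU (W u)" by (simp only: mult_ac)
  finally have "nU (W u) * nU (W u) <= C1 * B0 * nU u * nU (W u)" using B0_nonneg by (simp add: power2_eq_square)
  then show "nU (W u) <= C1 * B0 * nU u" using C1_nonneg B0_nonneg by (cases "nU (W u) = 0") (auto simp: less_le)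
  have "((%T. cnj (rf (q \<mu> T) (sg u) (sg u))) \<longlongrightarrow> cnj (rf (q0 \<mu>) (sg u) (sg u))) (at_right 0)"
   by (intro tendsto_intros rf_tendsto sg_H u)
  moreover have "\<forall>\<^sub>F T in at_right 0. cnj (rf (q \<mu> T) (sg u) (sg u)) = of_real (M_form \<mu> T (%x. of_real (V x) * frakF_adj \<mu> u x))"
   using eventually_at_right_real[of 0 1] by (auto elim!: eventually_mono simp flip: M_form_eq[OF _ _ u])
  ultimately show "((%T. of_real (M_form \<mu> T (%x. of_real (V x) * frakF_adj \<mu> u x))) \<longlongrightarrow> iU u (W u)) (at_right 0)"
   unfolding L2_inner_cnj[of _ "W u" u, symmetric] W(2)[OF u u] by (rule Lim_transform_eventually)
 next
  fix u v :: "real^3 => complex" and c assume u: "u \<in> U" "v \<in> U"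
  define l where "l = (%y. c * u y + v y)"
  have l: "l \<in> U" unfolding l_def by (rule L2_lincomb[OF u])
  define a where "a = (%x. c * W u x + W v x)"
  have a: "a \<in> U" unfolding a_def by (intro L2_lincomb W u)
  define d where "d = (%x. W l x - a x)"
  have d: "d \<in> U" unfolding d_def by (intro L2_diff W a l)
  \<comment> \<open>W is picked vector by vector, so linearity is recovered by showing that the
    defect d is orthogonal to itself.\<close>
  have "iU (W l) d = iU a d"
   unfolding a_def L2_inner_lincomb_left[OF W(1)[OF u(1)] W(1)[OF u(2)] d] W(2)[OF u(1) d] W(2)[OF u(2) d] W(2)[OF l d]
   unfolding l_def sg_lincomb[OF u] by (intro rf_lincomb_left sg_H u d)
  then have "iU d d = 0" using L2_inner_diff_left[OF W(1)[OF l] a d] by (simp flip: d_def)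
  then have "nU d = 0" by (simp add: L2_inner_self)
  then have "AE x in sphere_measure. d x = 0" using L2_norm_eq_0[OF d] by simp
  then show "AE x in sphere_measure. W (%y. c * u y + v y) x = c * W u x + W v x"
   by eventually_elim (simp add: d_def a_def l_def)
 qed
 then show ?thesis by blast
qed

abbreviation "W == calW \<mu> V"

text \<open>\<open>calW\<close> is one of possibly many representatives, so only its boundedness and
  its form are known; the rest of the argument goes through these.\<close>

lemma calW_bounded: "bounded_operator sph W"
 and calW_form: "u \<in> U ==> iU u (W u) = rf (q0 \<mu>) (sg u) (sg u)"
 and calW_real: "u \<in> U ==> Im (iU u (W u)) = 0"
proof -
 have W: "is_calW \<mu> V W" unfolding calW_def by (rule someI_ex[OF is_calW_exists])
 then show "bounded_operator sph W" by (simp add: is_calW_def)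
 assume u: "u \<in> U"
 have l: "((%T. complex_of_real (M_form \<mu> T (%x. of_real (V x) * frakF_adj \<mu> u x))) \<longlongrightarrow> iU u (W u)) (at_right 0)"
  using W u by (simp add: is_calW_def)
 from tendsto_Im[OF this] have "((%T. 0) \<longlongrightarrow> Im (iU u (W u))) (at_right (0::real))" by simp
 from tendsto_unique[OF _ this tendsto_const] show "Im (iU u (W u)) = 0" by simp
 have "\<forall>\<^sub>F T in at_right 0. complex_of_real (M_form \<mu> T (%x. of_real (V x) * frakF_adj \<mu> u x)) = rf (q \<mu> T) (sg u) (sg u)"
  using eventually_at_right_real[of 0 1] by (auto elim!: eventually_mono simp: M_form_eq[OF _ _ u])
 from Lim_transform_eventually[OF l this] show "iU u (W u) = rf (q0 \<mu>) (sg u) (sg u)"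
  by (intro tendsto_unique[OF _ _ rf_tendsto[OF sg_H[OF u] sg_H[OF u]]]) simp_all
qed

end

section \<open>The Birman--Schwinger principle\<close>

text \<open>K_T increases with T, so the admissible temperatures are closed upwards; hence failure
  at a single T bounds all of them from below.\<close>

lemma KT_plus_nonneg_mono:
 assumes "KT_plus_nonneg \<mu> T V'" "0 < T" "T <= T'"
 shows "KT_plus_nonneg \<mu> T' V'" unfolding KT_plus_nonneg_def
proof (intro allI impI, elim conjE)
 fix \<psi> \<phi> assume p: "L2_fourier \<psi> \<phi>" and i: "integrable leb (%p. K_symbol \<mu> T' p * (cmod (\<phi> p))^2)"
 have le: "0 <= K_symbol \<mu> T p" "K_symbol \<mu> T p <= K_symbol \<mu> T' p" for p
  unfolding K_symbol_eq using Kf_mono[OF assms(2,3)] Kf_pos[OF assms(2), THEN less_imp_le] by auto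
 have \<phi> [measurable]: "\<phi> \<in> borel_measurable leb" using p by (auto simp: L2_fourier_def L2_space_def)
 have [measurable]: "K_symbol \<mu> T \<in> borel_measurable leb" unfolding K_symbol_eq[abs_def]
  by (intro continuous_measurable_lebesgue continuous_on_compose2[OF Kf_continuous[OF assms(2)]] continuous_intros) auto
 have b: "K_symbol \<mu> T p * (cmod (\<phi> p))^2 <= K_symbol \<mu> T' p * (cmod (\<phi> p))^2" for p by (rule mult_right_mono[OF le(2)]) simp
 have i': "integrable leb (%p. K_symbol \<mu> T p * (cmod (\<phi> p))^2)"
  by (rule Bochner_Integration.integrable_bound[OF i]) (measurable, use b le order_trans[OF le] in \<open>simp add: abs_mult\<close>)
 have "0 <= (LINT p|leb. K_symbol \<mu> T p * (cmod (\<phi> p))^2) + (LINT x|leb. V' x * (cmod (\<psi> x))^2)"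
  using assms(1) p i' by (simp add: KT_plus_nonneg_def)
 moreover have "(LINT p|leb. K_symbol \<mu> T p * (cmod (\<phi> p))^2) <= (LINT p|leb. K_symbol \<mu> T' p * (cmod (\<phi> p))^2)"
  by (rule integral_mono[OF i' i b])
 ultimately show "0 <= (LINT p|leb. K_symbol \<mu> T' p * (cmod (\<phi> p))^2) + (LINT x|leb. V' x * (cmod (\<psi> x))^2)" by linarith
qed

context bcs begin

text \<open>The square root of K_T, so that the kinetic energy is a squared norm and the L2 calculus
  applies to it.\<close>

definition sK :: "real => (real^3 => complex) => real^3 => complex" where
 "sK T \<phi> p = of_real (sqrt (K_symbol \<mu> T p)) * \<phi> p"

text \<open>The potential energy as a form in v = |V|^(1/2) \<psi>, see
  \<open>Nf_mulX\<close>.\<close>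

definition Nf :: "(real^3 => complex) => real" where
 "Nf v = Re (iH v (Sg v))"

lemma Nf_bound: "v \<in> H ==> \<bar>Nf v\<bar> <= (nH v)^2"
 using order_trans[OF abs_Re_le_cmod L2_Cauchy_Schwarz[OF _ Sg_H, of v v]] mult_left_mono[OF Sg_norm[of v] L2_norm_nonneg[of leb v]]
 by (force simp: Nf_def power2_eq_square)

lemma Nf_mulX: "Nf (mulX \<psi>) = (LINT x|leb. V x * (cmod (\<psi> x))^2)"
proof -
 have "cnj (mulX \<psi> x) * Sg (mulX \<psi>) x = complex_of_real (V x * (cmod (\<psi> x))^2)" for x
 proof -
  have "cnj (mulX \<psi> x) * Sg (mulX \<psi>) x = of_real (sgn (V x) * (X x * X x)) * (\<psi> x * cnj (\<psi> x))" by (simp add: mulX_def Sg_def)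
  also have "... = complex_of_real (V x * (cmod (\<psi> x))^2)"
   unfolding X_square mult_sgn_abs by (simp only: complex_norm_square[symmetric] of_real_mult)
  finally show ?thesis .
 qed
 then show ?thesis by (simp only: Nf_def L2_inner_def integral_complex_of_real Re_complex_of_real)
qed

lemma sK_measurable:
 assumes "T > 0" "\<phi> \<in> borel_measurable leb"
 shows "sK T \<phi> \<in> borel_measurable leb" unfolding sK_def[abs_def] K_symbol_eq
 by (intro borel_measurable_times continuous_measurable_lebesgue continuous_on_of_real continuous_on_real_sqrt
   continuous_on_compose2[OF Kf_continuous[OF assms(1)]] continuous_intros assms(2)) auto

lemma sK_cmod: "T > 0 ==> (cmod (sK T \<phi> p))^2 = K_symbol \<mu> T p * (cmod (\<phi> p))^2"
 using K_symbol_lower(2)[of T p] by (simp add: sK_def norm_mult power_mult_distrib)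

lemma KT_plus_nonneg_iff:
 assumes T: "T > 0"
 shows "KT_plus_nonneg \<mu> T (%x. l * V x) \<longleftrightarrow> (ALL \<psi> \<phi>. L2_fourier \<psi> \<phi> & sK T \<phi> \<in> H --> 0 <= (nH (sK T \<phi>))^2 + l * Nf (mulX \<psi>))"
proof -
 have "sK T \<phi> \<in> H \<longleftrightarrow> integrable leb (%p. K_symbol \<mu> T p * (cmod (\<phi> p))^2)" if "L2_fourier \<psi> \<phi>" for \<psi> \<phi>
  using sK_measurable[OF T, of \<phi>] that by (simp add: L2_space_def sK_cmod T L2_fourier_def)
 then show ?thesis unfolding KT_plus_nonneg_def L2_norm_sq sK_cmod[OF T] Nf_mulX by (simp add: mult.assoc) blast
qed

lemma sK_mulX:
 assumes T: "T > 0" and p: "L2_fourier \<psi> \<phi>" "sK T \<phi> \<in> H"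
 shows "mulP \<phi> \<in> H" "mulX \<psi> \<in> H" "(nH (mulX \<psi>))^2 <= K0 * CT T * (nH (sK T \<phi>))^2"
proof -
 have [measurable]: "\<phi> \<in> borel_measurable leb" using p by (auto simp: L2_fourier_def L2_space_def)
 have [measurable]: "(%p::real^3. complex_of_real (norm p)) \<in> borel_measurable leb"
  by (intro continuous_measurable_lebesgue continuous_intros)
 have m: "mulP \<phi> \<in> borel_measurable leb" unfolding mulP_def[abs_def] by measurable
 have b: "(cmod (mulP \<phi> p))^2 <= CT T * (cmod (sK T \<phi> p))^2" for p
 proof -
  have "(cmod (mulP \<phi> p))^2 = (p \<bullet> p) * (cmod (\<phi> p))^2" by (simp add: mulP_def norm_mult power_mult_distrib dot_square_norm)
  also have "... <= (CT T * K_symbol \<mu> T p) * (cmod (\<phi> p))^2"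
   using K_symbol_lower(1)[OF T, of p] by (intro mult_right_mono) auto
  finally show ?thesis by (simp add: sK_cmod[OF T] mult.assoc)
 qed
 note i = L2_square_integrable[OF p(2)]
 show P: "mulP \<phi> \<in> H" by (rule L2_spaceI[OF m _ AE_I2[OF b]]) (use i in simp)
 show "mulX \<psi> \<in> H" by (rule sobolev(1)[OF K0(1) p(1) P])
 have "(nH (mulP \<phi>))^2 <= (LINT p|leb. CT T * (cmod (sK T \<phi> p))^2)"
  unfolding L2_norm_sq by (rule integral_mono[OF L2_square_integrable[OF P] _ b]) (use i in simp)
 then have "K0 * (nH (mulP \<phi>))^2 <= K0 * (CT T * (nH (sK T \<phi>))^2)" using K0(2) by (intro mult_left_mono) (auto simp: L2_norm_sq)
 then show "(nH (mulX \<psi>))^2 <= K0 * CT T * (nH (sK T \<phi>))^2" using sobolev(2)[OF K0(1) p(1) P] by (simp add: mult.assoc)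
qed

lemma sK_pK:
 assumes T: "T > 0" and w: "w \<in> H"
 shows "sK T (pK T w) \<in> H" "(nH (sK T (pK T w)))^2 = Re (kT T w w)" "(nH (sK T (pK T w)))^2 <= CT T * K0 * (nH w)^2"
  and "!!\<phi>. iH (sK T \<phi>) (sK T (pK T w)) = iH \<phi> (fourier (mulX w))"
proof -
 note G = Gw_L2[OF K0(1) w]
 have m: "pK T w \<in> borel_measurable leb" by (rule L2_measurable[OF pK_L2(1)[OF T w]])
 have e: "sK T \<phi> p = of_real (sqrt (K_symbol \<mu> T p)) * \<phi> p" "sK T (pK T w) p = fourier (mulX w) p / of_real (sqrt (K_symbol \<mu> T p))"
  "K_symbol \<mu> T p > 0" for \<phi> p using K_symbol_lower(2)[OF T, of p]
  by (simp_all add: sK_def pK_def field_simps flip: of_real_mult)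
 have b: "(cmod (sK T (pK T w) p))^2 <= CT T * (cmod (Gw w p))^2" if p: "p ~= 0" for p
 proof -
  have "(cmod (sK T (pK T w) p))^2 = (norm p)^2 / K_symbol \<mu> T p * (cmod (Gw w p))^2"
   unfolding e(2) Gw_def using e(3)[of p] p by (simp add: norm_divide power_divide)
  also have "(norm p)^2 / K_symbol \<mu> T p <= CT T"
   using K_symbol_lower(1,2)[OF T, of p] by (simp only: pos_divide_le_eq) (simp add: dot_square_norm)
  finally show ?thesis by (simp add: mult_right_mono)
 qed
 have ae: "AE p in lebesgue. (cmod (sK T (pK T w) p))^2 <= CT T * (cmod (Gw w p))^2" using AE_nonzero by eventually_elim (rule b)
 show s: "sK T (pK T w) \<in> H" by (rule L2_spaceI[OF sK_measurable[OF T m] _ ae]) (use L2_square_integrable[OF G(1)] in simp)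
 have "(nH (sK T (pK T w)))^2 <= CT T * (nH (Gw w))^2"
  unfolding L2_norm_sq using integral_mono_AE[OF L2_square_integrable[OF s] _ ae] L2_square_integrable[OF G(1)] by simp
 also have "... <= CT T * (K0 * (nH w)^2)" using K_symbol_lower(3)[OF T] G(2) by (intro mult_left_mono) auto
 finally show "(nH (sK T (pK T w)))^2 <= CT T * K0 * (nH w)^2" by (simp add: mult.assoc)
 show i: "iH (sK T \<phi>) (sK T (pK T w)) = iH \<phi> (fourier (mulX w))" for \<phi>
  unfolding L2_inner_def e(1)[of \<phi>] e(2) using e(3) by (intro Bochner_Integration.integral_cong refl) (simp add: less_imp_neq[symmetric])
 have "complex_of_real ((nH (sK T (pK T w)))^2) = kT T w w" unfolding kT_def i[symmetric] L2_inner_self ..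
 then show "(nH (sK T (pK T w)))^2 = Re (kT T w w)" by (metis Re_complex_of_real)
qed

text \<open>The trial vector is K_T^(-1) V times the adjoint of F applied to u. Its kinetic energy
  is \<open>kT\<close> at \<open>sg u\<close>; for the potential energy, |V|^(1/2) \<psi> = m Fa (A
  u) + \<zeta> is expanded under sgn V, with the pure \<zeta> term only estimated.\<close>

lemma nonneg_trial:
 assumes T: "0 < T" "T <= 1" and u: "u \<in> U" and nn: "KT_plus_nonneg \<mu> T (%x. l * V x)"
 obtains \<zeta> where "\<zeta> \<in> H" "nH \<zeta> <= C1 * (sqrt B0 * nU u)" "!!w'. w' \<in> H ==> iH \<zeta> w' = rf (q \<mu> T) (sg u) w'"
  "0 <= m_mu \<mu> T * (nU (A u))^2 + Re (rf (q \<mu> T) (sg u) (sg u))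
   + l * ((m_mu \<mu> T)^2 * Re (iU (A u) (A (A u))) + 2 * m_mu \<mu> T * Re (iH \<zeta> (sg (A u)))) + \<bar>l\<bar> * (nH \<zeta>)^2"
proof -
 let ?m = "m_mu \<mu> T"
 note s = sg_H[OF u]
 have y: "A u \<in> U" by (rule bounded_operator_L2[OF A_bounded u])
 obtain \<psi> \<zeta> where z: "L2_fourier \<psi> (pK T (sg u))" "!!x. mulX \<psi> x = of_real ?m * Fa (Ft (sg u)) x + \<zeta> x"
  "\<zeta> \<in> H" "!!w'. w' \<in> H ==> iH \<zeta> w' = rf (q \<mu> T) (sg u) w'" "nH \<zeta> <= C1 * nH (sg u)" using regular_part[OF T s] by blast
 define F where "F = Fa (A u)"
 have F: "F \<in> H" "Sg F \<in> H" "sg (A u) = Sg F" unfolding F_def by (auto intro!: Fa_H Sg_H y simp: sg_def)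
 have X: "mulX \<psi> = (%x. of_real ?m * F x + \<zeta> x)" by (rule ext) (simp add: z(2) F_def FVF_eq)
 note zS = Sg_H[OF z(3)]
 have "iH (mulX \<psi>) (Sg (mulX \<psi>)) = of_real ?m * iH (mulX \<psi>) (Sg F) + iH (mulX \<psi>) (Sg \<zeta>)"
  unfolding X lincombs(3) by (intro L2_inner_lincomb_right F zS L2_lincomb z(3))
 also have "... = of_real ?m * (of_real ?m * iH F (Sg F) + iH \<zeta> (Sg F)) + (of_real ?m * iH F (Sg \<zeta>) + iH \<zeta> (Sg \<zeta>))"
  unfolding X L2_inner_lincomb_left[OF F(1) z(3) F(2)] L2_inner_lincomb_left[OF F(1) z(3) zS] by simp
 also have "iH F (Sg \<zeta>) = cnj (iH \<zeta> (Sg F))" by (simp add: L2_inner_cnj Sg_adjoint)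
 finally have N: "Nf (mulX \<psi>) = ?m^2 * Re (iH F (Sg F)) + 2 * ?m * Re (iH \<zeta> (Sg F)) + Nf \<zeta>"
  by (simp add: Nf_def power2_eq_square algebra_simps)
 have FF: "iH F (Sg F) = iU (A u) (A (A u))" using A_symmetric[OF y y] by (simp add: F_def sg_def Sg_adjoint)
 have "(nH (sK T (pK T (sg u))))^2 = ?m * (nU (A u))^2 + Re (rf (q \<mu> T) (sg u) (sg u))"
  unfolding sK_pK(2)[OF T(1) s] kT_decomposition(1)[OF T s s] by (simp add: FVF_eq L2_inner_self)
 moreover have "0 <= (nH (sK T (pK T (sg u))))^2 + l * Nf (mulX \<psi>)"
  using nn z(1) sK_pK(1)[OF T(1) s] unfolding KT_plus_nonneg_iff[OF T(1)] by blast
 moreover have "l * Nf \<zeta> <= \<bar>l\<bar> * (nH \<zeta>)^2"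
  using mult_left_mono[OF Nf_bound[OF z(3)] abs_ge_zero[of l]] abs_ge_self[of "l * Nf \<zeta>"] by (simp add: abs_mult)
 moreover have "nH \<zeta> <= C1 * (sqrt B0 * nU u)" by (rule order_trans[OF z(5) mult_left_mono[OF sg_norm[OF u] C1_nonneg]])
 ultimately show ?thesis using that[OF z(3) _ z(4)] by (simp add: N FF F(3) algebra_simps)
qed

text \<open>\<kappa> is the supremum of minus the potential over the kinetic energy. Then \<kappa>
  times the kinetic plus the potential energy is a nonnegative form that nearly vanishes at
  near-maximisers, and its Cauchy--Schwarz inequality against K_T^(-1) |V|^(1/2) w is the eigenvalue
  equation in weak form.\<close>

lemma Birman_Schwinger:
 assumes T: "0 < T" and l: "l > 0" and nn: "~ KT_plus_nonneg \<mu> T (%x. l * V x)"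
 obtains \<kappa> where "\<kappa> > 1" "!!\<delta>. \<delta> > 0 ==> EX v:H. nH v > 0 & (ALL w:H. cmod (of_real \<kappa> * iH w v + of_real l * kT T w (Sg v)) <= \<delta> * nH v * nH w)"
proof -
 define P where "P = {(\<psi>, \<phi>). L2_fourier \<psi> \<phi> & sK T \<phi> \<in> H}"
 define C where "C = K0 * CT T"
 have C: "C > 0" using K0(2) K_symbol_lower(3)[OF T] by (simp add: C_def)
 have lin: "((%x. c * \<psi>' x + \<psi> x), (%x. c * \<phi>' x + \<phi> x)) \<in> P" if "(\<psi>, \<phi>) \<in> P" "(\<psi>', \<phi>') \<in> P" for \<psi> \<phi> \<psi>' \<phi>' c
 proof -
  have "sK T (%x. c * \<phi>' x + \<phi> x) = (%x. c * sK T \<phi>' x + sK T \<phi> x)" by (simp add: fun_eq_iff sK_def algebra_simps)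
  then show ?thesis using that by (auto simp: P_def intro: L2_fourier_lincomb L2_lincomb)
 qed
 have N: "- l * Nf (mulX \<psi>) <= l * C * (nH (sK T \<phi>))^2" "(nH (mulX \<psi>))^2 <= C * (nH (sK T \<phi>))^2" "mulX \<psi> \<in> H" if "(\<psi>, \<phi>) \<in> P" for \<psi> \<phi>
 proof -
  show b: "(nH (mulX \<psi>))^2 <= C * (nH (sK T \<phi>))^2" and h: "mulX \<psi> \<in> H" using sK_mulX[OF T] that by (auto simp: P_def C_def)
  have "- Nf (mulX \<psi>) <= C * (nH (sK T \<phi>))^2" using Nf_bound[OF h] b by linarith
  from mult_left_mono[OF this less_imp_le[OF l]] show "- l * Nf (mulX \<psi>) <= l * C * (nH (sK T \<phi>))^2" by (simp add: mult.assoc)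
 qed
 define R where "R = {- l * Nf (mulX \<psi>) / (nH (sK T \<phi>))^2 |\<psi> \<phi>. (\<psi>, \<phi>) \<in> P & nH (sK T \<phi>) > 0}"
 have bdd: "bdd_above R"
  unfolding R_def using N(1) by (intro bdd_aboveI[of _ "l * C"]) (auto simp only: mem_Collect_eq pos_divide_le_eq zero_less_power)
 have in_R: "- l * Nf (mulX \<psi>) / (nH (sK T \<phi>))^2 \<in> R" if "(\<psi>, \<phi>) \<in> P" "nH (sK T \<phi>) > 0" for \<psi> \<phi>
  using that unfolding R_def by blast
 obtain \<psi> \<phi> where p: "(\<psi>, \<phi>) \<in> P" "(nH (sK T \<phi>))^2 + l * Nf (mulX \<psi>) < 0"
  using nn unfolding KT_plus_nonneg_iff[OF T] by (auto simp: P_def not_le)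
 have pos: "nH (sK T \<phi>) > 0"
 proof (rule ccontr)
  assume "~ nH (sK T \<phi>) > 0"
  then have "nH (sK T \<phi>) = 0" by (simp add: less_le)
  then show False using N(1)[OF p(1)] p(2) by simp
 qed
 define \<kappa> where "\<kappa> = Sup R"
 have "1 < - l * Nf (mulX \<psi>) / (nH (sK T \<phi>))^2" using p(2) pos by (simp only: pos_less_divide_eq zero_less_power)
 also have "... <= \<kappa>" unfolding \<kappa>_def by (rule cSup_upper[OF in_R[OF p(1) pos] bdd])
 finally have \<kappa>: "\<kappa> > 1" .
 have form: "0 <= \<kappa> * (nH (sK T \<phi>))^2 + l * Nf (mulX \<psi>)" if "(\<psi>, \<phi>) \<in> P" for \<psi> \<phi>
 proof (cases "nH (sK T \<phi>) = 0")
  case True then show ?thesis using N(1)[OF that] by simp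
 next
  case False
  then have n: "nH (sK T \<phi>) > 0" by (simp add: less_le)
  have "- l * Nf (mulX \<psi>) / (nH (sK T \<phi>))^2 <= \<kappa>" unfolding \<kappa>_def by (rule cSup_upper[OF in_R[OF that n] bdd])
  then have "- l * Nf (mulX \<psi>) <= \<kappa> * (nH (sK T \<phi>))^2" using n by (simp only: pos_divide_le_eq zero_less_power)
  then show ?thesis by simp
 qed
 have "EX v:H. nH v > 0 & (ALL w:H. cmod (of_real \<kappa> * iH w v + of_real l * kT T w (Sg v)) <= \<delta> * nH v * nH w)" if \<delta>: "\<delta> > 0" for \<delta>
 proof -
  define D where "D = (\<kappa> + l * C) * C"
  have D: "D > 0" using \<kappa> l C by (simp add: D_def add_pos_pos)
  \<comment> \<open>The 1/2 keeps \<kappa> - \<epsilon> above 1/2; the other bound makes the product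
    of the two form values at most the square of \<delta> times the norms of v and w.\<close>
  define \<epsilon> where "\<epsilon> = min (1 / 2) (\<delta>^2 / (2 * l * D))"
  have \<epsilon>: "\<epsilon> > 0" "\<epsilon> <= 1 / 2" "\<epsilon> * D <= \<delta>^2 / (2 * l)"
  proof -
   show "\<epsilon> > 0" "\<epsilon> <= 1 / 2" using \<delta> l D by (auto simp: \<epsilon>_def)
   have "\<epsilon> * D <= \<delta>^2 / (2 * l * D) * D" using D by (intro mult_right_mono) (auto simp: \<epsilon>_def)
   then show "\<epsilon> * D <= \<delta>^2 / (2 * l)" using D by simp
  qed
  have "\<kappa> - \<epsilon> < \<kappa>" using \<epsilon> by simp
  then obtain r where r: "r \<in> R" "\<kappa> - \<epsilon> < r" unfolding \<kappa>_def using less_cSupE in_R[OF p(1) pos] by (metis empty_iff)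
  then obtain \<psi> \<phi> where a: "(\<psi>, \<phi>) \<in> P" "0 < nH (sK T \<phi>)" "\<kappa> - \<epsilon> < - l * Nf (mulX \<psi>) / (nH (sK T \<phi>))^2" by (auto simp: R_def)
  define E where "E = (nH (sK T \<phi>))^2"
  have E: "E > 0" "(\<kappa> - \<epsilon>) * E < - l * Nf (mulX \<psi>)" using a(2,3) by (simp_all only: E_def pos_less_divide_eq zero_less_power)
  define v where "v = mulX \<psi>"
  have v: "v \<in> H" using N(3)[OF a(1)] by (simp add: v_def)
  have "(1 / 2) * E <= (\<kappa> - \<epsilon>) * E" using \<kappa> \<epsilon>(2) E(1) by (intro mult_right_mono) auto
  also have "... <= l * (nH v)^2"
  proof -
   have "- Nf v <= (nH v)^2" using Nf_bound[OF v] by linarith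
   from mult_left_mono[OF this less_imp_le[OF l]] show ?thesis using E(2) by (simp add: v_def)
  qed
  \<comment> \<open>The kinetic energy of a near-maximiser is bounded by the norm of v, so the error
    can be expressed by v alone.\<close>
  finally have v2: "E <= 2 * l * (nH v)^2" by simp
  have vpos: "nH v > 0"
  proof (rule ccontr)
   assume "~ nH v > 0"
   then have "nH v = 0" by (simp add: less_le)
   then show False using v2 E(1) by simp
  qed
  have "cmod (of_real \<kappa> * iH w v + of_real l * kT T w (Sg v)) <= \<delta> * nH v * nH w" if w: "w \<in> H" for w
  proof -
   obtain \<psi>' where t: "L2_fourier \<psi>' (pK T w)" "mulX \<psi>' \<in> H" "!!w'. w' \<in> H ==> iH (mulX \<psi>') w' = kT T w w'"
    using trial_function[OF T w] by blast
   define \<phi>' where "\<phi>' = pK T w"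
   define v' where "v' = mulX \<psi>'"
   have v': "v' \<in> H" using t by (simp add: v'_def)
   have tP: "(\<psi>', \<phi>') \<in> P" using t sK_pK(1)[OF T w] by (simp add: P_def \<phi>'_def)
   note s = sK_pK(1)[OF T w, folded \<phi>'_def]
   have sa: "sK T \<phi> \<in> H" "L2_fourier \<psi> \<phi>" using a by (auto simp: P_def)
   define Q where "Q \<psi> \<phi> = \<kappa> * (nH (sK T \<phi>))^2 + l * Nf (mulX \<psi>)" for \<psi> \<phi>
   define x where "x = of_real \<kappa> * iH (sK T \<phi>) (sK T \<phi>') + of_real l * iH v (Sg v')"
   have x: "x = cnj (of_real \<kappa> * iH w v + of_real l * kT T w (Sg v))"
   proof -
    have "iH (sK T \<phi>) (sK T \<phi>') = iH v w"
     unfolding \<phi>'_def sK_pK(4)[OF T w] v_def by (rule pairing[OF sa(2) sK_mulX(1)[OF T sa(2,1)] w, symmetric])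
    moreover have "iH v (Sg v') = cnj (kT T w (Sg v))"
     unfolding t(3)[OF Sg_H[OF v], symmetric] v'_def[symmetric] L2_inner_cnj Sg_adjoint ..
    ultimately show ?thesis by (simp add: x_def L2_inner_cnj)
   qed
   have x': "cnj x = of_real \<kappa> * iH (sK T \<phi>') (sK T \<phi>) + of_real l * iH v' (Sg v)" by (simp add: x_def L2_inner_cnj Sg_adjoint)
   have "(cmod x)^2 <= Q \<psi> \<phi> * Q \<psi>' \<phi>'"
   proof (rule hermitian_discriminant)
    show "Im (z * x + cnj z * cnj x) = 0" for z by simp
    show "0 <= Q \<psi>' \<phi>'" unfolding Q_def by (rule form[OF tP])
    show "0 <= Q \<psi> \<phi> + Re (z * x + cnj z * cnj x) + (cmod z)^2 * Q \<psi>' \<phi>'" for z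
    proof -
     have e: "sK T (%x. z * \<phi>' x + \<phi> x) = (%x. z * sK T \<phi>' x + sK T \<phi> x)" by (simp add: fun_eq_iff sK_def algebra_simps)
     have "of_real ((nH (sK T (%x. z * \<phi>' x + \<phi> x)))^2) = of_real ((nH (sK T \<phi>))^2) + (z * iH (sK T \<phi>) (sK T \<phi>') + cnj z * iH (sK T \<phi>') (sK T \<phi>)) + of_real ((cmod z)^2 * (nH (sK T \<phi>'))^2)"
      unfolding e by (rule L2_norm_lincomb_sq[OF s sa(1)])
     from arg_cong[OF this, of Re]
     have 1: "(nH (sK T (%x. z * \<phi>' x + \<phi> x)))^2 = (nH (sK T \<phi>))^2 + Re (z * iH (sK T \<phi>) (sK T \<phi>') + cnj z * iH (sK T \<phi>') (sK T \<phi>)) + (cmod z)^2 * (nH (sK T \<phi>'))^2"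
      by (simp only: Re_complex_of_real plus_complex.simps)
     have "iH (%x. z * v' x + v x) (Sg (%x. z * v' x + v x)) = (z * iH v (Sg v') + cnj z * iH v' (Sg v)) + (iH v (Sg v) + z * cnj z * iH v' (Sg v'))"
      unfolding lincombs(3) L2_inner_lincomb_right[OF Sg_H[OF v'] Sg_H[OF v] L2_lincomb[OF v' v]]
       L2_inner_lincomb_left[OF v' v Sg_H[OF v']] L2_inner_lincomb_left[OF v' v Sg_H[OF v]] by (simp add: algebra_simps)
     from arg_cong[OF this, of Re]
     have 2: "Nf (mulX (%x. z * \<psi>' x + \<psi> x)) = Re (z * iH v (Sg v') + cnj z * iH v' (Sg v)) + Nf v + (cmod z)^2 * Nf v'"
      unfolding Nf_def mulX_lincomb v_def[symmetric] v'_def[symmetric] complex_norm_square[symmetric]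
      by (simp del: complex_norm_square flip: of_real_power)
     have 3: "z * x + cnj z * cnj x = of_real \<kappa> * (z * iH (sK T \<phi>) (sK T \<phi>') + cnj z * iH (sK T \<phi>') (sK T \<phi>)) + of_real l * (z * iH v (Sg v') + cnj z * iH v' (Sg v))"
      unfolding x' unfolding x_def by (simp add: algebra_simps)
     have "0 <= \<kappa> * (nH (sK T (%x. z * \<phi>' x + \<phi> x)))^2 + l * Nf (mulX (%x. z * \<psi>' x + \<psi> x))"
      by (rule form[OF lin[OF a(1) tP]])
     also have "... = Q \<psi> \<phi> + Re (z * x + cnj z * cnj x) + (cmod z)^2 * Q \<psi>' \<phi>'"
      unfolding 1 2 3 Q_def v_def[symmetric] v'_def[symmetric] by (simp add: algebra_simps)
     finally show ?thesis .
    qed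
   qed
   also have "... <= (\<epsilon> * E) * (D * (nH w)^2)"
   proof (rule mult_mono)
    show "Q \<psi> \<phi> <= \<epsilon> * E" using E(2) by (simp add: Q_def left_diff_distrib flip: E_def)
    have n: "(nH (sK T \<phi>'))^2 <= C * (nH w)^2" using sK_pK(3)[OF T w] by (simp add: \<phi>'_def C_def mult_ac)
    have "l * Nf (mulX \<psi>') <= l * (C * (nH (sK T \<phi>'))^2)"
     using Nf_bound[OF v'] N(2)[OF tP] l by (intro mult_left_mono) (auto simp: v'_def)
    then have "Q \<psi>' \<phi>' <= (\<kappa> + l * C) * (nH (sK T \<phi>'))^2" by (simp add: Q_def algebra_simps)
    also have "... <= (\<kappa> + l * C) * (C * (nH w)^2)" using \<kappa> l C by (intro mult_left_mono n) auto
    finally show "Q \<psi>' \<phi>' <= D * (nH w)^2" by (simp add: D_def mult.assoc)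
    show "0 <= Q \<psi>' \<phi>'" unfolding Q_def by (rule form[OF tP])
   qed (use \<epsilon> E in simp)
   also have "... = (\<epsilon> * D) * E * (nH w)^2" by (simp only: mult_ac)
   also have "... <= (\<delta>^2 / (2 * l)) * (2 * l * (nH v)^2) * (nH w)^2"
    using v2 E l by (intro mult_right_mono mult_mono \<epsilon>(3)) auto
   also have "... = (\<delta> * nH v * nH w)^2" using l by (simp add: power_mult_distrib)
   finally have "cmod x <= \<delta> * nH v * nH w" by (rule power2_le_imp_le) (use \<delta> in simp)
   then show ?thesis unfolding x complex_mod_cnj .
  qed
  then show ?thesis using v vpos by blast
 qed
 with \<kappa> that show ?thesis by blast
qed

end

lemma L2_fourier_norm:
 assumes "L2_fourier \<psi> \<phi>"
 shows "nH \<phi> = nH \<psi>"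
proof (rule tendsto_unique)
 have p: "\<psi> \<in> H" "\<phi> \<in> H" "((%R. nH (%p. fourier (trunc R \<psi>) p - \<phi> p)) \<longlongrightarrow> 0) at_top" using assms unfolding L2_fourier_iff by auto
 note t = trunc_L2[OF p(1)] fourier_L2[OF trunc_L2(2)[OF p(1)] trunc_L2(1)[OF p(1)]]
 show "((%R. nH (trunc R \<psi>)) \<longlongrightarrow> nH \<psi>) at_top" by (rule L2_norm_tendsto[OF t(1) p(1) trunc_tendsto[OF p(1)]])
 show "((%R. nH (trunc R \<psi>)) \<longlongrightarrow> nH \<phi>) at_top" using L2_norm_tendsto[OF t(4) p(2,3)] by (simp add: t(5))
qed simp

section \<open>Nonnegativity at high temperature, and the bottom of the effective operator on the
  sphere\<close>

context bcs begin

text \<open>Splitting V at height n leaves a remainder of small L^(3/2) norm, which part of the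
  kinetic energy absorbs through \<open>sobolev\<close>; a large T absorbs the bounded part. This
  keeps the infimum defining T_c from being taken over the empty set.\<close>

lemma large_T_nonneg:
 assumes l: "l > 0"
 shows "EX T>0. KT_plus_nonneg \<mu> T (%x. l * V x)"
proof -
 define V2 where "V2 n x = (if \<bar>V x\<bar> <= real n then 0 else V x)" for n x
 have [measurable]: "V2 n \<in> borel_measurable leb" for n unfolding V2_def[abs_def] by measurable
 have V2: "potential (V2 n)" for n
 proof
  show "integrable leb (V2 n)" by (rule Bochner_Integration.integrable_bound[OF V_integrable]) (auto simp: V2_def)
  show "integrable leb (%x. \<bar>V2 n x\<bar> powr (3 / 2))"
   by (rule Bochner_Integration.integrable_bound[OF V_integrable_32]) (auto simp: V2_def)
 qed
 have "(%n. LINT x|leb. \<bar>V2 n x\<bar> powr (3 / 2)) \<longlonglongrightarrow> (LINT x|leb. 0)"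
 proof (rule integral_dominated_convergence[OF _ _ V_integrable_32])
  show "AE x in lebesgue. (%n. \<bar>V2 n x\<bar> powr (3 / 2)) \<longlonglongrightarrow> 0"
  proof (rule AE_I2, rule tendsto_eventually)
   fix x show "\<forall>\<^sub>F n in sequentially. \<bar>V2 n x\<bar> powr (3 / 2) = 0"
    using eventually_ge_at_top[of "nat \<lceil>\<bar>V x\<bar>\<rceil>"] by eventually_elim (auto simp: V2_def nat_ceiling_le_eq)
  qed
 qed (auto simp: V2_def)
 then have "(%n. newton_const^2 * hls_const (LINT x|leb. \<bar>V2 n x\<bar> powr (3 / 2))) \<longlonglongrightarrow> newton_const^2 * (2 * 0 * (16 * pi / 3 + 0))"
  unfolding hls_const_def by (intro tendsto_intros) simp_all
 then have "\<forall>\<^sub>F n in sequentially. newton_const^2 * hls_const (LINT x|leb. \<bar>V2 n x\<bar> powr (3 / 2)) < (1 / (4 * l))^2"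
  by (rule order_tendstoD) (use l in simp)
 then obtain n where n: "newton_const^2 * hls_const (LINT x|leb. \<bar>V2 n x\<bar> powr (3 / 2)) < (1 / (4 * l))^2"
  by (auto simp: eventually_sequentially)
 interpret R: potential "V2 n" by (rule V2)
 have K: "R.sobolev_bound (1 / (4 * l))" using n l by (simp add: R.sobolev_bound_def R.I32_def less_imp_le)
 \<comment> \<open>Averaging K_T >= p^2 - \<mu> and K_T >= 2T gives K_T >= p^2/2 + l n for this
   T.\<close>
 define T where "T = \<mu> + l * real n"
 have T: "T > 0" using mu_pos l by (simp add: T_def add_pos_nonneg)
 have "0 <= (nH (sK T \<phi>))^2 + l * Nf (mulX \<psi>)" if p: "L2_fourier \<psi> \<phi>" "sK T \<phi> \<in> H" for \<psi> \<phi>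
 proof -
  note mP = sK_mulX[OF T p]
  have \<psi>: "\<psi> \<in> H" and \<phi>: "\<phi> \<in> H" using p(1) by (auto simp: L2_fourier_def)
  have RX: "R.mulX \<psi> \<in> H" "(nH (R.mulX \<psi>))^2 <= 1 / (4 * l) * (nH (mulP \<phi>))^2" using R.sobolev[OF K p(1) mP(1)] by auto
  have "- (real n * (nH \<psi>)^2 + (nH (R.mulX \<psi>))^2) <= Nf (mulX \<psi>)"
  proof -
   have i: "integrable leb (%x. V x * (cmod (\<psi> x))^2)"
    by (rule Bochner_Integration.integrable_bound[OF L2_square_integrable[OF mP(2)]])
     (use L2_measurable[OF \<psi>] in \<open>auto simp: mulX_def norm_mult power_mult_distrib X_square abs_mult\<close>)
   have j: "integrable leb (%x. - (real n * (cmod (\<psi> x))^2 + (cmod (R.mulX \<psi> x))^2))"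
    using L2_square_integrable[OF \<psi>] L2_square_integrable[OF RX(1)] by simp
   have "- (real n * (cmod (\<psi> x))^2 + (cmod (R.mulX \<psi> x))^2) <= V x * (cmod (\<psi> x))^2" for x
   proof -
    have "(cmod (R.mulX \<psi> x))^2 = \<bar>V2 n x\<bar> * (cmod (\<psi> x))^2" by (simp add: R.mulX_def norm_mult power_mult_distrib R.X_square)
    moreover have "- (real n + \<bar>V2 n x\<bar>) * (cmod (\<psi> x))^2 <= V x * (cmod (\<psi> x))^2"
     by (rule mult_right_mono) (auto simp: V2_def abs_le_iff)
    ultimately show ?thesis by (simp add: algebra_simps)
   qed
   from integral_mono[OF j i this] show ?thesis
    using L2_square_integrable[OF \<psi>] L2_square_integrable[OF RX(1)] by (simp add: Nf_mulX L2_norm_sq)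
  qed
  moreover have "1 / 2 * (nH (mulP \<phi>))^2 + l * real n * (nH \<phi>)^2 <= (nH (sK T \<phi>))^2"
  proof -
   have j: "integrable leb (%p. 1 / 2 * (cmod (mulP \<phi> p))^2 + l * real n * (cmod (\<phi> p))^2)"
    using L2_square_integrable[OF \<phi>] L2_square_integrable[OF mP(1)] by simp
   have "1 / 2 * (cmod (mulP \<phi> x))^2 + l * real n * (cmod (\<phi> x))^2 <= (cmod (sK T \<phi> x))^2" for x
   proof -
    have "1 / 2 * (x \<bullet> x) + l * real n <= K_symbol \<mu> T x"
     using Kf_bounds(1)[OF T, of "x \<bullet> x" \<mu>] Kf_bounds(2)[OF T, of \<mu> "x \<bullet> x"] mu_pos by (simp add: K_symbol_eq T_def)
    from mult_right_mono[OF this, of "(cmod (\<phi> x))^2"] show ?thesis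
     by (simp add: sK_cmod[OF T] mulP_def norm_mult power_mult_distrib dot_square_norm algebra_simps)
   qed
   from integral_mono[OF j L2_square_integrable[OF p(2)] this] show ?thesis
    using L2_square_integrable[OF \<phi>] L2_square_integrable[OF mP(1)] by (simp add: L2_norm_sq)
  qed
  moreover have "l * (nH (R.mulX \<psi>))^2 <= 1 / 4 * (nH (mulP \<phi>))^2" using mult_left_mono[OF RX(2), of l] l by simp
  moreover have "- (l * real n * (nH \<phi>)^2 + l * (nH (R.mulX \<psi>))^2) <= l * Nf (mulX \<psi>)"
   using mult_left_mono[OF calculation(1) less_imp_le[OF l]] unfolding L2_fourier_norm[OF p(1)] by (simp add: algebra_simps)
  moreover have "0 <= (nH (mulP \<phi>))^2" by simp
  ultimately show ?thesis by linarith
 qed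
 then show ?thesis using T unfolding KT_plus_nonneg_iff[OF T] by (intro exI[of _ T]) (simp add: KT_plus_nonneg_iff)
qed

text \<open>V is real, so conjugating the kernel reverses the sign of its argument.
  \<open>calV\<close> is thus A conjugated by complex conjugation, and the two have the same
  numerical range.\<close>

lemma calV_eq:
 assumes u: "u \<in> U"
 shows "calV \<mu> V u p = cnj (A (%q. cnj (u q)) p)"
proof -
 let ?c = "complex_of_real ft_const"
 let ?f = "%x. of_real (V x) * exp (- \<i> * complex_of_real (sqrt \<mu> * (x \<bullet> p)))"
 have f: "integrable leb ?f"
  using fourier_integrand_integrable[of "%x. of_real (V x)" "sqrt \<mu> *\<^sub>R p"] V_integrable by (simp add: inner_commute)
 have "cnj (A (%q. cnj (u q)) p) = ?c * (LINT x|leb. cnj (of_real (V x) * frakF_adj \<mu> (%q. cnj (u q)) x) * exp (- \<i> * complex_of_real (sqrt \<mu> * (x \<bullet> p))))"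
  unfolding FVF_def frakF_def by (simp add: Bochner_Integration.integral_cnj[symmetric] exp_cnj)
 also have "... = ?c * (LINT x|leb. ?c * (?f x * (LINT q|sph. u q * exp (\<i> * complex_of_real (sqrt \<mu> * (x \<bullet> q))))))"
  unfolding frakF_adj_def by (simp add: Bochner_Integration.integral_cnj[symmetric] exp_cnj mult_ac)
 also have "... = ?c * (?c * (LINT q|sph. u q * (LINT x|leb. ?f x * exp (\<i> * complex_of_real (sqrt \<mu> * (x \<bullet> q))))))"
  unfolding integral_mult_right_zero by (subst leb_sphere.kernel_Fubini[OF f L2_sphere_integrable[OF u], where C = 1])
   (auto simp: case_prod_beta intro!: continuous_pair_measurable_sphere continuous_intros)
 also have "... = ?c * (LINT q|sph. fourier (%x. of_real (V x)) (sqrt \<mu> *\<^sub>R (p - q)) * u q)"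
 proof -
  have "?c * (LINT x|leb. ?f x * exp (\<i> * complex_of_real (sqrt \<mu> * (x \<bullet> q)))) = fourier (%x. of_real (V x)) (sqrt \<mu> *\<^sub>R (p - q))" for q
  proof -
   have "?f x * exp (\<i> * complex_of_real (sqrt \<mu> * (x \<bullet> q))) = of_real (V x) * exp (- \<i> * complex_of_real ((sqrt \<mu> *\<^sub>R (p - q)) \<bullet> x))" for x
   proof -
    have "- \<i> * complex_of_real (sqrt \<mu> * (x \<bullet> p)) + \<i> * complex_of_real (sqrt \<mu> * (x \<bullet> q)) = - \<i> * complex_of_real ((sqrt \<mu> *\<^sub>R (p - q)) \<bullet> x)"
     by (simp add: inner_commute[of _ x] inner_diff_right algebra_simps)
    then show ?thesis by (simp only: mult.assoc exp_add[symmetric])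
   qed
   then show ?thesis unfolding fourier_eq by (simp only:)
  qed
  then have e: "?c * (u q * (LINT x|leb. ?f x * exp (\<i> * complex_of_real (sqrt \<mu> * (x \<bullet> q))))) = fourier (%x. of_real (V x)) (sqrt \<mu> *\<^sub>R (p - q)) * u q" for q
   by (simp only: mult.left_commute[of ?c]) (simp only: mult.commute)
  show ?thesis by (subst integral_mult_right_zero[of sph ?c, symmetric]) (simp only: e)
 qed
 finally show ?thesis unfolding calV_def by (simp add: powr_minus_divide)
qed

lemma nontrivial_U: "EX u:U. nU u > 0"
proof (intro bexI[of _ "%p. 1"])
 show "(%p. 1) \<in> U" by (simp add: L2_space_def)
qed (simp add: L2_norm_def measure_sphere)

lemma A_real: "u \<in> U ==> Im (iU u (A u)) = 0"
 using A_symmetric(2)[of u u] L2_inner_cnj[of sph u "A u"] by (simp add: complex_eq_iff)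

text \<open>Carries the sign of \<open>e_mu\<close> over from \<open>calV\<close> to A: an
  approximate minimiser of \<open>calV\<close> with error half of |e_\<mu>| still has negative
  energy, and so does its conjugate for A.\<close>

lemma negative_direction:
 assumes e: "e_mu \<mu> V < 0"
 obtains u where "u \<in> U" "nU u = 1" "Re (iU u (A u)) < 0"
proof -
 let ?j = "%u q. cnj (u q)"
 have j: "?j u \<in> U" "nU (?j u) = nU u" if "u \<in> U" for u :: "real^3 => complex"
  using L2_cnj[OF that] by (simp_all add: L2_norm_def)
 have cV: "calV \<mu> V u = ?j (A (?j u))" if "u \<in> U" for u by (rule ext) (rule calV_eq[OF that])
 have inn: "iU u (calV \<mu> V u) = cnj (iU (?j u) (A (?j u)))" if "u \<in> U" for u
  unfolding cV[OF that] L2_inner_def by (simp add: Bochner_Integration.integral_cnj[symmetric])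
 obtain C where C: "C > 0" "!!f. f \<in> U ==> nU (A f) <= C * nU f" using bounded_operator_bound[OF A_bounded] by blast
 note A2 = bounded_operator_L2[OF A_bounded]
 interpret real_form_operator sph "calV \<mu> V"
 proof
  show "bounded_operator sph (calV \<mu> V)" unfolding bounded_operator_def
  proof (intro conjI ballI allI exI[of _ C])
   fix f assume f: "f \<in> U"
   show "calV \<mu> V f \<in> U" unfolding cV[OF f] by (intro j A2 f)
   show "nU (calV \<mu> V f) <= C * nU f" unfolding cV[OF f] using C(2)[OF j(1)[OF f]] j A2 f by simp
  next
   fix f g :: "real^3 => complex" and c assume f: "f \<in> U" "g \<in> U"
   have "AE x in sphere_measure. A (%y. cnj c * ?j f y + ?j g y) x = cnj c * A (?j f) x + A (?j g) x"
    by (intro bounded_operator_lincomb A_bounded j f)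
   then show "AE x in sphere_measure. calV \<mu> V (%y. c * f y + g y) x = c * calV \<mu> V f x + calV \<mu> V g x"
    unfolding cV[OF f(1)] cV[OF f(2)] cV[OF L2_lincomb[OF f]] by eventually_elim simp
  qed
  show "Im (iU u (calV \<mu> V u)) = 0" if "u \<in> U" for u using A_real[OF j(1)[OF that]] by (simp add: inn that)
 qed (rule nontrivial_U)
 obtain u where u: "u \<in> U" "nU u = 1" "nU (%x. calV \<mu> V u x - of_real (e_mu \<mu> V) * u x) <= - e_mu \<mu> V / 2"
  unfolding e_mu_def using inf_spec_approximate_eigenvector[of "- inf_spec sph (calV \<mu> V) / 2"] e[unfolded e_mu_def] by auto
 have cu: "calV \<mu> V u \<in> U" unfolding cV[OF u(1)] by (intro j A2 u)
 have "\<bar>Re (iU u (%x. calV \<mu> V u x - of_real (e_mu \<mu> V) * u x))\<bar> <= nU u * nU (%x. calV \<mu> V u x - of_real (e_mu \<mu> V) * u x)"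
  by (rule order_trans[OF abs_Re_le_cmod L2_Cauchy_Schwarz]) (intro u L2_diff L2_scale cu)+
 moreover have "iU u (%x. calV \<mu> V u x - of_real (e_mu \<mu> V) * u x) = iU u (calV \<mu> V u) - of_real (e_mu \<mu> V)"
  using L2_inner_diff_right[OF cu L2_scale[OF u(1)] u(1)] by (simp add: L2_inner_scale_right L2_inner_self u(2))
 ultimately have "Re (iU u (calV \<mu> V u)) < 0" using u(2,3) e by (simp add: abs_le_iff)
 then show ?thesis using that[OF j(1)[OF u(1)]] j(2)[OF u(1)] u by (simp add: inn)
qed

abbreviation "Bl l == %u p. of_real l * A u p - of_real (l^2) * W u p"

lemma Bl_real_form: "real_form_operator sph (Bl l)"
proof
 show "bounded_operator sph (Bl l)"
  using bounded_operator_lincomb_op[OF A_bounded calW_bounded, of "of_real l" "- of_real (l^2)"] by simp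
 show "Im (iU u (Bl l u)) = 0" if u: "u \<in> U" for u
  using L2_inner_diff_right[OF L2_scale[OF bounded_operator_L2[OF A_bounded u]] L2_scale[OF bounded_operator_L2[OF calW_bounded u]] u]
  by (simp add: L2_inner_scale_right A_real[OF u] calW_real[OF u] flip: of_real_power)
qed (rule nontrivial_U)

lemma Bl_form:
 assumes u: "u \<in> U"
 shows "Re (iU u (Bl l u)) = l * Re (iU u (A u)) - l^2 * Re (iU u (W u))"
 using L2_inner_diff_right[OF L2_scale[OF bounded_operator_L2[OF A_bounded u]] L2_scale[OF bounded_operator_L2[OF calW_bounded u]] u]
 by (simp add: L2_inner_scale_right flip: of_real_power)

lemma b_form: "u \<in> U ==> b_mu \<mu> V l * (nU u)^2 <= l * Re (iU u (A u)) - l^2 * Re (iU u (W u))"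
 using real_form_operator.inf_spec_le_form[OF Bl_real_form, of u l] by (simp only: b_mu_def Bl_form)

lemma b_approx:
 assumes "\<epsilon> > 0"
 obtains u where "u \<in> U" "nU u = 1" "nU (%x. Bl l u x - of_real (b_mu \<mu> V l) * u x) <= \<epsilon>"
 using real_form_operator.inf_spec_approximate_eigenvector[OF Bl_real_form assms, of l] unfolding b_mu_def by blast

lemma form_abs_le:
 assumes "u \<in> U" "v \<in> U" "nU v <= C * nU u"
 shows "\<bar>Re (iU u v)\<bar> <= C * (nU u)^2"
 using order_trans[OF abs_Re_le_cmod L2_Cauchy_Schwarz[OF assms(1,2)]] mult_left_mono[OF assms(3) L2_norm_nonneg[of sph u]]
 by (simp add: power2_eq_square mult_ac)

text \<open>b is exactly of order l: A has a negative direction and W is a bounded perturbation of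
  order l^2. This is what later converts errors in 1/m into errors in m.\<close>

lemma b_bounds:
 assumes e: "e_mu \<mu> V < 0"
 obtains CW \<beta>0 \<beta>1 l0 where "CW > 0" "\<beta>0 > 0" "\<beta>1 > 0" "0 < l0" "l0 <= 1"
  "!!u. u \<in> U ==> nU (W u) <= CW * nU u"
  "!!l. 0 < l ==> l < l0 ==> b_mu \<mu> V l <= - \<beta>0 * l & - \<beta>1 * l <= b_mu \<mu> V l"
proof -
 obtain u0 where u0: "u0 \<in> U" "nU u0 = 1" "Re (iU u0 (A u0)) < 0" using negative_direction[OF e] .
 obtain CW where CW: "CW > 0" "!!u. u \<in> U ==> nU (W u) <= CW * nU u" using bounded_operator_bound[OF calW_bounded] by blast
 note W2 = bounded_operator_L2[OF calW_bounded] and A2 = bounded_operator_L2[OF A_bounded]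
 define a where "a = - Re (iU u0 (A u0))"
 have a: "a > 0" using u0 by (simp add: a_def)
 \<comment> \<open>l <= a/(2 CW) lets the second-order term consume at most half of the first-order
   gain.\<close>
 define l0 where "l0 = min 1 (a / (2 * CW))"
 have b: "b_mu \<mu> V l <= - (a / 2) * l & - (B0 + CW + 1) * l <= b_mu \<mu> V l" if l: "0 < l" "l < l0" for l
 proof
  have l1: "l < 1" "l * CW <= a / 2" using l CW(1) by (auto simp: l0_def pos_less_divide_eq mult_ac)
  have ll: "l^2 <= l" using l l1 by (simp add: power2_eq_square mult_left_le)
  have "b_mu \<mu> V l <= - l * a - l^2 * Re (iU u0 (W u0))" using b_form[OF u0(1), of l] u0(2) by (simp add: a_def)
  also have "... <= - l * a + l * (l * CW)"
  proof -
   have "- Re (iU u0 (W u0)) <= CW" using form_abs_le[OF u0(1) W2[OF u0(1)] CW(2)[OF u0(1)]] u0(2) by simp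
   from mult_left_mono[OF this, of "l^2"] show ?thesis by (simp add: power2_eq_square mult.assoc)
  qed
  also have "... <= - l * a + l * (a / 2)" using l l1 by (intro add_left_mono mult_left_mono) auto
  finally show "b_mu \<mu> V l <= - (a / 2) * l" by (simp add: mult.commute)
  obtain u where u: "u \<in> U" "nU u = 1" "nU (%x. Bl l u x - of_real (b_mu \<mu> V l) * u x) <= l" using b_approx[OF l(1)] .
  have B: "Bl l u \<in> U" by (intro L2_diff L2_scale A2 W2 u)
  have "\<bar>Re (iU u (%x. Bl l u x - of_real (b_mu \<mu> V l) * u x))\<bar> <= l"
   by (rule order_trans[OF order_trans[OF abs_Re_le_cmod L2_Cauchy_Schwarz[OF u(1) L2_diff[OF B L2_scale[OF u(1)]]]]]) (use u(2,3) in simp)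
  moreover have "iU u (%x. Bl l u x - of_real (b_mu \<mu> V l) * u x) = iU u (Bl l u) - of_real (b_mu \<mu> V l)"
   using L2_inner_diff_right[OF B L2_scale[OF u(1)] u(1)] by (simp add: L2_inner_scale_right L2_inner_self u(2))
  ultimately have "l * Re (iU u (A u)) - l^2 * Re (iU u (W u)) - b_mu \<mu> V l <= l"
   by (simp add: abs_le_iff Bl_form[OF u(1)] del: of_real_power)
  moreover have "- (l * B0) <= l * Re (iU u (A u))"
   using mult_left_mono[of "- B0" "Re (iU u (A u))" l] form_abs_le[OF u(1) A2[OF u(1)] A_norm[OF u(1)]] u(2) l by (simp add: abs_le_iff)
  moreover have "l^2 * Re (iU u (W u)) <= l * CW"
  proof -
   have "Re (iU u (W u)) <= CW" using form_abs_le[OF u(1) W2[OF u(1)] CW(2)[OF u(1)]] u(2) by simp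
   then have "l^2 * Re (iU u (W u)) <= l^2 * CW" by (intro mult_left_mono) auto
   also have "... <= l * CW" using ll CW(1) by (intro mult_right_mono) auto
   finally show ?thesis .
  qed
  ultimately show "- (B0 + CW + 1) * l <= b_mu \<mu> V l" by (simp add: algebra_simps)
 qed
 show ?thesis using that[of CW "a / 2" "B0 + CW + 1" l0] CW a b B0_nonneg by (simp add: l0_def)
qed

end

section \<open>Comparison of \<open>T\<^sub>c\<close> with \<open>b\<^sub>\<mu>\<close>\<close>

text \<open>Birman--Schwinger produces a coupling s < l, while \<beta> bounds the form at l. For
  \<alpha> >= -2 N l the form at s is at least -3 N l^2, which is above \<beta>; for smaller
  \<alpha> passing from l to s only increases the form.\<close>

lemma rayleigh_shrink:
 fixes \<alpha> \<omega> \<beta> N s l :: real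
 assumes s: "0 < s" "s < l" and \<omega>: "\<bar>\<omega>\<bar> <= N" and b: "\<beta> <= l * \<alpha> - l^2 * \<omega>" "\<beta> <= - 3 * N * l^2"
 shows "\<beta> <= s * \<alpha> - s^2 * \<omega>"
proof -
 have N: "0 <= N" using \<omega> by linarith
 have s2: "0 <= s^2" "s^2 <= l^2" "s * l <= l^2" "s^2 <= s * l" using s by (auto simp: power2_eq_square intro: mult_mono)
 have sw: "s^2 * \<omega> <= s^2 * N" using \<omega> by (intro mult_left_mono) auto
 have Nl: "s^2 * N <= l^2 * N" "s * l * N <= l^2 * N" "s^2 * N <= s * l * N" "0 <= l^2 * N" "0 <= s * l * N"
  using s s2 N by (auto intro: mult_right_mono)
 consider "\<bar>\<alpha>\<bar> <= 2 * N * l" | "2 * N * l < \<alpha>" | "\<alpha> < - 2 * N * l" by linarith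
 then show ?thesis
 proof cases
  case 1
  then have "s * (- (2 * N * l)) <= s * \<alpha>" using s by (intro mult_left_mono) auto
  then show ?thesis using b(2) sw Nl by (simp add: mult_ac)
 next
  case 2
  then have "s * (2 * N * l) <= s * \<alpha>" using s by (intro mult_left_mono) auto
  then show ?thesis using b(2) sw Nl by (simp add: mult_ac)
 next
  case 3
  have "- ((l + s) * \<omega>) <= (l + s) * N" using \<omega> s mult_left_mono[of "- \<omega>" N "l + s"] by simp
  also have "... <= (2 * l) * N" using s N by (intro mult_right_mono) auto
  finally have "\<alpha> - (l + s) * \<omega> <= 0" using 3 by (simp add: mult_ac)
  then have "(l - s) * (\<alpha> - (l + s) * \<omega>) <= 0" using s by (intro mult_nonneg_nonpos) auto
  then show ?thesis using b(1) by (simp add: power2_eq_square algebra_simps)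
 qed
qed

section \<open>Upper bound on T_c from approximate eigenvectors\<close>

context bcs begin

text \<open>With y the restriction of |V|^(1/2) sgn(V) v to the sphere, testing the eigenvalue
  equation with \<open>sg y\<close> makes ny^2 + s (m \<alpha> + \<rho>) small, and testing it with
  the representative \<zeta> of the regular form makes \<rho> + s (m \<omega> + \<tau>) small.
  Eliminating \<rho> leaves m times the form of s A - s^2 W; the error s^2 \<tau> is of order s^3 m
  because nv is of order s m ny.\<close>

lemma lower_bound_step:
 assumes T: "0 < T" "T <= 1" and m: "m_mu \<mu> T > 0" and s: "0 < s" "s * C1 <= 1 / 4" "s <= 1 / 2"
  and v: "v \<in> H" "nH v > 0" and bs: "!!w. w \<in> H ==> cmod (iH w v + of_real s * kT T w (Sg v)) <= s^2 * nH v * nH w"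
 obtains y where "y \<in> U" "nU y > 0"
  "(nU y)^2 + m_mu \<mu> T * (s * Re (iU y (A y)) - s^2 * Re (iU y (W y)))
   <= m_mu \<mu> T * (nU y)^2 * (s^2 * (B0^2 * eta \<mu> T) + s ^ 3 * (2 * B0 * (1 + C1 + C1^2)))"
proof -
 define m where "m = m_mu \<mu> T"
 have m: "m > 0" using m by (simp add: m_def)
 define c where "c = sqrt B0"
 have c: "c >= 0" "c * c = B0" using B0_nonneg by (auto simp: c_def)
 define y where "y = Ft (Sg v)"
 note Sv = Sg_H[OF v(1)]
 have y: "y \<in> U" unfolding y_def by (rule Ft_U[OF Sv])
 define ny where "ny = nU y" define nv where "nv = nH v"
 have nn: "0 <= ny" "0 < nv" using v by (auto simp: ny_def nv_def)
 have nS: "nH (Sg v) <= nv" using Sg_norm[OF v(1)] by (simp add: nv_def)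
 define r where "r = rf (q \<mu> T)"
 have kT: "kT T w (Sg v) = of_real m * iU (Ft w) y + r w (Sg v)" if "w \<in> H" for w
  unfolding kT_decomposition(1)[OF T that Sv] m_def y_def r_def ..
 have rb: "cmod (r w (Sg v)) <= C1 * (nH w * nv)" if "w \<in> H" for w
  unfolding r_def using C1_nonneg nS by (intro order_trans[OF rf_bound(1)[OF that Sv T]] mult_left_mono) auto
 have s2: "s^2 <= 1 / 4" using power_mono[OF s(3), of 2] s(1) by (simp add: power2_eq_square)
 \<comment> \<open>Test with v itself: the regular part costs at most s C1 <= 1/4 and the tolerance
   s^2 <= 1/4, so half of nv^2 must come from the singular part, which sees v only through
   y.\<close>
 have nv: "nv <= 2 * s * m * c * ny"
 proof -
  have "nv * nv = cmod (iH v v)" by (simp add: L2_inner_self nv_def norm_mult power2_eq_square)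
  also have "... <= cmod (iH v v + of_real s * kT T v (Sg v)) + cmod (of_real s * kT T v (Sg v))"
   using norm_triangle_ineq4[of "iH v v + of_real s * kT T v (Sg v)" "of_real s * kT T v (Sg v)"] by simp
  also have "... <= s^2 * nv * nv + s * (m * (c * nv * ny) + C1 * (nv * nv))"
  proof (rule add_mono)
   show "cmod (iH v v + of_real s * kT T v (Sg v)) <= s^2 * nv * nv" using bs[OF v(1)] by (simp add: nv_def)
   have "cmod (iU (Ft v) y) <= nU (Ft v) * ny" unfolding ny_def by (rule L2_Cauchy_Schwarz[OF Ft_U[OF v(1)] y])
   also have "... <= c * nv * ny" using nn Ft_norm[OF v(1)] by (intro mult_right_mono) (auto simp: c_def nv_def)
   finally have "cmod (of_real m * iU (Ft v) y) <= m * (c * nv * ny)" using m by (simp add: norm_mult)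
   from add_mono[OF this rb[OF v(1)]] have "cmod (kT T v (Sg v)) <= m * (c * nv * ny) + C1 * (nv * nv)"
    unfolding kT[OF v(1)] nv_def[symmetric] by (rule order_trans[OF norm_triangle_ineq])
   then show "cmod (of_real s * kT T v (Sg v)) <= s * (m * (c * nv * ny) + C1 * (nv * nv))"
    unfolding norm_mult using s(1) by (simp add: mult_left_mono)
  qed
  also have "... = (s^2 + s * C1) * (nv * nv) + (s * m * c * ny) * nv" by (simp add: algebra_simps)
  also have "... <= (1 / 2) * (nv * nv) + (s * m * c * ny) * nv" using s2 s(2) by (intro add_right_mono mult_right_mono) auto
  finally have "nv * nv <= (2 * s * m * c * ny) * nv" by simp
  then show ?thesis using nn by simp
 qed
 then have ny0: "ny > 0" using nn by (cases "ny = 0") auto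
 note sy = sg_H[OF y]
 have nsy: "nH (sg y) <= c * ny" using sg_norm[OF y] by (simp add: c_def ny_def)
 obtain \<zeta> where z: "\<zeta> \<in> H" "!!w'. w' \<in> H ==> iH \<zeta> w' = r (sg y) w'" "nH \<zeta> <= C1 * nH (sg y)"
  by (rule regular_part[OF T sy]) (simp add: r_def)
 note Sz = Sg_H[OF z(1)]
 define L where "L = C1 * (c * ny)"
 have nz: "nH (Sg \<zeta>) <= L"
  unfolding L_def by (rule order_trans[OF Sg_norm[OF z(1)] order_trans[OF z(3) mult_left_mono[OF nsy C1_nonneg]]])
 define \<rho> where "\<rho> = r (sg y) (Sg v)"
 define \<alpha> where "\<alpha> = Re (iU y (A y))"
 define \<omega> where "\<omega> = Re (r (sg y) (sg y))"
 have "cmod (of_real (ny^2) + of_real s * (of_real m * of_real \<alpha> + \<rho>)) <= s^2 * nv * nH (sg y)"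
 proof -
  have "iH (sg y) v = cnj (iU (Ft (Sg v)) y)" unfolding Ft_adjoint[OF Sv y] by (simp add: sg_def Sg_adjoint L2_inner_cnj)
  then have "iH (sg y) v = of_real (ny^2)" by (simp add: y_def[symmetric] L2_inner_self ny_def)
  moreover have "iU (Ft (sg y)) y = of_real \<alpha>"
   using A_symmetric(2)[OF y y] A_real[OF y] by (simp add: FVF_eq \<alpha>_def complex_eq_iff)
  ultimately show ?thesis using bs[OF sy] unfolding kT[OF sy] by (simp add: \<rho>_def nv_def)
 qed
 also have "... <= s^2 * nv * (c * ny)" using nn by (intro mult_left_mono nsy) auto
 finally have b: "cmod (of_real (ny^2) + of_real s * (of_real m * of_real \<alpha> + \<rho>)) <= s^2 * nv * (c * ny)" .
 define \<tau> where "\<tau> = r (Sg \<zeta>) (Sg v)"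
 have "cmod (\<rho> + of_real s * (of_real m * of_real \<omega> + \<tau>)) <= s^2 * nv * nH (Sg \<zeta>)"
 proof -
  have "iH (Sg \<zeta>) v = \<rho>" unfolding Sg_adjoint \<rho>_def by (rule z(2)[OF Sv])
  moreover have "iU (Ft (Sg \<zeta>)) y = r (sg y) (sg y)"
   using z(2)[OF sy] unfolding Ft_adjoint[OF Sz y] by (simp only: sg_def Sg_adjoint)
  moreover have "r (sg y) (sg y) = of_real \<omega>" unfolding \<omega>_def r_def M_form_eq[OF T y, symmetric] by simp
  ultimately show ?thesis using bs[OF Sz] unfolding kT[OF Sz] by (simp add: \<tau>_def nv_def)
 qed
 also have "... <= s^2 * nv * L" using nn by (intro mult_left_mono nz) auto
 finally have cc: "cmod (\<rho> + of_real s * (of_real m * of_real \<omega> + \<tau>)) <= s^2 * nv * L" .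
 have \<tau>: "cmod \<tau> <= C1 * (L * nv)"
  unfolding \<tau>_def using C1_nonneg nn nz by (intro order_trans[OF rb[OF Sz]] mult_left_mono mult_right_mono) auto
 define P where "P = of_real (ny^2) + of_real s * (of_real m * of_real \<alpha> + \<rho>)"
 define Q where "Q = \<rho> + of_real s * (of_real m * of_real \<omega> + \<tau>)"
 \<comment> \<open>The first-order remainder \<rho> cancels in P - s Q, which leaves the
   second-order term -s^2 m \<omega>.\<close>
 have "complex_of_real (ny^2 + s * m * \<alpha> - s^2 * m * \<omega>) = P - of_real s * Q + of_real (s^2) * \<tau>"
  by (simp add: P_def Q_def algebra_simps power2_eq_square)
 then have "\<bar>ny^2 + s * m * \<alpha> - s^2 * m * \<omega>\<bar> = cmod (P - of_real s * Q + of_real (s^2) * \<tau>)" by (metis norm_of_real)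
 also have "... <= cmod P + cmod (of_real s * Q) + cmod (of_real (s^2) * \<tau>)"
  by (rule order_trans[OF norm_triangle_ineq]) (intro add_right_mono norm_triangle_ineq4)
 also have "... = cmod P + s * cmod Q + s^2 * cmod \<tau>" using s(1) by (simp add: norm_mult norm_power)
 also have "... <= (s^2 * nv * (c * ny) + s * (s^2 * nv * L)) + s^2 * (C1 * (L * nv))"
  using s(1) by (intro add_mono mult_left_mono b[folded P_def] cc[folded Q_def] \<tau>) auto
 also have "... = s^2 * (1 + s * C1 + C1 * C1) * (c * ny) * nv" by (simp add: L_def algebra_simps)
 also have "... <= s^2 * (1 + C1 + C1^2) * (c * ny) * (2 * s * m * c * ny)"
 proof (intro mult_mono mult_right_mono mult_left_mono nv)
  show "1 + s * C1 + C1 * C1 <= 1 + C1 + C1^2" using mult_right_mono[of s 1 C1] s C1_nonneg by (simp add: power2_eq_square)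
 qed (use c nn m s C1_nonneg in auto)
 also have "... = m * ny^2 * (s ^ 3 * (2 * (c * c) * (1 + C1 + C1^2)))" by (simp only: power2_eq_square power3_eq_cube mult_ac)
 finally have main: "ny^2 + m * (s * \<alpha> - s^2 * \<omega>) <= m * ny^2 * (s ^ 3 * (2 * B0 * (1 + C1 + C1^2)))"
  unfolding c(2) by (simp add: abs_le_iff algebra_simps)
 \<comment> \<open>Replaces the regular form at T by its limit, the form of W, at the cost of
   \<open>eta\<close>.\<close>
 have "\<bar>\<omega> - Re (iU y (W y))\<bar> <= B0^2 * eta \<mu> T * ny^2"
 proof -
  have "\<bar>\<omega> - Re (iU y (W y))\<bar> <= cmod (r (sg y) (sg y) - rf (q0 \<mu>) (sg y) (sg y))"
   unfolding \<omega>_def calW_form[OF y] minus_complex.simps(1)[symmetric] by (rule abs_Re_le_cmod)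
  also have "... <= B0 * eta \<mu> T * (nH (sg y) * nH (sg y))" unfolding r_def by (rule rf_diff[OF T sy sy])
  also have "... <= B0 * eta \<mu> T * ((c * ny) * (c * ny))"
   using B0_nonneg eta_props(3)[OF mu_pos] nsy c nn by (intro mult_left_mono mult_mono) auto
  also have "... = B0 * (c * c) * eta \<mu> T * ny^2" by (simp only: power2_eq_square mult_ac)
  finally show ?thesis unfolding c(2) by (simp only: power2_eq_square)
 qed
 then have "m * (s^2 * (\<omega> - Re (iU y (W y)))) <= m * (s^2 * (B0^2 * eta \<mu> T * ny^2))" using m by (intro mult_left_mono) auto
 with main have "ny^2 + m * (s * \<alpha> - s^2 * Re (iU y (W y))) <= m * ny^2 * (s^2 * (B0^2 * eta \<mu> T) + s ^ 3 * (2 * B0 * (1 + C1 + C1^2)))"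
  by (simp add: algebra_simps)
 then show ?thesis using that[OF y] ny0 by (simp add: ny_def \<alpha>_def m_def)
qed

text \<open>Failure of nonnegativity at T forces m to be nearly 1/|b| or more, hence T to be small;
  the contrapositive bounds T_c from above. It compares \<open>lower_bound_step\<close> at s =
  l/\<kappa> with the variational bound on b, moved from l to s.\<close>

lemma lower_bound:
 assumes e: "e_mu \<mu> V < 0"
 obtains C l0 where "C > 0" "l0 > 0"
  "!!l T. 0 < l ==> l < l0 ==> 0 < T ==> T <= 1 ==> m_mu \<mu> T > 0 ==> ~ KT_plus_nonneg \<mu> T (%x. l * V x) ==>
   1 / m_mu \<mu> T <= - b_mu \<mu> V l + C * l^2 * (l + eta \<mu> T)"
proof -
 obtain CW \<beta>0 \<beta>1 l1 where bb: "CW > 0" "\<beta>0 > 0" "\<beta>1 > 0" "0 < l1" "l1 <= 1"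
  "!!u. u \<in> U ==> nU (W u) <= CW * nU u"
  "!!l. 0 < l ==> l < l1 ==> b_mu \<mu> V l <= - \<beta>0 * l & - \<beta>1 * l <= b_mu \<mu> V l" using b_bounds[OF e] by blast
 define C where "C = B0^2 + 2 * B0 * (1 + C1 + C1^2) + 1"
 \<comment> \<open>The four bounds serve \<open>b_bounds\<close>, s <= 1/2, s C1 <= 1/4, and the
   assumption of \<open>rayleigh_shrink\<close> that \<beta> is below -3 N l^2.\<close>
 define l0 where "l0 = min l1 (min (1 / 2) (min (1 / (4 * (C1 + 1))) (\<beta>0 / (3 * CW))))"
 show ?thesis
 proof (rule that[of C l0])
  show "C > 0" using B0_nonneg C1_nonneg by (simp add: C_def add_nonneg_pos)
  show "l0 > 0" using bb C1_nonneg by (simp add: l0_def)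
  fix l T assume l: "0 < l" "l < l0" and T: "0 < T" "T <= 1" and m: "m_mu \<mu> T > 0"
   and n: "~ KT_plus_nonneg \<mu> T (%x. l * V x)"
  define b where "b = b_mu \<mu> V l"
  have ll: "l < l1" "l <= 1 / 2" "l * (4 * (C1 + 1)) <= 1" "l * (3 * CW) <= \<beta>0"
   using l bb C1_nonneg by (auto simp: l0_def pos_less_divide_eq mult_ac)
  obtain \<kappa> where \<kappa>: "\<kappa> > 1" "!!\<delta>. \<delta> > 0 ==> EX v:H. nH v > 0 & (ALL w:H. cmod (of_real \<kappa> * iH w v + of_real l * kT T w (Sg v)) <= \<delta> * nH v * nH w)"
   using Birman_Schwinger[OF T(1) l(1) n] by blast
  define s where "s = l / \<kappa>"
  have s: "0 < s" "s < l" "s * \<kappa> = l" using \<kappa>(1) l by (auto simp: s_def divide_less_eq)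
  obtain v where v: "v \<in> H" "nH v > 0" "!!w. w \<in> H ==> cmod (of_real \<kappa> * iH w v + of_real l * kT T w (Sg v)) <= s^2 * nH v * nH w"
   using \<kappa>(2)[of "s^2"] s by auto
  have bs: "cmod (iH w v + of_real s * kT T w (Sg v)) <= s^2 * nH v * nH w" if w: "w \<in> H" for w
  proof -
   have "of_real \<kappa> * iH w v + of_real l * kT T w (Sg v) = of_real \<kappa> * (iH w v + of_real s * kT T w (Sg v))"
    unfolding s(3)[symmetric] by (simp add: algebra_simps)
   then have "\<kappa> * cmod (iH w v + of_real s * kT T w (Sg v)) <= s^2 * nH v * nH w"
    using v(3)[OF w] \<kappa>(1) by (simp add: norm_mult)
   moreover have "1 * cmod (iH w v + of_real s * kT T w (Sg v)) <= \<kappa> * cmod (iH w v + of_real s * kT T w (Sg v))"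
    using \<kappa>(1) by (intro mult_right_mono) auto
   ultimately show ?thesis by linarith
  qed
  have "s * C1 <= l * (C1 + 1)" using s C1_nonneg by (intro mult_mono) auto
  then have sC: "s * C1 <= 1 / 4" using ll(3) by linarith
  obtain y where y: "y \<in> U" "nU y > 0"
   "(nU y)^2 + m_mu \<mu> T * (s * Re (iU y (A y)) - s^2 * Re (iU y (W y)))
    <= m_mu \<mu> T * (nU y)^2 * (s^2 * (B0^2 * eta \<mu> T) + s ^ 3 * (2 * B0 * (1 + C1 + C1^2)))"
   using lower_bound_step[OF T m s(1) sC _ v(1,2) bs] s ll by auto
  define N where "N = (nU y)^2"
  have N: "N > 0" using y by (simp add: N_def)
  have "b * N <= s * Re (iU y (A y)) - s^2 * Re (iU y (W y))"
  proof (rule rayleigh_shrink[OF s(1,2)])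
   show "\<bar>Re (iU y (W y))\<bar> <= CW * N"
    unfolding N_def by (rule form_abs_le[OF y(1) bounded_operator_L2[OF calW_bounded y(1)] bb(6)[OF y(1)]])
   show "b * N <= l * Re (iU y (A y)) - l^2 * Re (iU y (W y))" unfolding b_def N_def by (rule b_form[OF y(1)])
   have "l * (l * (3 * CW)) <= l * \<beta>0" using l ll by (intro mult_left_mono) auto
   then have "b <= - (3 * CW * l^2)" using bb(7)[OF l(1) ll(1)] by (simp add: b_def power2_eq_square mult_ac)
   from mult_right_mono[OF this less_imp_le[OF N]] show "b * N <= - 3 * (CW * N) * l^2" by (simp add: mult_ac)
  qed
  then have "m_mu \<mu> T * (b * N) <= m_mu \<mu> T * (s * Re (iU y (A y)) - s^2 * Re (iU y (W y)))"
   using m by (intro mult_left_mono) auto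
  then have "N + m_mu \<mu> T * (b * N) <= m_mu \<mu> T * N * (s^2 * (B0^2 * eta \<mu> T) + s ^ 3 * (2 * B0 * (1 + C1 + C1^2)))"
   using y(3) by (simp add: N_def)
  also have "... <= m_mu \<mu> T * N * (C * l^2 * (l + eta \<mu> T))"
  proof (rule mult_left_mono)
   have e0: "0 <= eta \<mu> T" by (rule eta_props(3)[OF mu_pos])
   define D where "D = 2 * B0 * (1 + C1 + C1^2)"
   have D: "0 <= D" using B0_nonneg C1_nonneg by (simp add: D_def)
   have "s^2 * (B0^2 * eta \<mu> T) + s ^ 3 * D <= l^2 * (B0^2 * eta \<mu> T) + l ^ 3 * D"
    using s e0 D by (intro add_mono mult_right_mono power_mono) auto
   also have "... = l^2 * (B0^2 * eta \<mu> T + D * l)" by (simp add: power2_eq_square power3_eq_cube algebra_simps)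
   also have "... <= l^2 * (C * eta \<mu> T + C * l)"
    using e0 l D by (intro mult_left_mono add_mono mult_right_mono) (auto simp: C_def D_def[symmetric])
   finally show "s^2 * (B0^2 * eta \<mu> T) + s ^ 3 * (2 * B0 * (1 + C1 + C1^2)) <= C * l^2 * (l + eta \<mu> T)"
    unfolding D_def by (simp add: algebra_simps)
  qed (use m N in simp)
  finally have "N * 1 <= N * (m_mu \<mu> T * (- b + C * l^2 * (l + eta \<mu> T)))" by (simp add: algebra_simps)
  then have "1 <= m_mu \<mu> T * (- b + C * l^2 * (l + eta \<mu> T))" using N by (simp only: mult_le_cancel_left_pos)
  then show "1 / m_mu \<mu> T <= - b_mu \<mu> V l + C * l^2 * (l + eta \<mu> T)" using m by (simp add: pos_divide_le_eq b_def mult.commute)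
 qed
qed

end

text \<open>The arithmetic of the trial energy: Y, R and Z stand for the squared norm of A u, the
  form of A at A u and the cross term with \<zeta>, when A u = \<beta> u + l W u up to order l^2. As
  l m stays below L, every neglected term is of order l + \<eta>.\<close>

lemma trial_expansion:
 fixes \<beta> l m L G \<omega> \<omega>T W2 Y R Z \<zeta>2 \<eta> c1 c2 c3 c4 c5 :: real
 assumes l: "0 < l" and m: "0 < m" "l * m <= L" and G: "\<bar>\<beta>\<bar> <= G" "W2 <= G^2" "0 <= W2"
  and c: "0 <= c1" "0 <= c2" "0 <= c3" "0 <= c4" "0 <= c5" "0 <= \<eta>"
  and Y: "Y <= \<beta>^2 + 2 * \<beta> * l * \<omega> + l^2 * W2 + c1 * l^2"
  and R: "R <= \<beta> * (\<beta>^2 + 2 * \<beta> * l * \<omega> + l^2 * W2) + l * \<beta>^2 * \<omega> + c2 * l^2"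
  and Z: "Z <= \<beta> * \<omega>T + c3 * l" and \<omega>T: "\<bar>\<omega>T - \<omega>\<bar> <= c4 * \<eta>" and \<zeta>2: "\<zeta>2 <= c5"
 shows "m * Y + \<omega>T + l * (m^2 * R + 2 * m * Z) + l * \<zeta>2
  <= m * \<beta>^2 * (1 + m * l * \<beta>) + \<omega> * (1 + m * l * \<beta>) * (1 + 3 * (m * l * \<beta>))
   + (L * (G^2 + c1) + L^2 * (G ^ 3 + c2) + 2 * L * G * c4 + 2 * L * c3 + c4 + c5) * (l + \<eta>)"
proof -
 have L: "0 <= l * m" "0 <= L" "0 <= G" using l m G by (auto intro: order_trans[of _ "l * m"])
 have L2: "(l * m)^2 <= L^2" using L m by (intro power_mono) auto
 have "m * Y <= m * (\<beta>^2 + 2 * \<beta> * l * \<omega>) + (l * m) * (W2 + c1) * l"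
  using mult_left_mono[OF Y, of m] m by (simp add: algebra_simps power2_eq_square)
 moreover have "(l * m) * (W2 + c1) * l <= L * (G^2 + c1) * l" using L G l m c by (intro mult_right_mono mult_mono) auto
 moreover have "l * m^2 * R <= l * m^2 * (\<beta> ^ 3 + 3 * \<beta>^2 * l * \<omega>) + (l * m)^2 * (\<beta> * W2 + c2) * l"
  using mult_left_mono[OF R, of "l * m^2"] l by (simp add: algebra_simps power2_eq_square power3_eq_cube)
 moreover have "(l * m)^2 * (\<beta> * W2 + c2) * l <= L^2 * (G ^ 3 + c2) * l"
 proof (rule mult_right_mono)
  have "\<beta> * W2 <= G * G^2" using G L by (intro mult_mono) auto
  then have b: "\<beta> * W2 + c2 <= G ^ 3 + c2" by (simp add: power3_eq_cube power2_eq_square mult.assoc)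
  have "(l * m)^2 * (\<beta> * W2 + c2) <= (l * m)^2 * (G ^ 3 + c2)" by (rule mult_left_mono[OF b]) simp
  also have "... <= L^2 * (G ^ 3 + c2)" using L c by (intro mult_right_mono[OF L2]) auto
  finally show "(l * m)^2 * (\<beta> * W2 + c2) <= L^2 * (G ^ 3 + c2)" .
 qed (use l in simp)
 moreover have "2 * (l * m) * Z <= 2 * (l * m) * (\<beta> * \<omega>) + 2 * L * G * c4 * \<eta> + 2 * L * c3 * l"
 proof -
  have "2 * (l * m) * Z <= 2 * (l * m) * (\<beta> * \<omega>T + c3 * l)" using L by (intro mult_left_mono Z) auto
  also have "... = 2 * (l * m) * (\<beta> * \<omega>) + 2 * ((l * m) * (\<beta> * (\<omega>T - \<omega>))) + 2 * ((l * m) * (c3 * l))" by (simp add: algebra_simps)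
  also have "... <= 2 * (l * m) * (\<beta> * \<omega>) + 2 * (L * (G * (c4 * \<eta>))) + 2 * (L * (c3 * l))"
  proof -
   have "\<bar>\<beta> * (\<omega>T - \<omega>)\<bar> <= G * (c4 * \<eta>)" unfolding abs_mult using G \<omega>T L by (intro mult_mono) auto
   then have "(l * m) * (\<beta> * (\<omega>T - \<omega>)) <= (l * m) * (G * (c4 * \<eta>))" using L by (intro mult_left_mono) auto
   also have "... <= L * (G * (c4 * \<eta>))" using L c m by (intro mult_right_mono) auto
   finally have "(l * m) * (\<beta> * (\<omega>T - \<omega>)) <= L * (G * (c4 * \<eta>))" .
   moreover have "(l * m) * (c3 * l) <= L * (c3 * l)" using c l m by (intro mult_right_mono) auto
   ultimately show ?thesis by linarith
  qed
  finally show ?thesis by (simp add: mult.assoc)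
 qed
 moreover have "\<omega>T <= \<omega> + c4 * \<eta>" "l * \<zeta>2 <= c5 * l" using \<omega>T mult_left_mono[OF \<zeta>2, of l] l by (auto simp: mult.commute)
 moreover have "L * (G^2 + c1) * l + L^2 * (G ^ 3 + c2) * l + 2 * L * G * c4 * \<eta> + 2 * L * c3 * l + c4 * \<eta> + c5 * l
   <= (L * (G^2 + c1) + L^2 * (G ^ 3 + c2) + 2 * L * G * c4 + 2 * L * c3 + c4 + c5) * (l + \<eta>)"
  using l L c unfolding distrib_right by (intro add_mono mult_left_mono) auto
 \<comment> \<open>With t = m l \<beta> the coefficient of \<omega> is 1 + 4t + 3t^2 = (1 + t)(1 +
   3t), so the whole main term has the factor 1 + t, which changes sign at m = 1/|b|.\<close>
 moreover have "m * (\<beta>^2 + 2 * \<beta> * l * \<omega>) + \<omega> + l * m^2 * (\<beta> ^ 3 + 3 * \<beta>^2 * l * \<omega>) + 2 * (l * m) * (\<beta> * \<omega>)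
   = m * \<beta>^2 * (1 + m * l * \<beta>) + \<omega> * (1 + m * l * \<beta>) * (1 + 3 * (m * l * \<beta>))"
  by (simp add: algebra_simps power2_eq_square power3_eq_cube)
 moreover have "m * Y + \<omega>T + l * (m^2 * R + 2 * m * Z) + l * \<zeta>2 = m * Y + \<omega>T + (l * m^2 * R + 2 * (l * m) * Z) + l * \<zeta>2"
  by (simp add: algebra_simps)
 ultimately show ?thesis by linarith
qed

text \<open>Writing m l \<beta> = -(1 + t), the main term is -t (m \<beta>^2 - \<omega> (2 + 3t)).
  The bracket is at least \<beta>0/(2l), since m \<beta>^2 is of order 1/l, and t is at least D
  \<delta> l |\<beta>|; the two powers of l cancel.\<close>

lemma trial_main_term:
 fixes \<beta> l m G \<omega> \<beta>0 D \<delta> :: real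
 assumes l: "0 < l" "l * (10 * G) <= \<beta>0" and \<beta>: "\<beta> <= - \<beta>0" "0 < \<beta>0" and \<omega>: "\<bar>\<omega>\<bar> <= G"
  and m: "1 / (l * \<bar>\<beta>\<bar>) + D * \<delta> <= m" "m <= 2 / (l * \<bar>\<beta>\<bar>)" and D: "0 <= D" "0 <= \<delta>"
 shows "m * \<beta>^2 * (1 + m * l * \<beta>) + \<omega> * (1 + m * l * \<beta>) * (1 + 3 * (m * l * \<beta>)) <= - (D * \<beta>0^2 / 2) * \<delta>"
proof -
 define b where "b = l * \<bar>\<beta>\<bar>"
 have \<beta>n: "\<beta> < 0" using \<beta> by linarith
 then have b: "b > 0" "m * l * \<beta> = - (m * b)" using l by (auto simp: b_def mult_pos_neg)
 define t where "t = m * b - 1"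
 have "(1 / b + D * \<delta>) * b <= m * b" "m * b <= 2 / b * b"
  using m unfolding b_def[symmetric] by (auto intro!: mult_right_mono less_imp_le[OF b(1)] simp del: times_divide_eq_left)
 then have t: "D * \<delta> * b <= t" "t <= 1" using b by (simp_all add: t_def distrib_right)
 have t0: "0 <= t" using t(1) D b by (intro order_trans[OF _ t(1)]) simp
 have e: "m * l * \<beta> = - (1 + t)" using b by (simp add: t_def)
 have "\<beta>0 / (2 * l) <= m * \<beta>^2 - \<omega> * (2 + 3 * t)"
 proof -
  have "m * \<beta>^2 = (1 + t) * \<bar>\<beta>\<bar> / l" using l by (simp add: t_def b_def power2_eq_square)
  moreover have "\<beta>0 / l <= (1 + t) * \<bar>\<beta>\<bar> / l" using \<beta> t0 l mult_mono[of 1 "1 + t" \<beta>0 "\<bar>\<beta>\<bar>"] by (intro divide_right_mono) auto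
  moreover have "\<omega> * (2 + 3 * t) <= G * 5" using \<omega> t t0 by (intro mult_mono) auto
  moreover have "G * 5 <= \<beta>0 / (2 * l)" using l by (simp add: pos_le_divide_eq mult_ac)
  ultimately show ?thesis by simp
 qed
 then have "t * (\<beta>0 / (2 * l)) <= t * (m * \<beta>^2 - \<omega> * (2 + 3 * t))" using t0 by (rule mult_left_mono)
 moreover have "(D * \<delta> * b) * (\<beta>0 / (2 * l)) <= t * (\<beta>0 / (2 * l))" using \<beta> l by (intro mult_right_mono t) auto
 moreover have "(D * \<delta> * b) * (\<beta>0 / (2 * l)) = D * \<delta> * (\<bar>\<beta>\<bar> * \<beta>0) / 2" using l by (simp add: b_def)
 moreover have "D * \<delta> * (\<beta>0 * \<beta>0) / 2 <= D * \<delta> * (\<bar>\<beta>\<bar> * \<beta>0) / 2"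
  using \<beta> D by (intro divide_right_mono mult_left_mono mult_right_mono) auto
 moreover have "m * \<beta>^2 * (1 + m * l * \<beta>) + \<omega> * (1 + m * l * \<beta>) * (1 + 3 * (m * l * \<beta>)) = - (t * (m * \<beta>^2 - \<omega> * (2 + 3 * t)))"
  unfolding e by (simp add: algebra_simps)
 moreover have "- (D * \<beta>0^2 / 2) * \<delta> = - (D * \<delta> * (\<beta>0 * \<beta>0) / 2)" by (simp add: power2_eq_square)
 ultimately show ?thesis by linarith
qed

section \<open>Lower bound on T_c from the trial vector\<close>

context bcs begin

lemma Cauchy_Schwarz_Re:
 assumes "f \<in> L2_space M" "g \<in> L2_space M" "L2_norm M f <= a" "L2_norm M g <= b"
 shows "\<bar>Re (L2_inner M f g)\<bar> <= a * b"
 using order_trans[OF order_trans[OF abs_Re_le_cmod L2_Cauchy_Schwarz[OF assms(1,2)]] mult_mono[OF assms(3,4)]]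
  order_trans[OF L2_norm_nonneg assms(3)] by simp

text \<open>Expands the two quantities of \<open>nonneg_trial\<close> that involve only A to second
  order in l; n0 is the squared norm of the main part \<beta> u + l wl. It is applied with wl = W u
  in \<open>upper_bound\<close> and with wl = 0 in \<open>critical_temperature_pos\<close>.\<close>

lemma approximate_eigenvector_expansion:
 fixes \<beta> l G :: real
 assumes u: "u \<in> U" "nU u = 1" and wl: "wl \<in> U" "!!v. v \<in> U ==> nU (A v) <= G * nU v" "nU wl <= G"
  and l: "0 < l" "l <= 1" and \<beta>: "\<bar>\<beta>\<bar> <= G" "1 <= G"
  and e: "e \<in> U" "nU e <= l^2" and Au: "!!p. A u p = (of_real \<beta> * u p + of_real l * wl p) + e p"
 defines "\<omega> == Re (iU u wl)"
 defines "n0 == \<beta>^2 + 2 * \<beta> * l * \<omega> + l^2 * (nU wl)^2"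
 shows "(nU (A u))^2 <= n0 + (4 * G + 1) * l^2" and "Re (iU (A u) (A (A u))) <= \<beta> * n0 + l * \<beta>^2 * \<omega> + 9 * G ^ 3 * l^2"
proof -
 note A2 = bounded_operator_L2[OF A_bounded]
 define y where "y = A u"
 define y0 where "y0 = (%p. of_real \<beta> * u p + of_real l * wl p)"
 have lw: "(%p. of_real l * wl p) \<in> U" by (rule L2_scale[OF wl(1)])
 have y: "y \<in> U" and y0: "y0 \<in> U" unfolding y_def y0_def by (rule A2[OF u(1)]) (rule L2_lincomb[OF u(1) lw])
 have yy: "y = (%p. y0 p + e p)" "y = (%p. 1 * e p + y0 p)" by (simp_all add: fun_eq_iff y_def y0_def Au)
 have l2: "l^2 <= 1" "l^2 <= l" using l by (auto simp: power2_eq_square mult_le_one mult_left_le)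
 have "of_real ((nU y0)^2) = of_real ((nU (%p. of_real l * wl p))^2)
   + (of_real \<beta> * iU (%p. of_real l * wl p) u + cnj (of_real \<beta>) * iU u (%p. of_real l * wl p)) + of_real ((cmod (of_real \<beta>))^2 * (nU u)^2)"
  unfolding y0_def by (rule L2_norm_lincomb_sq[OF u(1) lw])
 from arg_cong[OF this, of Re] have n0: "(nU y0)^2 = n0" using arg_cong[OF L2_inner_cnj[of sph u wl], of Re] l
  by (simp add: n0_def \<omega>_def u(2) L2_inner_scale_left L2_inner_scale_right L2_norm_scale power_mult_distrib flip: of_real_power of_real_mult)
 have ny0: "nU y0 <= 2 * G"
 proof -
  have "nU y0 <= nU (%p. of_real \<beta> * u p) + nU (%p. of_real l * wl p)"
   unfolding y0_def by (rule L2_norm_triangle[OF L2_scale[OF u(1)] lw])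
  also have "... <= G + 1 * G" unfolding L2_norm_scale using u(2) \<beta> l wl by (intro add_mono mult_mono) auto
  finally show ?thesis by simp
 qed
 have ny: "nU y <= G" using wl(2)[OF u(1)] u(2) by (simp add: y_def)
 have "nU y <= nU y0 + nU e" unfolding yy(1) by (rule L2_norm_triangle[OF y0 e(1)])
 then have "(nU y)^2 <= (nU y0 + l^2)^2" using e(2) by (intro power_mono) auto
 also have "... = (nU y0)^2 + 2 * nU y0 * l^2 + l^2 * l^2" by (simp add: power2_eq_square algebra_simps)
 also have "... <= (nU y0)^2 + 2 * (2 * G) * l^2 + 1 * l^2" using ny0 l2 by (intro add_mono mult_right_mono mult_left_mono) auto
 finally show "(nU (A u))^2 <= n0 + (4 * G + 1) * l^2" by (simp add: n0 y_def algebra_simps)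
 have cs: "\<bar>Re (iU f (A g))\<bar> <= a * (G * b)" if "f \<in> U" "g \<in> U" "nU f <= a" "nU g <= b" for f g a b
  using \<beta>(2) that(4) by (intro Cauchy_Schwarz_Re that A2 order_trans[OF wl(2)[OF that(2)]] mult_left_mono) auto
 have 1: "Re (iU y (A y)) <= Re (iU y0 (A y0)) + 3 * G^2 * l^2"
 proof -
  have "iU y (A y) = iU y (A e) + iU y (A y0)"
   using bounded_operator_inner_lincomb[OF A_bounded e(1) y0 y, of 1] unfolding yy(2)[symmetric] by simp
  moreover have "iU y (A y0) = iU e (A y0) + iU y0 (A y0)"
   using L2_inner_lincomb_left[OF e(1) y0 A2[OF y0], of 1] unfolding yy(2)[symmetric] by simp
  moreover have "\<bar>Re (iU y (A e))\<bar> <= G * (G * l^2)" by (rule cs[OF y e(1) ny e(2)])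
  moreover have "\<bar>Re (iU e (A y0))\<bar> <= l^2 * (G * (2 * G))" by (rule cs[OF e(1) y0 e(2) ny0])
  ultimately show ?thesis by (simp add: power2_eq_square mult_ac)
 qed
 have 2: "Re (iU y0 (A y0)) = \<beta> * Re (iU y0 y) + l * (\<beta> * Re (iU y wl) + l * Re (iU wl (A wl)))"
 proof -
  have "iU y0 (A y0) = of_real \<beta> * iU y0 y + iU y0 (A (%p. of_real l * wl p))"
   using bounded_operator_inner_lincomb[OF A_bounded u(1) lw y0, of "of_real \<beta>"] by (simp add: y0_def y_def)
  moreover have "iU y0 (A (%p. of_real l * wl p)) = of_real l * iU y0 (A wl)"
   by (simp add: A_symmetric(2)[OF y0 lw] A_symmetric(2)[OF y0 wl(1)] L2_inner_scale_right)
  moreover have "iU y0 (A wl) = of_real \<beta> * iU y wl + of_real l * iU wl (A wl)"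
   using L2_inner_lincomb_left[OF u(1) lw A2[OF wl(1)], of "of_real \<beta>"] A_symmetric(2)[OF u(1) wl(1)]
   by (simp add: y0_def y_def L2_inner_scale_left)
  ultimately show ?thesis by simp
 qed
 have 3: "\<beta> * Re (iU y0 y) <= \<beta> * n0 + 2 * G^2 * l^2"
 proof -
  have "Re (iU y0 y) = Re (iU y0 e) + n0"
   using L2_inner_lincomb_right[OF e(1) y0 y0, of 1] unfolding yy(2)[symmetric] by (simp add: L2_inner_self n0 flip: of_real_power)
  moreover have "\<bar>\<beta> * Re (iU y0 e)\<bar> <= G * ((2 * G) * l^2)"
   unfolding abs_mult using \<beta> by (intro mult_mono Cauchy_Schwarz_Re[OF y0 e(1) ny0 e(2)]) auto
  ultimately show ?thesis by (simp add: distrib_left power2_eq_square mult_ac abs_le_iff)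
 qed
 have 4: "\<beta> * Re (iU y wl) <= \<beta>^2 * \<omega> + 2 * G ^ 3 * l"
 proof -
  have "iU y wl = iU e wl + iU y0 wl" using L2_inner_lincomb_left[OF e(1) y0 wl(1), of 1] unfolding yy(2)[symmetric] by simp
  moreover have "iU y0 wl = of_real \<beta> * iU u wl + of_real l * of_real ((nU wl)^2)"
   using L2_inner_lincomb_left[OF u(1) lw wl(1), of "of_real \<beta>"] by (simp add: y0_def L2_inner_scale_left L2_inner_self)
  ultimately have "Re (iU y wl) = Re (iU e wl) + \<beta> * \<omega> + l * (nU wl)^2" by (simp add: \<omega>_def flip: of_real_power)
  then have "\<beta> * Re (iU y wl) = \<beta>^2 * \<omega> + \<beta> * (Re (iU e wl) + l * (nU wl)^2)" by (simp add: power2_eq_square algebra_simps)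
  moreover have "\<beta> * (Re (iU e wl) + l * (nU wl)^2) <= G * (l * G^2 + l * G^2)"
  proof (rule order_trans[OF abs_ge_self], unfold abs_mult, rule mult_mono)
   have "\<bar>Re (iU e wl)\<bar> <= l^2 * G" by (rule Cauchy_Schwarz_Re[OF e(1) wl(1) e(2) wl(3)])
   also have "... <= l * G^2" using l2 l \<beta> by (intro mult_mono) (auto simp: power2_eq_square)
   finally have "\<bar>Re (iU e wl)\<bar> <= l * G^2" .
   moreover have "l * (nU wl)^2 <= l * G^2" "0 <= l * (nU wl)^2" using l wl(3) by (auto intro!: mult_left_mono power_mono)
   ultimately show "\<bar>Re (iU e wl) + l * (nU wl)^2\<bar> <= l * G^2 + l * G^2" by linarith
  qed (use \<beta> in auto)
  ultimately show ?thesis by (simp add: power3_eq_cube power2_eq_square mult_ac)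
 qed
 have 5: "\<bar>Re (iU wl (A wl))\<bar> <= G ^ 3" using cs[OF wl(1,1,3,3)] by (simp add: power3_eq_cube mult_ac)
 have "l * (\<beta> * Re (iU y wl) + l * Re (iU wl (A wl))) <= l * ((\<beta>^2 * \<omega> + 2 * G ^ 3 * l) + l * G ^ 3)"
  using 4 5 l by (intro mult_left_mono add_mono) auto
 then have "Re (iU y (A y)) <= \<beta> * n0 + l * \<beta>^2 * \<omega> + (5 * G^2 + 3 * G ^ 3) * l^2"
  using 1 2 3 by (simp add: algebra_simps power2_eq_square)
 also have "(5 * G^2 + 3 * G ^ 3) * l^2 <= 9 * G ^ 3 * l^2"
 proof (rule mult_right_mono)
  have "G^2 <= G ^ 3" "0 <= G ^ 3" using \<beta>(2) power_increasing[of 2 3 G] by auto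
  then show "5 * G^2 + 3 * G ^ 3 <= 9 * G ^ 3" by linarith
 qed simp
 finally show "Re (iU (A u) (A (A u))) <= \<beta> * n0 + l * \<beta>^2 * \<omega> + 9 * G ^ 3 * l^2" by (simp add: y_def)
qed

text \<open>An approximate eigenvector of l A - l^2 W with error l^3 satisfies A u = \<beta> u + l W
  u + e with \<beta> = b/l and e of norm at most l^2. If m exceeds 1/|b| by a large multiple of l +
  \<open>eta\<close>, the main term of the trial energy outweighs the errors.\<close>

lemma upper_bound:
 assumes neg: "e_mu \<mu> V < 0"
 obtains C l0 where "C > 0" "l0 > 0"
  "!!l T. 0 < l ==> l < l0 ==> 0 < T ==> T <= 1 ==> 1 / \<bar>b_mu \<mu> V l\<bar> + C * (l + eta \<mu> T) <= m_mu \<mu> T ==>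
   m_mu \<mu> T <= 2 / \<bar>b_mu \<mu> V l\<bar> ==> ~ KT_plus_nonneg \<mu> T (%x. l * V x)"
proof -
 obtain CW \<beta>0 \<beta>1 l1 where bb: "CW > 0" "\<beta>0 > 0" "\<beta>1 > 0" "0 < l1" "l1 <= 1"
  "!!u. u \<in> U ==> nU (W u) <= CW * nU u"
  "!!l. 0 < l ==> l < l1 ==> b_mu \<mu> V l <= - \<beta>0 * l & - \<beta>1 * l <= b_mu \<mu> V l" using b_bounds[OF neg] by blast
 note W2 = bounded_operator_L2[OF calW_bounded]
 define G where "G = B0 + CW + \<beta>1 + 1"
 have G: "1 <= G" "B0 <= G" "CW <= G" "\<beta>1 <= G" using B0_nonneg bb by (auto simp: G_def)
 define L where "L = 2 / \<beta>0"
 define c3 where "c3 = C1 * B0 * (G + 1)"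
 define C' where "C' = L * (G^2 + (4 * G + 1)) + L^2 * (G ^ 3 + 9 * G ^ 3) + 2 * L * G * B0^2 + 2 * L * c3 + B0^2 + C1^2 * B0"
 have L: "0 <= L" and c3: "0 <= c3" using bb C1_nonneg B0_nonneg G by (auto simp: L_def c3_def)
 have C': "0 <= C'" using L c3 G B0_nonneg C1_nonneg by (simp add: C'_def)
 \<comment> \<open>Makes the gain D \<beta>0^2/2 exceed the error constant C' by exactly 1.\<close>
 define D where "D = 2 * (C' + 1) / \<beta>0^2"
 have D: "D > 0" using C' bb by (simp add: D_def)
 define l0 where "l0 = min l1 (\<beta>0 / (10 * G))"
 show ?thesis
 proof (rule that[of D l0], rule D, use bb G in \<open>simp add: l0_def\<close>, rule notI)
  fix l T assume l: "0 < l" "l < l0" and T: "0 < T" "T <= 1" and m: "1 / \<bar>b_mu \<mu> V l\<bar> + D * (l + eta \<mu> T) <= m_mu \<mu> T" "m_mu \<mu> T <= 2 / \<bar>b_mu \<mu> V l\<bar>"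
   and nn: "KT_plus_nonneg \<mu> T (%x. l * V x)"
  have ll: "l < l1" "l <= 1" "l * (10 * G) <= \<beta>0" using l bb G by (auto simp: l0_def pos_less_divide_eq)
  define b where "b = b_mu \<mu> V l"
  define \<beta> where "\<beta> = b / l"
  have b: "b = l * \<beta>" "\<bar>b\<bar> = l * \<bar>\<beta>\<bar>" using l by (simp_all add: \<beta>_def abs_divide)
  have "b <= - \<beta>0 * l" "- \<beta>1 * l <= b" using bb(7)[OF l(1) ll(1)] by (auto simp: b_def)
  then have \<beta>: "\<beta> <= - \<beta>0" "- \<beta>1 <= \<beta>" using l by (simp_all add: \<beta>_def pos_divide_le_eq pos_le_divide_eq)
  have \<beta>G: "\<bar>\<beta>\<bar> <= G" using \<beta> bb G by (simp add: abs_le_iff)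
  have et: "0 <= eta \<mu> T" by (rule eta_props(3)[OF mu_pos])
  define M where "M = m_mu \<mu> T"
  have M: "1 / (l * \<bar>\<beta>\<bar>) + D * (l + eta \<mu> T) <= M" "M <= 2 / (l * \<bar>\<beta>\<bar>)" using m by (simp_all add: M_def b(2) flip: b_def)
  have "\<beta> < 0" using \<beta>(1) bb(2) by linarith
  then have bpos: "0 < l * \<bar>\<beta>\<bar>" using l by (simp add: mult_pos_neg)
  have "0 < 1 / (l * \<bar>\<beta>\<bar>)" using bpos by simp
  moreover have "0 <= D * (l + eta \<mu> T)" using D l et by simp
  ultimately have Mpos: "0 < M" using M(1) by linarith
  have lM: "l * M <= L"
  proof -
   have "l * M <= l * (2 / (l * \<bar>\<beta>\<bar>))" using M(2) l by (intro mult_left_mono) auto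
   also have "... = 2 / \<bar>\<beta>\<bar>" using l by simp
   also have "... <= L" unfolding L_def using \<beta>(1) bb(2) \<open>\<beta> < 0\<close> by (intro divide_left_mono) (auto simp: mult_neg_pos)
   finally show ?thesis .
  qed
  obtain u where u: "u \<in> U" "nU u = 1" "nU (%x. Bl l u x - of_real b * u x) <= l ^ 3"
   using b_approx[of "l ^ 3" l] l unfolding b_def by auto
  have Wu: "W u \<in> U" "nU (W u) <= G" using W2[OF u(1)] bb(6)[OF u(1)] u(2) G by auto
  have Au: "A u \<in> U" by (rule bounded_operator_L2[OF A_bounded u(1)])
  define e where "e = (%x. of_real (1 / l) * (Bl l u x - of_real b * u x))"
  have BlU: "(%x. Bl l u x - of_real b * u x) \<in> U" by (intro L2_diff L2_scale Au Wu u)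
  have eU: "e \<in> U" unfolding e_def by (rule L2_scale[OF BlU])
  have ne: "nU e <= l^2"
  proof -
   have "nU e = (1 / l) * nU (%x. Bl l u x - of_real b * u x)" unfolding e_def L2_norm_scale using l by (simp add: norm_divide)
   also have "... <= (1 / l) * l ^ 3" using l by (intro mult_left_mono u) auto
   also have "... = l^2" using l by (simp add: power3_eq_cube power2_eq_square)
   finally show ?thesis .
  qed
  have dec: "A u p = (of_real \<beta> * u p + of_real l * W u p) + e p" for p
   unfolding e_def b(1) using l by (simp add: power2_eq_square algebra_simps divide_simps)
  have AG: "nU (A v) <= G * nU v" if "v \<in> U" for v
   using A_norm[OF that] mult_right_mono[OF G(2) L2_norm_nonneg[of sph v]] by linarith
  note ex = approximate_eigenvector_expansion[OF u(1,2) Wu(1) AG Wu(2) l(1) ll(2) \<beta>G G(1) eU ne dec]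
  define \<omega> where "\<omega> = Re (iU u (W u))"
  define r where "r = Re (rf (q \<mu> T) (sg u) (sg u))"
  obtain \<zeta> where z: "\<zeta> \<in> H" "nH \<zeta> <= C1 * (sqrt B0 * nU u)" "!!w'. w' \<in> H ==> iH \<zeta> w' = rf (q \<mu> T) (sg u) w'"
   "0 <= M * (nU (A u))^2 + r
    + l * (M^2 * Re (iU (A u) (A (A u))) + 2 * M * Re (iH \<zeta> (sg (A u)))) + \<bar>l\<bar> * (nH \<zeta>)^2"
   unfolding M_def r_def by (rule nonneg_trial[OF T u(1) nn]) blast
  note su = sg_H[OF u(1)]
  have wr: "\<bar>\<omega>\<bar> <= G" using form_abs_le[OF u(1) Wu(1), of G] Wu u by (simp add: \<omega>_def)
  have "m_mu \<mu> T = M" by (simp add: M_def)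
  have rw: "\<bar>r - \<omega>\<bar> <= B0^2 * eta \<mu> T"
  proof -
   have "\<bar>r - \<omega>\<bar> <= cmod (rf (q \<mu> T) (sg u) (sg u) - rf (q0 \<mu>) (sg u) (sg u))"
    unfolding r_def \<omega>_def calW_form[OF u(1)] minus_complex.simps(1)[symmetric] by (rule abs_Re_le_cmod)
   also have "... <= B0 * eta \<mu> T * (nH (sg u) * nH (sg u))" by (rule rf_diff[OF T su su])
   also have "... <= B0 * eta \<mu> T * (sqrt B0 * sqrt B0)"
    using sg_norm[OF u(1)] u(2) B0_nonneg et by (intro mult_left_mono mult_mono) auto
   finally show ?thesis using B0_nonneg by (simp add: power2_eq_square mult_ac)
  qed
  have Z: "Re (iH \<zeta> (sg (A u))) <= \<beta> * r + c3 * l"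
  proof -
   define y0 where "y0 = (%p. of_real \<beta> * u p + of_real l * W u p)"
   have lw: "(%p. of_real l * W u p) \<in> U" by (rule L2_scale[OF Wu(1)])
   have y0: "y0 \<in> U" unfolding y0_def by (rule L2_lincomb[OF u(1) lw])
   have "A u = (%p. 1 * e p + y0 p)" by (simp add: fun_eq_iff dec y0_def)
   then have "sg (A u) = (%p. 1 * sg e p + sg y0 p)" by (simp only: sg_lincomb[OF eU y0])
   then have "iH \<zeta> (sg (A u)) = iH \<zeta> (sg e) + iH \<zeta> (sg y0)"
    using L2_inner_lincomb_right[OF sg_H[OF eU] sg_H[OF y0] z(1), of 1] by simp
   moreover have "iH \<zeta> (sg y0) = of_real \<beta> * iH \<zeta> (sg u) + iH \<zeta> (sg (%p. of_real l * W u p))"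
    unfolding y0_def sg_lincomb[OF u(1) lw] by (rule L2_inner_lincomb_right[OF su sg_H[OF lw] z(1)])
   ultimately have "Re (iH \<zeta> (sg (A u))) = \<beta> * r + (Re (iH \<zeta> (sg e)) + Re (iH \<zeta> (sg (%p. of_real l * W u p))))"
    by (simp add: z(3)[OF su] r_def)
   moreover have nz: "nH \<zeta> <= C1 * sqrt B0" using z(2) u(2) by simp
   have "\<bar>Re (iH \<zeta> (sg e))\<bar> <= (C1 * sqrt B0) * (sqrt B0 * l)" using order_trans[OF ne, of l] l ll(2) B0_nonneg
    by (intro Cauchy_Schwarz_Re[OF z(1) sg_H[OF eU] nz] order_trans[OF sg_norm[OF eU]] mult_left_mono)
     (auto simp: power2_eq_square mult_left_le)
   moreover have "\<bar>Re (iH \<zeta> (sg (%p. of_real l * W u p)))\<bar> <= (C1 * sqrt B0) * (sqrt B0 * (l * G))" using l Wu(2) B0_nonneg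
    by (intro Cauchy_Schwarz_Re[OF z(1) sg_H[OF lw] nz] order_trans[OF sg_norm[OF lw]] mult_left_mono)
     (auto simp: L2_norm_scale)
   moreover have "(C1 * sqrt B0) * (sqrt B0 * l) + (C1 * sqrt B0) * (sqrt B0 * (l * G)) = c3 * l"
   proof -
    have "(C1 * sqrt B0) * (sqrt B0 * l) + (C1 * sqrt B0) * (sqrt B0 * (l * G)) = C1 * (sqrt B0 * sqrt B0) * (G + 1) * l"
     by (simp only: algebra_simps)
    then show ?thesis using B0_nonneg by (simp add: c3_def)
   qed
   ultimately show ?thesis by linarith
  qed
  have z2: "(nH \<zeta>)^2 <= C1^2 * B0"
  proof -
   have "(nH \<zeta>)^2 <= (C1 * sqrt B0)^2" using z(2) u(2) by (intro power_mono) auto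
   then show ?thesis using B0_nonneg by (simp add: power_mult_distrib)
  qed
  have "0 <= M * (nU (A u))^2 + r + l * (M^2 * Re (iU (A u) (A (A u))) + 2 * M * Re (iH \<zeta> (sg (A u)))) + l * (nH \<zeta>)^2"
   using z(4) l by simp
  also have "... <= M * \<beta>^2 * (1 + M * l * \<beta>) + \<omega> * (1 + M * l * \<beta>) * (1 + 3 * (M * l * \<beta>)) + C' * (l + eta \<mu> T)"
   unfolding C'_def
  proof (rule trial_expansion[OF l(1) Mpos lM \<beta>G _ _ _ _ c3 _ _ et _ _ Z rw z2])
   show "(nU (W u))^2 <= G^2" using Wu(2) by (intro power_mono) auto
   show "(nU (A u))^2 <= \<beta>^2 + 2 * \<beta> * l * \<omega> + l^2 * (nU (W u))^2 + (4 * G + 1) * l^2" using ex(1) by (simp only: \<omega>_def)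
   show "Re (iU (A u) (A (A u))) <= \<beta> * (\<beta>^2 + 2 * \<beta> * l * \<omega> + l^2 * (nU (W u))^2) + l * \<beta>^2 * \<omega> + 9 * G ^ 3 * l^2"
    using ex(2) by (simp only: \<omega>_def)
  qed (use G C1_nonneg B0_nonneg in auto)
  also have "... <= - (D * \<beta>0^2 / 2) * (l + eta \<mu> T) + C' * (l + eta \<mu> T)"
   using l et D by (intro add_right_mono trial_main_term[OF l(1) ll(3) \<beta>(1) bb(2) wr M]) auto
  also have "D * \<beta>0^2 / 2 = C' + 1" using bb(2) by (simp add: D_def)
  also have "- (C' + 1) * (l + eta \<mu> T) + C' * (l + eta \<mu> T) = - (l + eta \<mu> T)" by (simp add: algebra_simps)
  finally show False using l et by simp
 qed
qed

end

section \<open>Positivity and weak-coupling limit of T_c\<close>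

context bcs begin

abbreviation "Tc l == critical_temperature \<mu> (%x. l * V x)"

text \<open>Failure at T excludes all smaller temperatures by \<open>KT_plus_nonneg_mono\<close>;
  for the infimum to be at least T the set must also be nonempty, which is
  \<open>large_T_nonneg\<close>.\<close>

lemma critical_temperature_bounds:
 assumes T: "T > 0"
 shows "l > 0 ==> ~ KT_plus_nonneg \<mu> T (%x. l * V x) ==> T <= Tc l" and "KT_plus_nonneg \<mu> T (%x. l * V x) ==> Tc l <= T"
proof -
 show "KT_plus_nonneg \<mu> T (%x. l * V x) ==> Tc l <= T"
  unfolding critical_temperature_def using T by (intro cInf_lower bdd_belowI[of _ 0]) auto
 assume l: "l > 0" and n: "~ KT_plus_nonneg \<mu> T (%x. l * V x)"
 show "T <= Tc l" unfolding critical_temperature_def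
 proof (rule cInf_greatest)
  show "{T. 0 < T & KT_plus_nonneg \<mu> T (%x. l * V x)} ~= {}" using large_T_nonneg[OF l] by blast
  fix T' assume "T' \<in> {T. 0 < T & KT_plus_nonneg \<mu> T (%x. l * V x)}"
  then show "T <= T'" using n KT_plus_nonneg_mono[of \<mu> T' _ T] by (cases "T' <= T") auto
 qed
qed

definition cm :: real where "cm = euler_mascheroni - 2 + ln (8 / pi)"

text \<open>The o(1) in the low-temperature asymptotics of \<open>m_mu\<close>.\<close>

definition gm :: "real => real" where "gm T = m_mu \<mu> T - sqrt \<mu> * (ln (\<mu> / T) + cm)"

lemma gm_tendsto: "(gm \<longlongrightarrow> 0) (at_right 0)" unfolding gm_def[abs_def] cm_def by (rule m_mu_asymptotics[OF mu_pos])

lemma m_mu_at_top: "filterlim (m_mu \<mu>) at_top (at_right 0)"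
proof -
 have "filterlim (%T. sqrt \<mu> * (ln (\<mu> / T) + cm)) at_top (at_right 0)" using mu_pos by real_asymp
 from filterlim_tendsto_add_at_top[OF gm_tendsto this] show ?thesis by (simp add: gm_def)
qed

text \<open>Valid for every coupling, not only for small ones: as T -> 0, m diverges and the trial
  energy is governed by l m^2 times the form of A at A u, which is close to \<beta>^3 < 0 for an
  approximate minimiser u of A.\<close>

lemma critical_temperature_pos:
 assumes e: "e_mu \<mu> V < 0" and l: "l > 0"
 shows "Tc l > 0"
proof -
 interpret A: real_form_operator sph A by standard (auto intro: A_bounded A_real nontrivial_U)
 define \<beta> where "\<beta> = inf_spec sph A"
 obtain u0 where u0: "u0 \<in> U" "nU u0 = 1" "Re (iU u0 (A u0)) < 0" using negative_direction[OF e] .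
 have \<beta>: "\<beta> < 0" using A.inf_spec_le_form[OF u0(1)] u0 by (simp add: \<beta>_def)
 define G where "G = B0 + \<bar>\<beta>\<bar> + 1"
 have G: "1 <= G" "B0 <= G" "\<bar>\<beta>\<bar> <= G" using B0_nonneg by (auto simp: G_def)
 \<comment> \<open>Makes the error 9 G^3 s^2 of the expansion at most half of |\<beta>|^3.\<close>
 define s where "s = min 1 (sqrt (\<bar>\<beta>\<bar> ^ 3 / (18 * G ^ 3)))"
 have "0 < \<bar>\<beta>\<bar> ^ 3 / (18 * G ^ 3)" using \<beta> G by (intro divide_pos_pos zero_less_power) auto
 then have s: "0 < s" "s <= 1" by (simp_all only: s_def real_sqrt_gt_zero min_less_iff_conj min.cobounded1 zero_less_one simp_thms)
 have s2: "9 * G ^ 3 * s^2 < \<bar>\<beta>\<bar> ^ 3"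
 proof -
  have "s^2 <= (sqrt (\<bar>\<beta>\<bar> ^ 3 / (18 * G ^ 3)))^2" using s by (intro power_mono) (auto simp: s_def)
  also have "... = \<bar>\<beta>\<bar> ^ 3 / (18 * G ^ 3)" using G by simp
  finally have "9 * G ^ 3 * s^2 <= 9 * G ^ 3 * (\<bar>\<beta>\<bar> ^ 3 / (18 * G ^ 3))" using G by (intro mult_left_mono) auto
  also have "... = \<bar>\<beta>\<bar> ^ 3 / 2" using G by simp
  also have "... < \<bar>\<beta>\<bar> ^ 3" using \<beta> by simp
  finally show ?thesis .
 qed
 obtain u where u: "u \<in> U" "nU u = 1" "nU (%x. A u x - of_real \<beta> * u x) <= s^2"
  using A.inf_spec_approximate_eigenvector[of "s^2"] s unfolding \<beta>_def by auto
 define y where "y = A u"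
 have y: "y \<in> U" unfolding y_def by (rule bounded_operator_L2[OF A_bounded u(1)])
 define d where "d = - Re (iU y (A y))"
 have "Re (iU y (A y)) <= \<beta> * \<beta>^2 + 9 * G ^ 3 * s^2"
 proof -
  have AG: "nU (A v) <= G * nU v" if "v \<in> U" for v
   using A_norm[OF that] mult_right_mono[OF G(2) L2_norm_nonneg[of sph v]] by linarith
  have dec: "A u p = (of_real \<beta> * u p + of_real s * 0) + (A u p - of_real \<beta> * u p)" for p by simp
  have z: "nU (%p. 0) <= G" using G by (simp add: L2_norm_def)
  show ?thesis
   using approximate_eigenvector_expansion(2)[OF u(1,2) L2_zero AG z s G(3,1) L2_diff[OF y[unfolded y_def] L2_scale[OF u(1)]] u(3) dec]
   by (simp add: y_def L2_norm_def)
 qed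
 moreover have "\<beta> * \<beta>^2 = - (\<bar>\<beta>\<bar> ^ 3)" using \<beta> by (simp add: power2_eq_square power3_eq_cube)
 ultimately have d: "d > 0" using s2 by (simp add: d_def)
 define N where "N = C1 * sqrt B0"
 have N: "0 <= N" using C1_nonneg B0_nonneg by (simp add: N_def)
 \<comment> \<open>Since m >= 1, all terms growing at most linearly in m are bounded by m K; m >
   K/(l d) makes the quadratic term win.\<close>
 define K where "K = (nU y)^2 + C1 * B0 + l * (2 * (N * nH (sg y))) + l * N^2"
 have "\<forall>\<^sub>F T in at_right 0. max 1 (K / (l * d)) < m_mu \<mu> T" using m_mu_at_top unfolding filterlim_at_top_dense by blast
 then have "\<forall>\<^sub>F T in at_right 0. 0 < T & T <= 1 & max 1 (K / (l * d)) < m_mu \<mu> T"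
  using eventually_at_right_real[OF zero_less_one] by eventually_elim auto
 then have "EX T. 0 < T & T <= 1 & max 1 (K / (l * d)) < m_mu \<mu> T" by (rule eventually_happens'[OF trivial_limit_at_right_real])
 then obtain T where T: "0 < T" "T <= 1" and m: "max 1 (K / (l * d)) < m_mu \<mu> T" by blast
 define M where "M = m_mu \<mu> T"
 have M: "1 <= M" "K < M * (l * d)" using m l d by (auto simp: M_def pos_divide_less_eq)
 have "~ KT_plus_nonneg \<mu> T (%x. l * V x)"
 proof
  assume nn: "KT_plus_nonneg \<mu> T (%x. l * V x)"
  obtain \<zeta> where z: "\<zeta> \<in> H" "nH \<zeta> <= N"
   "0 <= M * (nU y)^2 + Re (rf (q \<mu> T) (sg u) (sg u)) + l * (M^2 * (- d) + 2 * M * Re (iH \<zeta> (sg y))) + l * (nH \<zeta>)^2"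
   by (rule nonneg_trial[OF T u(1) nn]) (use l u(2) in \<open>simp add: M_def y_def d_def N_def\<close>)
  note su = sg_H[OF u(1)]
  have "Re (rf (q \<mu> T) (sg u) (sg u)) <= C1 * (nH (sg u) * nH (sg u))"
   by (rule order_trans[OF complex_Re_le_cmod rf_bound(1)[OF su su T]])
  also have "... <= C1 * (sqrt B0 * sqrt B0)"
   using sg_norm[OF u(1)] u(2) C1_nonneg B0_nonneg by (intro mult_left_mono mult_mono) auto
  finally have 1: "Re (rf (q \<mu> T) (sg u) (sg u)) <= C1 * B0" using B0_nonneg by simp
  have "\<bar>Re (iH \<zeta> (sg y))\<bar> <= N * nH (sg y)" by (rule Cauchy_Schwarz_Re[OF z(1) sg_H[OF y] z(2)]) simp
  then have "l * (2 * M) * Re (iH \<zeta> (sg y)) <= l * (2 * M) * (N * nH (sg y))" using l M by (intro mult_left_mono) auto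
  moreover have "l * (nH \<zeta>)^2 <= l * N^2" using l z(2) by (intro mult_left_mono power_mono) auto
  moreover have "1 * (C1 * B0 + l * N^2) <= M * (C1 * B0 + l * N^2)" using M C1_nonneg B0_nonneg l by (intro mult_right_mono) auto
  moreover have "M * K < M * (M * (l * d))" using M by (intro mult_strict_left_mono) auto
  ultimately show False using z(3) 1 by (simp add: K_def power2_eq_square algebra_simps)
 qed
 from critical_temperature_bounds(1)[OF T(1) l this] T(1) show ?thesis by linarith
qed

text \<open>\<open>TT \<delta> l\<close> is the temperature at which the asymptotics of
  \<open>m_mu\<close> predict 1/|b| + \<delta>. For \<delta> > 0 nonnegativity fails there by
  \<open>upper_bound\<close>, with -\<delta> it holds by \<open>lower_bound\<close>, and T_c is
  caught between the two.\<close>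

lemma critical_temperature_limit:
 assumes e: "e_mu \<mu> V < 0"
 shows "((%l. ln (\<mu> / Tc l) + 1 / (sqrt \<mu> * b_mu \<mu> V l)) \<longlongrightarrow> - cm) (at_right 0)"
proof -
 define b where "b l = \<bar>b_mu \<mu> V l\<bar>" for l
 obtain CW \<beta>0 \<beta>1 l1 where bb: "CW > 0" "\<beta>0 > 0" "\<beta>1 > 0" "0 < l1" "l1 <= 1"
  "!!u. u \<in> U ==> nU (W u) <= CW * nU u"
  "!!l. 0 < l ==> l < l1 ==> b_mu \<mu> V l <= - \<beta>0 * l & - \<beta>1 * l <= b_mu \<mu> V l" using b_bounds[OF e] by blast
 obtain C2 l2 where C2: "C2 > 0" "l2 > 0"
  "!!l T. 0 < l ==> l < l2 ==> 0 < T ==> T <= 1 ==> m_mu \<mu> T > 0 ==> ~ KT_plus_nonneg \<mu> T (%x. l * V x) ==>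
   1 / m_mu \<mu> T <= - b_mu \<mu> V l + C2 * l^2 * (l + eta \<mu> T)" using lower_bound[OF e] by blast
 obtain C3 l3 where C3: "C3 > 0" "l3 > 0"
  "!!l T. 0 < l ==> l < l3 ==> 0 < T ==> T <= 1 ==> 1 / \<bar>b_mu \<mu> V l\<bar> + C3 * (l + eta \<mu> T) <= m_mu \<mu> T ==>
   m_mu \<mu> T <= 2 / \<bar>b_mu \<mu> V l\<bar> ==> ~ KT_plus_nonneg \<mu> T (%x. l * V x)" using upper_bound[OF e] by blast
 have b: "\<beta>0 * l <= b l" "b l <= \<beta>1 * l" "0 < b l" "b_mu \<mu> V l = - b l" if "0 < l" "l < l1" for l
 proof -
  have "0 < \<beta>0 * l" using that bb by simp
  then show "\<beta>0 * l <= b l" "b l <= \<beta>1 * l" "0 < b l" "b_mu \<mu> V l = - b l" using bb(7)[OF that] by (auto simp: b_def)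
 qed
 have ev: "\<forall>\<^sub>F l in at_right 0. 0 < l & l < l1 & l < l2 & l < l3"
  using eventually_at_right_real[OF bb(4)] eventually_at_right_real[OF C2(2)] eventually_at_right_real[OF C3(2)]
  by eventually_elim auto
 have binv: "filterlim (%l. 1 / b l) at_top (at_right 0)"
 proof (rule filterlim_at_top_mono)
  show "filterlim (%l. 1 / (\<beta>1 * l)) at_top (at_right 0)" using bb(3) by real_asymp
  show "\<forall>\<^sub>F l in at_right 0. 1 / (\<beta>1 * l) <= 1 / b l"
   using ev by eventually_elim (use b in \<open>auto intro!: divide_left_mono mult_pos_pos simp: bb(3)\<close>)
 qed
 define TT where "TT \<delta> l = \<mu> * exp (cm - (1 / b l + \<delta>) / sqrt \<mu>)" for \<delta> l
 have TTpos: "TT \<delta> l > 0" for \<delta> l using mu_pos by (simp add: TT_def)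
 have TTln: "ln (\<mu> / TT \<delta> l) = (1 / b l + \<delta>) / sqrt \<mu> - cm" for \<delta> l
 proof -
  have "\<mu> / TT \<delta> l = exp (- (cm - (1 / b l + \<delta>) / sqrt \<mu>))" using mu_pos unfolding TT_def exp_minus by (simp add: field_simps)
  then show ?thesis by simp
 qed
 have TTm: "m_mu \<mu> (TT \<delta> l) = 1 / b l + \<delta> + gm (TT \<delta> l)" for \<delta> l using mu_pos by (simp add: gm_def TTln)
 have TTlim: "filterlim (TT \<delta>) (at_right 0) (at_right 0)" for \<delta>
 proof -
  have "filterlim (%t. \<mu> * exp (cm - (t + \<delta>) / sqrt \<mu>)) (at_right 0) at_top" using mu_pos by real_asymp
  from filterlim_compose[OF this binv] show ?thesis unfolding TT_def .
 qed
 have small: "\<forall>\<^sub>F l in at_right 0. TT \<delta> l <= 1 & \<bar>gm (TT \<delta> l)\<bar> < x & l + eta \<mu> (TT \<delta> l) < x" if "x > 0" for \<delta> x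
 proof -
  have "((%l. l + eta \<mu> (TT \<delta> l)) \<longlongrightarrow> 0 + 0) (at_right 0)"
   by (intro tendsto_add filterlim_compose[OF eta_props(2)[OF mu_pos] TTlim] tendsto_ident_at)
  then have "\<forall>\<^sub>F l in at_right 0. l + eta \<mu> (TT \<delta> l) < x" using that by (intro order_tendstoD(2)[where y = 0]) auto
  moreover have "\<forall>\<^sub>F l in at_right 0. \<bar>gm (TT \<delta> l)\<bar> < x"
   using tendstoD[OF filterlim_compose[OF gm_tendsto TTlim] that] by (simp add: dist_real_def)
  moreover have "\<forall>\<^sub>F l in at_right 0. TT \<delta> l \<in> {0<..<1}"
   using TTlim eventually_at_right_real[OF zero_less_one] unfolding filterlim_iff by blast
  ultimately show ?thesis by eventually_elim auto
 qed
 show ?thesis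
 proof (rule tendstoI)
  fix \<epsilon> :: real assume \<epsilon>: "\<epsilon> > 0"
  \<comment> \<open>A shift of the predicted m by \<delta> moves ln(\<mu>/T) by \<delta>/sqrt \<mu>
    = \<epsilon>/2.\<close>
  define \<delta> where "\<delta> = \<epsilon> * sqrt \<mu> / 2"
  have \<delta>: "\<delta> > 0" using \<epsilon> mu_pos by (simp add: \<delta>_def)
  \<comment> \<open>The three bounds absorb the remainder \<open>gm\<close>, the error C3 (l + eta)
    of \<open>upper_bound\<close> and the error C2 l^2 (l + eta) of \<open>lower_bound\<close>; in
    the last, \<beta>0 compares l^2 with b^2.\<close>
  define x where "x = min (\<delta> / 2) (min (\<delta> / (2 * C3)) (\<delta> * \<beta>0^2 / (2 * C2)))"
  have x: "x > 0" using \<delta> C2 C3 bb by (simp add: x_def)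
  have xx: "x <= \<delta> / 2" "C3 * x <= \<delta> / 2" "C2 * x <= \<delta> * \<beta>0^2 / 2"
  proof -
   have "x <= \<delta> / (2 * C3)" "x <= \<delta> * \<beta>0^2 / (2 * C2)" by (auto simp: x_def)
   from mult_left_mono[OF this(1), of C3] mult_left_mono[OF this(2), of C2]
   show "C3 * x <= \<delta> / 2" "C2 * x <= \<delta> * \<beta>0^2 / 2" using C2(1) C3(1) by auto
  qed (simp add: x_def)
  have "\<forall>\<^sub>F l in at_right 0. 2 * \<delta> < 1 / b l" using binv by (simp add: filterlim_at_top_dense)
  with ev small[OF x, of \<delta>] small[OF x, of "- \<delta>"]
  show "\<forall>\<^sub>F l in at_right 0. dist (ln (\<mu> / Tc l) + 1 / (sqrt \<mu> * b_mu \<mu> V l)) (- cm) < \<epsilon>"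
  proof eventually_elim
   case (elim l)
   define \<beta> where "\<beta> = b l"
   have l: "0 < l" "l < l1" "l < l2" "l < l3" using elim by auto
   note B = b[OF l(1,2), folded \<beta>_def]
   have dl: "2 * \<delta> < 1 / \<beta>" using elim by (simp add: \<beta>_def)
   define Tp where "Tp = TT \<delta> l"
   define Tm where "Tm = TT (- \<delta>) l"
   have Tp: "0 < Tp" "Tp <= 1" "\<bar>gm Tp\<bar> < x" "l + eta \<mu> Tp < x" and Tm: "0 < Tm" "Tm <= 1" "\<bar>gm Tm\<bar> < x" "l + eta \<mu> Tm < x"
    using elim TTpos by (auto simp: Tp_def Tm_def)
   have mp: "m_mu \<mu> Tp = 1 / \<beta> + \<delta> + gm Tp" and mm: "m_mu \<mu> Tm = 1 / \<beta> - \<delta> + gm Tm"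
    using TTm[of \<delta> l] TTm[of "- \<delta>" l] by (simp_all add: Tp_def Tm_def \<beta>_def)
   have "~ KT_plus_nonneg \<mu> Tp (%x. l * V x)"
   proof (rule C3(3)[OF l(1,4) Tp(1,2)])
    have "C3 * (l + eta \<mu> Tp) <= C3 * x" using C3(1) Tp by (intro mult_left_mono) auto
    then show "1 / \<bar>b_mu \<mu> V l\<bar> + C3 * (l + eta \<mu> Tp) <= m_mu \<mu> Tp" using xx Tp(3) mp B by simp
    have "2 / \<beta> = 1 / \<beta> + 1 / \<beta>" by simp
    then show "m_mu \<mu> Tp <= 2 / \<bar>b_mu \<mu> V l\<bar>" using xx Tp(3) mp B dl \<delta> by simp
   qed
   from critical_temperature_bounds(1)[OF Tp(1) l(1) this] have lo: "Tp <= Tc l" .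
   have "KT_plus_nonneg \<mu> Tm (%x. l * V x)"
   proof (rule ccontr)
    assume n: "~ KT_plus_nonneg \<mu> Tm (%x. l * V x)"
    define m where "m = m_mu \<mu> Tm"
    have m: "0 < m" "m <= 1 / \<beta> - \<delta> / 2" using mm Tm(3) xx dl \<delta> by (auto simp: m_def)
    have "1 / m <= \<beta> + C2 * l^2 * (l + eta \<mu> Tm)" using C2(3)[OF l(1,3) Tm(1,2) _ n] m(1) B by (simp add: m_def)
    then have "1 <= m * (\<beta> + C2 * l^2 * (l + eta \<mu> Tm))" using m(1) by (simp add: pos_divide_le_eq mult.commute)
    also have "... <= m * (\<beta> + C2 * l^2 * x)" using m Tm C2(1) by (intro mult_left_mono add_left_mono) auto
    also have "... < (1 / \<beta> - \<delta> / 2) * \<beta> + (1 / \<beta>) * (l^2 * (\<delta> * \<beta>0^2 / 2))"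
    proof -
     have "m * \<beta> <= (1 / \<beta> - \<delta> / 2) * \<beta>" using m B by (intro mult_right_mono) auto
     moreover have "m * (C2 * l^2 * x) < (1 / \<beta>) * (l^2 * (\<delta> * \<beta>0^2 / 2))"
     proof -
      have "m * (l^2 * (C2 * x)) <= m * (l^2 * (\<delta> * \<beta>0^2 / 2))" using m xx by (intro mult_left_mono) auto
      also have "... < (1 / \<beta>) * (l^2 * (\<delta> * \<beta>0^2 / 2))" using m \<delta> l bb by (intro mult_strict_right_mono) auto
      finally show ?thesis by (simp add: mult_ac)
     qed
     ultimately show ?thesis by (simp add: distrib_left)
    qed
    also have "... <= (1 / \<beta> - \<delta> / 2) * \<beta> + (1 / \<beta>) * (\<beta>^2 * (\<delta> / 2))"
    proof -
     have "(\<beta>0 * l)^2 <= \<beta>^2" using B bb l by (intro power_mono) auto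
     from mult_right_mono[OF this, of "\<delta> / 2"] have "l^2 * (\<delta> * \<beta>0^2 / 2) <= \<beta>^2 * (\<delta> / 2)"
      using \<delta> by (simp add: power_mult_distrib mult_ac)
     then show ?thesis using B by (intro add_left_mono mult_left_mono) auto
    qed
    also have "... = 1" using B by (simp add: left_diff_distrib power2_eq_square)
    finally show False by simp
   qed
   from critical_temperature_bounds(2)[OF Tm(1) this] have hi: "Tc l <= Tm" .
   have Tc: "Tc l > 0" using lo Tp by linarith
   have "ln (\<mu> / Tc l) <= ln (\<mu> / Tp)" using lo Tp Tc mu_pos by (simp add: divide_left_mono)
   moreover have "ln (\<mu> / Tm) <= ln (\<mu> / Tc l)" using hi Tm Tc mu_pos by (simp add: divide_left_mono)
   moreover have "ln (\<mu> / Tp) = 1 / (sqrt \<mu> * \<beta>) + \<epsilon> / 2 - cm" "ln (\<mu> / Tm) = 1 / (sqrt \<mu> * \<beta>) - \<epsilon> / 2 - cm"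
    using TTln[of \<delta> l] TTln[of "- \<delta>" l] mu_pos
    by (simp_all add: Tp_def Tm_def \<beta>_def \<delta>_def add_divide_distrib diff_divide_distrib mult.commute)
   moreover have "1 / (sqrt \<mu> * b_mu \<mu> V l) = - (1 / (sqrt \<mu> * \<beta>))" using B by simp
   ultimately show ?case using \<epsilon> unfolding dist_real_def by linarith
  qed
 qed
qed

end

theorem theorem3p3:
  fixes V :: "real^3 \<Rightarrow> real" and \<mu> :: real
  assumes "integrable lebesgue V"
    and "integrable lebesgue (\<lambda>x. \<bar>V x\<bar> powr (3 / 2))"
    and "\<mu> > 0"
    and "e_mu \<mu> V < 0"
  shows "(\<forall>l>0. critical_temperature \<mu> (\<lambda>x. l * V x) > 0) \<and>
    ((\<lambda>l. ln (\<mu> / critical_temperature \<mu> (\<lambda>x. l * V x)) + 1 / (sqrt \<mu> * b_mu \<mu> V l))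
       \<longlongrightarrow> 2 - euler_mascheroni - ln (8 / pi)) (at_right 0)"
proof -
 interpret bcs V \<mu> by unfold_locales (fact assms)+
 have "- cm = 2 - euler_mascheroni - ln (8 / pi)" by (simp add: cm_def)
 then show ?thesis using critical_temperature_pos[OF assms(4)] critical_temperature_limit[OF assms(4)] by simp
qed

end
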